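(* Consider the random connection model described in the context. Let $g:\mathbf{N}(\mathbb{R}^d)\to\mathbb{R}$ be measurable and such that for every $\varepsilon>0$ there is an $n_0\in\mathbb{N}$ with $$|g(\mu)|\le e^{\varepsilon\mu(\mathbb{R}^d)}\quad\text{for all }\mu\in\mathbf{N}(\mathbb{R}^d)\text{ with }\mu(\mathbb{R}^d)\ge n_0.$$ Let $x\in\mathbb{R}^d$. Then the function $t\mapsto\mathbb{E}\,g\big(C(0,\chi_t^{0,x})\big)$ is analytic on $[0,t_* )$. The expansion at $s\in[0,t_* )$ is given by $$\mathbb{E}\,g\big(C(0,\chi_{s+t}^{0,x})\big)=\mathbb{E}\,g\big(C(0,\chi_s^{0,x})\big)+\sum_{n=1}^\infty\frac{t^n}{n!}\int_{(\mathbb{R}^d)^n}\mathbb{E}\sum_{J\subset[n]}(-1)^{n-|J|}g\big(C(0,\chi_s^{0,\mathbf{x}_J,x})\big)\,d\mathbf{x}$$ for all $t$ with $s+t$ in some neighbourhood of $s$ in $[0,t_* )$.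
   Context: $\varphi:\mathbb{R}^d\to[0,1]$ is measurable with $\varphi(x)=\varphi(-x)$ and $0<m_\varphi:=\int\varphi(x)\,dx<\infty$. $\mathbf{N}(\mathbb{R}^d)$ is the space of locally finite subsets $\mu$ of $\mathbb{R}^d$, $\mu(B):=|\mu\cap B|$, with the $\sigma$-field generated by the maps $\mu\mapsto\mu(B)$, $B$ Borel. For $t\ge0$, $\eta_t$ is a stationary Poisson process on $\mathbb{R}^d$ with intensity $t$; for $t>0$ write $\eta_t=\{X_i:i\in\mathbb{N}\}$ with a.s. distinct $X_i$, and $\eta_0=\emptyset$. $\mathbb{R}^{[2d]}$ is the space of two-element subsets of $\mathbb{R}^d$; $<$ is the strict lexicographic order on $\mathbb{R}^d$. For points $y_1,\dots,y_k\in\mathbb{R}^d$ let $(Z_i)_{i\in I}$ be the family consisting of $y_1,\dots,y_k$ and (if $t>0$) the $X_j$, $j\in\mathbb{N}$, and let $\chi_t^{y_1,\dots,y_k}:=\{(\{Z_i,Z_j\},U_{i,j}):i,j\in I,\ Z_i<Z_j\}$ with independent marks $U_{i,j}$, uniform on $[0,1]$ and independent of $\eta_t$; when the added points vary over subfamilies of a fixed finite family the same marks are used for the same pairs of indices. For $\mathbf{x}=(x_1,\dots,x_n)\in(\mathbb{R}^d)^n$ and $J\subset[n]:=\{1,\dots,n\}$, $\mathbf{x}_J:=(x_i)_{i\in J}$, so $\chi_t^{0,\mathbf{x}_J,x}$ has added points $0$, $x_i$ ($i\in J$), $x$. For a point process $\tilde\chi$ on $\mathbb{R}^{[2d]}\times[0,1]$,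 $\mathcal{G}(\tilde\chi)$ is the graph whose vertices are the endpoints of those $e\in\mathbb{R}^{[2d]}$ with $\tilde\chi(\{e\}\times[0,1])=1$ and in which $e=\{x,y\}$ is an edge iff $\tilde\chi(\{(e,u)\})=1$ for some $u\le\varphi(y-x)$. $C(x,\tilde\chi)$ is the (vertex set of the) connected component of $x$ in $\mathcal{G}(\tilde\chi)$, and $C(x,\tilde\chi):=\{x\}$ if $x$ is not a vertex. $t_*:=\sup\{t\ge0:\mathbb{E}\exp(z|C(0,\chi_t^0)|)<\infty\text{ for some }z>0\}$. A function is analytic on $[0,t_* )$ if near every $s\in[0,t_* )$ it is given by a convergent power series in $t-s$.
   Formalization: It is additionally assumed that g(C(0,χ_t^{0,x}))·1{|C(0,χ_t^{0,x})|<n} is integrable for all n and t in [0,t_* ); the growth bound does not control g on small sets, so otherwise the expectation can be infinite. *)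

theory Defs
  imports "HOL-Probability.Probability"
begin

text \<open>The space \<open>\<real>\<^sup>d\<close> is \<open>real ^ 'd\<close>, abbreviated \<open>'d pt\<close>; the linear order on the finite index type \<open>'d\<close>
  fixes the order of the coordinates.\<close>

type_synonym 'd pt = "(real, 'd) vec"

definition lex_less :: "('d::{finite,linorder}) pt \<Rightarrow> 'd pt \<Rightarrow> bool" where
  "lex_less x y \<longleftrightarrow> (\<exists>i. x $ i < y $ i \<and> (\<forall>j<i. x $ j = y $ j))"


subsection \<open>Locally finite sets\<close>

definition locally_finite_sets :: "'a::metric_space set set" where
  "locally_finite_sets = {\<mu>. \<forall>B. bounded B \<longrightarrow> finite (\<mu> \<inter> B)}"

definition npts :: "'a set \<Rightarrow> 'a set \<Rightarrow> ennreal" where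
  "npts \<mu> B = emeasure (count_space UNIV) (\<mu> \<inter> B)"

definition N_space :: "'a::metric_space set measure" where
  "N_space = sigma locally_finite_sets
     {(\<lambda>\<mu>. npts \<mu> B) -` A \<inter> locally_finite_sets | A B. A \<in> sets borel \<and> B \<in> sets borel}"

text \<open>\<open>exp_npts z \<mu>\<close> is \<open>exp (z * |\<mu>|)\<close> for \<open>z > 0\<close>, with value \<open>\<infinity>\<close> when \<open>\<mu>\<close> is infinite.\<close>

definition exp_npts :: "real \<Rightarrow> 'a set \<Rightarrow> ennreal" where
  "exp_npts z \<mu> = (if finite \<mu> then ennreal (exp (z * real (card \<mu>))) else \<infinity>)"


subsection \<open>The Poisson process and its marks\<close>

text \<open>The mass function is written out because \<open>poisson_pmf\<close> does not cover rate \<open>0\<close>,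
  which occurs for Lebesgue null sets.\<close>

definition poisson_process ::
  "'w measure \<Rightarrow> real \<Rightarrow> ('w \<Rightarrow> 'a::euclidean_space set) \<Rightarrow> bool" where
  "poisson_process P t \<eta> \<longleftrightarrow>
     \<eta> \<in> P \<rightarrow>\<^sub>M N_space \<and>
     (\<forall>B\<in>sets borel. emeasure lborel B < \<infinity> \<longrightarrow>
        (\<forall>k. measure P {\<omega>\<in>space P. npts (\<eta> \<omega>) B = of_nat k}
             = (t * measure lborel B) ^ k / fact k * exp (- (t * measure lborel B)))) \<and>
     (\<forall>(I::nat set) B. finite I \<and> disjoint_family_on B I \<and> (\<forall>i\<in>I. B i \<in> sets borel) \<longrightarrow>
        prob_space.indep_vars P (\<lambda>_. borel) (\<lambda>i \<omega>. npts (\<eta> \<omega>) (B i)) I)"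

text \<open>Points are indexed by \<open>nat + nat\<close>: \<open>Inl i\<close> is the added point number \<open>i\<close> and \<open>Inr j\<close> is
  the Poisson point \<open>X j\<close>. The marks carry ordered pairs of such indices. The library's
  \<open>indep_var\<close> would force the point sequence and the mark family to have the same type, so
  their independence is expressed through the generated \<open>\<sigma>\<close>-fields. For \<open>t = 0\<close> there are no
  Poisson points and \<open>X\<close> is irrelevant.\<close>

definition marked_poisson ::
  "'w measure \<Rightarrow> real \<Rightarrow> (nat \<Rightarrow> 'w \<Rightarrow> 'a::euclidean_space)
     \<Rightarrow> ((nat + nat) \<times> (nat + nat) \<Rightarrow> 'w \<Rightarrow> real) \<Rightarrow> bool" where
  "marked_poisson P t X U \<longleftrightarrow>
     prob_space P \<and>
     prob_space.indep_vars P (\<lambda>_. borel) U UNIV \<and>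
     (\<forall>p. distr P borel (U p) = uniform_measure lborel {0..1}) \<and>
     (t > 0 \<longrightarrow>
        (\<forall>j. X j \<in> borel_measurable P) \<and>
        (AE \<omega> in P. inj (\<lambda>j. X j \<omega>)) \<and>
        poisson_process P t (\<lambda>\<omega>. range (\<lambda>j. X j \<omega>)) \<and>
        prob_space.indep_set P
          {(\<lambda>\<omega> j. X j \<omega>) -` A \<inter> space P | A. A \<in> sets (Pi\<^sub>M UNIV (\<lambda>_. borel))}
          {(\<lambda>\<omega> p. U p \<omega>) -` A \<inter> space P | A. A \<in> sets (Pi\<^sub>M UNIV (\<lambda>_. borel))})"

text \<open>The finite family of added points is a partial map \<open>y\<close>; restricting \<open>y\<close> gives a subfamily
  that keeps its indices and hence its marks.\<close>

definition chi ::
  "real \<Rightarrow> (nat \<Rightarrow> 'w \<Rightarrow> ('d::{finite,linorder}) pt)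
     \<Rightarrow> ((nat + nat) \<times> (nat + nat) \<Rightarrow> 'w \<Rightarrow> real)
     \<Rightarrow> (nat \<rightharpoonup> 'd pt) \<Rightarrow> 'w \<Rightarrow> ('d pt set \<times> real) set" where
  "chi t X U y \<omega> =
     (let I = dom y <+> (if t > 0 then UNIV else {});
          Z = case_sum (\<lambda>i. the (y i)) (\<lambda>j. X j \<omega>)
      in {({Z i, Z j}, U (i, j) \<omega>) | i j. i \<in> I \<and> j \<in> I \<and> lex_less (Z i) (Z j)})"


subsection \<open>The random graph and its clusters\<close>

definition rcm_verts :: "('a set \<times> real) set \<Rightarrow> 'a set" where
  "rcm_verts \<xi> = {v. \<exists>e. card e = 2 \<and> v \<in> e \<and> card (\<xi> \<inter> ({e} \<times> {0..1})) = 1}"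

definition rcm_edges ::
  "('a::real_vector \<Rightarrow> real) \<Rightarrow> ('a set \<times> real) set \<Rightarrow> ('a \<times> 'a) set" where
  "rcm_edges \<phi> \<xi> = {(x, y). x \<in> rcm_verts \<xi> \<and> y \<in> rcm_verts \<xi> \<and> x \<noteq> y \<and>
     (\<exists>u\<in>{0..1}. ({x, y}, u) \<in> \<xi> \<and> u \<le> \<phi> (y - x))}"

definition cluster ::
  "('a::real_vector \<Rightarrow> real) \<Rightarrow> 'a \<Rightarrow> ('a set \<times> real) set \<Rightarrow> 'a set" where
  "cluster \<phi> x \<xi> = (if x \<in> rcm_verts \<xi> then (rcm_edges \<phi> \<xi>)\<^sup>* `` {x} else {x})"

definition t_star ::
  "(('d::{finite,linorder}) pt \<Rightarrow> real) \<Rightarrow> (real \<Rightarrow> 'w measure)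
     \<Rightarrow> (real \<Rightarrow> nat \<Rightarrow> 'w \<Rightarrow> 'd pt)
     \<Rightarrow> (real \<Rightarrow> (nat + nat) \<times> (nat + nat) \<Rightarrow> 'w \<Rightarrow> real) \<Rightarrow> ereal" where
  "t_star \<phi> P X U = Sup (ereal ` {t. 0 \<le> t \<and>
     (\<exists>z>0. (\<integral>\<^sup>+\<omega>. exp_npts z (cluster \<phi> 0 (chi t (X t) (U t) [0 \<mapsto> 0] \<omega>)) \<partial>P t) < \<infinity>)})"

text \<open>The added points \<open>0, x\<^sub>i (i \<in> J), x\<close> for \<open>J \<subseteq> {1..n}\<close>; for \<open>n = 0\<close> and \<open>J = {}\<close> they are
  just \<open>0, x\<close>.\<close>

definition added :: "nat \<Rightarrow> nat set \<Rightarrow> (nat \<Rightarrow> 'a::zero) \<Rightarrow> 'a \<Rightarrow> (nat \<rightharpoonup> 'a)" where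
  "added n J xs x = ((\<lambda>i. Some (xs i)) |` J)(0 \<mapsto> 0, Suc n \<mapsto> x)"


subsection \<open>Analyticity\<close>

text \<open>Neighbourhoods are relative to \<open>S\<close>, so at the left end point of \<open>S = [0, t)\<close> the
  expansion is one-sided.\<close>

definition real_analytic_on :: "(real \<Rightarrow> real) \<Rightarrow> real set \<Rightarrow> bool" where
  "real_analytic_on f S \<longleftrightarrow>
     (\<forall>s\<in>S. \<exists>a. \<exists>\<delta>>0. \<forall>t\<in>S. \<bar>t - s\<bar> < \<delta> \<longrightarrow> (\<lambda>n. a n * (t - s) ^ n) sums f t)"

end

theory Submission
  imports Defs
begin

text \<open>Campbell's formula and inclusion-exclusion for the void probabilities give an expansion of
  the law of a finite cluster: among the added points let \<open>Y\<close> be those inside and \<open>A\<close> those outside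
  the cluster. The cluster consists of \<open>Y\<close> and \<open>k\<close> Poisson points \<open>z\<close> with density
  \<open>t ^ k / k! * W(S) * exp (- t * V(S))\<close>, \<open>S = Y \<union> z\<close>, where \<open>W(S)\<close> is the probability that \<open>S\<close> is
  connected without edges to \<open>A\<close> and \<open>V(S) = \<integral> (1 - \<Prod>v\<in>S. (1 - \<phi> (w - v))) dw \<le> |S| * m\<close>. All
  dependence on \<open>t\<close> is now in \<open>t ^ k * exp (- t * V(S))\<close>. Because of \<open>V(S) \<le> |S| * m\<close> a change of \<open>t\<close> by
  a small \<open>h\<close> costs at most a factor \<open>exp (\<epsilon> * |S|)\<close>, which the exponential moment below \<open>t_star\<close>
  absorbs; so the Taylor series may be integrated term by term. By the product rule the \<open>n\<close>-th coefficient sums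
  over \<open>q \<le> n\<close> terms in which \<open>q\<close> points are differentiated and \<open>n - q\<close> factors \<open>- V(S)\<close> appear.
  In the integral of the theorem the points \<open>x\<^sub>i\<close> of the cluster play the role of the \<open>q\<close>
  points, and the alternating sum over the others produces \<open>\<Prod>i. - (1 - \<Prod>v\<in>S. (1 - \<phi> (x\<^sub>i - v)))\<close>,
  which integrates to \<open>(- V(S)) ^ (n - q)\<close>.\<close>

subsection \<open>Counting injections\<close>

text \<open>The spaces \<open>P t\<close> for different \<open>t\<close> are unrelated, so no
  coupling in the intensity is at hand: intensities are compared only through the deterministic
  expansion \<open>animal\<close>. Being below the supremum \<open>t_star\<close> yields an
  exponential moment at some larger intensity only. Retaining the Poisson points independently
  inside \<open>P t\<close> gives the same expansion at a smaller intensity, for a component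
  contained in the original one; this transfers the moment and shows that the expansion has total
  mass 1, so that clusters are finite almost surely. At \<open>s = 0\<close> clusters with Poisson
  points have density zero and dominate nothing nearby, so the bound is taken at a small positive
  intensity instead. Expectations are computed in \<open>ennreal\<close>; inclusion-exclusion is
  therefore used with the odd terms moved to the other side, and signs return only once finiteness
  is known. Moments in the presence of both 0 and \<open>x\<close> come from the union of two
  one-point clusters and translation invariance. The case \<open>x = 0\<close> is degenerate:
  doubled marks make the origin a non-vertex, and the function is constant.\<close>

definition Inj :: "'a set \<Rightarrow> 'b set \<Rightarrow> ('a \<Rightarrow> 'b) set" where
  "Inj I J = {i \<in> I \<rightarrow>\<^sub>E J. inj_on i I}"

text \<open>Falling factorial; truncated subtraction makes it vanish for \<open>n < m\<close>, as it
  must when it counts injections.\<close>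

definition ffn :: "nat \<Rightarrow> nat \<Rightarrow> nat" where
  "ffn n m = (\<Prod>i<m. n - i)"

lemma ffn_0 [simp]: "ffn n 0 = 1"
  by (simp add: ffn_def)

lemma ffn_Suc: "ffn n (Suc m) = ffn n m * (n - m)"
  by (simp add: ffn_def)

lemma ffn_less: "n < m \<Longrightarrow> ffn n m = 0"
  by (auto simp: ffn_def intro!: bexI[of _ n])

lemma ffn_fact: "m \<le> n \<Longrightarrow> ffn n m * fact (n - m) = fact n"
proof (induction m)
  case (Suc m)
  then have "n - m = Suc (n - Suc m)" by simp
  then have "fact (n - m) = (n - m) * fact (n - Suc m)" by (metis fact_Suc of_nat_id)
  with Suc show ?case by (simp add: ffn_Suc mult.assoc)
qed simp

text \<open>Boxes of different colours are disjoint, so injectivity is a condition within each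
  colour only. A new index \<open>l\<close> can take \<open>card (B (Q l))\<close> values minus
  those already spent on its colour.\<close>

lemma card_coloured_Inj:
  fixes Q :: "'a \<Rightarrow> 'q" and B :: "'q \<Rightarrow> 'b set"
  assumes "finite I" and "\<And>l. l \<in> I \<Longrightarrow> finite (B (Q l))"
    and "\<And>l l'. l \<in> I \<Longrightarrow> l' \<in> I \<Longrightarrow> Q l \<noteq> Q l' \<Longrightarrow> B (Q l) \<inter> B (Q l') = {}"
  shows "card {i \<in> Inj I UNIV. \<forall>l\<in>I. i l \<in> B (Q l)} =
           (\<Prod>c\<in>Q ` I. ffn (card (B c)) (card {l\<in>I. Q l = c}))
       \<and> finite {i \<in> Inj I UNIV. \<forall>l\<in>I. i l \<in> B (Q l)}"
  using assms
proof (induction I rule: finite_induct)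
  case empty
  have "{i \<in> Inj {} UNIV. \<forall>l\<in>{}. i l \<in> B (Q l)} = {\<lambda>_. undefined}"
    by (auto simp: Inj_def)
  then show ?case by simp
next
  case (insert l I)
  let ?S = "\<lambda>I. {i \<in> Inj I UNIV. \<forall>l\<in>I. i l \<in> B (Q l)}"
  let ?m = "card {l'\<in>I. Q l' = Q l}"
  have IH: "card (?S I) = (\<Prod>c\<in>Q ` I. ffn (card (B c)) (card {l\<in>I. Q l = c}))" "finite (?S I)"
    using insert.IH insert.prems by auto
  have fB: "finite (B (Q l))" using insert.prems by auto
  have bij: "bij_betw (\<lambda>(i, j). i(l := j)) (SIGMA i:?S I. B (Q l) - i ` I) (?S (insert l I))"
  proof (rule bij_betwI[where g = "\<lambda>i. (i(l := undefined), i l)"])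
    show "(\<lambda>(i, j). i(l := j)) \<in> (SIGMA i:?S I. B (Q l) - i ` I) \<rightarrow> ?S (insert l I)"
      using insert.hyps by (fastforce simp: Inj_def inj_on_def PiE_iff extensional_def)
    show "(\<lambda>i. (i(l := undefined), i l)) \<in> ?S (insert l I) \<rightarrow> (SIGMA i:?S I. B (Q l) - i ` I)"
    proof (rule Pi_I)
      fix i assume i: "i \<in> ?S (insert l I)"
      then have "i l' \<noteq> i l" if "l' \<in> I" for l'
        using insert.hyps that by (auto simp: Inj_def inj_on_def)
      moreover have "inj_on (i(l := undefined)) I"
        using i insert.hyps by (auto simp: Inj_def inj_on_def)
      ultimately show "(i(l := undefined), i l) \<in> (SIGMA i:?S I. B (Q l) - i ` I)"
        using i insert.hyps by (auto simp: Inj_def PiE_iff extensional_def simp del: split_paired_All)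
    qed
    show "\<And>x. x \<in> (SIGMA i:?S I. B (Q l) - i ` I) \<Longrightarrow>
         (\<lambda>i. (i(l := undefined), i l)) ((\<lambda>(i, j). i(l := j)) x) = x"
      using insert.hyps by (auto simp: Inj_def PiE_iff extensional_def fun_eq_iff)
  qed auto
  \<comment> \<open>By disjointness of the boxes, only indices with the colour of \<open>l\<close>
    can have used up values of \<open>B (Q l)\<close>.\<close>
  have cd: "card (B (Q l) - i ` I) = card (B (Q l)) - ?m" if "i \<in> ?S I" for i
  proof -
    have "i ` I \<inter> B (Q l) = i ` {l'\<in>I. Q l' = Q l}"
    proof -
      have "Q l' = Q l" if "l' \<in> I" "i l' \<in> B (Q l)" for l'
        using that \<open>i \<in> ?S I\<close> insert.prems(2)[of l' l] by (cases "Q l' = Q l") auto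
      then show ?thesis using \<open>i \<in> ?S I\<close> by (force simp: image_iff)
    qed
    moreover have "card (i ` {l'\<in>I. Q l' = Q l}) = ?m"
      using that by (intro card_image) (auto simp: Inj_def inj_on_def)
    moreover have "B (Q l) - i ` I = B (Q l) - (i ` I \<inter> B (Q l))" by auto
    ultimately show ?thesis using insert.hyps(1) by (subst card_Diff_subset_Int) (auto simp: Int_commute)
  qed
  have c: "card (?S (insert l I)) = card (?S I) * (card (B (Q l)) - ?m)"
  proof -
    have "card (?S (insert l I)) = card (SIGMA i:?S I. B (Q l) - i ` I)"
      using bij_betw_same_card[OF bij] by simp
    also have "\<dots> = (\<Sum>i\<in>?S I. card (B (Q l) - i ` I))"
      using IH fB by (subst card_SigmaI) auto
    also have "\<dots> = (\<Sum>i\<in>?S I. card (B (Q l)) - ?m)" by (intro sum.cong refl cd)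
    finally show ?thesis by simp
  qed
  have fin: "finite (?S (insert l I))"
    using bij_betw_finite[OF bij] IH(2) fB by auto
  have e1: "{l'\<in>insert l I. Q l' = Q l} = insert l {l'\<in>I. Q l' = Q l}" by auto
  have m: "card {l'\<in>insert l I. Q l' = Q l} = Suc ?m"
    unfolding e1 using insert.hyps by (subst card_insert_disjoint) auto
  have e2: "c \<noteq> Q l \<Longrightarrow> {l'\<in>insert l I. Q l' = c} = {l'\<in>I. Q l' = c}" for c by auto
  have "(\<Prod>c\<in>Q ` insert l I. ffn (card (B c)) (card {l'\<in>insert l I. Q l' = c})) =
     ffn (card (B (Q l))) (Suc ?m) * (\<Prod>c\<in>Q ` I - {Q l}. ffn (card (B c)) (card {l'\<in>I. Q l' = c}))"
  proof -
    have "(\<Prod>c\<in>Q ` I - {Q l}. ffn (card (B c)) (card {l'\<in>insert l I. Q l' = c})) =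
          (\<Prod>c\<in>Q ` I - {Q l}. ffn (card (B c)) (card {l'\<in>I. Q l' = c}))"
      by (intro prod.cong refl) (subst e2, auto)
    then show ?thesis
      using insert.hyps(1) unfolding image_insert by (subst prod.insert_remove) (auto simp only: m)
  qed
  also have "\<dots> = (card (B (Q l)) - ?m) * (ffn (card (B (Q l))) ?m * (\<Prod>c\<in>Q ` I - {Q l}. ffn (card (B c)) (card {l'\<in>I. Q l' = c})))"
    by (simp add: ffn_Suc)
  also have "ffn (card (B (Q l))) ?m * (\<Prod>c\<in>Q ` I - {Q l}. ffn (card (B c)) (card {l'\<in>I. Q l' = c}))
     = (\<Prod>c\<in>Q ` I. ffn (card (B c)) (card {l'\<in>I. Q l' = c}))"
  proof (cases "Q l \<in> Q ` I")
    case True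
    then show ?thesis using insert.hyps(1) by (subst (2) prod.remove[of _ "Q l"]) auto
  next
    case False
    then have "{l'\<in>I. Q l' = Q l} = {}" by (auto simp: image_iff dest: sym)
    then have "?m = 0" by (metis card.empty)
    with False show ?thesis by simp
  qed
  finally show ?case using c IH(1) fin by simp
qed

lemma countable_Inj [simp, intro]: "finite I \<Longrightarrow> countable J \<Longrightarrow> countable (Inj I J)"
  by (rule countable_subset[of _ "I \<rightarrow>\<^sub>E J"]) (auto simp: Inj_def intro: countable_PiE)

subsection \<open>Factorial moments\<close>

text \<open>The falling factorial cancels against \<open>k!\<close> and leaves the exponential
  series shifted by \<open>m\<close>. These are the factorial moments of a Poisson variable.\<close>

lemma poisson_ffn_sums:
  fixes c :: real
  shows "(\<lambda>k. real (ffn k m) * (c ^ k / fact k * exp (- c))) sums c ^ m"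
proof -
  have "(\<lambda>k. c ^ m * exp (- c) * (c ^ k /\<^sub>R fact k)) sums (c ^ m * exp (- c) * exp c)"
    by (intro sums_mult exp_converges)
  also have "c ^ m * exp (- c) * exp c = c ^ m" by (simp add: exp_minus)
  also have "(\<lambda>k. c ^ m * exp (- c) * (c ^ k /\<^sub>R fact k)) =
     (\<lambda>k. real (ffn (k + m) m) * (c ^ (k + m) / fact (k + m) * exp (- c)))"
  proof
    fix k
    have "real (ffn (k + m) m) * fact k = fact (k + m)"
      using ffn_fact[of m "k + m"] by simp (metis of_nat_fact of_nat_mult)
    then show "c ^ m * exp (- c) * (c ^ k /\<^sub>R fact k) =
      real (ffn (k + m) m) * (c ^ (k + m) / fact (k + m) * exp (- c))"
      by (simp add: field_simps power_add)
  qed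
  finally have "(\<lambda>k. real (ffn (k + m) m) * (c ^ (k + m) / fact (k + m) * exp (- c))) sums c ^ m" .
  then show ?thesis
    by (subst (asm) sums_iff_shift) (simp add: ffn_less)
qed

text \<open>The falling factorial for counts in \<open>ennreal\<close>. Its value at infinity is 0,
  which is harmless because bounded sets contain finitely many points.\<close>

definition ffe :: "nat \<Rightarrow> ennreal \<Rightarrow> ennreal" where
  "ffe m x = (\<Sum>k. of_nat (ffn k m) * indicator {of_nat k} x)"

lemma ffe_of_nat: "ffe m (of_nat n) = of_nat (ffn n m)"
proof -
  have "ffe m (of_nat n) = (\<Sum>k\<in>{n}. of_nat (ffn k m) * indicator {of_nat k} (of_nat n :: ennreal))"
    unfolding ffe_def by (rule suminf_finite) (auto simp: indicator_def)
  then show ?thesis by simp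
qed

lemma ffe_measurable [measurable]: "ffe m \<in> borel_measurable borel"
  unfolding ffe_def by measurable

lemma nn_integral_ffe_poisson:
  assumes "prob_space P" and [measurable]: "N \<in> borel_measurable P" and c: "0 \<le> c"
    and N: "\<And>k::nat. measure P {\<omega>\<in>space P. N \<omega> = of_nat k} = c ^ k / fact k * exp (- c)"
  shows "(\<integral>\<^sup>+\<omega>. ffe m (N \<omega>) \<partial>P) = ennreal (c ^ m)"
proof -
  interpret prob_space P by fact
  have "(\<integral>\<^sup>+\<omega>. ffe m (N \<omega>) \<partial>P) = (\<Sum>k. \<integral>\<^sup>+\<omega>. of_nat (ffn k m) * indicator {\<omega>\<in>space P. N \<omega> = of_nat k} \<omega> \<partial>P)"
    unfolding ffe_def
    by (subst nn_integral_suminf[symmetric]) (auto intro!: nn_integral_cong suminf_cong split: split_indicator)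
  also have "\<dots> = (\<Sum>k. of_nat (ffn k m) * emeasure P {\<omega>\<in>space P. N \<omega> = of_nat k})"
    by (subst nn_integral_cmult_indicator) auto
  also have "\<dots> = (\<Sum>k. ennreal (real (ffn k m) * (c ^ k / fact k * exp (- c))))"
    unfolding emeasure_eq_measure N
    unfolding ennreal_of_nat_eq_real_of_nat
    by (intro suminf_cong ennreal_mult[symmetric]) (use c in auto)
  also have "\<dots> = ennreal (c ^ m)"
    using c by (intro suminf_ennreal_eq poisson_ffn_sums) auto
  finally show ?thesis .
qed

text \<open>Both sides are integrals of \<open>f\<close> against measures on tuples, so it suffices
  to compare these measures on boxes. There the inner sum counts injective tuples, and factorial
  moments of independent Poisson counts give the product of the volumes.\<close>

lemma Campbell:
  fixes X :: "nat \<Rightarrow> 'w \<Rightarrow> 'a::euclidean_space" and I :: "'b set"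
  assumes P: "prob_space P" and t: "0 \<le> t" and I: "finite I"
    and X [measurable]: "\<And>j. X j \<in> borel_measurable P"
    and inj: "AE \<omega> in P. inj (\<lambda>j. X j \<omega>)"
    and pp: "poisson_process P t (\<lambda>\<omega>. range (\<lambda>j. X j \<omega>))"
    and f [measurable]: "f \<in> borel_measurable (Pi\<^sub>M I (\<lambda>_. lborel))"
  shows "(\<integral>\<^sup>+\<omega>. \<integral>\<^sup>+i. f (\<lambda>l\<in>I. X (i l) \<omega>) \<partial>count_space (Inj I UNIV) \<partial>P) =
           ennreal t ^ card I * (\<integral>\<^sup>+z. f z \<partial>Pi\<^sub>M I (\<lambda>_. lborel))"
proof -
  interpret prob_space P by fact
  interpret L: product_sigma_finite "\<lambda>_::'b. lborel :: 'a measure" by standard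
  interpret LI: finite_product_sigma_finite "\<lambda>_::'b. lborel :: 'a measure" I by standard fact
  let ?N = "\<lambda>\<omega> B. npts (range (\<lambda>j. X j \<omega>)) B"
  let ?PM = "Pi\<^sub>M I (\<lambda>_. lborel :: 'a measure)"
  let ?C = "count_space (Inj I (UNIV :: nat set))"
  interpret C: sigma_finite_measure ?C
    using I by (intro sigma_finite_measure_count_space_countable) auto
  have lf: "finite (range (\<lambda>j. X j \<omega>) \<inter> B)" if "\<omega> \<in> space P" "bounded B" for \<omega> B
  proof -
    have "range (\<lambda>j. X j \<omega>) \<in> space N_space"
      using pp measurable_space[OF _ that(1)] unfolding poisson_process_def by metis
    then show ?thesis using that by (auto simp: N_space_def space_measure_of_conv locally_finite_sets_def)
  qed
  have N_prob: "measure P {\<omega>\<in>space P. ?N \<omega> B = of_nat k}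
      = (t * measure lborel B) ^ k / fact k * exp (- (t * measure lborel B))"
    if "B \<in> sets borel" "emeasure lborel B < \<infinity>" for B k
    using pp that by (simp add: poisson_process_def)
  have N_ind: "indep_vars (\<lambda>_. borel) (\<lambda>i \<omega>. ?N \<omega> (B i)) I"
    if "finite I" "disjoint_family_on B I" "\<And>i. i \<in> I \<Longrightarrow> B i \<in> sets borel" for I :: "nat set" and B
    using pp that by (simp add: poisson_process_def)
  have N_meas: "(\<lambda>\<omega>. ?N \<omega> B) \<in> borel_measurable P" if "B \<in> sets borel" for B
    using N_ind[of "{0}" "\<lambda>_. B"] that by (auto simp: disjoint_family_on_def indep_vars_def2)
  define M1 where "M1 = P \<Otimes>\<^sub>M ?C"
  define q where "q = (\<lambda>(\<omega>, i). \<lambda>l\<in>I. X (i l) \<omega>)"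
  have q_meas [measurable]: "q \<in> measurable M1 ?PM"
    unfolding q_def M1_def
  proof (rule measurable_PiM_single')
    fix l assume l: "l \<in> I"
    have "(\<lambda>x. (X (snd x l)) (fst x)) \<in> measurable (P \<Otimes>\<^sub>M ?C) borel"
    proof (rule measurable_compose_countable'[where I = UNIV and g = "\<lambda>x. snd x l" and f = "\<lambda>j x. X j (fst x)"])
      show "(\<lambda>x. snd x l) \<in> P \<Otimes>\<^sub>M ?C \<rightarrow>\<^sub>M count_space UNIV"
        by (rule measurable_compose[OF measurable_snd]) simp
    qed auto
    then show "(\<lambda>x. (case x of (\<omega>, i) \<Rightarrow> \<lambda>l\<in>I. X (i l) \<omega>) l) \<in> P \<Otimes>\<^sub>M ?C \<rightarrow>\<^sub>M lborel"
      using l by (simp add: case_prod_beta)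
  qed (auto simp: case_prod_beta)
  \<comment> \<open>The factorial moment measure of the process.\<close>
  define \<alpha> where "\<alpha> = distr M1 ?PM q"
  have int_\<alpha>: "(\<integral>\<^sup>+z. h z \<partial>\<alpha>) = (\<integral>\<^sup>+\<omega>. \<integral>\<^sup>+i. h (\<lambda>l\<in>I. X (i l) \<omega>) \<partial>?C \<partial>P)"
    if [measurable]: "h \<in> borel_measurable ?PM" for h :: "_ \<Rightarrow> ennreal"
  proof -
    have "(\<integral>\<^sup>+z. h z \<partial>\<alpha>) = (\<integral>\<^sup>+x. h (q x) \<partial>M1)"
      unfolding \<alpha>_def by (intro nn_integral_distr) auto
    also have "\<dots> = (\<integral>\<^sup>+\<omega>. \<integral>\<^sup>+i. h (q (\<omega>, i)) \<partial>?C \<partial>P)"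
      unfolding M1_def by (rule C.nn_integral_fst[symmetric]) (fold M1_def, measurable)
    finally show ?thesis by (simp add: q_def)
  qed
  have eq_bd: "emeasure \<alpha> (Pi\<^sub>E I A) = ennreal t ^ card I * emeasure ?PM (Pi\<^sub>E I A)"
    if A: "\<And>l. l \<in> I \<Longrightarrow> A l \<in> sets borel" and bd: "\<And>l. l \<in> I \<Longrightarrow> bounded (A l)" for A :: "'b \<Rightarrow> 'a set"
  proof -
    \<comment> \<open>The sides \<open>A l\<close> may overlap in any way. The atoms of the algebra
      they generate are pairwise disjoint, as independence of the counts requires;
      \<open>\<kappa>\<close> records which atom contains each coordinate, and the box splits into
      the pieces \<open>R \<kappa>\<close>.\<close>
    define atm where "atm K = (\<Inter>l\<in>K. A l) \<inter> (\<Inter>l\<in>I - K. - A l)" for K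
    define KK where "KK = Pi\<^sub>E I (\<lambda>l. {K \<in> Pow I. l \<in> K})"
    define R where "R \<kappa> = Pi\<^sub>E I (\<lambda>l. atm (\<kappa> l))" for \<kappa> :: "'b \<Rightarrow> 'b set"
    have fKK: "finite KK" unfolding KK_def using I by (intro finite_PiE) auto
    have at_sets [measurable]: "atm K \<in> sets borel" if "K \<subseteq> I" for K
    proof -
      have "atm K = {x\<in>space borel. (\<forall>l\<in>K. x \<in> A l) \<and> (\<forall>l\<in>I - K. x \<notin> A l)}" by (auto simp: atm_def)
      also have "\<dots> \<in> sets borel"
        using that I A by (intro sets.sets_Collect_conj sets.sets_Collect_finite_All sets.sets_Collect_neg)
          (auto dest: finite_subset)
      finally show ?thesis .
    qed
    have at_disj: "atm K \<inter> atm K' = {}" if "K \<subseteq> I" "K' \<subseteq> I" "K \<noteq> K'" for K K'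
      using that by (auto simp: atm_def)
    have at_bd: "bounded (atm K)" if "K \<subseteq> I" "l \<in> K" for K l
      by (rule bounded_subset[OF bd[of l]]) (use that in \<open>auto simp: atm_def\<close>)
    have KKD: "\<kappa> l \<subseteq> I" "l \<in> \<kappa> l" if "\<kappa> \<in> KK" "l \<in> I" for \<kappa> l
      using that by (auto simp: KK_def PiE_iff)
    have R_sets: "R \<kappa> \<in> sets ?PM" if "\<kappa> \<in> KK" for \<kappa>
      unfolding R_def using I that by (intro sets_PiM_I_finite) (auto dest: KKD)
    have R_disj: "disjoint_family_on R KK"
    proof (unfold disjoint_family_on_def, intro ballI impI)
      fix \<kappa> \<kappa>' assume k: "\<kappa> \<in> KK" "\<kappa>' \<in> KK" "\<kappa> \<noteq> \<kappa>'"
      then obtain l where "l \<in> I" "\<kappa> l \<noteq> \<kappa>' l"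
      proof -
        have "\<exists>l\<in>I. \<kappa> l \<noteq> \<kappa>' l"
        proof (rule ccontr)
          assume "\<not> (\<exists>l\<in>I. \<kappa> l \<noteq> \<kappa>' l)"
          then have "\<kappa> = \<kappa>'"
            using k unfolding KK_def by (intro PiE_ext[of \<kappa> I _ \<kappa>']) auto
          with k show False by simp
        qed
        with that show ?thesis by blast
      qed
      then have "atm (\<kappa> l) \<inter> atm (\<kappa>' l) = {}" using k by (intro at_disj) (auto dest: KKD)
      then show "R \<kappa> \<inter> R \<kappa>' = {}" using \<open>l \<in> I\<close> by (auto simp: R_def PiE_iff)
    qed
    have un: "Pi\<^sub>E I A = (\<Union>\<kappa>\<in>KK. R \<kappa>)"
    proof (intro equalityI subsetI)
      fix z assume z: "z \<in> Pi\<^sub>E I A"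
      show "z \<in> (\<Union>\<kappa>\<in>KK. R \<kappa>)"
        by (rule UN_I[of "\<lambda>l\<in>I. {l'\<in>I. z l \<in> A l'}"]) (use z in \<open>auto simp: KK_def R_def atm_def PiE_iff\<close>)
    next
      fix z assume "z \<in> (\<Union>\<kappa>\<in>KK. R \<kappa>)"
      then obtain \<kappa> where "\<kappa> \<in> KK" "z \<in> R \<kappa>" by blast
      then show "z \<in> Pi\<^sub>E I A" using KKD[of \<kappa>] by (force simp: R_def atm_def PiE_iff)
    qed
    have main: "emeasure \<alpha> (R \<kappa>) = ennreal t ^ card I * emeasure ?PM (R \<kappa>)" if \<kappa>: "\<kappa> \<in> KK" for \<kappa>
    proof -
      let ?Q = "\<kappa> ` I"
      let ?m = "\<lambda>c. card {l\<in>I. \<kappa> l = c}"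
      have Q: "c \<subseteq> I" "\<exists>l. l \<in> c" if "c \<in> ?Q" for c using that \<kappa> by (auto dest: KKD)
      have fQ: "finite ?Q" using I by simp
      have lat: "emeasure lborel (atm c) < \<infinity>" if "c \<in> ?Q" for c
        using at_bd[of c] Q[OF that] by (intro emeasure_bounded_finite) auto
      have "emeasure \<alpha> (R \<kappa>) = (\<integral>\<^sup>+z. indicator (R \<kappa>) z \<partial>\<alpha>)"
        using R_sets[OF \<kappa>] by (intro nn_integral_indicator[symmetric]) (simp add: \<alpha>_def)
      also have "\<dots> = (\<integral>\<^sup>+\<omega>. \<integral>\<^sup>+i. indicator (R \<kappa>) (\<lambda>l\<in>I. X (i l) \<omega>) \<partial>?C \<partial>P)"
        using R_sets[OF \<kappa>] by (intro int_\<alpha>) auto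
      \<comment> \<open>Almost surely the points are distinct, so the tuples that fall into
        \<open>R \<kappa>\<close> are the coloured injections with the atoms as boxes.\<close>
      also have "\<dots> = (\<integral>\<^sup>+\<omega>. (\<Prod>c\<in>?Q. ffe (?m c) (?N \<omega> (atm c))) \<partial>P)"
      proof (rule nn_integral_cong_AE)
        show "AE \<omega> in P. (\<integral>\<^sup>+i. indicator (R \<kappa>) (\<lambda>l\<in>I. X (i l) \<omega>) \<partial>?C) =
               (\<Prod>c\<in>?Q. ffe (?m c) (?N \<omega> (atm c)))"
          using inj AE_space
        proof eventually_elim
          fix \<omega> assume j: "inj (\<lambda>j. X j \<omega>)" and om: "\<omega> \<in> space P"
          define B where "B c = {j. X j \<omega> \<in> atm c}" for c
          have im: "range (\<lambda>j. X j \<omega>) \<inter> atm c = (\<lambda>j. X j \<omega>) ` B c" for c by (auto simp: B_def)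
          have fB: "finite (B c)" if "c \<in> ?Q" for c
          proof -
            have "finite (range (\<lambda>j. X j \<omega>) \<inter> atm c)"
              using Q[OF that] at_bd[of c] om by (intro lf) auto
            then show ?thesis unfolding im using j by (metis finite_imageD inj_on_subset subset_UNIV)
          qed
          have NB: "?N \<omega> (atm c) = of_nat (card (B c))" if "c \<in> ?Q" for c
            unfolding npts_def im using fB[OF that] j
            by (subst emeasure_count_space_finite) (auto simp: card_image inj_on_subset)
          let ?S = "{i \<in> Inj I UNIV. \<forall>l\<in>I. i l \<in> B (\<kappa> l)}"
          have cc: "card ?S = (\<Prod>c\<in>?Q. ffn (card (B c)) (?m c)) \<and> finite ?S"
          proof (rule card_coloured_Inj[OF I])
            show "finite (B (\<kappa> l))" if "l \<in> I" for l using that by (intro fB) auto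
            show "B (\<kappa> l) \<inter> B (\<kappa> l') = {}" if "l \<in> I" "l' \<in> I" "\<kappa> l \<noteq> \<kappa> l'" for l l'
              using at_disj[of "\<kappa> l" "\<kappa> l'"] that \<kappa> by (auto simp: B_def dest: KKD)
          qed
          have "(\<integral>\<^sup>+i. indicator (R \<kappa>) (\<lambda>l\<in>I. X (i l) \<omega>) \<partial>?C) = (\<integral>\<^sup>+i. indicator ?S i \<partial>?C)"
            by (intro nn_integral_cong) (auto simp: R_def B_def PiE_iff indicator_def)
          also have "\<dots> = emeasure ?C ?S" by (intro nn_integral_indicator) auto
          also have "\<dots> = of_nat (card ?S)" using cc by (subst emeasure_count_space_finite) auto
          also have "\<dots> = (\<Prod>c\<in>?Q. of_nat (ffn (card (B c)) (?m c)))" using cc by simp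
          also have "\<dots> = (\<Prod>c\<in>?Q. ffe (?m c) (?N \<omega> (atm c)))"
            by (intro prod.cong refl) (simp add: NB ffe_of_nat)
          finally show "(\<integral>\<^sup>+i. indicator (R \<kappa>) (\<lambda>l\<in>I. X (i l) \<omega>) \<partial>?C) =
             (\<Prod>c\<in>?Q. ffe (?m c) (?N \<omega> (atm c)))" .
        qed
      qed
      also have "\<dots> = (\<Prod>c\<in>?Q. \<integral>\<^sup>+\<omega>. ffe (?m c) (?N \<omega> (atm c)) \<partial>P)"
      proof -
        \<comment> \<open>Independence of the counts is given for families indexed by naturals, so
          the atoms in use are enumerated.\<close>
        obtain e where e: "bij_betw e {..<card ?Q} ?Q"
          using ex_bij_betw_nat_finite[OF fQ] by (auto simp: atLeast0LessThan)
        have dj: "disjoint_family_on (\<lambda>i. atm (e i)) {..<card ?Q}"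
        proof (unfold disjoint_family_on_def, intro ballI impI)
          fix i i' assume i: "i \<in> {..<card ?Q}" "i' \<in> {..<card ?Q}" "i \<noteq> i'"
          then have "e i \<noteq> e i'" using e by (auto simp: bij_betw_def inj_on_def)
          moreover have "e i \<in> ?Q" "e i' \<in> ?Q" using i bij_betwE[OF e] by auto
          ultimately show "atm (e i) \<inter> atm (e i') = {}" using Q by (intro at_disj) auto
        qed
        have eQ: "e i \<in> ?Q" if "i < card ?Q" for i using e that by (auto simp: bij_betw_def)
        have iv: "indep_vars (\<lambda>_. borel) (\<lambda>i \<omega>. ffe (?m (e i)) (?N \<omega> (atm (e i)))) {..<card ?Q}"
          by (rule indep_vars_compose2[OF N_ind[OF _ dj]]) (use Q(1)[OF eQ] in auto)
        have "(\<integral>\<^sup>+\<omega>. (\<Prod>c\<in>?Q. ffe (?m c) (?N \<omega> (atm c))) \<partial>P) =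
          (\<integral>\<^sup>+\<omega>. (\<Prod>i<card ?Q. ffe (?m (e i)) (?N \<omega> (atm (e i)))) \<partial>P)"
          by (intro nn_integral_cong prod.reindex_bij_betw[OF e, symmetric])
        also have "\<dots> = (\<Prod>i<card ?Q. \<integral>\<^sup>+\<omega>. ffe (?m (e i)) (?N \<omega> (atm (e i))) \<partial>P)"
          by (intro indep_vars_nn_integral iv) auto
        also have "\<dots> = (\<Prod>c\<in>?Q. \<integral>\<^sup>+\<omega>. ffe (?m c) (?N \<omega> (atm c)) \<partial>P)"
          by (rule prod.reindex_bij_betw[OF e])
        finally show ?thesis .
      qed
      also have "\<dots> = (\<Prod>c\<in>?Q. (ennreal t * emeasure lborel (atm c)) ^ ?m c)"
      proof (intro prod.cong refl)
        fix c assume c: "c \<in> ?Q"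
        have "(\<integral>\<^sup>+\<omega>. ffe (?m c) (?N \<omega> (atm c)) \<partial>P) = ennreal ((t * measure lborel (atm c)) ^ ?m c)"
          using c Q lat t by (intro nn_integral_ffe_poisson P N_meas N_prob) auto
        also have "\<dots> = (ennreal t * emeasure lborel (atm c)) ^ ?m c"
          using t lat[OF c] by (simp add: ennreal_power[symmetric] ennreal_mult emeasure_eq_ennreal_measure)
        finally show "(\<integral>\<^sup>+\<omega>. ffe (?m c) (?N \<omega> (atm c)) \<partial>P) = (ennreal t * emeasure lborel (atm c)) ^ ?m c" .
      qed
      also have "\<dots> = (\<Prod>l\<in>I. ennreal t * emeasure lborel (atm (\<kappa> l)))"
        by (subst prod.image_gen[OF I, where g = \<kappa>]) (auto intro!: prod.cong)
      also have "\<dots> = ennreal t ^ card I * (\<Prod>l\<in>I. emeasure lborel (atm (\<kappa> l)))"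
        by (simp add: prod.distrib)
      also have "(\<Prod>l\<in>I. emeasure lborel (atm (\<kappa> l))) = emeasure ?PM (R \<kappa>)"
        unfolding R_def using \<kappa> I by (subst L.emeasure_PiM) (auto dest: KKD)
      finally show ?thesis .
    qed
    have "emeasure \<alpha> (Pi\<^sub>E I A) = (\<Sum>\<kappa>\<in>KK. emeasure \<alpha> (R \<kappa>))"
      unfolding un using R_sets R_disj fKK by (intro sum_emeasure[symmetric]) (auto simp: \<alpha>_def)
    also have "\<dots> = (\<Sum>\<kappa>\<in>KK. ennreal t ^ card I * emeasure ?PM (R \<kappa>))"
      by (intro sum.cong main refl)
    also have "\<dots> = ennreal t ^ card I * emeasure ?PM (Pi\<^sub>E I A)"
      unfolding un sum_distrib_left[symmetric] using R_sets R_disj fKK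
      by (subst sum_emeasure[symmetric]) auto
    finally show ?thesis .
  qed
  have eq: "emeasure \<alpha> (Pi\<^sub>E I A) = ennreal t ^ card I * emeasure ?PM (Pi\<^sub>E I A)"
    if A: "\<And>l. l \<in> I \<Longrightarrow> A l \<in> sets borel" for A :: "'b \<Rightarrow> 'a set"
  proof -
    \<comment> \<open>Counts and volumes are finite on bounded boxes only; a general box is an
      increasing limit of these.\<close>
    define An where "An n = Pi\<^sub>E I (\<lambda>l. A l \<inter> cball 0 (real n))" for n
    have AnS: "An n \<in> sets ?PM" for n
      unfolding An_def using I A by (intro sets_PiM_I_finite) auto
    have inc: "incseq An"
      unfolding An_def by (intro incseq_SucI PiE_mono) auto
    have un: "Pi\<^sub>E I A = (\<Union>n. An n)"
    proof safe
      fix z assume z: "z \<in> Pi\<^sub>E I A"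
      obtain n where n: "(\<Sum>l\<in>I. norm (z l)) \<le> real n" using real_arch_simple by blast
      have "norm (z l) \<le> real n" if "l \<in> I" for l
        using member_le_sum[OF that, of "\<lambda>l. norm (z l)"] I n by simp
      then show "z \<in> (\<Union>n. An n)" using z by (auto simp: An_def PiE_iff intro!: exI[of _ n])
    qed (auto simp: An_def PiE_iff extensional_def)
    have "emeasure \<alpha> (Pi\<^sub>E I A) = (SUP n. emeasure \<alpha> (An n))"
      unfolding un using AnS inc by (intro SUP_emeasure_incseq[symmetric]) (auto simp: \<alpha>_def)
    also have "\<dots> = (SUP n. ennreal t ^ card I * emeasure ?PM (An n))"
      unfolding An_def using A by (subst eq_bd) (auto intro: bounded_Int)
    also have "\<dots> = ennreal t ^ card I * (SUP n. emeasure ?PM (An n))"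
      by (rule SUP_mult_left_ennreal[symmetric])
    also have "(SUP n. emeasure ?PM (An n)) = emeasure ?PM (Pi\<^sub>E I A)"
      unfolding un using AnS inc by (intro SUP_emeasure_incseq) auto
    finally show ?thesis .
  qed
  have "\<alpha> = scale_measure (ennreal t ^ card I) ?PM"
  proof (rule measure_eqI_PiM_finite[OF I, where A = "\<lambda>n. Pi\<^sub>E I (\<lambda>_. cball 0 (real n))"])
    show "emeasure \<alpha> (Pi\<^sub>E I A) = emeasure (scale_measure (ennreal t ^ card I) ?PM) (Pi\<^sub>E I A)"
      if "\<And>i. i \<in> I \<Longrightarrow> A i \<in> sets lborel" for A
      using eq[of A] that by simp
    show "range (\<lambda>n. Pi\<^sub>E I (\<lambda>_. cball 0 (real n))) \<subseteq> prod_algebra I (\<lambda>_. lborel :: 'a measure)"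
      using I by (auto intro!: prod_algebraI_finite)
    show "(\<Union>n. Pi\<^sub>E I (\<lambda>_. cball 0 (real n))) = space ?PM"
    proof safe
      fix z assume z: "z \<in> space ?PM"
      obtain n where n: "(\<Sum>l\<in>I. norm (z l)) \<le> real n" using real_arch_simple by blast
      have "norm (z l) \<le> real n" if "l \<in> I" for l
        using member_le_sum[OF that, of "\<lambda>l. norm (z l)"] I n by simp
      then show "z \<in> (\<Union>n. Pi\<^sub>E I (\<lambda>_. cball 0 (real n)))" using z by (auto simp: PiE_iff space_PiM intro!: exI[of _ n])
    qed (auto simp: space_PiM PiE_iff)
    fix n :: nat
    have "emeasure ?PM (Pi\<^sub>E I (\<lambda>_. cball 0 (real n))) = (\<Prod>l\<in>I. emeasure lborel (cball 0 (real n) :: 'a set))"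
      using I by (subst L.emeasure_PiM) auto
    also have "\<dots> < \<infinity>"
      using emeasure_bounded_finite[of "cball 0 (real n) :: 'a set"] by (auto simp: less_top[symmetric] power_eq_top_ennreal)
    finally show "emeasure \<alpha> (Pi\<^sub>E I (\<lambda>_. cball 0 (real n))) \<noteq> \<infinity>"
      by (subst eq) (auto simp: ennreal_mult_eq_top_iff power_eq_top_ennreal)
  qed (auto simp: \<alpha>_def)
  then have "(\<integral>\<^sup>+z. f z \<partial>\<alpha>) = ennreal t ^ card I * (\<integral>\<^sup>+z. f z \<partial>?PM)"
    by (simp add: nn_integral_scale_measure)
  then show ?thesis by (simp add: int_\<alpha>)
qed

section \<open>Sums over injections and over finite subsets\<close>

lemma borel_measurable_nn_integral_count:
  assumes "countable I" and "\<And>i. i \<in> I \<Longrightarrow> f i \<in> borel_measurable M"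
  shows "(\<lambda>x. \<integral>\<^sup>+i. f i x \<partial>count_space I) \<in> borel_measurable M"
proof -
  interpret C: sigma_finite_measure "count_space I"
    using assms(1) by (rule sigma_finite_measure_count_space_countable)
  have "(\<lambda>x. f (snd x) (fst x)) \<in> borel_measurable (M \<Otimes>\<^sub>M count_space I)"
    by (rule measurable_compose_countable'[where I = I and g = snd and f = "\<lambda>i x. f i (fst x)"])
      (use assms in \<open>auto intro: measurable_compose[OF measurable_fst]\<close>)
  then show ?thesis
    by (intro C.borel_measurable_nn_integral) (simp add: case_prod_beta')
qed

text \<open>Every subset of size \<open>card L\<close> is the image of exactly
  \<open>fact (card L)\<close> injections.\<close>

lemma nn_integral_Inj_image:
  fixes h :: "'b::countable set \<Rightarrow> ennreal"
  assumes L: "finite L"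
  shows "(\<integral>\<^sup>+g. h (g ` L) \<partial>count_space (Inj L A)) =
     fact (card L) * (\<integral>\<^sup>+G. h G \<partial>count_space {G. finite G \<and> G \<subseteq> A \<and> card G = card L})"
proof -
  let ?\<G> = "{G. finite G \<and> G \<subseteq> A \<and> card G = card L}"
  have cG: "countable ?\<G>"
    by (rule countable_subset[OF _ countable_Collect_finite]) auto
  have im: "g ` L \<in> ?\<G>" if "g \<in> Inj L A" for g
    using that L by (auto simp: Inj_def card_image)
  have "(\<integral>\<^sup>+g. h (g ` L) \<partial>count_space (Inj L A)) =
     (\<integral>\<^sup>+g. \<integral>\<^sup>+G. h G * indicator {G} (g ` L) \<partial>count_space ?\<G> \<partial>count_space (Inj L A))"
  proof (rule nn_integral_cong)
    fix g assume "g \<in> space (count_space (Inj L A))"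
    then have g: "g ` L \<in> ?\<G>" using im by simp
    have "(\<integral>\<^sup>+G. h G * indicator {G} (g ` L) \<partial>count_space ?\<G>) =
       (\<integral>\<^sup>+G. h (g ` L) * indicator {g ` L} G \<partial>count_space ?\<G>)"
      by (intro nn_integral_cong) (auto split: split_indicator)
    also have "\<dots> = h (g ` L)"
      using g by (subst nn_integral_cmult_indicator) auto
    finally show "h (g ` L) = (\<integral>\<^sup>+G. h G * indicator {G} (g ` L) \<partial>count_space ?\<G>)" ..
  qed
  also have "\<dots> = (\<integral>\<^sup>+G. \<integral>\<^sup>+g. h G * indicator {G} (g ` L) \<partial>count_space (Inj L A) \<partial>count_space ?\<G>)"
    by (rule nn_integral_count_space_nn_integral[OF cG]) auto
  also have "\<dots> = (\<integral>\<^sup>+G. fact (card L) * h G \<partial>count_space ?\<G>)"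
  proof (rule nn_integral_cong)
    fix G assume "G \<in> space (count_space ?\<G>)"
    then have G: "finite G" "G \<subseteq> A" "card G = card L" by auto
    let ?S = "{i \<in> Inj L UNIV. \<forall>l\<in>L. i l \<in> G}"
    have S: "card ?S = fact (card L)" "finite ?S"
    proof -
      have "ffn (card L) (card L) = fact (card L)" using ffn_fact[of "card L" "card L"] by simp
      note f3 = this
      have f1: "card ?S = (\<Prod>c\<in>(\<lambda>_. 0::nat) ` L. ffn (card G) (card {l\<in>L. 0 = c})) \<and> finite ?S"
        by (rule card_coloured_Inj[OF L, where B = "\<lambda>_. G" and Q = "\<lambda>_. 0::nat"]) (use G in auto)
      have f2: "(\<Prod>c\<in>(\<lambda>_. 0::nat) ` L. ffn (card G) (card {l\<in>L. 0 = c})) = ffn (card L) (card L)"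
      proof (cases "L = {}")
        case False
        then have "(\<lambda>_. 0::nat) ` L = {0}" by auto
        then show ?thesis using G by simp
      qed simp
      show "card ?S = fact (card L)" "finite ?S"
        by (rule trans[OF conjunct1[OF f1] trans[OF f2 f3]], rule conjunct2[OF f1])
    qed
    have "(\<integral>\<^sup>+g. h G * indicator {G} (g ` L) \<partial>count_space (Inj L A)) =
       (\<integral>\<^sup>+g. h G * indicator ?S g \<partial>count_space (Inj L A))"
    proof (intro nn_integral_cong)
      fix g assume "g \<in> space (count_space (Inj L A))"
      then have g: "g \<in> Inj L A" by simp
      have "g ` L = G \<longleftrightarrow> g \<in> ?S"
      proof
        assume "g \<in> ?S"
        then have "g ` L \<subseteq> G" by auto
        moreover have "card (g ` L) = card G" using g G by (auto simp: Inj_def card_image)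
        ultimately show "g ` L = G" using G card_subset_eq by blast
      qed (use g in \<open>auto simp: Inj_def PiE_iff\<close>)
      then show "h G * indicator {G} (g ` L) = h G * indicator ?S g"
        by (auto simp: indicator_def)
    qed
    also have "\<dots> = h G * emeasure (count_space (Inj L A)) ?S"
      using G by (intro nn_integral_cmult_indicator) (auto simp: Inj_def)
    also have "\<dots> = h G * fact (card L)"
      using S G by (subst emeasure_count_space_finite) (auto simp: Inj_def of_nat_fact)
    finally show "(\<integral>\<^sup>+g. h G * indicator {G} (g ` L) \<partial>count_space (Inj L A)) = fact (card L) * h G"
      by (simp add: mult.commute)
  qed
  also have "\<dots> = fact (card L) * (\<integral>\<^sup>+G. h G \<partial>count_space ?\<G>)"
    by (rule nn_integral_cmult) simp
  finally show ?thesis .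
qed

text \<open>A pair of injections with disjoint images is one injection on the union. This merges a
  tuple of points with points summed outside it, so that Campbell's formula applies to all of them
  at once.\<close>

lemma nn_integral_Inj_Un:
  assumes KL: "K \<inter> L = {}" and fin: "finite K" "finite L" and J: "countable J"
  shows "(\<integral>\<^sup>+i. \<integral>\<^sup>+g. F i g \<partial>count_space (Inj L (J - i ` K)) \<partial>count_space (Inj K J)) =
     (\<integral>\<^sup>+h. F (restrict h K) (restrict h L) \<partial>count_space (Inj (K \<union> L) J))"
proof -
  let ?S = "SIGMA i:Inj K J. Inj L (J - i ` K)"
  have bij: "bij_betw (\<lambda>h. (restrict h K, restrict h L)) (Inj (K \<union> L) J) ?S"
  proof (rule bij_betwI[where g = "\<lambda>(i, g) l. if l \<in> K then i l else g l"])
    show "(\<lambda>h. (restrict h K, restrict h L)) \<in> Inj (K \<union> L) J \<rightarrow> ?S"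
    proof
      fix h assume h: "h \<in> Inj (K \<union> L) J"
      then have "inj_on h (K \<union> L)" "h \<in> K \<union> L \<rightarrow> J" by (auto simp: Inj_def)
      then have "restrict h K \<in> Inj K J" "restrict h L \<in> Inj L J" "h ` K \<inter> h ` L = {}"
        using KL by (auto simp: Inj_def inj_on_def)
      moreover have "restrict h K ` K = h ` K" by auto
      ultimately show "(restrict h K, restrict h L) \<in> ?S"
        by (auto simp: Inj_def PiE_iff)
    qed
    show "(\<lambda>(i, g) l. if l \<in> K then i l else g l) \<in> ?S \<rightarrow> Inj (K \<union> L) J"
    proof clarify
      fix i g assume i: "i \<in> Inj K J" and g: "g \<in> Inj L (J - i ` K)"
      have ii: "inj_on i K" and gi: "inj_on g L" using i g by (auto simp: Inj_def)
      have d: "i l \<noteq> g l'" if "l \<in> K" "l' \<in> L" for l l'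
      proof -
        have "g l' \<notin> i ` K" using g that by (auto simp: Inj_def PiE_iff)
        then show ?thesis using that by (metis imageI)
      qed
      have "inj_on (\<lambda>l. if l \<in> K then i l else g l) (K \<union> L)"
      proof (rule inj_onI)
        fix l l' assume "l \<in> K \<union> L" "l' \<in> K \<union> L"
          and "(if l \<in> K then i l else g l) = (if l' \<in> K then i l' else g l')"
        then show "l = l'"
          using d[of l l'] d[of l' l] inj_onD[OF ii, of l l'] inj_onD[OF gi, of l l']
          by (cases "l \<in> K"; cases "l' \<in> K") simp_all
      qed
      then show "(\<lambda>l. if l \<in> K then i l else g l) \<in> Inj (K \<union> L) J"
        using i g by (auto simp: Inj_def PiE_iff extensional_def)
    qed
    show "(case (restrict h K, restrict h L) of (i, g) \<Rightarrow> \<lambda>l. if l \<in> K then i l else g l) = h"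
      if "h \<in> Inj (K \<union> L) J" for h
    proof
      fix l
      have "h l = undefined" if "l \<notin> K \<union> L"
        using \<open>h \<in> Inj (K \<union> L) J\<close> that by (auto simp: Inj_def intro: PiE_arb)
      then show "(case (restrict h K, restrict h L) of (i, g) \<Rightarrow> \<lambda>l. if l \<in> K then i l else g l) l = h l"
        by auto
    qed
    show "(\<lambda>h. (restrict h K, restrict h L)) ((\<lambda>(i, g) l. if l \<in> K then i l else g l) y) = y"
      if y: "y \<in> ?S" for y
    proof -
      obtain i g where [simp]: "y = (i, g)" by (cases y)
      have "i \<in> extensional K" "g \<in> extensional L" using y by (auto simp: Inj_def PiE_iff)
      then have "restrict i K = i" "restrict g L = g" by (auto intro: extensional_restrict)
      moreover have "restrict (\<lambda>l. if l \<in> K then i l else g l) K = restrict i K"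
        "restrict (\<lambda>l. if l \<in> K then i l else g l) L = restrict g L"
        using KL by (auto simp: restrict_def fun_eq_iff)
      ultimately show ?thesis by simp
    qed
  qed
  have "(\<integral>\<^sup>+i. \<integral>\<^sup>+g. F i g \<partial>count_space (Inj L (J - i ` K)) \<partial>count_space (Inj K J)) =
    (\<integral>\<^sup>+i. \<integral>\<^sup>+g. F i g * indicator ?S (i, g) \<partial>count_space UNIV \<partial>count_space UNIV)"
    by (auto simp: nn_integral_count_space_indicator intro!: nn_integral_cong split: split_indicator)
  also have "\<dots> = (\<integral>\<^sup>+x. F (fst x) (snd x) * indicator ?S x \<partial>count_space UNIV)"
    by (subst nn_integral_fst_count_space[symmetric]) simp
  also have "\<dots> = (\<integral>\<^sup>+x. F (fst x) (snd x) \<partial>count_space ?S)"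
    by (simp add: nn_integral_count_space_indicator)
  also have "\<dots> = (\<integral>\<^sup>+h. F (restrict h K) (restrict h L) \<partial>count_space (Inj (K \<union> L) J))"
    by (subst nn_integral_bij_count_space[OF bij, symmetric]) simp
  finally show ?thesis .
qed

text \<open>Inclusion-exclusion sums restricted by the size of the subset: with \<open>p\<close>
  even or odd, positive and negative terms are kept apart and everything stays in
  \<open>ennreal\<close>.\<close>

definition fsum :: "(nat \<Rightarrow> bool) \<Rightarrow> 'b set \<Rightarrow> ('b \<Rightarrow> ennreal) \<Rightarrow> ennreal" where
  "fsum p A a = (\<integral>\<^sup>+G. (\<Prod>j\<in>G. a j) \<partial>count_space {G. finite G \<and> G \<subseteq> A \<and> p (card G)})"

lemma fsum_indicator:
  "fsum p A a = (\<integral>\<^sup>+G. (\<Prod>j\<in>G. a j) * indicator {G. finite G \<and> G \<subseteq> A \<and> p (card G)} G \<partial>count_space UNIV)"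
  unfolding fsum_def by (rule nn_integral_count_space_indicator) simp

text \<open>Every finite set of naturals lies below some \<open>n\<close>, so monotone convergence
  over initial segments applies.\<close>

lemma fsum_incseq:
  fixes A :: "nat set"
  shows "(\<lambda>n. fsum p (A \<inter> {..<n}) a) \<longlonglongrightarrow> fsum p A a"
proof -
  let ?S = "\<lambda>n. {G. finite G \<and> G \<subseteq> A \<inter> {..<n} \<and> p (card G)}"
  have inc: "incseq (\<lambda>n G. (\<Prod>j\<in>G. a j) * indicator (?S n) G)"
    by (intro incseq_SucI le_funI) (auto simp: indicator_def less_Suc_eq)
  have "fsum p A a = (\<integral>\<^sup>+G. (SUP n. (\<Prod>j\<in>G. a j) * indicator (?S n) G) \<partial>count_space UNIV)"
    unfolding fsum_indicator
  proof (rule nn_integral_cong)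
    fix G :: "nat set"
    show "(\<Prod>j\<in>G. a j) * indicator {G. finite G \<and> G \<subseteq> A \<and> p (card G)} G = (SUP n. (\<Prod>j\<in>G. a j) * indicator (?S n) G)"
    proof (cases "finite G \<and> G \<subseteq> A \<and> p (card G)")
      case True
      then obtain m where "G \<subseteq> {..<m}" using finite_nat_iff_bounded by blast
      then have "(\<Prod>j\<in>G. a j) * indicator (?S m) G = (\<Prod>j\<in>G. a j)" using True by simp
      then have "(\<Prod>j\<in>G. a j) \<le> (SUP n. (\<Prod>j\<in>G. a j) * indicator (?S n) G)"
        by (metis (no_types, lifting) SUP_upper UNIV_I)
      moreover have "(SUP n. (\<Prod>j\<in>G. a j) * indicator (?S n) G) \<le> (\<Prod>j\<in>G. a j)"
        by (rule SUP_least) (auto simp: indicator_def)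
      ultimately show ?thesis using True by simp
    next
      case False
      then have "(\<Prod>j\<in>G. a j) * indicator (?S n) G = 0" for n by (auto simp: indicator_def)
      then show ?thesis using False by simp
    qed
  qed
  also have "\<dots> = (SUP n. fsum p (A \<inter> {..<n}) a)"
    unfolding fsum_indicator by (rule nn_integral_monotone_convergence_SUP[OF inc]) simp
  finally have eq: "fsum p A a = (SUP n. fsum p (A \<inter> {..<n}) a)" .
  have "incseq (\<lambda>n. fsum p (A \<inter> {..<n}) a)"
    unfolding fsum_indicator using inc by (auto simp: incseq_def le_fun_def intro!: nn_integral_mono)
  from LIMSEQ_SUP[OF this] show ?thesis unfolding eq .
qed

text \<open>Expand the product over a finite index set and move the odd terms to the left, so that
  nothing is subtracted. In this form the limit over initial segments is valid even when both sides
  are infinite.\<close>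

lemma prod_fsum:
  fixes a :: "nat \<Rightarrow> real"
  assumes a: "\<And>j. 0 \<le> a j \<and> a j \<le> 1"
  shows "(INF n. ennreal (\<Prod>j\<in>A \<inter> {..<n}. 1 - a j)) + fsum odd A (\<lambda>j. ennreal (a j)) =
           fsum even A (\<lambda>j. ennreal (a j))"
proof -
  have fin: "ennreal (\<Prod>j\<in>B. 1 - a j) + fsum odd B (\<lambda>j. ennreal (a j)) = fsum even B (\<lambda>j. ennreal (a j))"
    if B: "finite B" for B
  proof -
    have fs: "fsum p B (\<lambda>j. ennreal (a j)) = ennreal (\<Sum>G\<in>Pow B. if p (card G) then \<Prod>j\<in>G. a j else 0)" for p
    proof -
      have e: "{G. finite G \<and> G \<subseteq> B \<and> p (card G)} = {G \<in> Pow B. p (card G)}"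
        using B by (auto dest: finite_subset)
      have "fsum p B (\<lambda>j. ennreal (a j)) = (\<Sum>G\<in>{G\<in>Pow B. p (card G)}. \<Prod>j\<in>G. ennreal (a j))"
        unfolding fsum_def e using B by (subst nn_integral_count_space_finite) auto
      also have "\<dots> = (\<Sum>G\<in>{G\<in>Pow B. p (card G)}. ennreal (\<Prod>j\<in>G. a j))"
        using a by (simp add: prod_ennreal)
      also have "\<dots> = ennreal (\<Sum>G\<in>{G\<in>Pow B. p (card G)}. \<Prod>j\<in>G. a j)"
        using a by (intro sum_ennreal prod_nonneg) auto
      also have "(\<Sum>G\<in>{G\<in>Pow B. p (card G)}. \<Prod>j\<in>G. a j) = (\<Sum>G\<in>Pow B. if p (card G) then \<Prod>j\<in>G. a j else 0)"
        using B by (subst sum.inter_filter) auto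
      finally show ?thesis .
    qed
    have "(\<Prod>j\<in>B. 1 - a j) = (\<Prod>j\<in>B. - a j + 1)" by simp
    also have "\<dots> = (\<Sum>G\<in>Pow B. \<Prod>j\<in>G. - a j)"
      by (subst prod_add[OF B]) simp
    also have "\<dots> = (\<Sum>G\<in>Pow B. (if even (card G) then \<Prod>j\<in>G. a j else 0) - (if odd (card G) then \<Prod>j\<in>G. a j else 0))"
      by (intro sum.cong refl) (auto simp: prod_uminus)
    finally have eq: "(\<Prod>j\<in>B. 1 - a j) + (\<Sum>G\<in>Pow B. if odd (card G) then \<Prod>j\<in>G. a j else 0)
       = (\<Sum>G\<in>Pow B. if even (card G) then \<Prod>j\<in>G. a j else 0)"
      by (simp add: sum_subtractf)
    have nn: "0 \<le> (\<Sum>G\<in>Pow B. if p (card G) then \<Prod>j\<in>G. a j else 0)" for p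
      using a by (intro sum_nonneg) (auto intro!: prod_nonneg)
    have nn': "0 \<le> (\<Prod>j\<in>B. 1 - a j)" using a by (intro prod_nonneg) auto
    show ?thesis unfolding fs eq[symmetric] by (rule ennreal_plus[symmetric, OF nn' nn])
  qed
  have dec: "decseq (\<lambda>n. ennreal (\<Prod>j\<in>A \<inter> {..<n}. 1 - a j))"
  proof (rule decseq_SucI)
    fix n
    have "(\<Prod>j\<in>A \<inter> {..<Suc n}. 1 - a j) = (if n \<in> A then 1 - a n else 1) * (\<Prod>j\<in>A \<inter> {..<n}. 1 - a j)"
      by (auto simp: lessThan_Suc Int_insert_right)
    also have "\<dots> \<le> 1 * (\<Prod>j\<in>A \<inter> {..<n}. 1 - a j)"
      using a by (intro mult_right_mono prod_nonneg) (auto simp: diff_le_eq)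
    finally show "ennreal (\<Prod>j\<in>A \<inter> {..<Suc n}. 1 - a j) \<le> ennreal (\<Prod>j\<in>A \<inter> {..<n}. 1 - a j)"
      by (intro ennreal_leI) simp
  qed
  have "(\<lambda>n. ennreal (\<Prod>j\<in>A \<inter> {..<n}. 1 - a j) + fsum odd (A \<inter> {..<n}) (\<lambda>j. ennreal (a j)))
     \<longlonglongrightarrow> (INF n. ennreal (\<Prod>j\<in>A \<inter> {..<n}. 1 - a j)) + fsum odd A (\<lambda>j. ennreal (a j))"
    by (intro tendsto_add LIMSEQ_INF dec fsum_incseq)
  moreover have "(\<lambda>n. ennreal (\<Prod>j\<in>A \<inter> {..<n}. 1 - a j) + fsum odd (A \<inter> {..<n}) (\<lambda>j. ennreal (a j)))
     \<longlonglongrightarrow> fsum even A (\<lambda>j. ennreal (a j))"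
    by (subst fin) (auto intro: fsum_incseq)
  ultimately show ?thesis by (rule LIMSEQ_unique)
qed

text \<open>Subsets of size \<open>l\<close> are ordered tuples divided by \<open>l!\<close>. The
  index block starts at \<open>k\<close> so that it is disjoint from \<open>{..<k}\<close>, which
  indexes the cluster points.\<close>

lemma fsum_Inj:
  fixes A :: "'b::countable set"
  shows "fsum p A a = (\<Sum>l. if p l then (\<integral>\<^sup>+g. (\<Prod>j\<in>{k..<k + l}. a (g j)) \<partial>count_space (Inj {k..<k + l} A)) / fact l else 0)"
proof -
  have "fsum p A a = (\<integral>\<^sup>+G. (\<Sum>l. if p l then (\<Prod>j\<in>G. a j) * indicator {G. finite G \<and> G \<subseteq> A \<and> card G = l} G else 0) \<partial>count_space UNIV)"
    unfolding fsum_indicator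
  proof (rule nn_integral_cong)
    fix G :: "'b set"
    have "(\<Sum>l. if p l then (\<Prod>j\<in>G. a j) * indicator {G. finite G \<and> G \<subseteq> A \<and> card G = l} G else 0) =
      (\<Sum>l\<in>{card G}. if p l then (\<Prod>j\<in>G. a j) * indicator {G. finite G \<and> G \<subseteq> A \<and> card G = l} G else 0)"
      by (rule suminf_finite) auto
    then show "(\<Prod>j\<in>G. a j) * indicator {G. finite G \<and> G \<subseteq> A \<and> p (card G)} G =
      (\<Sum>l. if p l then (\<Prod>j\<in>G. a j) * indicator {G. finite G \<and> G \<subseteq> A \<and> card G = l} G else 0)"
      by (auto simp: indicator_def)
  qed
  also have "\<dots> = (\<Sum>l. if p l then (\<integral>\<^sup>+G. (\<Prod>j\<in>G. a j) \<partial>count_space {G. finite G \<and> G \<subseteq> A \<and> card G = l}) else 0)"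
    by (subst nn_integral_suminf) (auto simp: nn_integral_count_space_indicator intro!: suminf_cong)
  also have "\<dots> = (\<Sum>l. if p l then (\<integral>\<^sup>+g. (\<Prod>j\<in>{k..<k + l}. a (g j)) \<partial>count_space (Inj {k..<k + l} A)) / fact l else 0)"
  proof (intro suminf_cong)
    fix l
    have "(\<integral>\<^sup>+g. (\<Prod>j\<in>{k..<k + l}. a (g j)) \<partial>count_space (Inj {k..<k + l} A)) =
       (\<integral>\<^sup>+g. (\<Prod>j\<in>g ` {k..<k + l}. a j) \<partial>count_space (Inj {k..<k + l} A))"
      by (intro nn_integral_cong) (simp add: Inj_def prod.reindex)
    also have "\<dots> = fact l * (\<integral>\<^sup>+G. (\<Prod>j\<in>G. a j) \<partial>count_space {G. finite G \<and> G \<subseteq> A \<and> card G = l})"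
      using nn_integral_Inj_image[where L = "{k..<k + l}" and h = "\<lambda>G. \<Prod>j\<in>G. a j" and A = A] by simp
    finally have "(\<integral>\<^sup>+G. (\<Prod>j\<in>G. a j) \<partial>count_space {G. finite G \<and> G \<subseteq> A \<and> card G = l}) =
       (\<integral>\<^sup>+g. (\<Prod>j\<in>{k..<k + l}. a (g j)) \<partial>count_space (Inj {k..<k + l} A)) / fact l"
      using ennreal_mult_divide_eq[of "fact l" "\<integral>\<^sup>+G. (\<Prod>j\<in>G. a j) \<partial>count_space {G. finite G \<and> G \<subseteq> A \<and> card G = l}"]
        ennreal_of_nat_neq_top[of "fact l"] by (simp add: mult.commute of_nat_fact)
    then show "(if p l then \<integral>\<^sup>+G. (\<Prod>j\<in>G. a j) \<partial>count_space {G. finite G \<and> G \<subseteq> A \<and> card G = l} else 0) =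
       (if p l then (\<integral>\<^sup>+g. (\<Prod>j\<in>{k..<k + l}. a (g j)) \<partial>count_space (Inj {k..<k + l} A)) / fact l else 0)"
      by simp
  qed
  finally show ?thesis .
qed

subsection \<open>Void probabilities\<close>

text \<open>Campbell's formula serves as the interface to the Poisson property. \<open>J\<close> is
  the set of indices in use, all of them for positive intensity and none for intensity 0, so both
  cases share the proofs.\<close>

locale pois = prob_space P for P :: "'w measure" +
  fixes X :: "nat \<Rightarrow> 'w \<Rightarrow> 'a::euclidean_space" and J :: "nat set" and t :: real
  assumes t_nonneg: "0 \<le> t"
    and X_meas [measurable]: "\<And>j. X j \<in> borel_measurable P"
    and X_inj: "AE \<omega> in P. inj_on (\<lambda>j. X j \<omega>) J"
    and X_locfin: "\<And>\<omega> B. \<omega> \<in> space P \<Longrightarrow> bounded B \<Longrightarrow> finite ((\<lambda>j. X j \<omega>) ` J \<inter> B)"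
    and camp: "\<And>(I::nat set) f. finite I \<Longrightarrow> f \<in> borel_measurable (Pi\<^sub>M I (\<lambda>_. lborel)) \<Longrightarrow>
       (\<integral>\<^sup>+\<omega>. \<integral>\<^sup>+i. f (\<lambda>l\<in>I. X (i l) \<omega>) \<partial>count_space (Inj I J) \<partial>P) =
         ennreal t ^ card I * (\<integral>\<^sup>+z. f z \<partial>Pi\<^sub>M I (\<lambda>_. lborel))"

text \<open>Even and odd parts of the exponential series, the shape in which inclusion-exclusion
  split by parity delivers \<open>exp (- x) = cosh x - sinh x\<close>.\<close>

lemma suminf_cosh_sinh:
  assumes "0 \<le> (x::real)"
  shows "(\<Sum>l. if even l then ennreal (x ^ l / fact l) else 0) = ennreal (cosh x)"
    and "(\<Sum>l. if odd l then ennreal (x ^ l / fact l) else 0) = ennreal (sinh x)"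
proof -
  have "(\<lambda>l. if even l then x ^ l / fact l else 0) sums cosh x"
    using cosh_converges[of x] by (simp add: divide_inverse mult.commute cong: if_cong)
  then have "(\<Sum>l. ennreal (if even l then x ^ l / fact l else 0)) = ennreal (cosh x)"
    using assms by (intro suminf_ennreal_eq) auto
  then show "(\<Sum>l. if even l then ennreal (x ^ l / fact l) else 0) = ennreal (cosh x)"
    by (simp add: if_distrib cong: if_cong)
  have "(\<lambda>l. if odd l then x ^ l / fact l else 0) sums sinh x"
  proof -
    have "(\<lambda>l. if odd l then x ^ l / fact l else 0) = (\<lambda>n. if even n then 0 else x ^ n /\<^sub>R fact n)"
      by (auto simp: divide_inverse)
    then show ?thesis using sinh_converges[of x] by simp
  qed
  then have "(\<Sum>l. ennreal (if odd l then x ^ l / fact l else 0)) = ennreal (sinh x)"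
    using assms by (intro suminf_ennreal_eq) auto
  then show "(\<Sum>l. if odd l then ennreal (x ^ l / fact l) else 0) = ennreal (sinh x)"
    by (simp add: if_distrib cong: if_cong)
qed

section \<open>The void formula\<close>

context pois
begin

text \<open>If a further point at \<open>w\<close> is accepted with probability
  \<open>u z w\<close>, the infimum is the probability that no further Poisson point is accepted.
  Inclusion-exclusion and Campbell's formula with \<open>k + l\<close> points give the terms
  \<open>(t * V) ^ l / l!\<close>; their even and odd sums are \<open>cosh\<close> and
  \<open>sinh\<close>, whose difference is the exponential. The bounds on \<open>f\<close> and
  \<open>V\<close> make the odd part finite, so that it can be cancelled.\<close>

lemma void_formula_finite:
  fixes k :: nat and f :: "(nat \<Rightarrow> 'a) \<Rightarrow> ennreal" and u :: "(nat \<Rightarrow> 'a) \<Rightarrow> 'a \<Rightarrow> real"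
  defines "K \<equiv> {..<k}"
  assumes f [measurable]: "f \<in> borel_measurable (Pi\<^sub>M K (\<lambda>_. lborel))"
    and f_fin: "(\<integral>\<^sup>+z. f z \<partial>Pi\<^sub>M K (\<lambda>_. lborel)) < \<infinity>"
    and u [measurable]: "(\<lambda>(z, w). u z w) \<in> borel_measurable (Pi\<^sub>M K (\<lambda>_. lborel) \<Otimes>\<^sub>M lborel)"
    and u01: "\<And>z w. 0 \<le> u z w \<and> u z w \<le> 1"
    and V: "\<And>z. z \<in> space (Pi\<^sub>M K (\<lambda>_. lborel :: 'a measure)) \<Longrightarrow> (\<integral>\<^sup>+w. ennreal (u z w) \<partial>lborel) = ennreal (V z)"
    and V0: "\<And>z. 0 \<le> V z \<and> V z \<le> c"
  shows "(\<integral>\<^sup>+\<omega>. \<integral>\<^sup>+i. f (\<lambda>l\<in>K. X (i l) \<omega>) *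
             (INF n. ennreal (\<Prod>j\<in>(J - i ` K) \<inter> {..<n}. 1 - u (\<lambda>l\<in>K. X (i l) \<omega>) (X j \<omega>)))
             \<partial>count_space (Inj K J) \<partial>P) =
           ennreal t ^ k * (\<integral>\<^sup>+z. f z * ennreal (exp (- t * V z)) \<partial>Pi\<^sub>M K (\<lambda>_. lborel))"
proof -
  interpret L: product_sigma_finite "\<lambda>_::nat. lborel :: 'a measure" by standard
  let ?PK = "Pi\<^sub>M K (\<lambda>_. lborel :: 'a measure)"
  have finK [simp]: "finite K" and cK: "card K = k" by (auto simp: K_def)
  have V_meas [measurable]: "(\<lambda>z. ennreal (V z)) \<in> borel_measurable ?PK"
  proof -
    have "(\<lambda>z. \<integral>\<^sup>+w. ennreal (u z w) \<partial>lborel) \<in> borel_measurable ?PK" by measurable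
    then show ?thesis by (rule measurable_cong[THEN iffD1, rotated]) (rule V)
  qed
  have V_measr [measurable]: "V \<in> borel_measurable ?PK"
  proof -
    have "(\<lambda>z. enn2real (ennreal (V z))) \<in> borel_measurable ?PK" by measurable
    then show ?thesis using V0 by simp
  qed
  define Xi where "Xi i \<omega> = (\<lambda>l\<in>K. X (i l) \<omega>)" for i \<omega>
  have Xi [measurable]: "Xi i \<in> measurable P ?PK" for i
    unfolding Xi_def by (rule measurable_restrict) simp
  have uX [measurable]: "(\<lambda>\<omega>. u (Xi i \<omega>) (X j \<omega>)) \<in> borel_measurable P" for i j
  proof -
    have "(\<lambda>\<omega>. (Xi i \<omega>, X j \<omega>)) \<in> P \<rightarrow>\<^sub>M ?PK \<Otimes>\<^sub>M lborel" by (rule measurable_Pair) auto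
    from measurable_compose[OF this u] show ?thesis by simp
  qed
  define T where "T i l \<omega> = (\<integral>\<^sup>+g. (\<Prod>j\<in>{k..<k + l}. ennreal (u (Xi i \<omega>) (X (g j) \<omega>))) \<partial>count_space (Inj {k..<k + l} (J - i ` K)))"
    for i l \<omega>
  have T_meas [measurable]: "T i l \<in> borel_measurable P" for i l
    unfolding T_def by (rule borel_measurable_nn_integral_count) auto
  \<comment> \<open>The \<open>l\<close> extra indices avoid those chosen by \<open>i\<close>, so
    together they form one injection on \<open>k + l\<close> indices, to which Campbell's formula
    applies; the extra coordinates then integrate to \<open>V z\<close> each.\<close>
  have A: "(\<integral>\<^sup>+\<omega>. \<integral>\<^sup>+i. f (Xi i \<omega>) * T i l \<omega> \<partial>count_space (Inj K J) \<partial>P) =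
      ennreal t ^ (k + l) * (\<integral>\<^sup>+z. f z * ennreal (V z) ^ l \<partial>?PK)" for l
  proof -
    let ?L = "{k..<k + l}"
    have un: "K \<union> ?L = {..<k + l}" by (auto simp: K_def)
    have KL: "K \<inter> ?L = {}" "card (K \<union> ?L) = k + l"
      unfolding un by (auto simp: K_def)
    define G where "G z = f (restrict z K) * (\<Prod>j\<in>?L. ennreal (u (restrict z K) (z j)))" for z
    have rK [measurable]: "(\<lambda>z. restrict z K) \<in> Pi\<^sub>M (K \<union> ?L) (\<lambda>_. lborel) \<rightarrow>\<^sub>M ?PK"
      by (rule measurable_restrict_subset) auto
    have uz: "(\<lambda>z. u (restrict z K) (z j)) \<in> borel_measurable (Pi\<^sub>M (K \<union> ?L) (\<lambda>_. lborel))" if "j \<in> ?L" for j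
    proof -
      have "(\<lambda>z. (restrict z K, z j)) \<in> Pi\<^sub>M (K \<union> ?L) (\<lambda>_. lborel) \<rightarrow>\<^sub>M ?PK \<Otimes>\<^sub>M lborel"
        using that by (intro measurable_Pair rK measurable_component_singleton) auto
      from measurable_compose[OF this u] show ?thesis by simp
    qed
    have G_meas: "G \<in> borel_measurable (Pi\<^sub>M (K \<union> ?L) (\<lambda>_. lborel))"
      unfolding G_def using uz by (intro borel_measurable_times_ennreal borel_measurable_prod_ennreal measurable_compose[OF rK f]) auto
    have "(\<integral>\<^sup>+\<omega>. \<integral>\<^sup>+i. f (Xi i \<omega>) * T i l \<omega> \<partial>count_space (Inj K J) \<partial>P) =
      (\<integral>\<^sup>+\<omega>. \<integral>\<^sup>+h. G (\<lambda>l\<in>K \<union> ?L. X (h l) \<omega>) \<partial>count_space (Inj (K \<union> ?L) J) \<partial>P)"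
    proof (rule nn_integral_cong)
      fix \<omega>
      have "(\<integral>\<^sup>+i. f (Xi i \<omega>) * T i l \<omega> \<partial>count_space (Inj K J)) =
        (\<integral>\<^sup>+i. \<integral>\<^sup>+g. f (Xi i \<omega>) * (\<Prod>j\<in>?L. ennreal (u (Xi i \<omega>) (X (g j) \<omega>)))
           \<partial>count_space (Inj ?L (J - i ` K)) \<partial>count_space (Inj K J))"
        unfolding T_def by (intro nn_integral_cong nn_integral_cmult[symmetric]) simp
      also have "\<dots> = (\<integral>\<^sup>+h. f (Xi (restrict h K) \<omega>) * (\<Prod>j\<in>?L. ennreal (u (Xi (restrict h K) \<omega>) (X (restrict h ?L j) \<omega>)))
           \<partial>count_space (Inj (K \<union> ?L) J))"
        using KL by (intro nn_integral_Inj_Un) auto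
      also have "\<dots> = (\<integral>\<^sup>+h. G (\<lambda>l\<in>K \<union> ?L. X (h l) \<omega>) \<partial>count_space (Inj (K \<union> ?L) J))"
      proof (rule nn_integral_cong)
        fix h
        have "restrict (\<lambda>l\<in>K \<union> ?L. X (h l) \<omega>) K = Xi (restrict h K) \<omega>"
          by (auto simp: Xi_def restrict_def fun_eq_iff)
        then show "f (Xi (restrict h K) \<omega>) * (\<Prod>j\<in>?L. ennreal (u (Xi (restrict h K) \<omega>) (X (restrict h ?L j) \<omega>)))
          = G (\<lambda>l\<in>K \<union> ?L. X (h l) \<omega>)"
          by (simp add: G_def)
      qed
      finally show "(\<integral>\<^sup>+i. f (Xi i \<omega>) * T i l \<omega> \<partial>count_space (Inj K J)) =
        (\<integral>\<^sup>+h. G (\<lambda>l\<in>K \<union> ?L. X (h l) \<omega>) \<partial>count_space (Inj (K \<union> ?L) J))" .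
    qed
    also have "\<dots> = ennreal t ^ (k + l) * (\<integral>\<^sup>+z. G z \<partial>Pi\<^sub>M (K \<union> ?L) (\<lambda>_. lborel))"
      using camp[OF _ G_meas] KL by simp
    also have "(\<integral>\<^sup>+z. G z \<partial>Pi\<^sub>M (K \<union> ?L) (\<lambda>_. lborel)) =
       (\<integral>\<^sup>+x. \<integral>\<^sup>+y. G (merge K ?L (x, y)) \<partial>Pi\<^sub>M ?L (\<lambda>_. lborel) \<partial>?PK)"
      using KL G_meas by (intro L.product_nn_integral_fold) auto
    also have "\<dots> = (\<integral>\<^sup>+x. f x * ennreal (V x) ^ l \<partial>?PK)"
    proof (rule nn_integral_cong)
      fix x assume x: "x \<in> space ?PK"
      have ux [measurable]: "(\<lambda>w. u x w) \<in> borel_measurable lborel"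
        using measurable_compose_Pair1[OF x u] by simp
      have "(\<integral>\<^sup>+y. G (merge K ?L (x, y)) \<partial>Pi\<^sub>M ?L (\<lambda>_. lborel)) =
         (\<integral>\<^sup>+y. f x * (\<Prod>j\<in>?L. ennreal (u x (y j))) \<partial>Pi\<^sub>M ?L (\<lambda>_. lborel))"
      proof (rule nn_integral_cong)
        fix y
        have "restrict (merge K ?L (x, y)) K = x"
          using x by (auto simp: merge_def space_PiM PiE_iff extensional_def restrict_def fun_eq_iff)
        moreover have "merge K ?L (x, y) j = y j" if "j \<in> ?L" for j
          using that KL by (auto simp: merge_def)
        ultimately show "G (merge K ?L (x, y)) = f x * (\<Prod>j\<in>?L. ennreal (u x (y j)))"
          by (simp add: G_def)
      qed
      also have "\<dots> = f x * (\<integral>\<^sup>+y. (\<Prod>j\<in>?L. ennreal (u x (y j))) \<partial>Pi\<^sub>M ?L (\<lambda>_. lborel))"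
        by (intro nn_integral_cmult borel_measurable_prod_ennreal) (auto intro!: measurable_compose[OF measurable_component_singleton])
      also have "(\<integral>\<^sup>+y. (\<Prod>j\<in>?L. ennreal (u x (y j))) \<partial>Pi\<^sub>M ?L (\<lambda>_. lborel)) = ennreal (V x) ^ l"
        by (subst L.product_nn_integral_prod) (auto simp: V[OF x])
      finally show "(\<integral>\<^sup>+y. G (merge K ?L (x, y)) \<partial>Pi\<^sub>M ?L (\<lambda>_. lborel)) = f x * ennreal (V x) ^ l" .
    qed
    finally show ?thesis .
  qed
  have inner_meas: "(\<lambda>\<omega>. \<integral>\<^sup>+i. f (Xi i \<omega>) * h i \<omega> \<partial>count_space (Inj K J)) \<in> borel_measurable P"
    if "\<And>i. h i \<in> borel_measurable P" for h
    using that by (intro borel_measurable_nn_integral_count) auto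
  define FS where "FS p i \<omega> = fsum p (J - i ` K) (\<lambda>j. ennreal (u (Xi i \<omega>) (X j \<omega>)))" for p i \<omega>
  have FS_eq: "FS p i \<omega> = (\<Sum>l. if p l then T i l \<omega> / fact l else 0)" for p i \<omega>
    unfolding FS_def T_def by (rule fsum_Inj)
  have FS_meas [measurable]: "FS p i \<in> borel_measurable P" for p i
    unfolding FS_eq by measurable
  have B: "(\<integral>\<^sup>+\<omega>. \<integral>\<^sup>+i. f (Xi i \<omega>) * FS p i \<omega> \<partial>count_space (Inj K J) \<partial>P) =
      ennreal t ^ k * (\<integral>\<^sup>+z. f z * (\<Sum>l. if p l then ennreal ((t * V z) ^ l / fact l) else 0) \<partial>?PK)" for p
  proof -
    have "(\<integral>\<^sup>+\<omega>. \<integral>\<^sup>+i. f (Xi i \<omega>) * FS p i \<omega> \<partial>count_space (Inj K J) \<partial>P) =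
      (\<integral>\<^sup>+\<omega>. (\<Sum>l. \<integral>\<^sup>+i. f (Xi i \<omega>) * (if p l then T i l \<omega> / fact l else 0) \<partial>count_space (Inj K J)) \<partial>P)"
      unfolding FS_eq ennreal_suminf_cmult[symmetric] by (intro nn_integral_cong nn_integral_suminf) simp
    also have "\<dots> = (\<Sum>l. \<integral>\<^sup>+\<omega>. \<integral>\<^sup>+i. f (Xi i \<omega>) * (if p l then T i l \<omega> / fact l else 0) \<partial>count_space (Inj K J) \<partial>P)"
      by (intro nn_integral_suminf inner_meas) auto
    also have "\<dots> = (\<Sum>l. ennreal t ^ k * (\<integral>\<^sup>+z. f z * (if p l then ennreal ((t * V z) ^ l / fact l) else 0) \<partial>?PK))"
    proof (intro suminf_cong)
      fix l
      show "(\<integral>\<^sup>+\<omega>. \<integral>\<^sup>+i. f (Xi i \<omega>) * (if p l then T i l \<omega> / fact l else 0) \<partial>count_space (Inj K J) \<partial>P) =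
        ennreal t ^ k * (\<integral>\<^sup>+z. f z * (if p l then ennreal ((t * V z) ^ l / fact l) else 0) \<partial>?PK)"
      proof (cases "p l")
        case True
        have fl: "inverse (fact l :: ennreal) = ennreal (inverse (fact l))"
          by (simp add: inverse_ennreal flip: ennreal_fact)
        have "(\<integral>\<^sup>+\<omega>. \<integral>\<^sup>+i. f (Xi i \<omega>) * (T i l \<omega> / fact l) \<partial>count_space (Inj K J) \<partial>P) =
          (\<integral>\<^sup>+\<omega>. (\<integral>\<^sup>+i. f (Xi i \<omega>) * T i l \<omega> \<partial>count_space (Inj K J)) * inverse (fact l) \<partial>P)"
          by (intro nn_integral_cong) (simp add: divide_ennreal_def mult.assoc[symmetric] nn_integral_multc)
        also have "\<dots> = (\<integral>\<^sup>+\<omega>. \<integral>\<^sup>+i. f (Xi i \<omega>) * T i l \<omega> \<partial>count_space (Inj K J) \<partial>P) * inverse (fact l)"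
          by (intro nn_integral_multc inner_meas) auto
        also have "\<dots> = ennreal t ^ k * (ennreal t ^ l * (\<integral>\<^sup>+z. f z * ennreal (V z) ^ l \<partial>?PK) * inverse (fact l))"
          unfolding A by (simp add: power_add mult.assoc)
        also have "ennreal t ^ l * (\<integral>\<^sup>+z. f z * ennreal (V z) ^ l \<partial>?PK) * inverse (fact l) =
           (\<integral>\<^sup>+z. ennreal t ^ l * (f z * ennreal (V z) ^ l) * inverse (fact l) \<partial>?PK)"
          by (subst nn_integral_multc, simp, subst nn_integral_cmult) simp_all
        also have "\<dots> = (\<integral>\<^sup>+z. f z * ennreal ((t * V z) ^ l / fact l) \<partial>?PK)"
        proof (rule nn_integral_cong)
          fix z
          have "ennreal ((t * V z) ^ l / fact l) = ennreal t ^ l * ennreal (V z) ^ l * ennreal (inverse (fact l))"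
            using V0[of z] t_nonneg
            by (simp add: divide_inverse power_mult_distrib ennreal_mult' ennreal_power)
          then show "ennreal t ^ l * (f z * ennreal (V z) ^ l) * inverse (fact l) = f z * ennreal ((t * V z) ^ l / fact l)"
            by (simp add: fl ac_simps)
        qed
        finally show ?thesis using True by simp
      qed simp
    qed
    also have "\<dots> = ennreal t ^ k * (\<Sum>l. \<integral>\<^sup>+z. f z * (if p l then ennreal ((t * V z) ^ l / fact l) else 0) \<partial>?PK)"
      by (rule ennreal_suminf_cmult)
    also have "(\<Sum>l. \<integral>\<^sup>+z. f z * (if p l then ennreal ((t * V z) ^ l / fact l) else 0) \<partial>?PK) =
      (\<integral>\<^sup>+z. f z * (\<Sum>l. if p l then ennreal ((t * V z) ^ l / fact l) else 0) \<partial>?PK)"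
      by (subst nn_integral_suminf[symmetric]) (auto simp: ennreal_suminf_cmult)
    finally show ?thesis .
  qed
  define IN where "IN i \<omega> = (INF n. ennreal (\<Prod>j\<in>(J - i ` K) \<inter> {..<n}. 1 - u (Xi i \<omega>) (X j \<omega>)))" for i \<omega>
  have IN_meas [measurable]: "IN i \<in> borel_measurable P" for i
    unfolding IN_def by measurable
  have IN_eq: "IN i \<omega> + FS odd i \<omega> = FS even i \<omega>" for i \<omega>
    unfolding IN_def FS_def using u01 by (intro prod_fsum) auto
  have [measurable]: "(sinh :: real \<Rightarrow> real) \<in> borel_measurable borel"
    by (intro borel_measurable_continuous_onI continuous_intros)
  \<comment> \<open>The odd part. It appears on both sides of the following chain and is cancelled
    at the end.\<close>
  let ?S = "ennreal t ^ k * (\<integral>\<^sup>+z. f z * ennreal (sinh (t * V z)) \<partial>?PK)"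
  have "(\<integral>\<^sup>+\<omega>. \<integral>\<^sup>+i. f (Xi i \<omega>) * IN i \<omega> \<partial>count_space (Inj K J) \<partial>P) + ?S =
     (\<integral>\<^sup>+\<omega>. \<integral>\<^sup>+i. f (Xi i \<omega>) * IN i \<omega> \<partial>count_space (Inj K J) \<partial>P) +
     (\<integral>\<^sup>+\<omega>. \<integral>\<^sup>+i. f (Xi i \<omega>) * FS odd i \<omega> \<partial>count_space (Inj K J) \<partial>P)"
    unfolding B using t_nonneg V0 by (simp add: suminf_cosh_sinh)
  also have "\<dots> = (\<integral>\<^sup>+\<omega>. \<integral>\<^sup>+i. f (Xi i \<omega>) * FS even i \<omega> \<partial>count_space (Inj K J) \<partial>P)"
    by (subst nn_integral_add[symmetric])
      (auto intro!: inner_meas nn_integral_cong simp: nn_integral_add[symmetric] IN_eq[symmetric] distrib_left)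
  also have "\<dots> = ennreal t ^ k * (\<integral>\<^sup>+z. f z * ennreal (cosh (t * V z)) \<partial>?PK)"
    unfolding B using t_nonneg V0 by (simp add: suminf_cosh_sinh)
  also have "(\<integral>\<^sup>+z. f z * ennreal (cosh (t * V z)) \<partial>?PK) =
     (\<integral>\<^sup>+z. f z * ennreal (exp (- t * V z)) + f z * ennreal (sinh (t * V z)) \<partial>?PK)"
  proof (rule nn_integral_cong)
    fix z
    have "cosh (t * V z) = exp (- t * V z) + sinh (t * V z)"
      by (simp add: cosh_minus_sinh[symmetric])
    then have "ennreal (cosh (t * V z)) = ennreal (exp (- t * V z)) + ennreal (sinh (t * V z))"
      using t_nonneg V0[of z] by (simp add: ennreal_plus)
    then show "f z * ennreal (cosh (t * V z)) = f z * ennreal (exp (- t * V z)) + f z * ennreal (sinh (t * V z))"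
      by (simp add: distrib_left)
  qed
  also have "\<dots> = (\<integral>\<^sup>+z. f z * ennreal (exp (- t * V z)) \<partial>?PK) + (\<integral>\<^sup>+z. f z * ennreal (sinh (t * V z)) \<partial>?PK)"
    by (rule nn_integral_add) auto
  also have "ennreal t ^ k * \<dots> = ennreal t ^ k * (\<integral>\<^sup>+z. f z * ennreal (exp (- t * V z)) \<partial>?PK) + ?S"
    by (rule distrib_left)
  finally have eq: "(\<integral>\<^sup>+\<omega>. \<integral>\<^sup>+i. f (Xi i \<omega>) * IN i \<omega> \<partial>count_space (Inj K J) \<partial>P) + ?S =
     ennreal t ^ k * (\<integral>\<^sup>+z. f z * ennreal (exp (- t * V z)) \<partial>?PK) + ?S" .
  have "(\<integral>\<^sup>+z. f z * ennreal (sinh (t * V z)) \<partial>?PK) \<le> (\<integral>\<^sup>+z. f z * ennreal (sinh (t * c)) \<partial>?PK)"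
    using V0 t_nonneg by (intro nn_integral_mono mult_left_mono ennreal_leI) (auto intro!: mult_left_mono)
  also have "\<dots> < \<infinity>"
    using f_fin by (simp add: nn_integral_multc ennreal_mult_less_top)
  finally have "(\<integral>\<^sup>+z. f z * ennreal (sinh (t * V z)) \<partial>?PK) < \<infinity>" .
  moreover have "ennreal t ^ k < \<infinity>" using t_nonneg by (simp add: ennreal_power)
  ultimately have "?S < \<infinity>" by (simp add: ennreal_mult_less_top)
  with eq[unfolded add.commute[of _ ?S] ennreal_add_left_cancel]
  have "(\<integral>\<^sup>+\<omega>. \<integral>\<^sup>+i. f (Xi i \<omega>) * IN i \<omega> \<partial>count_space (Inj K J) \<partial>P) =
     ennreal t ^ k * (\<integral>\<^sup>+z. f z * ennreal (exp (- t * V z)) \<partial>?PK)"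
    by auto
  then show ?thesis unfolding IN_def Xi_def .
qed

text \<open>The functions \<open>min f m\<close> on bounded boxes are integrable and increase to
  \<open>f\<close>, so monotone convergence removes the integrability assumed in
  \<open>void_formula_finite\<close>.\<close>

lemma void_formula:
  fixes k :: nat and f :: "(nat \<Rightarrow> 'a) \<Rightarrow> ennreal" and u :: "(nat \<Rightarrow> 'a) \<Rightarrow> 'a \<Rightarrow> real"
  defines "K \<equiv> {..<k}"
  assumes f [measurable]: "f \<in> borel_measurable (Pi\<^sub>M K (\<lambda>_. lborel))"
    and u [measurable]: "(\<lambda>(z, w). u z w) \<in> borel_measurable (Pi\<^sub>M K (\<lambda>_. lborel) \<Otimes>\<^sub>M lborel)"
    and u01: "\<And>z w. 0 \<le> u z w \<and> u z w \<le> 1"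
    and V: "\<And>z. z \<in> space (Pi\<^sub>M K (\<lambda>_. lborel :: 'a measure)) \<Longrightarrow> (\<integral>\<^sup>+w. ennreal (u z w) \<partial>lborel) = ennreal (V z)"
    and V0: "\<And>z. 0 \<le> V z \<and> V z \<le> c"
  shows "(\<integral>\<^sup>+\<omega>. \<integral>\<^sup>+i. f (\<lambda>l\<in>K. X (i l) \<omega>) *
             (INF n. ennreal (\<Prod>j\<in>(J - i ` K) \<inter> {..<n}. 1 - u (\<lambda>l\<in>K. X (i l) \<omega>) (X j \<omega>)))
             \<partial>count_space (Inj K J) \<partial>P) =
           ennreal t ^ k * (\<integral>\<^sup>+z. f z * ennreal (exp (- t * V z)) \<partial>Pi\<^sub>M K (\<lambda>_. lborel))"
proof -
  interpret L: product_sigma_finite "\<lambda>_::nat. lborel :: 'a measure" by standard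
  let ?PK = "Pi\<^sub>M K (\<lambda>_. lborel :: 'a measure)"
  have finK [simp]: "finite K" by (auto simp: K_def)
  have V_measr [measurable]: "V \<in> borel_measurable ?PK"
  proof -
    have "(\<lambda>z. enn2real (\<integral>\<^sup>+w. ennreal (u z w) \<partial>lborel)) \<in> borel_measurable ?PK" by measurable
    then show ?thesis by (rule measurable_cong[THEN iffD1, rotated]) (use V V0 in simp)
  qed
  define E where "E m = Pi\<^sub>E K (\<lambda>_. cball 0 (real m) :: 'a set)" for m :: nat
  have E [measurable]: "E m \<in> sets ?PK" for m
    unfolding E_def by (intro sets_PiM_I_finite) auto
  have E_fin: "emeasure ?PK (E m) < \<infinity>" for m
  proof -
    have "emeasure ?PK (E m) = (\<Prod>l\<in>K. emeasure lborel (cball 0 (real m) :: 'a set))"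
      unfolding E_def by (subst L.emeasure_PiM) auto
    also have "\<dots> < \<infinity>"
      using emeasure_bounded_finite[of "cball 0 (real m) :: 'a set"] by (auto simp: less_top[symmetric] power_eq_top_ennreal)
    finally show ?thesis .
  qed
  define fm where "fm m z = min (f z) (of_nat m) * indicator (E m) z" for m z
  have fm_meas [measurable]: "fm m \<in> borel_measurable ?PK" for m
    unfolding fm_def by measurable
  have fm_inc: "incseq fm"
  proof (rule incseq_SucI, rule le_funI)
    fix m z
    have "E m \<subseteq> E (Suc m)" unfolding E_def by (intro PiE_mono) auto
    then have "indicator (E m) z \<le> (indicator (E (Suc m)) z :: ennreal)" by (auto simp: indicator_def)
    moreover have "min (f z) (of_nat m) \<le> min (f z) (of_nat (Suc m))"
      by (intro min.mono) (simp_all add: add_increasing)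
    ultimately show "fm m z \<le> fm (Suc m) z"
      unfolding fm_def by (intro mult_mono) auto
  qed
  have fm_sup: "(SUP m. fm m z) = f z" if z: "z \<in> space ?PK" for z
  proof (rule antisym)
    show "(SUP m. fm m z) \<le> f z" by (rule SUP_least) (auto simp: fm_def indicator_def)
    obtain m0 where m0: "(\<Sum>l\<in>K. norm (z l)) \<le> real m0" using real_arch_simple by blast
    have zE: "z \<in> E m" if "m0 \<le> m" for m
    proof -
      have "norm (z l) \<le> real m" if "l \<in> K" for l
        using member_le_sum[OF that, of "\<lambda>l. norm (z l)"] m0 \<open>m0 \<le> m\<close> by simp
      then show ?thesis using z by (auto simp: E_def space_PiM PiE_iff)
    qed
    have "f z = inf (f z) (SUP m::nat. of_nat m)"
      by (simp add: ennreal_SUP_of_nat_eq_top)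
    also have "\<dots> = (SUP m::nat. min (f z) (of_nat m))"
      unfolding inf_min[symmetric] by (rule inf_SUP)
    also have "\<dots> \<le> (SUP m. fm m z)"
    proof (rule SUP_least)
      fix m :: nat
      have "min (f z) (of_nat m) \<le> min (f z) (of_nat (max m m0))"
        by (intro min.mono) simp_all
      also have "\<dots> = fm (max m m0) z" using zE[of "max m m0"] by (simp add: fm_def)
      also have "\<dots> \<le> (SUP m. fm m z)" by (rule SUP_upper) simp
      finally show "min (f z) (of_nat m) \<le> (SUP m. fm m z)" .
    qed
    finally show "f z \<le> (SUP m. fm m z)" .
  qed
  define Xi where "Xi i \<omega> = (\<lambda>l\<in>K. X (i l) \<omega>)" for i \<omega>
  have Xi [measurable]: "Xi i \<in> measurable P ?PK" for i
    unfolding Xi_def by (rule measurable_restrict) simp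
  have Xi_sp: "Xi i \<omega> \<in> space ?PK" for i \<omega> by (auto simp: Xi_def space_PiM)
  have uX [measurable]: "(\<lambda>\<omega>. u (Xi i \<omega>) (X j \<omega>)) \<in> borel_measurable P" for i j
  proof -
    have "(\<lambda>\<omega>. (Xi i \<omega>, X j \<omega>)) \<in> P \<rightarrow>\<^sub>M ?PK \<Otimes>\<^sub>M lborel" by (rule measurable_Pair) auto
    from measurable_compose[OF this u] show ?thesis by simp
  qed
  define IN where "IN i \<omega> = (INF n. ennreal (\<Prod>j\<in>(J - i ` K) \<inter> {..<n}. 1 - u (Xi i \<omega>) (X j \<omega>)))" for i \<omega>
  have IN_meas [measurable]: "IN i \<in> borel_measurable P" for i
    unfolding IN_def by measurable
  have fm: "fm m z \<le> fm m' z" if "m \<le> m'" for m m' z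
    using fm_inc that by (auto simp: incseq_def le_fun_def)
  have step: "(\<integral>\<^sup>+\<omega>. \<integral>\<^sup>+i. fm m (Xi i \<omega>) * IN i \<omega> \<partial>count_space (Inj K J) \<partial>P) =
      ennreal t ^ k * (\<integral>\<^sup>+z. fm m z * ennreal (exp (- t * V z)) \<partial>?PK)" for m
    unfolding IN_def Xi_def K_def
  proof (rule void_formula_finite)
    show "fm m \<in> borel_measurable (Pi\<^sub>M {..<k} (\<lambda>_. lborel))" using fm_meas by (simp add: K_def)
    have "(\<integral>\<^sup>+z. fm m z \<partial>?PK) \<le> (\<integral>\<^sup>+z. of_nat m * indicator (E m) z \<partial>?PK)"
      by (intro nn_integral_mono) (simp add: fm_def mult_right_mono)
    also have "\<dots> = of_nat m * emeasure ?PK (E m)" by (rule nn_integral_cmult_indicator) simp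
    also have "\<dots> < \<infinity>" using E_fin[of m] by (simp add: ennreal_mult_less_top of_nat_less_top)
    finally show "(\<integral>\<^sup>+z. fm m z \<partial>Pi\<^sub>M {..<k} (\<lambda>_. lborel)) < \<infinity>" by (simp add: K_def)
  qed (use u u01 V V0 in \<open>auto simp: K_def\<close>)
  have "(\<integral>\<^sup>+\<omega>. \<integral>\<^sup>+i. f (Xi i \<omega>) * IN i \<omega> \<partial>count_space (Inj K J) \<partial>P) =
    (\<integral>\<^sup>+\<omega>. \<integral>\<^sup>+i. (SUP m. fm m (Xi i \<omega>) * IN i \<omega>) \<partial>count_space (Inj K J) \<partial>P)"
    by (intro nn_integral_cong) (simp add: SUP_mult_right_ennreal[symmetric] fm_sup[OF Xi_sp])
  also have "\<dots> = (\<integral>\<^sup>+\<omega>. (SUP m. \<integral>\<^sup>+i. fm m (Xi i \<omega>) * IN i \<omega> \<partial>count_space (Inj K J)) \<partial>P)"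
    by (intro nn_integral_cong nn_integral_monotone_convergence_SUP)
      (auto simp: incseq_def le_fun_def intro!: mult_right_mono fm)
  also have "\<dots> = (SUP m. \<integral>\<^sup>+\<omega>. \<integral>\<^sup>+i. fm m (Xi i \<omega>) * IN i \<omega> \<partial>count_space (Inj K J) \<partial>P)"
    by (intro nn_integral_monotone_convergence_SUP borel_measurable_nn_integral_count)
      (auto simp: incseq_def le_fun_def intro!: mult_right_mono fm nn_integral_mono)
  also have "\<dots> = ennreal t ^ k * (SUP m. \<integral>\<^sup>+z. fm m z * ennreal (exp (- t * V z)) \<partial>?PK)"
    unfolding step by (rule SUP_mult_left_ennreal[symmetric])
  also have "(SUP m. \<integral>\<^sup>+z. fm m z * ennreal (exp (- t * V z)) \<partial>?PK) =
     (\<integral>\<^sup>+z. (SUP m. fm m z * ennreal (exp (- t * V z))) \<partial>?PK)"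
    by (intro nn_integral_monotone_convergence_SUP[symmetric])
      (auto simp: incseq_def le_fun_def intro!: mult_right_mono fm)
  also have "\<dots> = (\<integral>\<^sup>+z. f z * ennreal (exp (- t * V z)) \<partial>?PK)"
    by (intro nn_integral_cong) (simp add: SUP_mult_right_ennreal[symmetric] fm_sup)
  finally show ?thesis unfolding IN_def Xi_def .
qed

end

subsection \<open>Taylor expansion under the integral\<close>

text \<open>The \<open>n\<close>-th derivative of \<open>s ^ k * exp (- s * v)\<close> in
  \<open>s\<close>, by Leibniz's rule. The falling factorial \<open>fact m * (k choose m)\<close>
  vanishes for \<open>m > k\<close>, where \<open>k - m\<close> is truncated.\<close>

definition taylor_term :: "nat \<Rightarrow> real \<Rightarrow> nat \<Rightarrow> real \<Rightarrow> real" where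
  "taylor_term n s k v = (\<Sum>m\<le>n. real (n choose m) * (-1) ^ (n - m) *
     (real (fact m * (k choose m)) * s ^ (k - m) * v ^ (n - m) * exp (- s * v)))"

text \<open>Both series are Cauchy products of a finite binomial series with an exponential series.
  The second one, with absolute values throughout, is the majorant used for exchanging sum and
  integral.\<close>

lemma taylor_term_sums:
  fixes s h v :: real
  shows "(\<lambda>n. h ^ n / fact n * taylor_term n s k v) sums ((s + h) ^ k * exp (- (s + h) * v))"
    and "(\<lambda>n. \<Sum>m\<le>n. (real (k choose m) * \<bar>h\<bar> ^ m * \<bar>s\<bar> ^ (k - m)) * ((\<bar>h\<bar> * \<bar>v\<bar>) ^ (n - m) / fact (n - m))) sums
          ((\<bar>s\<bar> + \<bar>h\<bar>) ^ k * exp (\<bar>h\<bar> * \<bar>v\<bar>))"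
proof -
  have fin: "(\<lambda>m. real (k choose m) * x ^ m * y ^ (k - m)) sums (y + x) ^ k" for x y :: real
  proof -
    have "(\<lambda>m. real (k choose m) * x ^ m * y ^ (k - m)) sums (\<Sum>m\<le>k. real (k choose m) * x ^ m * y ^ (k - m))"
      by (rule sums_finite) auto
    also have "(\<Sum>m\<le>k. real (k choose m) * x ^ m * y ^ (k - m)) = (y + x) ^ k"
      by (subst add.commute) (simp add: binomial_ring)
    finally show ?thesis .
  qed
  have ex: "(\<lambda>l. x ^ l / fact l) sums exp x" for x :: real
    using exp_converges[of x] by (simp add: divide_inverse mult.commute)
  have CP: "(\<lambda>n. \<Sum>m\<le>n. (real (k choose m) * x ^ m * y ^ (k - m)) * (w ^ (n - m) / fact (n - m))) sums
          ((y + x) ^ k * exp w)" for x y w :: real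
  proof -
    have "summable (\<lambda>m. norm (real (k choose m) * x ^ m * y ^ (k - m)))"
      by (rule summable_finite[of "{..k}"]) auto
    moreover have "summable (\<lambda>l. norm (w ^ l / fact l))"
      using summable_norm_exp[of w] by (simp add: divide_inverse mult.commute)
    ultimately show ?thesis
      using Cauchy_product_sums[of "\<lambda>m. real (k choose m) * x ^ m * y ^ (k - m)" "\<lambda>l. w ^ l / fact l"]
        sums_unique[OF fin[of x y]] sums_unique[OF ex[of w]] by simp
  qed
  show "(\<lambda>n. \<Sum>m\<le>n. (real (k choose m) * \<bar>h\<bar> ^ m * \<bar>s\<bar> ^ (k - m)) * ((\<bar>h\<bar> * \<bar>v\<bar>) ^ (n - m) / fact (n - m))) sums
          ((\<bar>s\<bar> + \<bar>h\<bar>) ^ k * exp (\<bar>h\<bar> * \<bar>v\<bar>))"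
    by (rule CP)
  have "(\<lambda>n. exp (- s * v) * (\<Sum>m\<le>n. (real (k choose m) * h ^ m * s ^ (k - m)) * ((- h * v) ^ (n - m) / fact (n - m))))
     sums (exp (- s * v) * ((s + h) ^ k * exp (- h * v)))"
    by (intro sums_mult CP)
  also have "exp (- s * v) * ((s + h) ^ k * exp (- h * v)) = (s + h) ^ k * exp (- (s + h) * v)"
    by (simp add: algebra_simps exp_add[symmetric])
  also have "(\<lambda>n. exp (- s * v) * (\<Sum>m\<le>n. (real (k choose m) * h ^ m * s ^ (k - m)) * ((- h * v) ^ (n - m) / fact (n - m)))) =
     (\<lambda>n. h ^ n / fact n * taylor_term n s k v)"
  proof
    fix n
    show "exp (- s * v) * (\<Sum>m\<le>n. (real (k choose m) * h ^ m * s ^ (k - m)) * ((- h * v) ^ (n - m) / fact (n - m))) =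
       h ^ n / fact n * taylor_term n s k v"
      unfolding taylor_term_def sum_distrib_left
    proof (intro sum.cong refl)
      fix m assume "m \<in> {..n}"
      then have m: "m \<le> n" by simp
      have "h ^ n = h ^ m * h ^ (n - m)" using m by (simp flip: power_add)
      moreover have "real (n choose m) = fact n / (fact m * fact (n - m))"
        using m by (rule binomial_fact)
      moreover have "(- h * v) ^ (n - m) = (-1) ^ (n - m) * h ^ (n - m) * v ^ (n - m)"
        by (metis mult.assoc mult_minus1 power_mult_distrib)
      ultimately show "exp (- s * v) * ((real (k choose m) * h ^ m * s ^ (k - m)) * ((- h * v) ^ (n - m) / fact (n - m))) =
         h ^ n / fact n * (real (n choose m) * (- 1) ^ (n - m) *
           (real (fact m * (k choose m)) * s ^ (k - m) * v ^ (n - m) * exp (- s * v)))"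
        by (simp add: field_simps)
    qed
  qed
  finally show "(\<lambda>n. h ^ n / fact n * taylor_term n s k v) sums ((s + h) ^ k * exp (- (s + h) * v))" .
qed

text \<open>Up to the sign of \<open>W\<close>, the integrand in \<open>int\<close> is the sum of
  the majorant series at \<open>h = \<delta>\<close>. It therefore dominates the Taylor series for
  all smaller \<open>h\<close>, and also each coefficient after division by a power of
  \<open>\<delta>\<close>.\<close>

lemma analytic_integral:
  fixes W v :: "'b \<Rightarrow> real" and \<kappa> :: "'b \<Rightarrow> nat"
  assumes W [measurable]: "W \<in> borel_measurable M" and v [measurable]: "v \<in> borel_measurable M"
    and \<kappa> [measurable]: "\<kappa> \<in> measurable M (count_space UNIV)"
    and v0: "\<And>x. 0 \<le> v x" and s: "0 \<le> s" and \<delta>: "0 < \<delta>"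
    and int: "integrable M (\<lambda>x. W x * ((s + \<delta>) ^ \<kappa> x * exp ((\<delta> - s) * v x)))"
  shows "integrable M (\<lambda>x. W x * (real (fact m * (\<kappa> x choose m)) * s ^ (\<kappa> x - m) * v x ^ l * exp (- s * v x)))"
    and "\<bar>h\<bar> < \<delta> \<Longrightarrow> integrable M (\<lambda>x. W x * ((s + h) ^ \<kappa> x * exp (- (s + h) * v x)))"
    and "\<bar>h\<bar> < \<delta> \<Longrightarrow> (\<lambda>n. h ^ n / fact n * (\<Sum>m\<le>n. real (n choose m) * (-1) ^ (n - m) *
          (\<integral>x. W x * (real (fact m * (\<kappa> x choose m)) * s ^ (\<kappa> x - m) * v x ^ (n - m) * exp (- s * v x)) \<partial>M)))
        sums (\<integral>x. W x * ((s + h) ^ \<kappa> x * exp (- (s + h) * v x)) \<partial>M)"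
proof -
  have chm [measurable]: "(\<lambda>x. real (fact m * (\<kappa> x choose m)) * s ^ (\<kappa> x - m)) \<in> borel_measurable M" for m
    by (rule measurable_compose[OF \<kappa>]) simp
  have powm [measurable]: "(\<lambda>x. c ^ \<kappa> x) \<in> borel_measurable M" for c :: real
    by (rule measurable_compose[OF \<kappa>]) simp
  have int_abs: "integrable M (\<lambda>x. \<bar>W x\<bar> * ((s + \<delta>) ^ \<kappa> x * exp ((\<delta> - s) * v x)))"
  proof -
    have "integrable M (\<lambda>x. \<bar>W x * ((s + \<delta>) ^ \<kappa> x * exp ((\<delta> - s) * v x))\<bar>)"
      using int by (rule integrable_abs)
    then show ?thesis using s \<delta> by (simp add: abs_mult)
  qed
  have bound: "(real (k choose m) * h ^ m * s ^ (k - m)) * ((h * u) ^ l / fact l) \<le> (s + h) ^ k * exp (h * u)"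
    if "0 \<le> h" "0 \<le> u" for h u :: real and k m l
  proof -
    have "real (k choose m) * h ^ m * s ^ (k - m) \<le> (s + h) ^ k"
    proof (cases "m \<le> k")
      case True
      have "real (k choose m) * h ^ m * s ^ (k - m) \<le> (\<Sum>m\<le>k. real (k choose m) * h ^ m * s ^ (k - m))"
        using True s that by (intro member_le_sum) auto
      then show ?thesis by (subst add.commute) (simp add: binomial_ring)
    qed (use s that in \<open>simp add: binomial_eq_0\<close>)
    moreover have "(h * u) ^ l / fact l \<le> exp (h * u)"
    proof -
      have "(h * u) ^ l / fact l = (\<Sum>i\<in>{l}. (h * u) ^ i / fact i)" by simp
      also have "\<dots> \<le> (\<Sum>i. (h * u) ^ i / fact i)"
        using that summable_exp[of "h * u"] by (intro sum_le_suminf) (auto simp: divide_inverse mult.commute)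
      also have "\<dots> = exp (h * u)" by (simp add: exp_def divide_inverse mult.commute)
      finally show ?thesis .
    qed
    ultimately show ?thesis using that s by (intro mult_mono) auto
  qed
  \<comment> \<open>A Cauchy estimate: one term of the binomial and one of the exponential series
    are at most the full sums at \<open>h = \<delta>\<close>, and dividing by
    \<open>\<delta> ^ (m + l)\<close> isolates the coefficient.\<close>
  have term_bound: "\<bar>W x * (real (fact m * (\<kappa> x choose m)) * s ^ (\<kappa> x - m) * v x ^ l * exp (- s * v x))\<bar> \<le>
     (fact m * fact l / \<delta> ^ (m + l)) * (\<bar>W x\<bar> * ((s + \<delta>) ^ \<kappa> x * exp ((\<delta> - s) * v x)))" for x m l
  proof -
    have "real (fact m * (\<kappa> x choose m)) * s ^ (\<kappa> x - m) * v x ^ l =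
       (fact m * fact l / \<delta> ^ (m + l)) * ((real (\<kappa> x choose m) * \<delta> ^ m * s ^ (\<kappa> x - m)) * ((\<delta> * v x) ^ l / fact l))"
      using \<delta> by (simp add: field_simps power_add power_mult_distrib)
    also have "\<dots> \<le> (fact m * fact l / \<delta> ^ (m + l)) * ((s + \<delta>) ^ \<kappa> x * exp (\<delta> * v x))"
      using \<delta> v0 by (intro mult_left_mono bound) auto
    finally have "real (fact m * (\<kappa> x choose m)) * s ^ (\<kappa> x - m) * v x ^ l \<le>
       (fact m * fact l / \<delta> ^ (m + l)) * ((s + \<delta>) ^ \<kappa> x * exp (\<delta> * v x))" .
    then have "\<bar>W x\<bar> * exp (- s * v x) * (real (fact m * (\<kappa> x choose m)) * s ^ (\<kappa> x - m) * v x ^ l) \<le>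
       \<bar>W x\<bar> * exp (- s * v x) * ((fact m * fact l / \<delta> ^ (m + l)) * ((s + \<delta>) ^ \<kappa> x * exp (\<delta> * v x)))"
      by (intro mult_left_mono) auto
    moreover have "exp ((\<delta> - s) * v x) = exp (\<delta> * v x) * exp (- s * v x)"
      by (simp add: algebra_simps exp_add[symmetric])
    ultimately show ?thesis
      using s v0[of x] by (simp add: abs_mult ac_simps)
  qed
  show int1: "integrable M (\<lambda>x. W x * (real (fact m * (\<kappa> x choose m)) * s ^ (\<kappa> x - m) * v x ^ l * exp (- s * v x)))" for m l
  proof (rule Bochner_Integration.integrable_bound[OF integrable_mult_right[OF int_abs, of "fact m * fact l / \<delta> ^ (m + l)"]])
    show "AE x in M. norm (W x * (real (fact m * (\<kappa> x choose m)) * s ^ (\<kappa> x - m) * v x ^ l * exp (- s * v x))) \<le>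
       norm ((fact m * fact l / \<delta> ^ (m + l)) * (\<bar>W x\<bar> * ((s + \<delta>) ^ \<kappa> x * exp ((\<delta> - s) * v x))))"
      unfolding real_norm_def by (intro AE_I2 order_trans[OF term_bound abs_ge_self])
  qed measurable
  assume h: "\<bar>h\<bar> < \<delta>"
  let ?g = "\<lambda>x. W x * ((s + h) ^ \<kappa> x * exp (- (s + h) * v x))"
  have "\<bar>?g x\<bar> \<le> \<bar>W x\<bar> * ((s + \<delta>) ^ \<kappa> x * exp ((\<delta> - s) * v x))" for x
  proof -
    have "\<bar>s + h\<bar> ^ \<kappa> x \<le> (s + \<delta>) ^ \<kappa> x" using h s by (intro power_mono) auto
    moreover have "- (s + h) * v x \<le> (\<delta> - s) * v x" using h v0 by (intro mult_right_mono) auto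
    ultimately show ?thesis
      unfolding abs_mult power_abs abs_exp_cancel using s \<delta> by (intro mult_left_mono mult_mono) auto
  qed
  then show "integrable M ?g"
    by (intro Bochner_Integration.integrable_bound[OF int_abs]) (auto intro!: AE_I2 order_trans[OF _ abs_ge_self])
  let ?q = "\<lambda>n x. W x * (h ^ n / fact n * taylor_term n s (\<kappa> x) (v x))"
  have q_alt: "?q n x = h ^ n / fact n * (\<Sum>m\<le>n. real (n choose m) * (-1) ^ (n - m) *
      (W x * (real (fact m * (\<kappa> x choose m)) * s ^ (\<kappa> x - m) * v x ^ (n - m) * exp (- s * v x))))" for n x
    unfolding taylor_term_def by (simp add: sum_distrib_left ac_simps)
  have q_int: "integrable M (?q n)" for n
    unfolding q_alt by (intro integrable_mult_right Bochner_Integration.integrable_sum impI int1)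
  have q_val: "(\<integral>x. ?q n x \<partial>M) = h ^ n / fact n * (\<Sum>m\<le>n. real (n choose m) * (-1) ^ (n - m) *
      (\<integral>x. W x * (real (fact m * (\<kappa> x choose m)) * s ^ (\<kappa> x - m) * v x ^ (n - m) * exp (- s * v x)) \<partial>M))" for n
    unfolding q_alt
    by (subst integral_mult_right_zero, subst Bochner_Integration.integral_sum, intro integrable_mult_right impI int1,
        simp only: integral_mult_right_zero)
  \<comment> \<open>Majorant of the \<open>n\<close>-th Taylor term; the sum over \<open>n\<close>
    is below the integrable function of \<open>int_abs\<close>.\<close>
  let ?B = "\<lambda>n x. \<bar>W x\<bar> * exp (- s * v x) * (\<Sum>m\<le>n. (real (\<kappa> x choose m) * \<bar>h\<bar> ^ m * \<bar>s\<bar> ^ (\<kappa> x - m)) * ((\<bar>h\<bar> * \<bar>v x\<bar>) ^ (n - m) / fact (n - m)))"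
  have q_B: "\<bar>?q n x\<bar> \<le> ?B n x" for n x
  proof -
    have "\<bar>h ^ n / fact n * taylor_term n s (\<kappa> x) (v x)\<bar> \<le>
      exp (- s * v x) * (\<Sum>m\<le>n. (real (\<kappa> x choose m) * \<bar>h\<bar> ^ m * \<bar>s\<bar> ^ (\<kappa> x - m)) * ((\<bar>h\<bar> * \<bar>v x\<bar>) ^ (n - m) / fact (n - m)))"
      unfolding taylor_term_def sum_distrib_left
    proof (rule order_trans[OF sum_abs], rule sum_mono)
      fix m assume "m \<in> {..n}"
      then have m: "m \<le> n" by simp
      have "\<bar>h\<bar> ^ n = \<bar>h\<bar> ^ m * \<bar>h\<bar> ^ (n - m)" using m by (simp flip: power_add)
      moreover have "real (n choose m) = fact n / (fact m * fact (n - m))"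
        using m by (rule binomial_fact)
      note hn = calculation and b = this
      show "\<bar>h ^ n / fact n * (real (n choose m) * (- 1) ^ (n - m) *
           (real (fact m * (\<kappa> x choose m)) * s ^ (\<kappa> x - m) * v x ^ (n - m) * exp (- s * v x)))\<bar> \<le>
         exp (- s * v x) * (real (\<kappa> x choose m) * \<bar>h\<bar> ^ m * \<bar>s\<bar> ^ (\<kappa> x - m) * ((\<bar>h\<bar> * \<bar>v x\<bar>) ^ (n - m) / fact (n - m)))"
        unfolding b by (simp add: abs_mult power_abs power_mult_distrib hn field_simps)
    qed
    from mult_left_mono[OF this, of "\<bar>W x\<bar>"] show ?thesis by (simp add: abs_mult mult.assoc)
  qed
  have B_sums: "(\<lambda>n. ?B n x) sums (\<bar>W x\<bar> * exp (- s * v x) * ((s + \<bar>h\<bar>) ^ \<kappa> x * exp (\<bar>h\<bar> * v x)))" for x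
    using sums_mult[OF taylor_term_sums(2)[of "\<kappa> x" h s "v x"], of "\<bar>W x\<bar> * exp (- s * v x)"] s v0[of x] by simp
  have B_nn: "0 \<le> ?B n x" for n x by (intro mult_nonneg_nonneg sum_nonneg) auto
  have B_meas [measurable]: "?B n \<in> borel_measurable M" for n
  proof -
    have [measurable]: "(\<lambda>x. real (\<kappa> x choose m) * \<bar>h\<bar> ^ m * \<bar>s\<bar> ^ (\<kappa> x - m)) \<in> borel_measurable M" for m
      by (rule measurable_compose[OF \<kappa>]) simp
    show ?thesis by measurable
  qed
  have sumB: "(\<Sum>n. \<integral>\<^sup>+x. ennreal (?B n x) \<partial>M) < \<infinity>"
  proof -
    have "(\<Sum>n. \<integral>\<^sup>+x. ennreal (?B n x) \<partial>M) = (\<integral>\<^sup>+x. (\<Sum>n. ennreal (?B n x)) \<partial>M)"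
      by (rule nn_integral_suminf[symmetric]) measurable
    also have "\<dots> = (\<integral>\<^sup>+x. ennreal (\<bar>W x\<bar> * exp (- s * v x) * ((s + \<bar>h\<bar>) ^ \<kappa> x * exp (\<bar>h\<bar> * v x))) \<partial>M)"
      by (intro nn_integral_cong suminf_ennreal_eq B_nn B_sums)
    also have "\<dots> \<le> (\<integral>\<^sup>+x. ennreal (\<bar>W x\<bar> * ((s + \<delta>) ^ \<kappa> x * exp ((\<delta> - s) * v x))) \<partial>M)"
    proof (intro nn_integral_mono ennreal_leI)
      fix x
      have "exp (- s * v x) * ((s + \<bar>h\<bar>) ^ \<kappa> x * exp (\<bar>h\<bar> * v x)) = (s + \<bar>h\<bar>) ^ \<kappa> x * exp ((\<bar>h\<bar> - s) * v x)"
        by (simp add: algebra_simps exp_add[symmetric])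
      also have "\<dots> \<le> (s + \<delta>) ^ \<kappa> x * exp ((\<delta> - s) * v x)"
        using h s v0[of x] by (intro mult_mono power_mono) (auto intro!: mult_right_mono)
      finally show "\<bar>W x\<bar> * exp (- s * v x) * ((s + \<bar>h\<bar>) ^ \<kappa> x * exp (\<bar>h\<bar> * v x)) \<le> \<bar>W x\<bar> * ((s + \<delta>) ^ \<kappa> x * exp ((\<delta> - s) * v x))"
        by (simp add: mult.assoc mult_left_mono)
    qed
    also have "\<dots> < \<infinity>"
      using integrableD(2)[OF int_abs] s \<delta> by (simp add: less_top[symmetric] abs_mult)
    finally show ?thesis .
  qed
  have "(\<lambda>n. \<integral>x. ?q n x \<partial>M) sums (\<integral>x. (\<Sum>n. ?q n x) \<partial>M)"
  proof (rule sums_integral)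
    show "integrable M (?q n)" for n by (rule q_int)
    show "AE x in M. summable (\<lambda>n. norm (?q n x))"
      by (intro AE_I2 summable_comparison_test'[OF sums_summable[OF B_sums]]) (use q_B in auto)
    show "summable (\<lambda>n. \<integral>x. norm (?q n x) \<partial>M)"
    proof (rule summable_suminf_not_top)
      show "0 \<le> (\<integral>x. norm (?q n x) \<partial>M)" for n by simp
      have "(\<Sum>n. ennreal (\<integral>x. norm (?q n x) \<partial>M)) = (\<Sum>n. \<integral>\<^sup>+x. ennreal (norm (?q n x)) \<partial>M)"
        by (intro suminf_cong nn_integral_eq_integral[symmetric] integrable_norm q_int) auto
      also have "\<dots> \<le> (\<Sum>n. \<integral>\<^sup>+x. ennreal (?B n x) \<partial>M)"
        by (intro suminf_le nn_integral_mono ennreal_leI) (use q_B in auto)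
      finally show "(\<Sum>n. ennreal (\<integral>x. norm (?q n x) \<partial>M)) \<noteq> top"
        using sumB by (auto simp: top_unique)
    qed
  qed
  moreover have "(\<Sum>n. ?q n x) = ?g x" for x
    using sums_mult[OF taylor_term_sums(1)[of h s "\<kappa> x" "v x"], of "W x"] by (simp add: sums_iff)
  ultimately show "(\<lambda>n. h ^ n / fact n * (\<Sum>m\<le>n. real (n choose m) * (-1) ^ (n - m) *
          (\<integral>x. W x * (real (fact m * (\<kappa> x choose m)) * s ^ (\<kappa> x - m) * v x ^ (n - m) * exp (- s * v x)) \<partial>M)))
        sums (\<integral>x. ?g x \<partial>M)"
    by (simp only: q_val)
qed

subsection \<open>Components of the random graph\<close>

lemma lex_less_irrefl [simp]: "\<not> lex_less x x"
  by (simp add: lex_less_def)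

lemma lex_less_total: "x \<noteq> y \<Longrightarrow> lex_less x y \<or> lex_less y x"
proof -
  assume "x \<noteq> y"
  then have ne: "{i. x $ i \<noteq> y $ i} \<noteq> {}" by (auto simp: vec_eq_iff)
  define i where "i = Min {i. x $ i \<noteq> y $ i}"
  have i: "x $ i \<noteq> y $ i" using Min_in[OF _ ne] by (simp add: i_def)
  have "x $ j = y $ j" if "j < i" for j
  proof (rule ccontr)
    assume "x $ j \<noteq> y $ j"
    then have "i \<le> j" unfolding i_def by (intro Min_le) auto
    with that show False by simp
  qed
  with i show ?thesis by (auto simp: lex_less_def neq_iff)
qed

lemma lex_less_asym: "lex_less x y \<Longrightarrow> \<not> lex_less y x"
proof (unfold lex_less_def, clarify)
  fix i j assume a: "x $ i < y $ i" "\<forall>k<i. x $ k = y $ k" "y $ j < x $ j" "\<forall>k<j. y $ k = x $ k"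
  then show False by (cases i j rule: linorder_cases) force+
qed

lemma lex_less_translate [simp]: "lex_less (a + x) (a + y) \<longleftrightarrow> lex_less x y"
  by (simp add: lex_less_def)

lemma lex_less_pred [measurable (raw)]:
  assumes [measurable]: "f \<in> borel_measurable M" "g \<in> borel_measurable M"
  shows "Measurable.pred M (\<lambda>x. lex_less (f x) (g x))"
proof -
  have nth: "(\<lambda>v. v $ i) \<in> borel_measurable borel" for i
    by (intro borel_measurable_continuous_onI continuous_intros)
  have [measurable]: "(\<lambda>x. f x $ i) \<in> borel_measurable M" "(\<lambda>x. g x $ i) \<in> borel_measurable M" for i
    by (rule measurable_compose[OF _ nth], fact)+
  have "Measurable.pred M (\<lambda>x. \<forall>j\<in>{..<i}. f x $ j = g x $ j)" for i
    by measurable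
  then have [measurable]: "Measurable.pred M (\<lambda>x. \<forall>j<i. f x $ j = g x $ j)" for i
    by simp
  show ?thesis unfolding lex_less_def by measurable
qed

text \<open>Each unordered pair with distinct positions occurs once, in the orientation whose mark
  decides the edge.\<close>

definition lexpairs :: "'i set \<Rightarrow> ('i \<Rightarrow> ('d::{finite,linorder}) pt) \<Rightarrow> ('i \<times> 'i) set" where
  "lexpairs S Z = {(i, j). i \<in> S \<and> j \<in> S \<and> lex_less (Z i) (Z j)}"

definition conn_from :: "'i \<Rightarrow> 'i set \<Rightarrow> ('i \<times> 'i) set \<Rightarrow> bool" where
  "conn_from r S E \<longleftrightarrow> (\<forall>j\<in>S. (r, j) \<in> (E \<union> E\<inverse>)\<^sup>*)"

definition pairw :: "(('d::{finite,linorder}) pt \<Rightarrow> real) \<Rightarrow> ('i \<Rightarrow> 'd pt) \<Rightarrow> 'i \<times> 'i \<Rightarrow> real" where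
  "pairw \<phi> Z p = \<phi> (Z (snd p) - Z (fst p))"

text \<open>The probability that the random graph on the points \<open>Z i\<close>, \<open>i \<in> S\<close>, is connected.\<close>

definition connw :: "(('d::{finite,linorder}) pt \<Rightarrow> real) \<Rightarrow> 'i set \<Rightarrow> ('i \<Rightarrow> 'd pt) \<Rightarrow> 'i \<Rightarrow> real" where
  "connw \<phi> S Z r = (\<Sum>E\<in>{E \<in> Pow (lexpairs S Z). conn_from r S E}.
     (\<Prod>p\<in>E. pairw \<phi> Z p) * (\<Prod>p\<in>lexpairs S Z - E. 1 - pairw \<phi> Z p))"

text \<open>The otherwise unused diagonal mark \<open>u (i, i)\<close> keeps the point \<open>i\<close> with probability \<open>\<rho> i\<close>. This
  thinning makes moments at intensity \<open>t\<close> available at all smaller intensities.\<close>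

definition gedges :: "(('d::{finite,linorder}) pt \<Rightarrow> real) \<Rightarrow> ('i \<Rightarrow> real) \<Rightarrow> 'i set \<Rightarrow> ('i \<Rightarrow> 'd pt)
    \<Rightarrow> ('i \<times> 'i \<Rightarrow> real) \<Rightarrow> ('i \<times> 'i) set" where
  "gedges \<phi> \<rho> I Z u = {(i, j). i \<in> I \<and> j \<in> I \<and> lex_less (Z i) (Z j) \<and>
      u (i, i) \<le> \<rho> i \<and> u (j, j) \<le> \<rho> j \<and> u (i, j) \<le> \<phi> (Z j - Z i)}"

definition icomp :: "(('d::{finite,linorder}) pt \<Rightarrow> real) \<Rightarrow> ('i \<Rightarrow> real) \<Rightarrow> 'i set \<Rightarrow> ('i \<Rightarrow> 'd pt)
    \<Rightarrow> ('i \<times> 'i \<Rightarrow> real) \<Rightarrow> 'i \<Rightarrow> 'i set" where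
  "icomp \<phi> \<rho> I Z u r = (gedges \<phi> \<rho> I Z u \<union> (gedges \<phi> \<rho> I Z u)\<inverse>)\<^sup>* `` {r}"

lemma icomp_subset: "r \<in> I \<Longrightarrow> icomp \<phi> \<rho> I Z u r \<subseteq> I"
proof
  fix j assume "r \<in> I" "j \<in> icomp \<phi> \<rho> I Z u r"
  then have "(r, j) \<in> (gedges \<phi> \<rho> I Z u \<union> (gedges \<phi> \<rho> I Z u)\<inverse>)\<^sup>*" by (simp add: icomp_def)
  then show "j \<in> I" using \<open>r \<in> I\<close> by (induction rule: rtrancl_induct) (auto simp: gedges_def)
qed

lemma icomp_root [simp]: "r \<in> icomp \<phi> \<rho> I Z u r"
  by (simp add: icomp_def)

lemma icomp_mono:
  assumes "\<And>i. \<rho> i \<le> \<rho>' i" "I \<subseteq> I'"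
  shows "icomp \<phi> \<rho> I Z u r \<subseteq> icomp \<phi> \<rho>' I' Z u r"
proof -
  have "gedges \<phi> \<rho> I Z u \<subseteq> gedges \<phi> \<rho>' I' Z u"
    using assms by (auto simp: gedges_def intro: order_trans)
  then show ?thesis unfolding icomp_def by (intro Image_mono rtrancl_mono) auto
qed

definition openpairs :: "(('d::{finite,linorder}) pt \<Rightarrow> real) \<Rightarrow> 'i set \<Rightarrow> ('i \<Rightarrow> 'd pt)
    \<Rightarrow> ('i \<times> 'i \<Rightarrow> real) \<Rightarrow> ('i \<times> 'i) set" where
  "openpairs \<phi> S Z u = {p \<in> lexpairs S Z. u p \<le> pairw \<phi> Z p}"

text \<open>Only the diagonal mark of \<open>w\<close> and the marks of pairs joining
  \<open>w\<close> to \<open>S\<close> enter, so these events are independent for different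
  \<open>w\<close> outside \<open>S\<close>.\<close>

definition sep :: "(('d::{finite,linorder}) pt \<Rightarrow> real) \<Rightarrow> ('i \<Rightarrow> real) \<Rightarrow> 'i set \<Rightarrow> ('i \<Rightarrow> 'd pt)
    \<Rightarrow> ('i \<times> 'i \<Rightarrow> real) \<Rightarrow> 'i \<Rightarrow> bool" where
  "sep \<phi> \<rho> S Z u w \<longleftrightarrow> \<not> (u (w, w) \<le> \<rho> w \<and> (\<exists>v\<in>S.
      lex_less (Z v) (Z w) \<and> u (v, w) \<le> \<phi> (Z w - Z v) \<or> lex_less (Z w) (Z v) \<and> u (w, v) \<le> \<phi> (Z v - Z w)))"

text \<open>A component equals \<open>S\<close> when \<open>S\<close> is connected by its own edges
  and no edge leaves it; the two requirements involve disjoint sets of marks. Assumption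
  \<open>k\<close> excludes a root that is thinned out: its component would be \<open>{r}\<close>
  while the condition on the diagonal marks fails.\<close>

lemma icomp_eq_iff:
  assumes r: "r \<in> S" "S \<subseteq> I" and k: "u (r, r) \<le> \<rho> r"
  shows "icomp \<phi> \<rho> I Z u r = S \<longleftrightarrow>
    (\<forall>i\<in>S. u (i, i) \<le> \<rho> i) \<and> conn_from r S (openpairs \<phi> S Z u) \<and> (\<forall>w\<in>I - S. sep \<phi> \<rho> S Z u w)"
    (is "_ \<longleftrightarrow> ?R")
proof
  let ?G = "gedges \<phi> \<rho> I Z u"
  assume c: "icomp \<phi> \<rho> I Z u r = S"
  have kept: "u (i, i) \<le> \<rho> i" if "i \<in> S" for i
  proof -
    have "(r, i) \<in> (?G \<union> ?G\<inverse>)\<^sup>*" using that c by (auto simp: icomp_def)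
    then show ?thesis by (cases rule: rtranclE) (use k in \<open>auto simp: gedges_def\<close>)
  qed
  have "conn_from r S (openpairs \<phi> S Z u)"
    unfolding conn_from_def
  proof
    fix j assume "j \<in> S"
    then have "(r, j) \<in> (?G \<union> ?G\<inverse>)\<^sup>*" using c by (auto simp: icomp_def)
    then show "(r, j) \<in> (openpairs \<phi> S Z u \<union> (openpairs \<phi> S Z u)\<inverse>)\<^sup>*"
    proof (induction rule: rtrancl_induct)
      case (step i j)
      have "i \<in> S" using step.hyps(1) c by (auto simp: icomp_def)
      moreover have "j \<in> S" using rtrancl_into_rtrancl[OF step.hyps] c by (auto simp: icomp_def)
      ultimately have "(i, j) \<in> openpairs \<phi> S Z u \<union> (openpairs \<phi> S Z u)\<inverse>"
        using step.hyps(2) by (auto simp: gedges_def openpairs_def lexpairs_def pairw_def)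
      with step.IH show ?case by (rule rtrancl_into_rtrancl)
    qed simp
  qed
  moreover have "sep \<phi> \<rho> S Z u w" if w: "w \<in> I - S" for w
  proof (rule ccontr)
    assume "\<not> sep \<phi> \<rho> S Z u w"
    then obtain v where v: "v \<in> S" "(v, w) \<in> ?G \<union> ?G\<inverse>"
      using w r kept by (auto simp: sep_def gedges_def)
    then have "(r, v) \<in> (?G \<union> ?G\<inverse>)\<^sup>*" using c by (auto simp: icomp_def)
    from rtrancl_into_rtrancl[OF this v(2)] have "w \<in> S" using c by (auto simp: icomp_def)
    with w show False by simp
  qed
  ultimately show ?R using kept by blast
next
  let ?G = "gedges \<phi> \<rho> I Z u"
  assume R: ?R
  show "icomp \<phi> \<rho> I Z u r = S"
  proof (intro equalityI subsetI)
    fix j assume "j \<in> S"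
    then have "(r, j) \<in> (openpairs \<phi> S Z u \<union> (openpairs \<phi> S Z u)\<inverse>)\<^sup>*"
      using R by (auto simp: conn_from_def)
    moreover have "openpairs \<phi> S Z u \<subseteq> ?G"
      using R r by (auto simp: openpairs_def lexpairs_def gedges_def pairw_def)
    ultimately show "j \<in> icomp \<phi> \<rho> I Z u r"
      unfolding icomp_def using rtrancl_mono[of "openpairs \<phi> S Z u \<union> (openpairs \<phi> S Z u)\<inverse>" "?G \<union> ?G\<inverse>"] by blast
  next
    fix j assume "j \<in> icomp \<phi> \<rho> I Z u r"
    then have "(r, j) \<in> (?G \<union> ?G\<inverse>)\<^sup>*" by (simp add: icomp_def)
    then show "j \<in> S"
    proof (induction rule: rtrancl_induct)
      case (step i j)
      show ?case
      proof (rule ccontr)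
        assume "j \<notin> S"
        then have "sep \<phi> \<rho> S Z u j" using R step.hyps(2) by (auto simp: gedges_def)
        then show False using step by (auto simp: sep_def gedges_def)
      qed
    qed (use r in simp)
  qed
qed

text \<open>The weight depends on positions only, and an injective relabelling carries edge sets to
  edge sets. This is the passage between indexed families and plain sets of points.\<close>

lemma connw_image:
  assumes inj: "inj_on Z S" and r: "r \<in> S"
  shows "connw \<phi> (Z ` S) id (Z r) = connw \<phi> S Z r"
proof -
  let ?m = "map_prod Z Z"
  have inj': "inj_on ?m (S \<times> S)" using inj by (intro map_prod_inj_on)
  have lp: "lexpairs (Z ` S) id = ?m ` lexpairs S Z" by (force simp: lexpairs_def)
  have sub: "lexpairs S Z \<subseteq> S \<times> S" by (auto simp: lexpairs_def)
  have injl: "inj_on ?m E" if "E \<subseteq> lexpairs S Z" for E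
    using inj' sub that by (blast intro: inj_on_subset)
  have conn: "conn_from (Z r) (Z ` S) (?m ` E) \<longleftrightarrow> conn_from r S E" if E: "E \<subseteq> lexpairs S Z" for E
  proof
    assume "conn_from r S E"
    have "(Z i, Z j) \<in> (?m ` E \<union> (?m ` E)\<inverse>)\<^sup>*" if "(i, j) \<in> (E \<union> E\<inverse>)\<^sup>*" for i j
      using that
    proof (induction rule: rtrancl_induct)
      case (step j k)
      then have "(Z j, Z k) \<in> ?m ` E \<union> (?m ` E)\<inverse>" by force
      with step.IH show ?case by (rule rtrancl_into_rtrancl)
    qed simp
    with \<open>conn_from r S E\<close> show "conn_from (Z r) (Z ` S) (?m ` E)" by (auto simp: conn_from_def)
  next
    assume c: "conn_from (Z r) (Z ` S) (?m ` E)"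
    have "\<exists>j\<in>S. y = Z j \<and> (r, j) \<in> (E \<union> E\<inverse>)\<^sup>*" if "(Z r, y) \<in> (?m ` E \<union> (?m ` E)\<inverse>)\<^sup>*" for y
      using that
    proof (induction rule: rtrancl_induct)
      case base
      then show ?case using r by auto
    next
      case (step y y')
      then obtain j where j: "j \<in> S" "y = Z j" "(r, j) \<in> (E \<union> E\<inverse>)\<^sup>*" by blast
      from step.hyps(2) obtain a b where ab: "(a, b) \<in> E \<union> E\<inverse>" "y = Z a" "y' = Z b" by auto
      then have "a \<in> S" "b \<in> S" using E sub by auto
      then have "a = j" using ab j inj by (auto dest: inj_onD)
      then have "(r, b) \<in> (E \<union> E\<inverse>)\<^sup>*" using j(3) ab(1) by (auto intro: rtrancl_into_rtrancl)
      then show ?case using ab \<open>b \<in> S\<close> by blast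
    qed
    then show "conn_from r S E"
      using c inj unfolding conn_from_def by (metis imageI inj_onD)
  qed
  let ?A = "{E \<in> Pow (lexpairs S Z). conn_from r S E}"
  have set_eq: "{E \<in> Pow (lexpairs (Z ` S) id). conn_from (Z r) (Z ` S) E} = (\<lambda>E. ?m ` E) ` ?A"
  proof (intro equalityI subsetI)
    fix E' assume E': "E' \<in> {E \<in> Pow (lexpairs (Z ` S) id). conn_from (Z r) (Z ` S) E}"
    then obtain E where "E \<subseteq> lexpairs S Z" "E' = ?m ` E" unfolding lp by (auto simp: subset_image_iff)
    then show "E' \<in> (\<lambda>E. ?m ` E) ` ?A" using E' conn by auto
  next
    fix E' assume "E' \<in> (\<lambda>E. ?m ` E) ` ?A"
    then obtain E where "E \<subseteq> lexpairs S Z" "E' = ?m ` E" "conn_from r S E" by auto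
    then show "E' \<in> {E \<in> Pow (lexpairs (Z ` S) id). conn_from (Z r) (Z ` S) E}"
      unfolding lp using conn by auto
  qed
  have injA: "inj_on (\<lambda>E. ?m ` E) ?A"
    using injl[OF order_refl] by (auto intro!: inj_onI dest: inj_on_image_eq_iff)
  have "connw \<phi> (Z ` S) id (Z r) = (\<Sum>E\<in>?A. (\<Prod>p\<in>?m ` E. pairw \<phi> id p) *
       (\<Prod>p\<in>?m ` lexpairs S Z - ?m ` E. 1 - pairw \<phi> id p))"
    unfolding connw_def set_eq unfolding lp by (subst sum.reindex[OF injA]) simp
  also have "\<dots> = connw \<phi> S Z r"
    unfolding connw_def
  proof (intro sum.cong refl)
    fix E assume "E \<in> ?A"
    then have E: "E \<subseteq> lexpairs S Z" by auto
    have "?m ` lexpairs S Z - ?m ` E = ?m ` (lexpairs S Z - E)"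
      using injl[OF order_refl] E by (intro inj_on_image_set_diff[symmetric]) auto
    then show "(\<Prod>p\<in>?m ` E. pairw \<phi> id p) * (\<Prod>p\<in>?m ` lexpairs S Z - ?m ` E. 1 - pairw \<phi> id p) =
      (\<Prod>p\<in>E. pairw \<phi> Z p) * (\<Prod>p\<in>lexpairs S Z - E. 1 - pairw \<phi> Z p)"
      using injl[OF E] injl[of "lexpairs S Z - E"] by (simp add: prod.reindex pairw_def)
  qed
  finally show ?thesis .
qed

lemma connw_translate: "connw \<phi> ((+) a ` S) id (a + r) = connw \<phi> S id r" if "r \<in> S"
proof -
  have "connw \<phi> ((+) a ` S) id ((+) a r) = connw \<phi> S ((+) a) r"
    using that by (intro connw_image) auto
  also have "\<dots> = connw \<phi> S id r"
    by (simp add: connw_def lexpairs_def pairw_def)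
  finally show ?thesis .
qed

lemma finite_lexpairs [simp]: "finite S \<Longrightarrow> finite (lexpairs S Z)"
  by (rule finite_subset[of _ "S \<times> S"]) (auto simp: lexpairs_def)

lemma connw_nonneg:
  assumes "\<And>y. 0 \<le> \<phi> y \<and> \<phi> y \<le> 1"
  shows "0 \<le> connw \<phi> S Z r"
  unfolding connw_def using assms by (intro sum_nonneg mult_nonneg_nonneg prod_nonneg) (auto simp: pairw_def)

lemma connw_measurable:
  assumes S: "finite S" and [measurable]: "\<phi> \<in> borel_measurable borel"
    and [measurable]: "\<And>i. i \<in> S \<Longrightarrow> Z i \<in> borel_measurable M"
  shows "(\<lambda>x. connw \<phi> S (\<lambda>i. Z i x) r) \<in> borel_measurable M"
proof -
  \<comment> \<open>The set of lexicographic pairs varies with the positions. Summing over all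
    \<open>E \<subseteq> S \<times> S\<close> and writing the order as a case distinction gives a
    fixed finite sum.\<close>
  have eq: "connw \<phi> S z r = (\<Sum>E\<in>{E \<in> Pow (S \<times> S). conn_from r S E}.
     (if \<forall>p\<in>E. lex_less (z (fst p)) (z (snd p)) then
       \<Prod>p\<in>S \<times> S. if p \<in> E then pairw \<phi> z p else if lex_less (z (fst p)) (z (snd p)) then 1 - pairw \<phi> z p else 1
      else 0))" for z
  proof -
    have a: "{E \<in> Pow (lexpairs S z). conn_from r S E} = {E \<in> {E \<in> Pow (S \<times> S). conn_from r S E}. \<forall>p\<in>E. lex_less (z (fst p)) (z (snd p))}"
      by (auto simp: lexpairs_def)
    have b: "(\<Prod>p\<in>E. pairw \<phi> z p) * (\<Prod>p\<in>lexpairs S z - E. 1 - pairw \<phi> z p) =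
      (\<Prod>p\<in>S \<times> S. if p \<in> E then pairw \<phi> z p else if lex_less (z (fst p)) (z (snd p)) then 1 - pairw \<phi> z p else 1)"
      if E: "E \<subseteq> S \<times> S" "\<forall>p\<in>E. lex_less (z (fst p)) (z (snd p))" for E
    proof -
      have E': "E \<subseteq> lexpairs S z" using E by (auto simp: lexpairs_def)
      have fl: "finite (lexpairs S z)" using S by simp
      have "(\<Prod>p\<in>S \<times> S. if p \<in> E then pairw \<phi> z p else if lex_less (z (fst p)) (z (snd p)) then 1 - pairw \<phi> z p else 1)
        = (\<Prod>p\<in>lexpairs S z. if p \<in> E then pairw \<phi> z p else 1 - pairw \<phi> z p)"
        using S E by (intro prod.mono_neutral_cong_right) (auto simp: lexpairs_def)
      also have "\<dots> = (\<Prod>p\<in>E. pairw \<phi> z p) * (\<Prod>p\<in>lexpairs S z - E. 1 - pairw \<phi> z p)"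
        by (subst prod.subset_diff[OF E' fl]) (auto simp: mult.commute intro!: arg_cong2[where f="(*)"] prod.cong)
      finally show ?thesis ..
    qed
    show ?thesis
      unfolding connw_def a using S
      by (subst sum.inter_filter) (auto intro!: sum.cong simp: b finite_subset)
  qed
  have [measurable]: "(\<lambda>x. pairw \<phi> (\<lambda>i. Z i x) p) \<in> borel_measurable M" if "p \<in> S \<times> S" for p
    unfolding pairw_def using that by (intro measurable_compose[OF borel_measurable_diff \<open>\<phi> \<in> _\<close>]) auto
  have "Measurable.pred M (\<lambda>x. lex_less (Z (fst p) x) (Z (snd p) x))" if "p \<in> S \<times> S" for p
    using that by (intro lex_less_pred) auto
  note this [measurable]
  have [measurable]: "Measurable.pred M (\<lambda>x. \<forall>p\<in>E. lex_less (Z (fst p) x) (Z (snd p) x))" if "E \<subseteq> S \<times> S" for E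
    using S that by (intro pred_intros_finite) (auto intro: finite_subset)
  show ?thesis
    unfolding eq using S by (intro borel_measurable_sum measurable_If borel_measurable_prod) auto
qed

text \<open>The probability that a point at \<open>w\<close> has no edge to \<open>S\<close>.\<close>

definition nh :: "('a::real_vector \<Rightarrow> real) \<Rightarrow> 'a set \<Rightarrow> 'a \<Rightarrow> real" where
  "nh \<phi> S w = (\<Prod>v\<in>S. 1 - \<phi> (w - v))"

text \<open>Reachability is a countable union over path lengths and intermediate vertices.\<close>

lemma pred_rtrancl:
  fixes R :: "'m \<Rightarrow> ('i::countable \<times> 'i) set"
  assumes "\<And>i j. Measurable.pred M (\<lambda>x. (i, j) \<in> R x)"
  shows "Measurable.pred M (\<lambda>x. (i, j) \<in> (R x)\<^sup>*)"
proof -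
  have "Measurable.pred M (\<lambda>x. (i, j) \<in> R x ^^ n)" for n
  proof (induction n arbitrary: j)
    case (Suc n)
    have eq: "(\<lambda>x. (i, j) \<in> R x ^^ Suc n) = (\<lambda>x. \<exists>k. (i, k) \<in> R x ^^ n \<and> (k, j) \<in> R x)"
      by auto
    show ?case unfolding eq using Suc assms by (intro pred_intros_countable pred_intros_logic)
  qed simp
  then show ?thesis unfolding rtrancl_power by (intro pred_intros_countable)
qed

lemma pred_icomp:
  fixes Z :: "'i::countable \<Rightarrow> 'm \<Rightarrow> ('d::{finite,linorder}) pt"
  assumes [measurable]: "\<phi> \<in> borel_measurable borel"
    and Z: "\<And>i. i \<in> I \<Longrightarrow> Z i \<in> borel_measurable M" and [measurable]: "\<And>p. U p \<in> borel_measurable M"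
  shows "Measurable.pred M (\<lambda>x. j \<in> icomp \<phi> \<rho> I (\<lambda>i. Z i x) (\<lambda>p. U p x) r)"
proof -
  have ge: "Measurable.pred M (\<lambda>x. (i, j) \<in> gedges \<phi> \<rho> I (\<lambda>i. Z i x) (\<lambda>p. U p x))" for i j
  proof (cases "i \<in> I \<and> j \<in> I")
    case True
    then have [measurable]: "Z i \<in> borel_measurable M" "Z j \<in> borel_measurable M" using Z by auto
    show ?thesis using True unfolding gedges_def by simp
  qed (auto simp: gedges_def)
  show ?thesis
    unfolding icomp_def Image_singleton mem_Collect_eq
    by (rule pred_rtrancl) (use ge in simp)
qed

lemma pred_icomp_eq:
  fixes Z :: "'i::countable \<Rightarrow> 'm \<Rightarrow> ('d::{finite,linorder}) pt"
  assumes "\<phi> \<in> borel_measurable borel"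
    and "\<And>i. i \<in> I \<Longrightarrow> Z i \<in> borel_measurable M" and "\<And>p. U p \<in> borel_measurable M"
  shows "Measurable.pred M (\<lambda>x. icomp \<phi> \<rho> I (\<lambda>i. Z i x) (\<lambda>p. U p x) r = S)"
proof -
  have eq: "(\<lambda>x. icomp \<phi> \<rho> I (\<lambda>i. Z i x) (\<lambda>p. U p x) r = S) =
    (\<lambda>x. \<forall>j. j \<in> icomp \<phi> \<rho> I (\<lambda>i. Z i x) (\<lambda>p. U p x) r \<longleftrightarrow> j \<in> S)" by (auto simp: set_eq_iff)
  show ?thesis unfolding eq using pred_icomp[OF assms] by (intro pred_intros_countable pred_intros_logic) auto
qed

section \<open>The law of a component for fixed positions and random marks\<close>

locale marks = prob_space Q for Q :: "'q measure" +
  fixes U :: "'i::countable \<times> 'i \<Rightarrow> 'q \<Rightarrow> real" and \<phi> :: "('d::{finite,linorder}) pt \<Rightarrow> real" and \<rho> :: "'i \<Rightarrow> real"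
  assumes U_indep: "indep_vars (\<lambda>_. borel) U UNIV"
    and U_unif: "\<And>p. distr Q borel (U p) = uniform_measure lborel {0..1}"
    and \<phi>_meas [measurable]: "\<phi> \<in> borel_measurable borel"
    and \<phi>01: "\<And>y. 0 \<le> \<phi> y \<and> \<phi> y \<le> 1" and \<phi>_sym: "\<And>y. \<phi> (- y) = \<phi> y"
    and \<rho>01: "\<And>i. 0 \<le> \<rho> i \<and> \<rho> i \<le> 1"
begin

lemma U_meas [measurable]: "U p \<in> borel_measurable Q"
  using U_indep by (cases p) (auto simp: indep_vars_def2)

lemma prob_U:
  assumes c: "0 \<le> c" "c \<le> 1"
  shows "prob {\<omega>\<in>space Q. U p \<omega> \<le> c} = c" and "prob {\<omega>\<in>space Q. U p \<omega> > c} = 1 - c"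
proof -
  have "prob {\<omega>\<in>space Q. U p \<omega> \<le> c} = measure (distr Q borel (U p)) {..c}"
    by (subst measure_distr) (auto intro!: arg_cong[where f = prob])
  also have "\<dots> = measure (uniform_measure lborel {0..1}) {..c}" by (simp add: U_unif)
  also have "\<dots> = measure lborel ({0..1} \<inter> {..c}) / measure lborel {0..1::real}"
    by (subst measure_uniform_measure) auto
  also have "{0..1} \<inter> {..c} = {0..c}" using c by auto
  finally show 1: "prob {\<omega>\<in>space Q. U p \<omega> \<le> c} = c" using c by simp
  have "{\<omega>\<in>space Q. U p \<omega> > c} = space Q - {\<omega>\<in>space Q. U p \<omega> \<le> c}" by auto
  then show "prob {\<omega>\<in>space Q. U p \<omega> > c} = 1 - c" using 1 by (simp add: prob_compl)
qed

lemma AE_U01: "AE \<omega> in Q. \<forall>p. 0 < U p \<omega> \<and> U p \<omega> \<le> 1"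
proof (subst AE_all_countable, rule allI)
  fix p
  have "AE \<omega> in Q. U p \<omega> \<in> {\<omega>. 0 < \<omega>} "
    using prob_U(2)[of 0 p] by (subst prob_Collect_eq_1[symmetric]) auto
  moreover have "AE \<omega> in Q. U p \<omega> \<le> 1"
    using prob_U(1)[of 1 p] by (subst prob_Collect_eq_1[symmetric]) auto
  ultimately show "AE \<omega> in Q. 0 < U p \<omega> \<and> U p \<omega> \<le> 1" by eventually_elim auto
qed

lemma sep_pred [measurable]: "Measurable.pred (Pi\<^sub>M K (\<lambda>_. borel)) (\<lambda>f. sep \<phi> \<rho> S Z f w)"
  if "finite S" "(w, w) \<in> K" "\<And>v. v \<in> S \<Longrightarrow> (v, w) \<in> K \<and> (w, v) \<in> K"
proof -
  have [measurable]: "(\<lambda>f. f p) \<in> borel_measurable (Pi\<^sub>M K (\<lambda>_. borel :: real measure))" if "p \<in> K" for p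
    using that by (rule measurable_component_singleton)
  show ?thesis
    unfolding sep_def using that by (intro pred_intros_logic pred_intros_finite) measurable
qed

lemma sep_meas [measurable]: "finite S \<Longrightarrow> Measurable.pred Q (\<lambda>\<omega>. sep \<phi> \<rho> S Z (\<lambda>p. U p \<omega>) w)"
  unfolding sep_def by (intro pred_intros_logic pred_intros_finite) auto

text \<open>The complement is the event that \<open>w\<close> is retained minus the event that
  \<open>w\<close> is retained without an edge to \<open>S\<close>; the latter is an intersection of
  independent mark events.\<close>

lemma prob_sep:
  assumes S: "finite S" and w: "w \<notin> S" and inj: "inj_on Z (insert w S)"
  shows "prob {\<omega>\<in>space Q. sep \<phi> \<rho> S Z (\<lambda>p. U p \<omega>) w} = 1 - \<rho> w * (1 - (\<Prod>v\<in>S. 1 - \<phi> (Z w - Z v)))"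
proof -
  \<comment> \<open>\<open>q v\<close> is the orientation of the pair of \<open>v\<close> and
    \<open>w\<close> whose mark decides the edge, and \<open>vv\<close> recovers \<open>v\<close>
    from it.\<close>
  define q where "q v = (if lex_less (Z v) (Z w) then (v, w) else (w, v))" for v
  define vv where "vv p = (if fst p = w then snd p else fst p)" for p :: "'i \<times> 'i"
  let ?a = "\<lambda>v. \<phi> (Z w - Z v)"
  have vw: "v \<noteq> w" "Z v \<noteq> Z w" if "v \<in> S" for v
    using that w inj_onD[OF inj, of v w] by auto
  have qv: "vv (q v) = v" "q v \<noteq> (w, w)" if "v \<in> S" for v
    using vw[OF that] by (auto simp: q_def vv_def)
  have injq: "inj_on q S" by (rule inj_on_inverseI[of _ vv]) (rule qv)
  have flip: "\<phi> (Z v - Z w) = ?a v" for v using \<phi>_sym[of "Z v - Z w"] by simp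
  have open_iff: "(lex_less (Z v) (Z w) \<and> u (v, w) \<le> \<phi> (Z w - Z v) \<or> lex_less (Z w) (Z v) \<and> u (w, v) \<le> \<phi> (Z v - Z w))
      \<longleftrightarrow> u (q v) \<le> ?a v" if "v \<in> S" for v u
    using vw[OF that] lex_less_total[of "Z v" "Z w"] lex_less_asym[of "Z v" "Z w"] by (auto simp: q_def flip)
  define T where "T p = (if p = (w, w) then {..\<rho> w} else {?a (vv p)<..})" for p
  let ?J = "insert (w, w) (q ` S)"
  have fJ: "finite ?J" "(w, w) \<notin> q ` S" using S qv(2) by (auto, metis)
  let ?A = "{\<omega>\<in>space Q. U (w, w) \<omega> \<le> \<rho> w}"
  let ?AB = "{\<omega>\<in>space Q. U (w, w) \<omega> \<le> \<rho> w \<and> (\<forall>v\<in>S. U (q v) \<omega> > ?a v)}"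
  have "prob ?AB = prob (\<Inter>p\<in>?J. U p -` T p \<inter> space Q)"
    using qv by (intro arg_cong[where f = prob]) (auto simp: T_def)
  also have "\<dots> = (\<Prod>p\<in>?J. prob (U p -` T p \<inter> space Q))"
    using fJ by (intro indep_varsD[OF U_indep]) (auto simp: T_def)
  also have "\<dots> = prob (U (w, w) -` T (w, w) \<inter> space Q) * (\<Prod>v\<in>S. prob (U (q v) -` T (q v) \<inter> space Q))"
    using fJ injq S by (simp add: prod.reindex)
  also have "prob (U (w, w) -` T (w, w) \<inter> space Q) = \<rho> w"
    using prob_U(1)[of "\<rho> w" "(w, w)"] \<rho>01 by (simp add: T_def vimage_def Int_def conj_commute)
  also have "(\<Prod>v\<in>S. prob (U (q v) -` T (q v) \<inter> space Q)) = (\<Prod>v\<in>S. 1 - ?a v)"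
  proof (intro prod.cong refl)
    fix v assume v: "v \<in> S"
    have "U (q v) -` T (q v) \<inter> space Q = {\<omega>\<in>space Q. U (q v) \<omega> > ?a v}"
      using qv[OF v] by (auto simp: T_def)
    then show "prob (U (q v) -` T (q v) \<inter> space Q) = 1 - ?a v"
      using prob_U(2)[of "?a v" "q v"] \<phi>01 by simp
  qed
  finally have AB: "prob ?AB = \<rho> w * (\<Prod>v\<in>S. 1 - ?a v)" .
  have "{\<omega>\<in>space Q. sep \<phi> \<rho> S Z (\<lambda>p. U p \<omega>) w} = space Q - (?A - ?AB)"
  proof -
    have "sep \<phi> \<rho> S Z u w \<longleftrightarrow> \<not> (u (w, w) \<le> \<rho> w \<and> (\<exists>v\<in>S. u (q v) \<le> ?a v))" for u
      unfolding sep_def using open_iff by (metis (no_types, lifting))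
    then show ?thesis by (auto simp: not_le)
  qed
  then have "prob {\<omega>\<in>space Q. sep \<phi> \<rho> S Z (\<lambda>p. U p \<omega>) w} = prob (space Q - (?A - ?AB))"
    by simp
  also have "\<dots> = 1 - prob (?A - ?AB)"
    using S by (intro prob_compl) measurable
  also have "prob (?A - ?AB) = prob ?A - prob ?AB"
    using S by (intro finite_measure_Diff) (auto intro!: measurable)
  also have "prob ?A = \<rho> w" using \<rho>01 by (intro prob_U) auto
  finally show ?thesis using AB by (simp add: algebra_simps)
qed

text \<open>Sum over the set \<open>E\<close> of open pairs inside \<open>S\<close>. For given
  \<open>E\<close> the event prescribes every mark inside \<open>S \<times> S\<close> separately
  and, for each \<open>w\<close>, the marks touching \<open>w\<close>; these blocks are disjoint and
  hence independent.\<close>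

lemma prob_component_window:
  assumes S: "finite S" and W: "finite W" and SW: "S \<inter> W = {}" and inj: "inj_on Z (S \<union> W)" and r: "r \<in> S"
  shows "prob {\<omega>\<in>space Q. (\<forall>i\<in>S. U (i, i) \<omega> \<le> \<rho> i) \<and> conn_from r S (openpairs \<phi> S Z (\<lambda>p. U p \<omega>)) \<and>
       (\<forall>w\<in>W. sep \<phi> \<rho> S Z (\<lambda>p. U p \<omega>) w)} =
     (\<Prod>i\<in>S. \<rho> i) * connw \<phi> S Z r * (\<Prod>w\<in>W. 1 - \<rho> w * (1 - (\<Prod>v\<in>S. 1 - \<phi> (Z w - Z v))))"
proof -
  \<comment> \<open>The blocks of marks: a singleton for each pair inside \<open>S\<close>, and for
    \<open>(w, w)\<close> the diagonal mark together with all marks joining \<open>w\<close> to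
    \<open>S\<close>. \<open>L\<close> lists the blocks.\<close>
  define K where "K p = (if p \<in> S \<times> S then {p} else
      insert p ((\<lambda>v. (v, fst p)) ` S \<union> (\<lambda>v. (fst p, v)) ` S))" for p
  define L where "L = S \<times> S \<union> (\<lambda>w. (w, w)) ` W"
  have fL: "finite L" "L \<noteq> {}" using S W r by (auto simp: L_def)
  have dL: "S \<times> S \<inter> (\<lambda>w. (w, w)) ` W = {}" using SW by auto
  have KW: "K (w, w) = insert (w, w) ((\<lambda>v. (v, w)) ` S \<union> (\<lambda>v. (w, v)) ` S)" if "w \<in> W" for w
    using that SW by (auto simp: K_def)
  have disj: "disjoint_family_on K L"
    unfolding disjoint_family_on_def L_def
  proof (intro ballI impI)
    fix p p' assume "p \<in> S \<times> S \<union> (\<lambda>w. (w, w)) ` W" "p' \<in> S \<times> S \<union> (\<lambda>w. (w, w)) ` W" "p \<noteq> p'"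
    then show "K p \<inter> K p' = {}"
      using SW by (auto simp: K_def)
  qed
  have ind: "indep_vars (\<lambda>p. Pi\<^sub>M (K p) (\<lambda>_. borel)) (\<lambda>p \<omega>. restrict (\<lambda>q. U q \<omega>) (K p)) L"
    by (rule indep_vars_restrict[OF U_indep _ disj]) auto
  \<comment> \<open>Diagonal pairs decide retention and lexicographic pairs decide membership in
    \<open>E\<close>; the opposite orientation is left unconstrained.\<close>
  define cond where "cond E p x \<longleftrightarrow> (fst p = snd p \<longrightarrow> x \<le> \<rho> (fst p)) \<and>
      (p \<in> lexpairs S Z \<longrightarrow> (p \<in> E \<longleftrightarrow> x \<le> pairw \<phi> Z p))" for E p and x :: real
  define T where "T E p = (if p \<in> S \<times> S then {f \<in> space (Pi\<^sub>M (K p) (\<lambda>_. borel)). cond E p (f p)}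
      else {f \<in> space (Pi\<^sub>M (K p) (\<lambda>_. borel)). sep \<phi> \<rho> S Z f (fst p)})" for E p
  have T_sets: "T E p \<in> sets (Pi\<^sub>M (K p) (\<lambda>_. borel))" if p: "p \<in> L" for E p
  proof (cases "p \<in> S \<times> S")
    case True
    have [measurable]: "(\<lambda>f. f p) \<in> borel_measurable (Pi\<^sub>M (K p) (\<lambda>_. borel :: real measure))"
      by (rule measurable_component_singleton) (simp add: K_def)
    show ?thesis using True unfolding T_def cond_def by (simp, measurable)
  next
    case False
    then obtain w where w: "w \<in> W" "p = (w, w)" using p by (auto simp: L_def)
    have "Measurable.pred (Pi\<^sub>M (K p) (\<lambda>_. borel)) (\<lambda>f. sep \<phi> \<rho> S Z f w)"
      using S w KW by (intro sep_pred) auto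
    then show ?thesis using False w unfolding T_def by (simp add: pred_def)
  qed
  define AE' where "AE' E = (\<Inter>p\<in>L. (\<lambda>\<omega>. restrict (\<lambda>q. U q \<omega>) (K p)) -` T E p \<inter> space Q)" for E
  have ev_S: "(\<lambda>\<omega>. restrict (\<lambda>q. U q \<omega>) (K p)) -` T E p \<inter> space Q = {\<omega>\<in>space Q. cond E p (U p \<omega>)}"
    if "p \<in> S \<times> S" for E p
    using that by (auto simp: T_def K_def space_PiM)
  have ev_W: "(\<lambda>\<omega>. restrict (\<lambda>q. U q \<omega>) (K (w, w))) -` T E (w, w) \<inter> space Q = {\<omega>\<in>space Q. sep \<phi> \<rho> S Z (\<lambda>p. U p \<omega>) w}"
    if w: "w \<in> W" for E w
  proof -
    have "sep \<phi> \<rho> S Z (restrict u (K (w, w))) w \<longleftrightarrow> sep \<phi> \<rho> S Z u w" for u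
      unfolding sep_def KW[OF w] by auto
    then show ?thesis using w SW by (auto simp: T_def space_PiM)
  qed
  have AE'_eq: "AE' E = {\<omega>\<in>space Q. (\<forall>p\<in>S \<times> S. cond E p (U p \<omega>)) \<and> (\<forall>w\<in>W. sep \<phi> \<rho> S Z (\<lambda>p. U p \<omega>) w)}" for E
  proof -
    have "AE' E = (\<Inter>p\<in>S \<times> S. {\<omega>\<in>space Q. cond E p (U p \<omega>)}) \<inter> (\<Inter>w\<in>W. {\<omega>\<in>space Q. sep \<phi> \<rho> S Z (\<lambda>p. U p \<omega>) w})"
    proof -
      have un: "(\<Inter>p\<in>A \<union> f ` B. e p) = (\<Inter>p\<in>A. e p) \<inter> (\<Inter>w\<in>B. e (f w))" for A B f and e :: "'i \<times> 'i \<Rightarrow> 'q set"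
        by blast
      show ?thesis
        unfolding AE'_def L_def un by (intro arg_cong2[where f = "(\<inter>)"] INF_cong refl ev_S ev_W)
    qed
    then show ?thesis using r by auto
  qed
  define pr where "pr E p = (if fst p = snd p then \<rho> (fst p) else 1) *
      (if p \<in> lexpairs S Z then if p \<in> E then pairw \<phi> Z p else 1 - pairw \<phi> Z p else 1)" for E p
  have pairw01: "0 \<le> pairw \<phi> Z p" "pairw \<phi> Z p \<le> 1" for p using \<phi>01 by (auto simp: pairw_def)
  have prob_cond: "prob {\<omega>\<in>space Q. cond E p (U p \<omega>)} = pr E p" for E p
  proof -
    consider "fst p = snd p" | "fst p \<noteq> snd p" "p \<in> lexpairs S Z" "p \<in> E" | "fst p \<noteq> snd p" "p \<in> lexpairs S Z" "p \<notin> E"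
      | "fst p \<noteq> snd p" "p \<notin> lexpairs S Z" by blast
    then show ?thesis
    proof cases
      case 1
      then have "p \<notin> lexpairs S Z" by (auto simp: lexpairs_def)
      then show ?thesis using 1 prob_U(1)[of "\<rho> (fst p)" p] \<rho>01 by (simp add: cond_def pr_def)
    next
      case 2
      then show ?thesis using prob_U(1)[OF pairw01] by (simp add: cond_def pr_def)
    next
      case 3
      then show ?thesis using prob_U(2)[OF pairw01] by (simp add: cond_def pr_def not_le)
    next
      case 4
      then show ?thesis by (simp add: cond_def pr_def prob_space)
    qed
  qed
  let ?w = "\<Prod>w\<in>W. 1 - \<rho> w * (1 - (\<Prod>v\<in>S. 1 - \<phi> (Z w - Z v)))"
  have prob_AE': "prob (AE' E) = (\<Prod>i\<in>S. \<rho> i) * ((\<Prod>p\<in>E. pairw \<phi> Z p) * (\<Prod>p\<in>lexpairs S Z - E. 1 - pairw \<phi> Z p)) * ?w"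
    if E: "E \<subseteq> lexpairs S Z" for E
  proof -
    have "prob (AE' E) = (\<Prod>p\<in>L. prob ((\<lambda>\<omega>. restrict (\<lambda>q. U q \<omega>) (K p)) -` T E p \<inter> space Q))"
      unfolding AE'_def by (intro indep_varsD[OF ind] fL order_refl T_sets)
    also have "\<dots> = (\<Prod>p\<in>S \<times> S. prob ((\<lambda>\<omega>. restrict (\<lambda>q. U q \<omega>) (K p)) -` T E p \<inter> space Q)) *
        (\<Prod>w\<in>W. prob ((\<lambda>\<omega>. restrict (\<lambda>q. U q \<omega>) (K (w, w))) -` T E (w, w) \<inter> space Q))"
      unfolding L_def using S W dL by (subst prod.union_disjoint) (auto simp: prod.reindex inj_on_def)
    also have "(\<Prod>w\<in>W. prob ((\<lambda>\<omega>. restrict (\<lambda>q. U q \<omega>) (K (w, w))) -` T E (w, w) \<inter> space Q)) = ?w"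
    proof (intro prod.cong refl)
      fix w assume w: "w \<in> W"
      show "prob ((\<lambda>\<omega>. restrict (\<lambda>q. U q \<omega>) (K (w, w))) -` T E (w, w) \<inter> space Q) = 1 - \<rho> w * (1 - (\<Prod>v\<in>S. 1 - \<phi> (Z w - Z v)))"
        unfolding ev_W[OF w] using w SW S inj by (intro prob_sep inj_on_subset[OF inj]) auto
    qed
    also have "(\<Prod>p\<in>S \<times> S. prob ((\<lambda>\<omega>. restrict (\<lambda>q. U q \<omega>) (K p)) -` T E p \<inter> space Q)) = (\<Prod>p\<in>S \<times> S. pr E p)"
      by (intro prod.cong refl) (simp add: ev_S prob_cond)
    also have "\<dots> = (\<Prod>p\<in>S \<times> S. if fst p = snd p then \<rho> (fst p) else 1) *
      (\<Prod>p\<in>S \<times> S. if p \<in> lexpairs S Z then if p \<in> E then pairw \<phi> Z p else 1 - pairw \<phi> Z p else 1)"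
      unfolding pr_def by (rule prod.distrib)
    also have "(\<Prod>p\<in>S \<times> S. if fst p = snd p then \<rho> (fst p) else 1) = (\<Prod>p\<in>(\<lambda>i. (i, i)) ` S. \<rho> (fst p))"
      using S by (intro prod.mono_neutral_cong_right) auto
    also have "\<dots> = (\<Prod>i\<in>S. \<rho> i)" by (subst prod.reindex) (auto simp: inj_on_def)
    also have "(\<Prod>p\<in>S \<times> S. if p \<in> lexpairs S Z then if p \<in> E then pairw \<phi> Z p else 1 - pairw \<phi> Z p else 1) =
       (\<Prod>p\<in>lexpairs S Z. if p \<in> E then pairw \<phi> Z p else 1 - pairw \<phi> Z p)"
      using S by (intro prod.mono_neutral_cong_right) (auto simp: lexpairs_def)
    also have "\<dots> = (\<Prod>p\<in>E. pairw \<phi> Z p) * (\<Prod>p\<in>lexpairs S Z - E. 1 - pairw \<phi> Z p)"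
      using S by (subst prod.subset_diff[OF E]) (auto simp: mult.commute intro!: arg_cong2[where f="(*)"] prod.cong)
    finally show ?thesis .
  qed
  let ?C = "{E \<in> Pow (lexpairs S Z). conn_from r S E}"
  have fC: "finite ?C" using S by simp
  \<comment> \<open>The marks inside \<open>S\<close> determine the set of open pairs, which is why
    the events for different \<open>E\<close> are disjoint.\<close>
  have AE'_cond: "(\<forall>p\<in>S \<times> S. cond E p (u p)) \<longleftrightarrow> (\<forall>i\<in>S. u (i, i) \<le> \<rho> i) \<and> openpairs \<phi> S Z u = E"
    if "E \<subseteq> lexpairs S Z" for E u
  proof -
    have "lexpairs S Z \<subseteq> S \<times> S" by (auto simp: lexpairs_def)
    then show ?thesis using that by (auto simp: cond_def openpairs_def)
  qed
  have AE'_eq2: "AE' E = {\<omega>\<in>space Q. ((\<forall>i\<in>S. U (i, i) \<omega> \<le> \<rho> i) \<and>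
        openpairs \<phi> S Z (\<lambda>p. U p \<omega>) = E) \<and> (\<forall>w\<in>W. sep \<phi> \<rho> S Z (\<lambda>p. U p \<omega>) w)}"
    if "E \<subseteq> lexpairs S Z" for E
    unfolding AE'_eq by (simp only: AE'_cond[OF that])
  have "{\<omega>\<in>space Q. (\<forall>i\<in>S. U (i, i) \<omega> \<le> \<rho> i) \<and> conn_from r S (openpairs \<phi> S Z (\<lambda>p. U p \<omega>)) \<and>
       (\<forall>w\<in>W. sep \<phi> \<rho> S Z (\<lambda>p. U p \<omega>) w)} = (\<Union>E\<in>?C. AE' E)"
  proof -
    have "openpairs \<phi> S Z u \<subseteq> lexpairs S Z" for u by (auto simp: openpairs_def)
    moreover have "(\<Union>E\<in>?C. AE' E) = (\<Union>E\<in>?C. {\<omega>\<in>space Q. ((\<forall>i\<in>S. U (i, i) \<omega> \<le> \<rho> i) \<and>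
        openpairs \<phi> S Z (\<lambda>p. U p \<omega>) = E) \<and> (\<forall>w\<in>W. sep \<phi> \<rho> S Z (\<lambda>p. U p \<omega>) w)})"
      by (intro SUP_cong refl AE'_eq2) auto
    ultimately show ?thesis by auto
  qed
  then have "prob {\<omega>\<in>space Q. (\<forall>i\<in>S. U (i, i) \<omega> \<le> \<rho> i) \<and> conn_from r S (openpairs \<phi> S Z (\<lambda>p. U p \<omega>)) \<and>
       (\<forall>w\<in>W. sep \<phi> \<rho> S Z (\<lambda>p. U p \<omega>) w)} = prob (\<Union>E\<in>?C. AE' E)" by simp
  also have "\<dots> = (\<Sum>E\<in>?C. prob (AE' E))"
  proof (rule finite_measure_finite_Union[OF fC])
    show "AE' ` ?C \<subseteq> sets Q"
    proof
      fix A assume "A \<in> AE' ` ?C"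
      then obtain E where A: "A = AE' E" by auto
      have "(\<lambda>\<omega>. restrict (\<lambda>q. U q \<omega>) (K p)) -` T E p \<inter> space Q \<in> sets Q" if "p \<in> L" for p
        using T_sets[OF that] by (intro measurable_sets[where A = "Pi\<^sub>M (K p) (\<lambda>_. borel)"]) auto
      then show "A \<in> sets Q" unfolding A AE'_def using fL by (intro sets.finite_INT) auto
    qed
    show "disjoint_family_on AE' ?C"
      unfolding disjoint_family_on_def
    proof (intro ballI impI)
      fix E E' assume "E \<in> ?C" "E' \<in> ?C" "E \<noteq> E'"
      then show "AE' E \<inter> AE' E' = {}" by (auto simp: AE'_eq2)
    qed
  qed
  also have "\<dots> = (\<Sum>E\<in>?C. (\<Prod>i\<in>S. \<rho> i) * ((\<Prod>p\<in>E. pairw \<phi> Z p) * (\<Prod>p\<in>lexpairs S Z - E. 1 - pairw \<phi> Z p)) * ?w)"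
    by (intro sum.cong refl prob_AE') auto
  also have "\<dots> = (\<Prod>i\<in>S. \<rho> i) * connw \<phi> S Z r * ?w"
    unfolding connw_def by (simp add: sum_distrib_left sum_distrib_right)
  finally show ?thesis .
qed

end

context marks
begin

lemma nh_image: "inj_on Z S \<Longrightarrow> nh \<phi> (Z ` S) w = (\<Prod>v\<in>S. 1 - \<phi> (w - Z v))"
  unfolding nh_def by (simp add: prod.reindex)

lemma nh01: "0 \<le> nh \<phi> S w \<and> nh \<phi> S w \<le> 1"
  unfolding nh_def using \<phi>01 by (auto intro!: prod_nonneg prod_le_1)

text \<open>Finite windows \<open>W n\<close> exhaust the complement of \<open>S\<close>, and the
  window events decrease to the event in question, so its probability is the limit of the finite
  products.\<close>

lemma component_law:
  assumes S: "finite S" "r \<in> S" "S \<subseteq> I" and inj: "inj_on Z I" and \<rho>r: "\<rho> r = 1"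
    and W: "\<And>n. finite (W n)" "incseq W" "(\<Union>n. W n) = I - S"
  shows "emeasure Q {\<omega>\<in>space Q. icomp \<phi> \<rho> I Z (\<lambda>p. U p \<omega>) r = S} =
    ennreal ((\<Prod>i\<in>S. \<rho> i) * connw \<phi> S Z r) * (INF n. ennreal (\<Prod>w\<in>W n. 1 - \<rho> w * (1 - nh \<phi> (Z ` S) (Z w))))"
proof -
  let ?c = "(\<Prod>i\<in>S. \<rho> i) * connw \<phi> S Z r"
  define x where "x n = (\<Prod>w\<in>W n. 1 - \<rho> w * (1 - nh \<phi> (Z ` S) (Z w)))" for n
  have fac: "0 \<le> 1 - \<rho> w * (1 - nh \<phi> (Z ` S) (Z w)) \<and> 1 - \<rho> w * (1 - nh \<phi> (Z ` S) (Z w)) \<le> 1" for w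
  proof -
    have "\<rho> w * (1 - nh \<phi> (Z ` S) (Z w)) \<le> 1 * 1" using \<rho>01 nh01 by (intro mult_mono) auto
    moreover have "0 \<le> \<rho> w * (1 - nh \<phi> (Z ` S) (Z w))" using \<rho>01 nh01 by simp
    ultimately show ?thesis by simp
  qed
  have x0: "0 \<le> x n" for n unfolding x_def using fac by (intro prod_nonneg) auto
  have xdec: "x (Suc n) \<le> x n" for n
  proof -
    have "W n \<subseteq> W (Suc n)" using W(2) by (auto dest: incseq_SucD)
    then have "x (Suc n) = (\<Prod>w\<in>W (Suc n) - W n. 1 - \<rho> w * (1 - nh \<phi> (Z ` S) (Z w))) * x n"
      unfolding x_def using W(1) by (subst prod.subset_diff) auto
    also have "\<dots> \<le> 1 * x n"
      using fac x0 by (intro mult_right_mono prod_le_1) auto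
    finally show ?thesis by simp
  qed
  have c0: "0 \<le> ?c" using \<rho>01 \<phi>01 by (intro mult_nonneg_nonneg prod_nonneg connw_nonneg) auto
  define Ev where "Ev n = {\<omega>\<in>space Q. (\<forall>i\<in>S. U (i, i) \<omega> \<le> \<rho> i) \<and> conn_from r S (openpairs \<phi> S Z (\<lambda>p. U p \<omega>)) \<and>
       (\<forall>w\<in>W n. sep \<phi> \<rho> S Z (\<lambda>p. U p \<omega>) w)}" for n
  have conn_meas: "Measurable.pred Q (\<lambda>\<omega>. conn_from r S (openpairs \<phi> S Z (\<lambda>p. U p \<omega>)))"
  proof -
    have "Measurable.pred Q (\<lambda>\<omega>. (i, j) \<in> openpairs \<phi> S Z (\<lambda>p. U p \<omega>))" for i j
      unfolding openpairs_def by simp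
    then show ?thesis unfolding conn_from_def
      using S(1) by (intro pred_intros_finite pred_rtrancl) simp_all
  qed
  have Ev_sets: "Ev n \<in> sets Q" for n
    unfolding Ev_def using S(1) W(1)[of n] conn_meas
    by (intro sets.sets_Collect_conj sets.sets_Collect_finite_All) (auto simp: pred_def[symmetric] intro: sep_meas)
  have Ev_dec: "decseq Ev"
    unfolding Ev_def using W(2) by (intro decseq_SucI) (auto dest: incseq_SucD)
  have em: "emeasure Q (Ev n) = ennreal ?c * ennreal (x n)" for n
  proof -
    have Wn: "W n \<subseteq> I - S" using W(3) by auto
    have "prob (Ev n) = ?c * (\<Prod>w\<in>W n. 1 - \<rho> w * (1 - (\<Prod>v\<in>S. 1 - \<phi> (Z w - Z v))))"
      unfolding Ev_def using S W Wn by (intro prob_component_window inj_on_subset[OF inj]) auto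
    also have "\<dots> = ?c * x n"
      unfolding x_def using inj_on_subset[OF inj S(3)] by (simp add: nh_image)
    finally show ?thesis using c0 x0 by (simp add: emeasure_eq_measure ennreal_mult)
  qed
  have "emeasure Q {\<omega>\<in>space Q. icomp \<phi> \<rho> I Z (\<lambda>p. U p \<omega>) r = S} = emeasure Q (\<Inter>n. Ev n)"
  proof (rule emeasure_eq_AE)
    \<comment> \<open>Marks are at most 1 almost surely, so a root with retention probability 1 is
      kept, as \<open>icomp_eq_iff\<close> requires.\<close>
    show "AE \<omega> in Q. \<omega> \<in> {\<omega>\<in>space Q. icomp \<phi> \<rho> I Z (\<lambda>p. U p \<omega>) r = S} \<longleftrightarrow> \<omega> \<in> (\<Inter>n. Ev n)"
      using AE_U01 AE_space
    proof eventually_elim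
      fix \<omega> assume u: "\<forall>p. 0 < U p \<omega> \<and> U p \<omega> \<le> 1" and om: "\<omega> \<in> space Q"
      have "icomp \<phi> \<rho> I Z (\<lambda>p. U p \<omega>) r = S \<longleftrightarrow> (\<forall>i\<in>S. U (i, i) \<omega> \<le> \<rho> i) \<and>
         conn_from r S (openpairs \<phi> S Z (\<lambda>p. U p \<omega>)) \<and> (\<forall>w\<in>I - S. sep \<phi> \<rho> S Z (\<lambda>p. U p \<omega>) w)"
        using S u \<rho>r by (intro icomp_eq_iff) auto
      then show "\<omega> \<in> {\<omega>\<in>space Q. icomp \<phi> \<rho> I Z (\<lambda>p. U p \<omega>) r = S} \<longleftrightarrow> \<omega> \<in> (\<Inter>n. Ev n)"
        unfolding W(3)[symmetric] using om by (auto simp: Ev_def)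
    qed
    show "{\<omega>\<in>space Q. icomp \<phi> \<rho> I Z (\<lambda>p. U p \<omega>) r = S} \<in> sets Q"
      using pred_icomp_eq[of \<phi> I "\<lambda>i _. Z i" Q U \<rho> r S] by (simp add: pred_def)
    show "(\<Inter>n. Ev n) \<in> sets Q" using Ev_sets by auto
  qed
  also have "\<dots> = ennreal ?c * (INF n. ennreal (x n))"
  proof (rule LIMSEQ_unique)
    show "(\<lambda>n. emeasure Q (Ev n)) \<longlonglongrightarrow> emeasure Q (\<Inter>n. Ev n)"
      using Ev_sets Ev_dec by (intro Lim_emeasure_decseq) auto
    have "(\<lambda>n. ennreal (x n)) \<longlonglongrightarrow> (INF n. ennreal (x n))"
      using xdec by (intro LIMSEQ_INF decseq_SucI ennreal_leI) auto
    then show "(\<lambda>n. emeasure Q (Ev n)) \<longlonglongrightarrow> ennreal ?c * (INF n. ennreal (x n))"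
      unfolding em by (intro ennreal_tendsto_cmult) auto
  qed
  finally show ?thesis unfolding x_def .
qed

text \<open>Two independent uniform marks have a product law, under which the diagonal is null.
  Distinct marks are what removes a doubled point from the vertex set.\<close>

lemma AE_U_inj: "AE \<omega> in Q. inj (\<lambda>p. U p \<omega>)"
proof -
  have "AE \<omega> in Q. U p \<omega> \<noteq> U q \<omega>" if pq: "p \<noteq> q" for p q
  proof -
    let ?L = "uniform_measure lborel {0..1::real}"
    interpret L: prob_space ?L by (rule prob_space_uniform_measure) auto
    have "?L \<Otimes>\<^sub>M ?L = distr Q (borel \<Otimes>\<^sub>M borel) (\<lambda>\<omega>. (U p \<omega>, U q \<omega>))"
    proof (rule pair_measure_eqI)
      show "sigma_finite_measure ?L" ..
      then show "sigma_finite_measure ?L" .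
      show "sets (?L \<Otimes>\<^sub>M ?L) = sets (distr Q (borel \<Otimes>\<^sub>M borel) (\<lambda>\<omega>. (U p \<omega>, U q \<omega>)))"
        by (simp cong: sets_pair_measure_cong)
      fix A B assume "A \<in> sets ?L" "B \<in> sets ?L"
      then have AB: "A \<in> sets borel" "B \<in> sets borel" by auto
      let ?A = "\<lambda>i. if i = p then A else B"
      have "prob (\<Inter>i\<in>{p, q}. U i -` ?A i \<inter> space Q) = (\<Prod>i\<in>{p, q}. prob (U i -` ?A i \<inter> space Q))"
        using AB by (intro indep_varsD[OF U_indep]) auto
      then have "prob ((U p -` A \<inter> space Q) \<inter> (U q -` B \<inter> space Q)) = prob (U p -` A \<inter> space Q) * prob (U q -` B \<inter> space Q)"
        using pq by simp
      moreover have "emeasure ?L A = prob (U p -` A \<inter> space Q)" "emeasure ?L B = prob (U q -` B \<inter> space Q)"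
        using AB unfolding U_unif[of p, symmetric] by (simp add: emeasure_distr emeasure_eq_measure)
          (use AB in \<open>simp add: U_unif[of p] U_unif[of q, symmetric] emeasure_distr emeasure_eq_measure\<close>)
      moreover have "(\<lambda>\<omega>. (U p \<omega>, U q \<omega>)) -` (A \<times> B) \<inter> space Q = (U p -` A \<inter> space Q) \<inter> (U q -` B \<inter> space Q)"
        by auto
      ultimately show "emeasure ?L A * emeasure ?L B = emeasure (distr Q (borel \<Otimes>\<^sub>M borel) (\<lambda>\<omega>. (U p \<omega>, U q \<omega>))) (A \<times> B)"
        using AB by (subst emeasure_distr) (auto simp: emeasure_eq_measure ennreal_mult)
    qed
    then have "distr Q (borel \<Otimes>\<^sub>M borel) (\<lambda>\<omega>. (U p \<omega>, U q \<omega>)) = ?L \<Otimes>\<^sub>M ?L" ..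
    note d = this
    have ae: "AE z in ?L \<Otimes>\<^sub>M ?L. fst z \<noteq> snd z"
    proof -
      have "AE y in ?L. x \<noteq> y" for x :: real
        using AE_lborel_singleton[of x] by (intro AE_uniform_measureI) (auto elim: eventually_mono)
      moreover have "pair_sigma_finite ?L ?L" ..
      ultimately show ?thesis
      proof (intro pair_sigma_finite.AE_pair_measure)
        have "{z \<in> space (borel \<Otimes>\<^sub>M borel). fst z \<noteq> (snd z :: real)} \<in> sets (borel \<Otimes>\<^sub>M borel)" by measurable
        then show "{z \<in> space (?L \<Otimes>\<^sub>M ?L). fst z \<noteq> snd z} \<in> sets (?L \<Otimes>\<^sub>M ?L)"
          by (simp add: space_pair_measure cong: sets_pair_measure_cong)
      qed auto
    qed
    have "AE z in distr Q (borel \<Otimes>\<^sub>M borel) (\<lambda>\<omega>. (U p \<omega>, U q \<omega>)). fst z \<noteq> snd z"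
      unfolding d by (rule ae)
    then show ?thesis by (subst (asm) AE_distr_iff) auto
  qed
  then have "AE \<omega> in Q. \<forall>p q. p \<noteq> q \<longrightarrow> U p \<omega> \<noteq> U q \<omega>"
    by (subst AE_all_countable, intro allI, subst AE_all_countable) auto
  then show ?thesis by eventually_elim (auto simp: inj_def)
qed

end

subsection \<open>Measurability of the cluster\<close>

lemma space_N_space: "space N_space = locally_finite_sets"
  by (simp add: N_space_def space_measure_of_conv)

lemma measurable_N_spaceI:
  fixes f :: "'m \<Rightarrow> 'a::metric_space set"
  assumes "\<And>x. x \<in> space M \<Longrightarrow> f x \<in> locally_finite_sets"
    and "\<And>B. B \<in> sets borel \<Longrightarrow> (\<lambda>x. npts (f x) B) \<in> borel_measurable M"
  shows "f \<in> M \<rightarrow>\<^sub>M N_space"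
  unfolding N_space_def
proof (rule measurable_measure_of)
  fix Y :: "'a set set" assume "Y \<in> {(\<lambda>\<mu>. npts \<mu> B) -` A \<inter> locally_finite_sets |A B. A \<in> sets borel \<and> B \<in> sets borel}"
  then obtain A B where Y: "Y = (\<lambda>\<mu>. npts \<mu> B) -` A \<inter> locally_finite_sets" "A \<in> sets borel" "B \<in> sets borel"
    by auto
  have "f -` Y \<inter> space M = (\<lambda>x. npts (f x) B) -` A \<inter> space M" using assms(1) by (auto simp: Y)
  then show "f -` Y \<inter> space M \<in> sets M" using measurable_sets[OF assms(2)[OF Y(3)] Y(2)] by simp
qed (use assms(1) in auto)

lemma finite_locally_finite: "finite S \<Longrightarrow> S \<in> locally_finite_sets"
  by (simp add: locally_finite_sets_def)

lemma locally_finite_subset: "S \<in> locally_finite_sets \<Longrightarrow> S' \<subseteq> S \<Longrightarrow> S' \<in> locally_finite_sets"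
  unfolding locally_finite_sets_def by (auto intro: finite_subset[OF Int_mono[OF _ order_refl]])

text \<open>A point with several indices is counted at the index of least code, so the count is a
  countable sum of indicators whatever coincidences occur.\<close>

lemma npts_image:
  fixes Z :: "'i::countable \<Rightarrow> 'a"
  shows "npts (Z ` A) B = (\<integral>\<^sup>+i. indicator {i. i \<in> A \<and> Z i \<in> B \<and> (\<forall>k. k \<in> A \<and> to_nat k < to_nat i \<longrightarrow> Z k \<noteq> Z i)} i \<partial>count_space UNIV)"
proof -
  let ?A = "{i. i \<in> A \<and> Z i \<in> B \<and> (\<forall>k. k \<in> A \<and> to_nat k < to_nat i \<longrightarrow> Z k \<noteq> Z i)}"
  have bij: "bij_betw Z ?A (Z ` A \<inter> B)"
  proof (rule bij_betwI')
    fix i j assume i: "i \<in> ?A" and j: "j \<in> ?A"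
    show "Z i = Z j \<longleftrightarrow> i = j"
    proof
      assume "Z i = Z j"
      then have "\<not> to_nat i < to_nat j" "\<not> to_nat j < to_nat i" using i j by auto
      then show "i = j" by (metis inj_to_nat injD linorder_neqE_nat)
    qed simp
  next
    fix y assume y: "y \<in> Z ` A \<inter> B"
    then obtain i0 where i0: "i0 \<in> A \<and> Z i0 = y" by auto
    obtain i where i: "i \<in> A" "Z i = y" and least: "\<And>k. k \<in> A \<and> Z k = y \<Longrightarrow> to_nat i \<le> to_nat k"
      using ex_has_least_nat[of "\<lambda>i. i \<in> A \<and> Z i = y", OF i0, of to_nat] by blast
    have "Z k \<noteq> Z i" if "k \<in> A" "to_nat k < to_nat i" for k
      using least[of k] i that by auto
    then have "i \<in> ?A"
      using i(1) y unfolding i(2)[symmetric] by blast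
    then show "\<exists>x\<in>?A. y = Z x" using i(2) by blast
  qed auto
  have "npts (Z ` A) B = (\<integral>\<^sup>+y. 1 \<partial>count_space (Z ` A \<inter> B))"
    unfolding npts_def by (simp add: emeasure_count_space)
  also have "\<dots> = (\<integral>\<^sup>+i. 1 \<partial>count_space ?A)"
    by (subst nn_integral_bij_count_space[OF bij, symmetric]) simp
  also have "\<dots> = (\<integral>\<^sup>+i. indicator ?A i \<partial>count_space UNIV)"
    by (subst nn_integral_count_space_indicator) simp_all
  finally show ?thesis .
qed

lemma measurable_image_N_space:
  fixes Z :: "'i::countable \<Rightarrow> 'm \<Rightarrow> 'a::euclidean_space"
  assumes Z: "\<And>i. i \<in> I \<Longrightarrow> Z i \<in> borel_measurable M"
    and A: "\<And>i. Measurable.pred M (\<lambda>x. i \<in> A x)" and AI: "\<And>x. x \<in> space M \<Longrightarrow> A x \<subseteq> I"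
    and lf: "\<And>x. x \<in> space M \<Longrightarrow> (\<lambda>i. Z i x) ` A x \<in> locally_finite_sets"
  shows "(\<lambda>x. (\<lambda>i. Z i x) ` A x) \<in> M \<rightarrow>\<^sub>M N_space"
proof (rule measurable_N_spaceI[OF lf])
  fix B :: "'a set" assume B [measurable]: "B \<in> sets borel"
  \<comment> \<open>The default 0 outside \<open>I\<close> makes every coordinate measurable, as
    needed for the countable quantifiers over all indices.\<close>
  define Y where "Y i = (if i \<in> I then Z i else (\<lambda>_. 0))" for i
  have [measurable]: "Y i \<in> borel_measurable M" for i using Z by (auto simp: Y_def)
  have "(\<lambda>x. npts ((\<lambda>i. Y i x) ` A x) B) \<in> borel_measurable M"
    unfolding npts_image
  proof (rule borel_measurable_nn_integral_count)
    fix i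
    have "Measurable.pred M (\<lambda>x. i \<in> A x \<and> Y i x \<in> B \<and> (\<forall>k. k \<in> A x \<and> to_nat k < to_nat i \<longrightarrow> Y k x \<noteq> Y i x))"
      using A by (intro pred_intros_logic pred_intros_countable) auto
    then show "(\<lambda>x. indicator {i. i \<in> A x \<and> Y i x \<in> B \<and> (\<forall>k. k \<in> A x \<and> to_nat k < to_nat i \<longrightarrow> Y k x \<noteq> Y i x)} i :: ennreal)
       \<in> borel_measurable M"
      unfolding indicator_def mem_Collect_eq of_bool_def by (intro measurable_If) (auto simp: pred_def)
  qed simp
  moreover have "(\<lambda>i. Y i x) ` A x = (\<lambda>i. Z i x) ` A x" if "x \<in> space M" for x
    using AI[OF that] by (intro image_cong) (auto simp: Y_def)
  ultimately show "(\<lambda>x. npts ((\<lambda>i. Z i x) ` A x) B) \<in> borel_measurable M"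
    by (subst (asm) measurable_cong[where g = "\<lambda>x. npts ((\<lambda>i. Z i x) ` A x) B"]) simp_all
qed

section \<open>The cluster in terms of indices\<close>

definition marked_pairs :: "'i set \<Rightarrow> ('i \<Rightarrow> ('d::{finite,linorder}) pt) \<Rightarrow> ('i \<times> 'i \<Rightarrow> real) \<Rightarrow> ('d pt set \<times> real) set" where
  "marked_pairs I Z u = {({Z i, Z j}, u (i, j)) | i j. i \<in> I \<and> j \<in> I \<and> lex_less (Z i) (Z j)}"

lemma chi_marked_pairs:
  "chi t X U y \<omega> = marked_pairs (dom y <+> (if t > 0 then UNIV else {}))
     (case_sum (\<lambda>i. the (y i)) (\<lambda>j. X j \<omega>)) (\<lambda>p. U p \<omega>)"
  by (simp add: chi_def marked_pairs_def Let_def)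

lemma lex_pair_eq:
  "lex_less a b \<Longrightarrow> lex_less c d \<Longrightarrow> {a, b} = {c, d} \<longleftrightarrow> a = c \<and> b = d"
  using lex_less_asym by (auto simp: doubleton_eq_iff)

text \<open>The cardinality condition becomes uniqueness of the mark among all index pairs with the
  same two positions. For countably many indices only countable quantifiers occur, and coinciding
  points are covered.\<close>

lemma rcm_verts_iff:
  "v \<in> rcm_verts (marked_pairs I Z u) \<longleftrightarrow> (\<exists>k l. k \<in> I \<and> l \<in> I \<and> lex_less (Z k) (Z l) \<and> (v = Z k \<or> v = Z l) \<and>
     0 \<le> u (k, l) \<and> u (k, l) \<le> 1 \<and> (\<forall>k' l'. k' \<in> I \<and> l' \<in> I \<and> lex_less (Z k') (Z l') \<and> Z k' = Z k \<and> Z l' = Z l \<and>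
        0 \<le> u (k', l') \<and> u (k', l') \<le> 1 \<longrightarrow> u (k', l') = u (k, l)))" (is "_ \<longleftrightarrow> ?R")
proof
  assume "v \<in> rcm_verts (marked_pairs I Z u)"
  then obtain e q where e: "card e = 2" "v \<in> e" "marked_pairs I Z u \<inter> ({e} \<times> {0..1}) = {q}"
    by (auto simp: rcm_verts_def card_1_singleton_iff)
  then have "q \<in> marked_pairs I Z u \<inter> ({e} \<times> {0..1})" by simp
  then obtain k l where kl: "k \<in> I" "l \<in> I" "lex_less (Z k) (Z l)" "q = ({Z k, Z l}, u (k, l))" "e = {Z k, Z l}"
      "0 \<le> u (k, l)" "u (k, l) \<le> 1"
    by (auto simp: marked_pairs_def)
  have "u (k', l') = u (k, l)" if "k' \<in> I" "l' \<in> I" "lex_less (Z k') (Z l')" "Z k' = Z k" "Z l' = Z l"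
    "0 \<le> u (k', l')" "u (k', l') \<le> 1" for k' l'
  proof -
    have "({Z k', Z l'}, u (k', l')) \<in> marked_pairs I Z u \<inter> ({e} \<times> {0..1})"
    proof -
      have "({Z k', Z l'}, u (k', l')) \<in> marked_pairs I Z u"
        unfolding marked_pairs_def using that by blast
      then show ?thesis using that kl(5) by simp
    qed
    then show ?thesis unfolding e(3) kl(4) by simp
  qed
  then show ?R using kl e(2) by blast
next
  assume ?R
  then obtain k l where kl: "k \<in> I" "l \<in> I" "lex_less (Z k) (Z l)" "v = Z k \<or> v = Z l" "0 \<le> u (k, l)" "u (k, l) \<le> 1"
    and un: "\<And>k' l'. k' \<in> I \<Longrightarrow> l' \<in> I \<Longrightarrow> lex_less (Z k') (Z l') \<Longrightarrow> Z k' = Z k \<Longrightarrow> Z l' = Z l \<Longrightarrow>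
        0 \<le> u (k', l') \<Longrightarrow> u (k', l') \<le> 1 \<Longrightarrow> u (k', l') = u (k, l)" by blast
  have "marked_pairs I Z u \<inter> ({{Z k, Z l}} \<times> {0..1}) = {({Z k, Z l}, u (k, l))}"
  proof (intro equalityI subsetI)
    fix q assume "q \<in> marked_pairs I Z u \<inter> ({{Z k, Z l}} \<times> {0..1})"
    then obtain k' l' where q: "k' \<in> I" "l' \<in> I" "lex_less (Z k') (Z l')" "q = ({Z k', Z l'}, u (k', l'))" "{Z k', Z l'} = {Z k, Z l}"
      "0 \<le> u (k', l')" "u (k', l') \<le> 1" by (auto simp: marked_pairs_def)
    then show "q \<in> {({Z k, Z l}, u (k, l))}" using un[of k' l'] lex_pair_eq[OF q(3) kl(3)] by simp
  qed (use kl in \<open>auto simp: marked_pairs_def\<close>)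
  moreover have "card {Z k, Z l} = 2" using kl(3) by (auto simp: card_insert_if)
  ultimately show "v \<in> rcm_verts (marked_pairs I Z u)"
    unfolding rcm_verts_def using kl(4) by (intro CollectI exI[of _ "{Z k, Z l}"]) auto
qed

lemma rcm_edges_iff:
  "(a, b) \<in> rcm_edges \<phi> (marked_pairs I Z u) \<longleftrightarrow> a \<in> rcm_verts (marked_pairs I Z u) \<and> b \<in> rcm_verts (marked_pairs I Z u) \<and> a \<noteq> b \<and>
     (\<exists>k l. k \<in> I \<and> l \<in> I \<and> lex_less (Z k) (Z l) \<and> (Z k = a \<and> Z l = b \<or> Z k = b \<and> Z l = a) \<and>
        0 \<le> u (k, l) \<and> u (k, l) \<le> 1 \<and> u (k, l) \<le> \<phi> (b - a))"
proof -
  have "(\<exists>w\<in>{0..1}. ({a, b}, w) \<in> marked_pairs I Z u \<and> w \<le> \<phi> (b - a)) \<longleftrightarrow>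
    (\<exists>k l. k \<in> I \<and> l \<in> I \<and> lex_less (Z k) (Z l) \<and> (Z k = a \<and> Z l = b \<or> Z k = b \<and> Z l = a) \<and>
        0 \<le> u (k, l) \<and> u (k, l) \<le> 1 \<and> u (k, l) \<le> \<phi> (b - a))"
    (is "?L \<longleftrightarrow> ?R")
  proof
    assume ?L
    then obtain k l where "k \<in> I" "l \<in> I" "lex_less (Z k) (Z l)" "{a, b} = {Z k, Z l}" "0 \<le> u (k, l)" "u (k, l) \<le> 1" "u (k, l) \<le> \<phi> (b - a)"
      by (auto simp: marked_pairs_def)
    moreover from this have "Z k = a \<and> Z l = b \<or> Z k = b \<and> Z l = a" by (auto simp: doubleton_eq_iff)
    ultimately show ?R by blast
  next
    assume ?R
    then obtain k l where kl: "k \<in> I" "l \<in> I" "lex_less (Z k) (Z l)" "Z k = a \<and> Z l = b \<or> Z k = b \<and> Z l = a"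
        "0 \<le> u (k, l)" "u (k, l) \<le> 1" "u (k, l) \<le> \<phi> (b - a)" by blast
    have "({Z k, Z l}, u (k, l)) \<in> marked_pairs I Z u"
      unfolding marked_pairs_def using kl by blast
    moreover have "{Z k, Z l} = {a, b}" using kl(4) by auto
    ultimately have "({a, b}, u (k, l)) \<in> marked_pairs I Z u" by simp
    then show ?L using kl by auto
  qed
  then show ?thesis by (simp add: rcm_edges_def)
qed

lemma rcm_verts_subset: "rcm_verts (marked_pairs I Z u) \<subseteq> Z ` I"
  by (auto simp: rcm_verts_iff)

text \<open>An index counts as soon as some reachable index has the same position. Measurability is
  required at every outcome and not only almost surely, so coinciding positions have to be
  allowed.\<close>

definition cluster_idx :: "(('d::{finite,linorder}) pt \<Rightarrow> real) \<Rightarrow> 'i set \<Rightarrow> ('i \<Rightarrow> 'd pt) \<Rightarrow> ('i \<times> 'i \<Rightarrow> real) \<Rightarrow> 'i \<Rightarrow> 'i set" where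
  "cluster_idx \<phi> I Z u r = {i. i \<in> I \<and> (\<exists>k. (r, k) \<in> {(i, j). i \<in> I \<and> j \<in> I \<and> (Z i, Z j) \<in> rcm_edges \<phi> (marked_pairs I Z u)}\<^sup>* \<and>
     (k = r \<or> k \<in> I) \<and> Z k = Z i)}"

lemma cluster_eq_image:
  assumes r: "r \<in> I"
  shows "cluster \<phi> (Z r) (marked_pairs I Z u) = Z ` cluster_idx \<phi> I Z u r"
proof -
  let ?\<xi> = "marked_pairs I Z u"
  let ?R = "{(i, j). i \<in> I \<and> j \<in> I \<and> (Z i, Z j) \<in> rcm_edges \<phi> ?\<xi>}"
  have sub: "a \<in> Z ` I \<and> b \<in> Z ` I" if "(a, b) \<in> rcm_edges \<phi> ?\<xi>" for a b
    using that rcm_verts_subset[of I Z u] by (auto simp: rcm_edges_iff)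
  have 1: "\<exists>k\<in>I. (r, k) \<in> ?R\<^sup>* \<and> Z k = y" if "(Z r, y) \<in> (rcm_edges \<phi> ?\<xi>)\<^sup>*" for y
    using that
  proof (induction rule: rtrancl_induct)
    case base
    then show ?case using r by blast
  next
    case (step y y')
    then obtain k where k: "k \<in> I" "(r, k) \<in> ?R\<^sup>*" "Z k = y" by blast
    obtain k' where k': "k' \<in> I" "Z k' = y'" using sub[OF step.hyps(2)] by auto
    have "(k, k') \<in> ?R" using k k' step.hyps(2) by simp
    with k(2) have "(r, k') \<in> ?R\<^sup>*" by (rule rtrancl_into_rtrancl)
    with k' show ?case by blast
  qed
  have 2: "(Z r, Z k) \<in> (rcm_edges \<phi> ?\<xi>)\<^sup>*" if "(r, k) \<in> ?R\<^sup>*" for k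
    using that by (induction rule: rtrancl_induct) (auto intro: rtrancl_into_rtrancl)
  have C: "Z ` cluster_idx \<phi> I Z u r = (rcm_edges \<phi> ?\<xi>)\<^sup>* `` {Z r}"
  proof (intro equalityI subsetI)
    fix y assume "y \<in> Z ` cluster_idx \<phi> I Z u r"
    then obtain k where "(r, k) \<in> ?R\<^sup>*" "Z k = y" by (auto simp: cluster_idx_def)
    then show "y \<in> (rcm_edges \<phi> ?\<xi>)\<^sup>* `` {Z r}" using 2 by auto
  next
    fix y assume "y \<in> (rcm_edges \<phi> ?\<xi>)\<^sup>* `` {Z r}"
    then obtain k where "k \<in> I" "(r, k) \<in> ?R\<^sup>*" "Z k = y" using 1 by auto
    then have "k \<in> cluster_idx \<phi> I Z u r" unfolding cluster_idx_def by blast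
    then show "y \<in> Z ` cluster_idx \<phi> I Z u r" using \<open>Z k = y\<close> by blast
  qed
  show ?thesis
  proof (cases "Z r \<in> rcm_verts ?\<xi>")
    case False
    have "y = Z r" if "(Z r, y) \<in> (rcm_edges \<phi> ?\<xi>)\<^sup>*" for y
      using that by (cases rule: converse_rtranclE) (use False in \<open>auto simp: rcm_edges_iff\<close>)
    then have "(rcm_edges \<phi> ?\<xi>)\<^sup>* `` {Z r} = {Z r}" by auto
    then show ?thesis using False unfolding C by (simp add: cluster_def)
  qed (simp add: C cluster_def)
qed

lemma measurable_cluster:
  fixes Z :: "'i::countable \<Rightarrow> 'm \<Rightarrow> ('d::{finite,linorder}) pt"
  assumes [measurable]: "\<phi> \<in> borel_measurable borel"
    and Z: "\<And>i. i \<in> I \<Longrightarrow> Z i \<in> borel_measurable M" and U [measurable]: "\<And>p. U p \<in> borel_measurable M"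
    and r: "r \<in> I" and lf: "\<And>x. x \<in> space M \<Longrightarrow> (\<lambda>i. Z i x) ` I \<in> locally_finite_sets"
  shows "(\<lambda>x. cluster \<phi> (Z r x) (marked_pairs I (\<lambda>i. Z i x) (\<lambda>p. U p x))) \<in> M \<rightarrow>\<^sub>M N_space"
proof -
  let ?\<xi> = "\<lambda>x. marked_pairs I (\<lambda>i. Z i x) (\<lambda>p. U p x)"
  have impI_pred: "Measurable.pred M (\<lambda>x. c \<and> Q x)" if "c \<Longrightarrow> Measurable.pred M Q" for c Q
    using that by (cases c) auto
  have vert: "Measurable.pred M (\<lambda>x. Z i x \<in> rcm_verts (?\<xi> x))" if i: "i \<in> I" for i
  proof -
    note [measurable] = Z[OF i]
    define Y where "Y i = (if i \<in> I then Z i else (\<lambda>_. 0))" for i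
    have [measurable]: "Y i \<in> borel_measurable M" for i using Z by (auto simp: Y_def)
    have eq: "(\<lambda>x. Z i x \<in> rcm_verts (?\<xi> x)) = (\<lambda>x. \<exists>k l. k \<in> I \<and> l \<in> I \<and> lex_less (Y k x) (Y l x) \<and> (Z i x = Y k x \<or> Z i x = Y l x) \<and>
     0 \<le> U (k, l) x \<and> U (k, l) x \<le> 1 \<and> (\<forall>k' l'. k' \<in> I \<and> l' \<in> I \<and> lex_less (Y k' x) (Y l' x) \<and> Y k' x = Y k x \<and> Y l' x = Y l x \<and>
        0 \<le> U (k', l') x \<and> U (k', l') x \<le> 1 \<longrightarrow> U (k', l') x = U (k, l) x))"
      unfolding rcm_verts_iff by (intro ext ex_cong1 conj_cong refl all_cong1 imp_cong) (auto simp: Y_def)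
    show ?thesis unfolding eq by measurable
  qed
  have edge: "Measurable.pred M (\<lambda>x. i \<in> I \<and> j \<in> I \<and> (Z i x, Z j x) \<in> rcm_edges \<phi> (?\<xi> x))" for i j
  proof (cases "i \<in> I \<and> j \<in> I")
    case True
    note [measurable] = Z[OF conjunct1[OF True]] Z[OF conjunct2[OF True]] vert[OF conjunct1[OF True]] vert[OF conjunct2[OF True]]
    define Y where "Y i = (if i \<in> I then Z i else (\<lambda>_. 0))" for i
    have [measurable]: "Y i \<in> borel_measurable M" for i using Z by (auto simp: Y_def)
    have eq: "(\<lambda>x. (Z i x, Z j x) \<in> rcm_edges \<phi> (?\<xi> x)) = (\<lambda>x. Z i x \<in> rcm_verts (?\<xi> x) \<and> Z j x \<in> rcm_verts (?\<xi> x) \<and> Z i x \<noteq> Z j x \<and>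
      (\<exists>k l. k \<in> I \<and> l \<in> I \<and> lex_less (Y k x) (Y l x) \<and> (Y k x = Z i x \<and> Y l x = Z j x \<or> Y k x = Z j x \<and> Y l x = Z i x) \<and>
        0 \<le> U (k, l) x \<and> U (k, l) x \<le> 1 \<and> U (k, l) x \<le> \<phi> (Z j x - Z i x)))"
      unfolding rcm_edges_iff by (intro ext ex_cong1 conj_cong refl) (auto simp: Y_def)
    have "Measurable.pred M (\<lambda>x. (Z i x, Z j x) \<in> rcm_edges \<phi> (?\<xi> x))" unfolding eq by measurable
    then show ?thesis using True by simp
  qed auto
  have path: "Measurable.pred M (\<lambda>x. (r, k) \<in> {(i, j). i \<in> I \<and> j \<in> I \<and> (Z i x, Z j x) \<in> rcm_edges \<phi> (?\<xi> x)}\<^sup>*)" for k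
    by (rule pred_rtrancl) (use edge in simp)
  have idx: "Measurable.pred M (\<lambda>x. i \<in> cluster_idx \<phi> I (\<lambda>i. Z i x) (\<lambda>p. U p x) r)" for i
  proof (cases "i \<in> I")
    case True
    have eq: "(\<lambda>x. i \<in> cluster_idx \<phi> I (\<lambda>i. Z i x) (\<lambda>p. U p x) r) = (\<lambda>x. \<exists>k. k \<in> I \<and>
       ((r, k) \<in> {(i, j). i \<in> I \<and> j \<in> I \<and> (Z i x, Z j x) \<in> rcm_edges \<phi> (?\<xi> x)}\<^sup>* \<and> Z k x = Z i x))"
      using True r by (auto simp: cluster_idx_def fun_eq_iff)
    have "Measurable.pred M (\<lambda>x. Z k x = Z i x)" if "k \<in> I" for k
      using Z[OF that] Z[OF True] by measurable
    then show ?thesis unfolding eq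
      by (intro pred_intros_countable impI_pred pred_intros_logic path)
  qed (auto simp: cluster_idx_def)
  have "(\<lambda>x. (\<lambda>i. Z i x) ` cluster_idx \<phi> I (\<lambda>i. Z i x) (\<lambda>p. U p x) r) \<in> M \<rightarrow>\<^sub>M N_space"
  proof (rule measurable_image_N_space[OF Z idx])
    show "(\<lambda>i. Z i x) ` cluster_idx \<phi> I (\<lambda>i. Z i x) (\<lambda>p. U p x) r \<in> locally_finite_sets" if "x \<in> space M" for x
      by (rule locally_finite_subset[OF lf[OF that]]) (auto simp: cluster_idx_def)
  qed (auto simp: cluster_idx_def)
  then show ?thesis using cluster_eq_image[OF r, of \<phi> "\<lambda>i. Z i _"] by simp
qed

text \<open>Distinct positions give each pair a single mark, so every point that has a companion is
  a vertex, and symmetry of \<open>\<phi>\<close> makes the orientation immaterial. A lone point is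
  its own cluster under either description.\<close>

lemma cluster_eq_icomp:
  assumes inj: "inj_on Z I" and r: "r \<in> I" and u: "\<And>p. 0 \<le> u p \<and> u p \<le> 1"
    and sym: "\<And>y. \<phi> (- y) = \<phi> y"
  shows "cluster \<phi> (Z r) (marked_pairs I Z u) = Z ` icomp \<phi> (\<lambda>_. 1) I Z u r"
proof -
  let ?\<xi> = "marked_pairs I Z u" and ?G = "gedges \<phi> (\<lambda>_. 1) I Z u"
  have ieq: "Z i = Z j \<longleftrightarrow> i = j" if "i \<in> I" "j \<in> I" for i j using inj that by (auto dest: inj_onD)
  have flip: "\<phi> (a - b) = \<phi> (b - a)" for a b using sym[of "a - b"] by simp
  have vert: "Z i \<in> rcm_verts ?\<xi>" if "i \<in> I" "j \<in> I" "i \<noteq> j" for i j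
    unfolding rcm_verts_iff using that lex_less_total[of "Z i" "Z j"] ieq[of i j] u
    by (metis ieq)
  have edge: "(Z i, Z j) \<in> rcm_edges \<phi> ?\<xi> \<longleftrightarrow> (i, j) \<in> ?G \<union> ?G\<inverse>" if ij: "i \<in> I" "j \<in> I" for i j
  proof
    assume "(Z i, Z j) \<in> rcm_edges \<phi> ?\<xi>"
    then obtain k l where "k \<in> I" "l \<in> I" "lex_less (Z k) (Z l)" "Z k = Z i \<and> Z l = Z j \<or> Z k = Z j \<and> Z l = Z i" "u (k, l) \<le> \<phi> (Z j - Z i)"
      by (auto simp: rcm_edges_iff)
    then show "(i, j) \<in> ?G \<union> ?G\<inverse>" using ij ieq u flip[of "Z i" "Z j"] by (auto simp: gedges_def)
  next
    assume G: "(i, j) \<in> ?G \<union> ?G\<inverse>"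
    then have "i \<noteq> j" by (auto simp: gedges_def)
    then have "Z i \<in> rcm_verts ?\<xi>" "Z j \<in> rcm_verts ?\<xi>" "Z i \<noteq> Z j" using vert ij ieq by auto
    moreover have "\<exists>k l. k \<in> I \<and> l \<in> I \<and> lex_less (Z k) (Z l) \<and> (Z k = Z i \<and> Z l = Z j \<or> Z k = Z j \<and> Z l = Z i) \<and>
        0 \<le> u (k, l) \<and> u (k, l) \<le> 1 \<and> u (k, l) \<le> \<phi> (Z j - Z i)"
    proof (cases "(i, j) \<in> ?G")
      case True
      then show ?thesis using u by (intro exI[of _ i] exI[of _ j]) (simp add: gedges_def)
    next
      case False
      then have "(j, i) \<in> ?G" using G by simp
      then show ?thesis using u flip[of "Z i" "Z j"] by (intro exI[of _ j] exI[of _ i]) (simp add: gedges_def)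
    qed
    ultimately show "(Z i, Z j) \<in> rcm_edges \<phi> ?\<xi>" by (simp add: rcm_edges_iff)
  qed
  have "{(i, j). i \<in> I \<and> j \<in> I \<and> (Z i, Z j) \<in> rcm_edges \<phi> ?\<xi>} = ?G \<union> ?G\<inverse>"
    using edge by (auto simp: gedges_def)
  then have "cluster_idx \<phi> I Z u r = {i \<in> I. \<exists>k. k \<in> icomp \<phi> (\<lambda>_. 1) I Z u r \<and> (k = r \<or> k \<in> I) \<and> Z k = Z i}"
    by (simp add: cluster_idx_def icomp_def)
  also have "\<dots> = icomp \<phi> (\<lambda>_. 1) I Z u r"
    using icomp_subset[OF r, of \<phi> "\<lambda>_. 1" Z u] ieq by blast
  finally show ?thesis by (simp add: cluster_eq_image[OF r])
qed

text \<open>If two indices share the position \<open>c\<close>, any pair containing \<open>c\<close>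
  carries at least two different marks, so it does not have multiplicity one and \<open>c\<close> is
  not a vertex.\<close>

lemma cluster_doubled_point:
  assumes ij: "i \<in> I" "j \<in> I" "i \<noteq> j" "Z i = c" "Z j = c" and u: "\<And>p. 0 \<le> u p \<and> u p \<le> 1" "inj u"
  shows "cluster \<phi> c (marked_pairs I Z u) = {c}"
proof -
  have "c \<notin> rcm_verts (marked_pairs I Z u)"
  proof
    assume "c \<in> rcm_verts (marked_pairs I Z u)"
    from this[unfolded rcm_verts_iff] obtain k l where kl: "k \<in> I" "l \<in> I" "lex_less (Z k) (Z l)" "c = Z k \<or> c = Z l"
      and "\<forall>k' l'. k' \<in> I \<and> l' \<in> I \<and> lex_less (Z k') (Z l') \<and> Z k' = Z k \<and> Z l' = Z l \<and>
        0 \<le> u (k', l') \<and> u (k', l') \<le> 1 \<longrightarrow> u (k', l') = u (k, l)" by blast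
    then have un: "u (k', l') = u (k, l)"
      if "k' \<in> I" "l' \<in> I" "lex_less (Z k') (Z l')" "Z k' = Z k" "Z l' = Z l" for k' l'
      using that u(1) by blast
    from kl(4) show False
    proof
      assume "c = Z k"
      then have "u (i, l) = u (k, l)" "u (j, l) = u (k, l)" using un[of i l] un[of j l] ij kl by auto
      then have "u (i, l) = u (j, l)" by simp
      then show False using u(2) ij by (auto dest: injD)
    next
      assume "c = Z l"
      then have "u (k, i) = u (k, l)" "u (k, j) = u (k, l)" using un[of k i] un[of k j] ij kl by auto
      then have "u (k, i) = u (k, j)" by simp
      then show False using u(2) ij by (auto dest: injD)
    qed
  qed
  then show ?thesis by (simp add: cluster_def)
qed

subsection \<open>Expansion over finite clusters\<close>

text \<open>The \<open>V(S)\<close> of the overview. For integrable \<open>\<phi>\<close> it is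
  finite on finite sets, so nothing is lost by passing to reals.\<close>

definition hvol :: "('a::euclidean_space \<Rightarrow> real) \<Rightarrow> 'a set \<Rightarrow> real" where
  "hvol \<phi> S = enn2real (\<integral>\<^sup>+w. ennreal (1 - nh \<phi> S w) \<partial>lborel)"

text \<open>Almost every tuple satisfies this. Under it the set formed by \<open>Y\<close> and the
  tuple has \<open>card Y + card I\<close> elements, so that functions of the set can be written in
  coordinates.\<close>

definition cfg :: "'a set \<Rightarrow> 'b set \<Rightarrow> ('b \<Rightarrow> 'a) \<Rightarrow> bool" where
  "cfg Y I z \<longleftrightarrow> inj_on z I \<and> z ` I \<inter> Y = {}"

definition cfg_int :: "'a::euclidean_space set \<Rightarrow> 'b set \<Rightarrow> ('a set \<Rightarrow> ennreal) \<Rightarrow> ennreal" where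
  "cfg_int Y I H = (\<integral>\<^sup>+z. (if cfg Y I z then H (z ` I) else 0) \<partial>Pi\<^sub>M I (\<lambda>_. lborel))"

text \<open>The \<open>W(S)\<close> of the overview.\<close>

definition wt :: "(('d::{finite,linorder}) pt \<Rightarrow> real) \<Rightarrow> 'd pt \<Rightarrow> 'd pt set \<Rightarrow> 'd pt set \<Rightarrow> real" where
  "wt \<phi> c A S = connw \<phi> S id c * (\<Prod>v\<in>A. nh \<phi> S v)"

text \<open>The expansion over all finite clusters containing \<open>Y\<close> and avoiding \<open>A\<close>, at intensity \<open>\<tau>\<close>.\<close>

definition animal :: "(('d::{finite,linorder}) pt \<Rightarrow> real) \<Rightarrow> real \<Rightarrow> 'd pt \<Rightarrow> 'd pt set \<Rightarrow> 'd pt set \<Rightarrow> ('d pt set \<Rightarrow> ennreal) \<Rightarrow> ennreal" where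
  "animal \<phi> \<tau> c Y A F = (\<Sum>k. ennreal (\<tau> ^ k / fact k) * cfg_int Y {..<k}
     (\<lambda>B. F (Y \<union> B) * ennreal (wt \<phi> c A (Y \<union> B) * exp (- \<tau> * hvol \<phi> (Y \<union> B)))))"

lemma inj_on_case_sum:
  assumes "inj_on f A" "inj_on g B" "f ` A \<inter> g ` B = {}"
  shows "inj_on (case_sum f g) (A <+> B)"
proof (rule inj_onI)
  fix x x' assume x: "x \<in> A <+> B" "x' \<in> A <+> B" and eq: "case_sum f g x = case_sum f g x'"
  have d: "f a \<noteq> g b" if "a \<in> A" "b \<in> B" for a b using assms(3) that by blast
  show "x = x'"
  proof (cases x)
    case (Inl a)
    then show ?thesis using x eq d[of a] inj_onD[OF assms(1), of a] by (cases x') auto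
  next
    case (Inr b)
    then show ?thesis using x eq d[of _ b] inj_onD[OF assms(2), of b] by (cases x') auto
  qed
qed

lemma image_case_sum_Plus: "case_sum f g ` (A <+> B) = f ` A \<union> g ` B"
  unfolding Plus_def image_Un image_image by simp

lemma pred_equal:
  fixes f g :: "'m \<Rightarrow> 'a::euclidean_space"
  assumes [measurable]: "f \<in> borel_measurable M" "g \<in> borel_measurable M"
  shows "Measurable.pred M (\<lambda>x. f x = g x)"
  by measurable

lemma cfg_pred:
  fixes Y :: "'a::euclidean_space set"
  assumes "finite Y" "finite I"
  shows "Measurable.pred (Pi\<^sub>M I (\<lambda>_. lborel)) (cfg Y I)"
proof -
  have eq: "cfg Y I = (\<lambda>z. (\<forall>i\<in>I. \<forall>j\<in>I - {i}. z i \<noteq> z j) \<and> (\<forall>i\<in>I. \<forall>y\<in>Y. z i \<noteq> y))"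
    by (auto simp: cfg_def fun_eq_iff inj_on_def)
  have comp: "(\<lambda>z. z i) \<in> borel_measurable (Pi\<^sub>M I (\<lambda>_. lborel :: 'a measure))" if "i \<in> I" for i
    using measurable_component_singleton[OF that, of "\<lambda>_. lborel :: 'a measure"] by simp
  have ne: "Measurable.pred (Pi\<^sub>M I (\<lambda>_. lborel :: 'a measure)) (\<lambda>z. z i = z j)" if "i \<in> I" "j \<in> I" for i j
    using that by (intro pred_equal comp)
  have ny: "Measurable.pred (Pi\<^sub>M I (\<lambda>_. lborel :: 'a measure)) (\<lambda>z. z i = y)" if "i \<in> I" for i and y :: 'a
    using that by (intro pred_equal comp) auto
  show ?thesis
    unfolding eq using assms
    by (intro pred_intros_logic pred_intros_finite ne ny) auto
qed

lemma INF_cmult_decseq: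
  assumes "decseq x"
  shows "(INF n. ennreal c * x n) = ennreal c * (INF n. x n)"
proof (rule LIMSEQ_unique)
  show "(\<lambda>n. ennreal c * x n) \<longlonglongrightarrow> (INF n. ennreal c * x n)"
    using assms by (intro LIMSEQ_INF) (auto simp: decseq_def intro: mult_left_mono)
  show "(\<lambda>n. ennreal c * x n) \<longlonglongrightarrow> ennreal c * (INF n. x n)"
    using assms by (intro ennreal_tendsto_cmult LIMSEQ_INF) auto
qed

lemma measurable_finite_image_N_space:
  fixes Z :: "'i \<Rightarrow> 'm \<Rightarrow> 'a::euclidean_space"
  assumes S: "finite S" and Z: "\<And>i. i \<in> S \<Longrightarrow> Z i \<in> borel_measurable M"
  shows "(\<lambda>x. (\<lambda>i. Z i x) ` S) \<in> M \<rightarrow>\<^sub>M N_space"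
proof -
  obtain e where e: "bij_betw e {..<card S} S"
    using ex_bij_betw_nat_finite[OF S] by (auto simp: atLeast0LessThan)
  have "(\<lambda>x. (\<lambda>i. Z (e i) x) ` {..<card S}) \<in> M \<rightarrow>\<^sub>M N_space"
  proof (rule measurable_image_N_space[where I = "{..<card S}"])
    fix i assume "i \<in> {..<card S}"
    then have "e i \<in> S" using bij_betwE[OF e] by blast
    then show "Z (e i) \<in> borel_measurable M" by (rule Z)
  qed (auto intro: finite_locally_finite)
  moreover have "(\<lambda>i. Z (e i) x) ` {..<card S} = (\<lambda>i. Z i x) ` S" for x
  proof -
    have "(\<lambda>i. Z (e i) x) ` {..<card S} = (\<lambda>i. Z i x) ` (e ` {..<card S})" by (simp only: image_image)
    then show ?thesis by (simp only: bij_betw_imp_surj_on[OF e])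
  qed
  ultimately show ?thesis by simp
qed

lemma sum_Inj_tuples:
  fixes J :: "'b::countable set"
  shows "(\<Sum>k. (\<integral>\<^sup>+i. h (i ` {..<k}) \<partial>count_space (Inj {..<k::nat} J)) / fact k) =
    (\<integral>\<^sup>+G. h G \<partial>count_space {G. finite G \<and> G \<subseteq> J})"
proof -
  have "(\<integral>\<^sup>+i. h (i ` {..<k}) \<partial>count_space (Inj {..<k::nat} J)) / fact k =
     (\<integral>\<^sup>+G. h G * indicator {G. finite G \<and> G \<subseteq> J \<and> card G = k} G \<partial>count_space UNIV)" for k
  proof -
    have "(\<integral>\<^sup>+i. h (i ` {..<k}) \<partial>count_space (Inj {..<k::nat} J)) =
      fact k * (\<integral>\<^sup>+G. h G \<partial>count_space {G. finite G \<and> G \<subseteq> J \<and> card G = k})"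
      using nn_integral_Inj_image[where L = "{..<k}" and h = h and A = J] by simp
    then show ?thesis
      using ennreal_mult_divide_eq[of "fact k" "\<integral>\<^sup>+G. h G \<partial>count_space {G. finite G \<and> G \<subseteq> J \<and> card G = k}"]
        ennreal_of_nat_neq_top[of "fact k"] by (simp add: mult.commute of_nat_fact nn_integral_count_space_indicator)
  qed
  then have "(\<Sum>k. (\<integral>\<^sup>+i. h (i ` {..<k}) \<partial>count_space (Inj {..<k::nat} J)) / fact k) =
     (\<integral>\<^sup>+G. (\<Sum>k. h G * indicator {G. finite G \<and> G \<subseteq> J \<and> card G = k} G) \<partial>count_space UNIV)"
    by (subst nn_integral_suminf) simp_all
  also have "\<dots> = (\<integral>\<^sup>+G. h G * indicator {G. finite G \<and> G \<subseteq> J} G \<partial>count_space UNIV)"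
  proof (rule nn_integral_cong)
    fix G :: "'b set"
    have "(\<Sum>k. h G * indicator {G. finite G \<and> G \<subseteq> J \<and> card G = k} G) =
      (\<Sum>k\<in>{card G}. h G * indicator {G. finite G \<and> G \<subseteq> J \<and> card G = k} G)"
      by (rule suminf_finite) auto
    then show "(\<Sum>k. h G * indicator {G. finite G \<and> G \<subseteq> J \<and> card G = k} G) = h G * indicator {G. finite G \<and> G \<subseteq> J} G"
      by (simp add: indicator_def)
  qed
  also have "\<dots> = (\<integral>\<^sup>+G. h G \<partial>count_space {G. finite G \<and> G \<subseteq> J})"
    by (simp add: nn_integral_count_space_indicator)
  finally show ?thesis .
qed

section \<open>The connection function and measurability of its weights\<close>

locale kernel =
  fixes \<phi> :: "('d::{finite,linorder}) pt \<Rightarrow> real" and m :: real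
  assumes \<phi>_measurable [measurable]: "\<phi> \<in> borel_measurable borel"
    and \<phi>_range: "\<And>y. 0 \<le> \<phi> y \<and> \<phi> y \<le> 1" and \<phi>_symm: "\<And>y. \<phi> (- y) = \<phi> y"
    and \<phi>_int: "(\<integral>\<^sup>+y. ennreal (\<phi> y) \<partial>lborel) = ennreal m" and m_nonneg: "0 \<le> m"
begin

lemma nh_range: "0 \<le> nh \<phi> S w \<and> nh \<phi> S w \<le> 1"
  unfolding nh_def using \<phi>_range by (auto intro!: prod_nonneg prod_le_1)

lemma nh_measurable [measurable]: "nh \<phi> S \<in> borel_measurable borel"
  unfolding nh_def by measurable

text \<open>Union bound for having an edge to some point of \<open>S\<close>; integrated over
  \<open>w\<close> it bounds the volume by \<open>m\<close> per point.\<close>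

lemma one_minus_nh_le: "finite S \<Longrightarrow> 1 - nh \<phi> S w \<le> (\<Sum>v\<in>S. \<phi> (w - v))"
proof (induction S rule: finite_induct)
  case (insert v S)
  have "nh \<phi> (insert v S) w = nh \<phi> S w - \<phi> (w - v) * nh \<phi> S w"
    using insert by (simp add: nh_def algebra_simps)
  moreover have "\<phi> (w - v) * nh \<phi> S w \<le> \<phi> (w - v) * 1"
    using \<phi>_range nh_range by (intro mult_left_mono) auto
  ultimately show ?case using insert by simp
qed (simp add: nh_def)

lemma nn_integral_translate:
  fixes f :: "'d pt \<Rightarrow> ennreal"
  assumes [measurable]: "f \<in> borel_measurable borel"
  shows "(\<integral>\<^sup>+w. f (w - v) \<partial>lborel) = (\<integral>\<^sup>+w. f w \<partial>lborel)"
proof -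
  have "(\<integral>\<^sup>+w. f w \<partial>lborel) = (\<integral>\<^sup>+w. f w \<partial>distr lborel borel ((+) (- v)))"
    by (simp only: lborel_distr_plus)
  also have "\<dots> = (\<integral>\<^sup>+w. f (- v + w) \<partial>lborel)" by (subst nn_integral_distr) auto
  finally show ?thesis by simp
qed

lemma hvol_le:
  assumes "finite S"
  shows "(\<integral>\<^sup>+w. ennreal (1 - nh \<phi> S w) \<partial>lborel) \<le> ennreal (real (card S) * m)"
proof -
  have "(\<integral>\<^sup>+w. ennreal (1 - nh \<phi> S w) \<partial>lborel) \<le> (\<integral>\<^sup>+w. (\<Sum>v\<in>S. ennreal (\<phi> (w - v))) \<partial>lborel)"
    using assms \<phi>_range one_minus_nh_le by (intro nn_integral_mono) (simp add: sum_ennreal ennreal_leI)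
  also have "\<dots> = (\<Sum>v\<in>S. \<integral>\<^sup>+w. ennreal (\<phi> (w - v)) \<partial>lborel)"
    by (rule nn_integral_sum) auto
  also have "\<dots> = (\<Sum>v\<in>S. ennreal m)"
    using nn_integral_translate[of "\<lambda>w. ennreal (\<phi> w)"] by (simp add: \<phi>_int)
  also have "\<dots> = ennreal (real (card S) * m)"
    using m_nonneg by (simp add: ennreal_mult ennreal_of_nat_eq_real_of_nat)
  finally show ?thesis .
qed

lemma nn_integral_hvol: "finite S \<Longrightarrow> (\<integral>\<^sup>+w. ennreal (1 - nh \<phi> S w) \<partial>lborel) = ennreal (hvol \<phi> S)"
  unfolding hvol_def by (subst ennreal_enn2real) (auto intro: le_less_trans[OF hvol_le])

lemma hvol_bounds: "finite S \<Longrightarrow> 0 \<le> hvol \<phi> S \<and> hvol \<phi> S \<le> real (card S) * m"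
proof
  assume S: "finite S"
  show "0 \<le> hvol \<phi> S" by (simp add: hvol_def)
  have "ennreal (hvol \<phi> S) \<le> ennreal (real (card S) * m)"
    using hvol_le[OF S] by (simp only: nn_integral_hvol[OF S])
  then show "hvol \<phi> S \<le> real (card S) * m" using m_nonneg by (simp only: ennreal_le_iff mult_nonneg_nonneg of_nat_0_le_iff)
qed

lemma wt_nonneg: "0 \<le> wt \<phi> c A S"
  unfolding wt_def using \<phi>_range nh_range by (intro mult_nonneg_nonneg connw_nonneg prod_nonneg) auto

lemma nh_config:
  assumes "finite Y" "finite I" "cfg Y I z"
  shows "nh \<phi> (Y \<union> z ` I) w = (\<Prod>v\<in>Y. 1 - \<phi> (w - v)) * (\<Prod>i\<in>I. 1 - \<phi> (w - z i))"
proof -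
  have "Y \<inter> z ` I = {}" "inj_on z I" using assms by (auto simp: cfg_def)
  then show ?thesis unfolding nh_def using assms by (subst prod.union_disjoint) (auto simp: prod.reindex)
qed

lemma component_measurable:
  "i \<in> I \<Longrightarrow> (\<lambda>z. z i) \<in> borel_measurable (Pi\<^sub>M I (\<lambda>_. lborel :: 'a::euclidean_space measure))"
  using measurable_component_singleton[of i I "\<lambda>_. lborel :: 'a measure"] by simp

lemma connw_config_measurable:
  fixes I :: "'b set"
  assumes Y: "finite Y" and I: "finite I" and c: "c \<in> Y"
  shows "(\<lambda>z. if cfg Y I z then connw \<phi> (Y \<union> z ` I) id c else 0) \<in> borel_measurable (Pi\<^sub>M I (\<lambda>_. lborel))"
proof -
  \<comment> \<open>Over the disjoint sum of \<open>Y\<close> and \<open>I\<close> the fixed and the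
    variable points form one family with a fixed index set; it is injective under
    \<open>cfg\<close>, so the weight of the set can be computed on indices.\<close>
  let ?Z = "\<lambda>z. case_sum (\<lambda>v. v) z"
  have eq: "connw \<phi> (Y \<union> z ` I) id c = connw \<phi> (Y <+> I) (?Z z) (Inl c)" if "cfg Y I z" for z
  proof -
    have "inj_on (?Z z) (Y <+> I)" using that by (intro inj_on_case_sum) (auto simp: cfg_def)
    moreover have "?Z z ` (Y <+> I) = Y \<union> z ` I" by (simp add: image_case_sum_Plus)
    ultimately show ?thesis using connw_image[of "?Z z" "Y <+> I" "Inl c" \<phi>] c by auto
  qed
  have "(\<lambda>z. connw \<phi> (Y <+> I) (\<lambda>i. (case i of Inl v \<Rightarrow> (\<lambda>z. v) | Inr j \<Rightarrow> (\<lambda>z. z j)) z) (Inl c)) \<in> borel_measurable (Pi\<^sub>M I (\<lambda>_. lborel))"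
    using Y I by (intro connw_measurable) (auto intro: component_measurable)
  moreover have "(\<lambda>i. (case i of Inl v \<Rightarrow> (\<lambda>z. v) | Inr j \<Rightarrow> (\<lambda>z. z j)) z) = ?Z z" for z :: "'b \<Rightarrow> 'd pt"
    by (auto simp: fun_eq_iff split: sum.splits)
  ultimately have "(\<lambda>z. connw \<phi> (Y <+> I) (?Z z) (Inl c)) \<in> borel_measurable (Pi\<^sub>M I (\<lambda>_. lborel))" by (simp only:)
  then have "(\<lambda>z. if cfg Y I z then connw \<phi> (Y <+> I) (?Z z) (Inl c) else 0) \<in> borel_measurable (Pi\<^sub>M I (\<lambda>_. lborel))"
    using cfg_pred[OF Y I] by (intro measurable_If) (auto simp: pred_def)
  then show ?thesis by (rule measurable_cong[THEN iffD1, rotated]) (simp add: eq)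
qed

lemma nh_config_measurable:
  fixes I :: "'b set"
  assumes Y: "finite Y" and I: "finite I"
  shows "(\<lambda>(z, w). if cfg Y I z then nh \<phi> (Y \<union> z ` I) w else 1) \<in> borel_measurable (Pi\<^sub>M I (\<lambda>_. lborel) \<Otimes>\<^sub>M lborel)"
proof -
  let ?M = "Pi\<^sub>M I (\<lambda>_. lborel) \<Otimes>\<^sub>M lborel :: (('b \<Rightarrow> 'd pt) \<times> 'd pt) measure"
  have comp: "(\<lambda>x. fst x i) \<in> borel_measurable ?M" if "i \<in> I" for i
    by (rule measurable_compose[OF measurable_fst component_measurable[OF that]])
  have [measurable]: "(\<lambda>x. \<phi> (snd x - fst x i)) \<in> borel_measurable ?M" if "i \<in> I" for i
    using comp[OF that] by measurable
  have "(\<lambda>x. (\<Prod>v\<in>Y. 1 - \<phi> (snd x - v)) * (\<Prod>i\<in>I. 1 - \<phi> (snd x - fst x i))) \<in> borel_measurable ?M"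
    by (intro borel_measurable_times borel_measurable_prod borel_measurable_diff) measurable
  moreover have "Measurable.pred ?M (\<lambda>x. cfg Y I (fst x))"
    using measurable_compose[OF measurable_fst cfg_pred[OF Y I]] .
  ultimately have "(\<lambda>x. if cfg Y I (fst x) then (\<Prod>v\<in>Y. 1 - \<phi> (snd x - v)) * (\<Prod>i\<in>I. 1 - \<phi> (snd x - fst x i)) else 1) \<in> borel_measurable ?M"
    by (intro measurable_If) (auto simp: pred_def)
  then show ?thesis
    by (rule measurable_cong[THEN iffD1, rotated]) (auto simp: nh_config[OF Y I])
qed

lemma nh_config_measurable1:
  assumes Y: "finite Y" and I: "finite I"
  shows "(\<lambda>z. if cfg Y I z then nh \<phi> (Y \<union> z ` I) w else 1) \<in> borel_measurable (Pi\<^sub>M I (\<lambda>_. lborel))"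
  using measurable_compose[OF measurable_Pair2' nh_config_measurable[OF Y I], of w] by simp

lemma hvol_config_measurable:
  assumes Y: "finite Y" and I: "finite I"
  shows "(\<lambda>z. if cfg Y I z then hvol \<phi> (Y \<union> z ` I) else 0) \<in> borel_measurable (Pi\<^sub>M I (\<lambda>_. lborel))"
proof -
  note [measurable] = nh_config_measurable[OF Y I]
  have "(\<lambda>z. enn2real (\<integral>\<^sup>+w. ennreal (1 - (if cfg Y I z then nh \<phi> (Y \<union> z ` I) w else 1)) \<partial>lborel)) \<in> borel_measurable (Pi\<^sub>M I (\<lambda>_. lborel))"
    by measurable
  then show ?thesis by (rule measurable_cong[THEN iffD1, rotated]) (simp add: hvol_def)
qed

lemma wt_config_measurable:
  assumes Y: "finite Y" and I: "finite I" and c: "c \<in> Y" and A: "finite A"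
  shows "(\<lambda>z. if cfg Y I z then wt \<phi> c A (Y \<union> z ` I) else 0) \<in> borel_measurable (Pi\<^sub>M I (\<lambda>_. lborel))"
proof -
  have "(\<lambda>z. (if cfg Y I z then connw \<phi> (Y \<union> z ` I) id c else 0) * (\<Prod>v\<in>A. if cfg Y I z then nh \<phi> (Y \<union> z ` I) v else 1))
     \<in> borel_measurable (Pi\<^sub>M I (\<lambda>_. lborel))"
    using Y I c by (intro borel_measurable_times borel_measurable_prod nh_config_measurable1 connw_config_measurable)
  then show ?thesis by (rule measurable_cong[THEN iffD1, rotated]) (simp add: wt_def)
qed

lemma config_N_space:
  assumes Y: "finite Y" and I: "finite I"
  shows "(\<lambda>z. Y \<union> z ` I) \<in> Pi\<^sub>M I (\<lambda>_. lborel) \<rightarrow>\<^sub>M N_space"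
proof -
  have "(\<lambda>z. (\<lambda>i. (case i of Inl v \<Rightarrow> (\<lambda>z. v) | Inr j \<Rightarrow> (\<lambda>z. z j)) z) ` (Y <+> I)) \<in> Pi\<^sub>M I (\<lambda>_. lborel) \<rightarrow>\<^sub>M N_space"
    using Y I by (intro measurable_finite_image_N_space) (auto intro: component_measurable)
  moreover have "(\<lambda>i. (case i of Inl v \<Rightarrow> (\<lambda>z. v) | Inr j \<Rightarrow> (\<lambda>z. z j)) z) ` (Y <+> I) = Y \<union> z ` I" for z
    by (force simp: Plus_def)
  ultimately show ?thesis by simp
qed

lemma animal_integrand_measurable:
  assumes Y: "finite Y" and I: "finite I" and c: "c \<in> Y" and A: "finite A"
    and F: "F \<in> borel_measurable N_space"
  shows "(\<lambda>z. if cfg Y I z then F (Y \<union> z ` I) * ennreal (wt \<phi> c A (Y \<union> z ` I) * exp (- \<tau> * hvol \<phi> (Y \<union> z ` I))) else 0)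
     \<in> borel_measurable (Pi\<^sub>M I (\<lambda>_. lborel))"
proof -
  note [measurable] = wt_config_measurable[OF Y I c A] hvol_config_measurable[OF Y I]
  have "(\<lambda>z. F (Y \<union> z ` I) * ennreal ((if cfg Y I z then wt \<phi> c A (Y \<union> z ` I) else 0) *
      exp (- \<tau> * (if cfg Y I z then hvol \<phi> (Y \<union> z ` I) else 0)))) \<in> borel_measurable (Pi\<^sub>M I (\<lambda>_. lborel))"
    by (intro borel_measurable_times_ennreal measurable_compose[OF config_N_space[OF Y I] F]) measurable
  then show ?thesis by (rule measurable_cong[THEN iffD1, rotated]) simp
qed

lemma decseq_prod:
  fixes a :: "nat \<Rightarrow> real"
  assumes "\<And>j. 0 \<le> a j \<and> a j \<le> 1"
  shows "decseq (\<lambda>n. ennreal (\<Prod>j\<in>A \<inter> {..<n}. a j))"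
proof (rule decseq_SucI)
  fix n
  have "(\<Prod>j\<in>A \<inter> {..<Suc n}. a j) = (if n \<in> A then a n else 1) * (\<Prod>j\<in>A \<inter> {..<n}. a j)"
    by (auto simp: lessThan_Suc Int_insert_right)
  also have "\<dots> \<le> 1 * (\<Prod>j\<in>A \<inter> {..<n}. a j)"
    using assms by (intro mult_right_mono prod_nonneg) auto
  finally show "ennreal (\<Prod>j\<in>A \<inter> {..<Suc n}. a j) \<le> ennreal (\<Prod>j\<in>A \<inter> {..<n}. a j)"
    by (intro ennreal_leI) simp
qed

end

section \<open>The random connection model with thinning\<close>

locale rcm = pois P X J t + kernel \<phi> m
  for P :: "'w measure" and X :: "nat \<Rightarrow> 'w \<Rightarrow> ('d::{finite,linorder}) pt" and J t
    and \<phi> :: "'d pt \<Rightarrow> real" and m +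
  fixes U :: "(nat + nat) \<times> (nat + nat) \<Rightarrow> 'w \<Rightarrow> real" and r0 :: real
  assumes U_indeps: "indep_vars (\<lambda>_. borel) U UNIV"
    and U_uniform: "\<And>p. distr P borel (U p) = uniform_measure lborel {0..1}"
    and XU_indep: "distr P (Pi\<^sub>M UNIV (\<lambda>_. borel) \<Otimes>\<^sub>M Pi\<^sub>M UNIV (\<lambda>_. borel)) (\<lambda>\<omega>. (\<lambda>j. X j \<omega>, \<lambda>p. U p \<omega>)) =
        distr P (Pi\<^sub>M UNIV (\<lambda>_. borel)) (\<lambda>\<omega> j. X j \<omega>) \<Otimes>\<^sub>M distr P (Pi\<^sub>M UNIV (\<lambda>_. borel)) (\<lambda>\<omega> p. U p \<omega>)"
    and r0: "0 \<le> r0 \<and> r0 \<le> 1"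
begin

text \<open>Added points are always retained, Poisson points with probability \<open>r0\<close>; the
  retained points then behave like a process of intensity \<open>r0 * t\<close>.\<close>

definition rho :: "nat + nat \<Rightarrow> real" where
  "rho i = case_sum (\<lambda>_. 1) (\<lambda>_. r0) i"

sublocale marks P U \<phi> rho
  by unfold_locales (use U_indeps U_uniform \<phi>_measurable \<phi>_range \<phi>_symm r0 in \<open>auto simp: rho_def split: sum.splits\<close>)

definition locs :: "(nat \<rightharpoonup> 'd pt) \<Rightarrow> (nat \<Rightarrow> 'd pt) \<Rightarrow> nat + nat \<Rightarrow> 'd pt" where
  "locs y x = case_sum (\<lambda>i. the (y i)) x"

definition vset :: "(nat \<rightharpoonup> 'd pt) \<Rightarrow> (nat + nat) set" where
  "vset y = dom y <+> J"

definition rcluster :: "(nat \<rightharpoonup> 'd pt) \<Rightarrow> nat \<Rightarrow> (nat \<Rightarrow> 'd pt) \<Rightarrow> ((nat + nat) \<times> (nat + nat) \<Rightarrow> real) \<Rightarrow> (nat + nat) set" where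
  "rcluster y r x u = icomp \<phi> rho (vset y) (locs y x) u (Inl r)"

text \<open>The joint law of positions and marks is a product, so Tonelli allows averaging over the
  marks with the positions held fixed.\<close>

lemma nn_integral_decouple:
  fixes H :: "(nat \<Rightarrow> 'd pt) \<Rightarrow> ((nat + nat) \<times> (nat + nat) \<Rightarrow> real) \<Rightarrow> ennreal"
  assumes H: "(\<lambda>(x, u). H x u) \<in> borel_measurable (Pi\<^sub>M UNIV (\<lambda>_. borel) \<Otimes>\<^sub>M Pi\<^sub>M UNIV (\<lambda>_. borel))"
  shows "(\<integral>\<^sup>+\<omega>. H (\<lambda>j. X j \<omega>) (\<lambda>p. U p \<omega>) \<partial>P) = (\<integral>\<^sup>+\<omega>. \<integral>\<^sup>+\<omega>'. H (\<lambda>j. X j \<omega>) (\<lambda>p. U p \<omega>') \<partial>P \<partial>P)"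
proof -
  let ?PX = "Pi\<^sub>M UNIV (\<lambda>_. borel) :: (nat \<Rightarrow> 'd pt) measure"
  let ?PU = "Pi\<^sub>M UNIV (\<lambda>_. borel) :: ((nat + nat) \<times> (nat + nat) \<Rightarrow> real) measure"
  have X: "(\<lambda>\<omega> j. X j \<omega>) \<in> P \<rightarrow>\<^sub>M ?PX" by (rule measurable_PiM_single') auto
  have U: "(\<lambda>\<omega> p. U p \<omega>) \<in> P \<rightarrow>\<^sub>M ?PU" by (rule measurable_PiM_single') auto
  interpret DU: prob_space "distr P ?PU (\<lambda>\<omega> p. U p \<omega>)" by (rule prob_space_distr[OF U])
  have H': "(\<lambda>(x, u). H x u) \<in> borel_measurable (distr P ?PX (\<lambda>\<omega> j. X j \<omega>) \<Otimes>\<^sub>M distr P ?PU (\<lambda>\<omega> p. U p \<omega>))"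
    using H by (simp cong: measurable_cong_sets sets_pair_measure_cong)
  have "(\<integral>\<^sup>+\<omega>. H (\<lambda>j. X j \<omega>) (\<lambda>p. U p \<omega>) \<partial>P) =
     (\<integral>\<^sup>+z. (\<lambda>(x, u). H x u) z \<partial>distr P (?PX \<Otimes>\<^sub>M ?PU) (\<lambda>\<omega>. (\<lambda>j. X j \<omega>, \<lambda>p. U p \<omega>)))"
    using X U H by (subst nn_integral_distr) auto
  also have "\<dots> = (\<integral>\<^sup>+x. \<integral>\<^sup>+u. H x u \<partial>distr P ?PU (\<lambda>\<omega> p. U p \<omega>) \<partial>distr P ?PX (\<lambda>\<omega> j. X j \<omega>))"
    unfolding XU_indep using DU.nn_integral_fst[OF H'] by simp
  also have "\<dots> = (\<integral>\<^sup>+\<omega>. \<integral>\<^sup>+u. H (\<lambda>j. X j \<omega>) u \<partial>distr P ?PU (\<lambda>\<omega> p. U p \<omega>) \<partial>P)"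
  proof (rule nn_integral_distr[OF X])
    show "(\<lambda>x. \<integral>\<^sup>+u. H x u \<partial>distr P ?PU (\<lambda>\<omega> p. U p \<omega>)) \<in> borel_measurable (distr P ?PX (\<lambda>\<omega> j. X j \<omega>))"
      using DU.borel_measurable_nn_integral[of "H" ?PX] H by (simp cong: measurable_cong_sets sets_pair_measure_cong)
  qed
  also have "\<dots> = (\<integral>\<^sup>+\<omega>. \<integral>\<^sup>+\<omega>'. H (\<lambda>j. X j \<omega>) (\<lambda>p. U p \<omega>') \<partial>P \<partial>P)"
  proof (rule nn_integral_cong)
    fix \<omega>
    have "(\<lambda>u. H (\<lambda>j. X j \<omega>) u) \<in> borel_measurable ?PU"
      using measurable_compose_Pair1[OF _ H, of "\<lambda>j. X j \<omega>"] by (simp add: space_PiM)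
    then show "(\<integral>\<^sup>+u. H (\<lambda>j. X j \<omega>) u \<partial>distr P ?PU (\<lambda>\<omega> p. U p \<omega>)) = (\<integral>\<^sup>+\<omega>'. H (\<lambda>j. X j \<omega>) (\<lambda>p. U p \<omega>') \<partial>P)"
      by (subst nn_integral_distr[OF U]) simp_all
  qed
  finally show ?thesis .
qed

text \<open>Campbell's formula for one point: a finite set has Lebesgue measure zero, so the
  expected number of points in it is zero.\<close>

lemma X_avoids:
  assumes Y: "finite Y"
  shows "AE \<omega> in P. \<forall>j\<in>J. X j \<omega> \<notin> Y"
proof -
  interpret L: product_sigma_finite "\<lambda>_::nat. lborel :: 'd pt measure" by standard
  have [measurable]: "Y \<in> sets borel" using Y by (rule borel_closed[OF finite_imp_closed])
  define h where "h \<omega> = (\<integral>\<^sup>+i. indicator Y (X (i 0) \<omega>) \<partial>count_space (Inj {0::nat} J))" for \<omega>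
  have h: "h \<in> borel_measurable P"
    unfolding h_def by (rule borel_measurable_nn_integral_count) auto
  have f: "(\<lambda>z. indicator Y (z 0) :: ennreal) \<in> borel_measurable (Pi\<^sub>M {0::nat} (\<lambda>_. lborel))"
    using component_measurable[of 0 "{0::nat}"] by measurable
  have "(\<integral>\<^sup>+\<omega>. \<integral>\<^sup>+i. indicator Y ((\<lambda>l\<in>{0::nat}. X (i l) \<omega>) 0) \<partial>count_space (Inj {0::nat} J) \<partial>P) =
     ennreal t ^ card {0::nat} * (\<integral>\<^sup>+z. indicator Y (z 0) \<partial>Pi\<^sub>M {0::nat} (\<lambda>_. lborel))"
    by (rule camp[OF _ f]) simp
  also have "(\<integral>\<^sup>+z. indicator Y (z 0) \<partial>Pi\<^sub>M {0::nat} (\<lambda>_. lborel)) = emeasure lborel Y"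
    by (subst L.product_nn_integral_singleton) auto
  also have "\<dots> = 0" using Y by (intro emeasure_lborel_countable countable_finite)
  finally have "(\<integral>\<^sup>+\<omega>. h \<omega> \<partial>P) = 0" by (simp add: h_def)
  then have "AE \<omega> in P. h \<omega> = 0" using nn_integral_0_iff_AE[OF h] by blast
  then show ?thesis
  proof eventually_elim
    fix \<omega> assume "h \<omega> = 0"
    then have z: "indicator Y (X (i 0) \<omega>) = (0 :: ennreal)" if "i \<in> Inj {0::nat} J" for i
      using that unfolding h_def by (simp add: nn_integral_0_iff_AE AE_count_space)
    show "\<forall>j\<in>J. X j \<omega> \<notin> Y"
    proof
      fix j assume "j \<in> J"
      then have "(\<lambda>l\<in>{0::nat}. j) \<in> Inj {0} J" by (auto simp: Inj_def)
      from z[OF this] show "X j \<omega> \<notin> Y" by (auto simp: indicator_def split: if_splits)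
    qed
  qed
qed

text \<open>A finite vertex set consists of its added points \<open>K\<close> and a finite set of
  Poisson indices. The latter is summed as ordered tuples divided by \<open>k!\<close>, to fit
  Campbell's formula.\<close>

lemma nn_integral_finite_sets_Plus:
  fixes h :: "(nat + nat) set \<Rightarrow> ennreal"
  assumes D: "finite D"
  shows "(\<integral>\<^sup>+S. h S \<partial>count_space {S. finite S \<and> S \<subseteq> D <+> J \<and> Inl r \<in> S}) =
    (\<Sum>K\<in>{K \<in> Pow D. r \<in> K}. \<Sum>k. (\<integral>\<^sup>+i. h (K <+> i ` {..<k}) \<partial>count_space (Inj {..<k} J)) / fact k)"
proof -
  let ?S = "{S. finite S \<and> S \<subseteq> D <+> J \<and> Inl r \<in> S}" and ?K = "{K \<in> Pow D. r \<in> K}"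
  have "(\<integral>\<^sup>+S. h S \<partial>count_space ?S) = (\<integral>\<^sup>+S. (\<Sum>K\<in>?K. h S * indicator {K} (Inl -` S)) \<partial>count_space ?S)"
  proof (rule nn_integral_cong)
    fix S assume "S \<in> space (count_space ?S)"
    then have "Inl -` S \<in> ?K" by auto
    moreover have "(\<Sum>K\<in>?K. h S * indicator {K} (Inl -` S)) = (\<Sum>K\<in>?K. if Inl -` S = K then h S else 0)"
      by (intro sum.cong) (auto simp: indicator_def)
    ultimately show "h S = (\<Sum>K\<in>?K. h S * indicator {K} (Inl -` S))"
      using D by (simp add: sum.delta)
  qed
  also have "\<dots> = (\<Sum>K\<in>?K. \<integral>\<^sup>+S. h S * indicator {K} (Inl -` S) \<partial>count_space ?S)"
    by (rule nn_integral_sum) simp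
  also have "\<dots> = (\<Sum>K\<in>?K. \<Sum>k. (\<integral>\<^sup>+i. h (K <+> i ` {..<k}) \<partial>count_space (Inj {..<k} J)) / fact k)"
  proof (rule sum.cong[OF refl])
    fix K assume K: "K \<in> ?K"
    let ?SK = "{S \<in> ?S. Inl -` S = K}" and ?G = "{G. finite G \<and> G \<subseteq> J}"
    have fK: "finite K" using K D finite_subset by blast
    have bij: "bij_betw (\<lambda>G. K <+> G) ?G ?SK"
    proof (rule bij_betwI[where g = "\<lambda>S. Inr -` S"])
      show "(\<lambda>G. K <+> G) \<in> ?G \<rightarrow> ?SK" using K fK by auto
      show "(\<lambda>S. Inr -` S) \<in> ?SK \<rightarrow> ?G" by (auto intro: finite_vimageI)
      show "K <+> Inr -` S = S" if "S \<in> ?SK" for S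
      proof (intro set_eqI)
        fix x show "x \<in> K <+> Inr -` S \<longleftrightarrow> x \<in> S" using that by (cases x) auto
      qed
    qed auto
    have "(\<integral>\<^sup>+S. h S * indicator {K} (Inl -` S) \<partial>count_space ?S) = (\<integral>\<^sup>+S. h S * indicator {K} (Inl -` S) \<partial>count_space ?SK)"
      by (rule nn_integral_count_space_eq) (auto simp: indicator_def)
    also have "\<dots> = (\<integral>\<^sup>+S. h S \<partial>count_space ?SK)"
      by (rule nn_integral_cong) auto
    also have "\<dots> = (\<integral>\<^sup>+G. h (K <+> G) \<partial>count_space ?G)"
      by (rule nn_integral_bij_count_space[OF bij, symmetric])
    also have "\<dots> = (\<Sum>k. (\<integral>\<^sup>+i. h (K <+> i ` {..<k}) \<partial>count_space (Inj {..<k} J)) / fact k)"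
      by (rule sum_Inj_tuples[symmetric])
    finally show "(\<integral>\<^sup>+S. h S * indicator {K} (Inl -` S) \<partial>count_space ?S) =
      (\<Sum>k. (\<integral>\<^sup>+i. h (K <+> i ` {..<k}) \<partial>count_space (Inj {..<k} J)) / fact k)" .
  qed
  finally show ?thesis .
qed

text \<open>Infinite components contribute 0; that they have probability zero is deduced later from
  the total mass of the expansion.\<close>

definition \<Phi> :: "('d pt set \<Rightarrow> ennreal) \<Rightarrow> (nat \<rightharpoonup> 'd pt) \<Rightarrow> nat \<Rightarrow> (nat \<Rightarrow> 'd pt) \<Rightarrow> ((nat + nat) \<times> (nat + nat) \<Rightarrow> real) \<Rightarrow> ennreal" where
  "\<Phi> F y r x u = (if finite (rcluster y r x u) then F (locs y x ` rcluster y r x u) else 0)"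

lemma \<Phi>_expand:
  assumes "r \<in> dom y"
  shows "\<Phi> F y r x u = (\<integral>\<^sup>+S. F (locs y x ` S) * indicator {S} (rcluster y r x u) \<partial>count_space {S. finite S \<and> S \<subseteq> vset y \<and> Inl r \<in> S})"
proof (cases "finite (rcluster y r x u)")
  case True
  have sub: "rcluster y r x u \<subseteq> vset y" "Inl r \<in> rcluster y r x u"
  proof -
    have "Inl r \<in> vset y" using assms by (auto simp: vset_def)
    from icomp_subset[OF this] show "rcluster y r x u \<subseteq> vset y" unfolding rcluster_def .
  qed (simp add: rcluster_def)
  have "(\<integral>\<^sup>+S. F (locs y x ` S) * indicator {S} (rcluster y r x u) \<partial>count_space {S. finite S \<and> S \<subseteq> vset y \<and> Inl r \<in> S}) =
    (\<integral>\<^sup>+S. F (locs y x ` rcluster y r x u) * indicator {rcluster y r x u} S \<partial>count_space {S. finite S \<and> S \<subseteq> vset y \<and> Inl r \<in> S})"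
    by (intro nn_integral_cong) (auto split: split_indicator)
  also have "\<dots> = F (locs y x ` rcluster y r x u)"
    using True sub by (subst nn_integral_cmult_indicator) auto
  finally show ?thesis using True by (simp add: \<Phi>_def)
next
  case False
  then have "(\<integral>\<^sup>+S. F (locs y x ` S) * indicator {S} (rcluster y r x u) \<partial>count_space {S. finite S \<and> S \<subseteq> vset y \<and> Inl r \<in> S}) =
    (\<integral>\<^sup>+S. 0 \<partial>count_space {S. finite S \<and> S \<subseteq> vset y \<and> Inl r \<in> S})"
    by (intro nn_integral_cong) (auto split: split_indicator)
  with False show ?thesis by (simp add: \<Phi>_def)
qed

lemma countable_finite_vsets [simp]: "countable {S. finite S \<and> S \<subseteq> vset y \<and> Inl r \<in> S}"
  by (rule countable_subset[OF _ countable_Collect_finite]) auto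

lemma locs_measurable: "(\<lambda>z. locs y (fst z) i) \<in> borel_measurable (Pi\<^sub>M UNIV (\<lambda>_. borel) \<Otimes>\<^sub>M N)"
proof -
  have "(\<lambda>z. fst z j) \<in> borel_measurable (Pi\<^sub>M UNIV (\<lambda>_::nat. borel :: 'd pt measure) \<Otimes>\<^sub>M N)" for j
    by (rule measurable_compose[OF measurable_fst measurable_component_singleton]) simp
  then show ?thesis by (cases i) (simp_all add: locs_def)
qed

lemma \<Phi>_measurable:
  assumes F: "F \<in> borel_measurable N_space" and r: "r \<in> dom y"
  shows "(\<lambda>(x, u). \<Phi> F y r x u) \<in> borel_measurable (Pi\<^sub>M UNIV (\<lambda>_. borel) \<Otimes>\<^sub>M Pi\<^sub>M UNIV (\<lambda>_. borel))"
proof -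
  let ?M = "Pi\<^sub>M UNIV (\<lambda>_. borel) \<Otimes>\<^sub>M Pi\<^sub>M UNIV (\<lambda>_. borel)"
  have u: "(\<lambda>z. snd z p) \<in> borel_measurable (Pi\<^sub>M UNIV (\<lambda>_. borel) \<Otimes>\<^sub>M Pi\<^sub>M UNIV (\<lambda>_. borel :: real measure))" for p :: "(nat + nat) \<times> (nat + nat)"
    by (rule measurable_compose[OF measurable_snd measurable_component_singleton]) simp
  have "(\<lambda>z. \<Phi> F y r (fst z) (snd z)) \<in> borel_measurable ?M"
    unfolding \<Phi>_expand[OF r]
  proof (rule borel_measurable_nn_integral_count, simp)
    fix S assume "S \<in> {S. finite S \<and> S \<subseteq> vset y \<and> Inl r \<in> S}"
    then have S: "finite S" by simp
    have "(\<lambda>z. F (locs y (fst z) ` S)) \<in> borel_measurable ?M"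
      using S by (intro measurable_compose[OF measurable_finite_image_N_space F] locs_measurable) auto
    moreover have "Measurable.pred ?M (\<lambda>z. rcluster y r (fst z) (snd z) = S)"
      unfolding rcluster_def
      using pred_icomp_eq[where Z = "\<lambda>i z. locs y (fst z) i" and U = "\<lambda>p z. snd z p" and \<rho> = rho and I = "vset y" and r = "Inl r" and S = S,
          OF \<phi>_measurable locs_measurable u] by simp
    ultimately show "(\<lambda>z. F (locs y (fst z) ` S) * indicator {S} (rcluster y r (fst z) (snd z))) \<in> borel_measurable ?M"
      unfolding indicator_def of_bool_def by (intro borel_measurable_times_ennreal measurable_If) (auto simp: pred_def)
  qed
  then show ?thesis by (simp add: case_prod_beta')
qed

end

context rcm
begin

theorem animal_formula:
  assumes F: "F \<in> borel_measurable N_space" and y: "finite (dom y)" "inj_on (\<lambda>i. the (y i)) (dom y)" and r: "r \<in> dom y"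
  shows "(\<integral>\<^sup>+\<omega>. \<Phi> F y r (\<lambda>j. X j \<omega>) (\<lambda>p. U p \<omega>) \<partial>P) =
    (\<Sum>K\<in>{K \<in> Pow (dom y). r \<in> K}. animal \<phi> (r0 * t) (the (y r)) ((\<lambda>i. the (y i)) ` K) ((\<lambda>i. the (y i)) ` (dom y - K)) F)"
proof -
  let ?y = "\<lambda>i. the (y i)"
  let ?KK = "{K \<in> Pow (dom y). r \<in> K}"
  let ?c = "the (y r)"
  have fKK: "finite ?KK" using y(1) by simp
  define SS where "SS K k z = ?y ` K \<union> z ` {..<k}" for K and k :: nat and z :: "nat \<Rightarrow> 'd pt"
  \<comment> \<open>\<open>f\<close> carries the connection weight and the retention of the cluster
    points, \<open>u\<close> is the probability that a further Poisson point is retained and linked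
    to the cluster, and \<open>V\<close> is the integral of \<open>u\<close>. All three vanish
    outside \<open>cfg\<close>.\<close>
  define f where "f K k z = (if cfg (?y ` K) {..<k} z then F (SS K k z) * ennreal (r0 ^ k * wt \<phi> ?c (?y ` (dom y - K)) (SS K k z)) else 0)" for K k z
  define u where "u K k z w = (if cfg (?y ` K) {..<k} z then r0 * (1 - nh \<phi> (SS K k z) w) else 0)" for K k z w
  define V where "V K k z = (if cfg (?y ` K) {..<k} z then r0 * hvol \<phi> (SS K k z) else 0)" for K k z
  define Xi where "Xi k i \<omega> = (\<lambda>l\<in>{..<k::nat}. X (i l) \<omega>)" for k i \<omega>
  define IN where "IN K k i \<omega> = (INF n. ennreal (\<Prod>j\<in>(J - i ` {..<k}) \<inter> {..<n}. 1 - u K k (Xi k i \<omega>) (X j \<omega>)))" for K k i \<omega>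
  have KD: "K \<subseteq> dom y" "r \<in> K" "finite K" "finite (?y ` K)" "?c \<in> ?y ` K" if "K \<in> ?KK" for K
    using that y(1) finite_subset by auto
  have f_meas: "f K k \<in> borel_measurable (Pi\<^sub>M {..<k} (\<lambda>_. lborel))" if "K \<in> ?KK" for K k
  proof -
    have "(\<lambda>z. (if cfg (?y ` K) {..<k} z then 1 else 0) * F (SS K k z) *
        ennreal (r0 ^ k * (if cfg (?y ` K) {..<k} z then wt \<phi> ?c (?y ` (dom y - K)) (?y ` K \<union> z ` {..<k}) else 0))) \<in> borel_measurable (Pi\<^sub>M {..<k} (\<lambda>_. lborel))"
      unfolding SS_def using KD[OF that] y(1) cfg_pred[of "?y ` K" "{..<k}"]
      by (intro borel_measurable_times_ennreal measurable_If measurable_compose[OF config_N_space F]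
          measurable_compose[OF _ measurable_ennreal] borel_measurable_times wt_config_measurable) (auto simp: pred_def)
    then show ?thesis
      by (rule measurable_cong[THEN iffD1, rotated]) (simp add: f_def SS_def)
  qed
  have u_meas: "(\<lambda>(z, w). u K k z w) \<in> borel_measurable (Pi\<^sub>M {..<k} (\<lambda>_. lborel) \<Otimes>\<^sub>M lborel)" if "K \<in> ?KK" for K k
  proof -
    have "(\<lambda>x. r0 * (1 - (case x of (z, w) \<Rightarrow> if cfg (?y ` K) {..<k} z then nh \<phi> (?y ` K \<union> z ` {..<k}) w else 1))) \<in> borel_measurable (Pi\<^sub>M {..<k} (\<lambda>_. lborel) \<Otimes>\<^sub>M lborel)"
      using KD[OF that] by (intro borel_measurable_times borel_measurable_diff nh_config_measurable) auto
    then show ?thesis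
      by (rule measurable_cong[THEN iffD1, rotated]) (auto simp: u_def SS_def)
  qed
  have u01: "0 \<le> u K k z w \<and> u K k z w \<le> 1" for K k z w
    using r0 nh_range[of "SS K k z" w] by (auto simp: u_def intro: mult_le_one)
  have fSS: "finite (SS K k z)" if "K \<in> ?KK" for K k z using KD[OF that] by (simp add: SS_def)
  have V_eq: "(\<integral>\<^sup>+w. ennreal (u K k z w) \<partial>lborel) = ennreal (V K k z)" if "K \<in> ?KK" for K k z
  proof (cases "cfg (?y ` K) {..<k} z")
    case True
    have "(\<integral>\<^sup>+w. ennreal (u K k z w) \<partial>lborel) = (\<integral>\<^sup>+w. ennreal r0 * ennreal (1 - nh \<phi> (SS K k z) w) \<partial>lborel)"
      using True r0 by (intro nn_integral_cong) (simp add: u_def ennreal_mult')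
    also have "\<dots> = ennreal r0 * (\<integral>\<^sup>+w. ennreal (1 - nh \<phi> (SS K k z) w) \<partial>lborel)"
      by (rule nn_integral_cmult) measurable
    also have "\<dots> = ennreal (V K k z)"
      using True r0 by (simp add: V_def nn_integral_hvol[OF fSS[OF that]] ennreal_mult')
    finally show ?thesis .
  qed (simp add: u_def V_def)
  \<comment> \<open>\<open>void_formula\<close> asks for a bound on \<open>V\<close>; for fixed
    \<open>K\<close> and \<open>k\<close> the number of points provides one.\<close>
  have V_bd: "0 \<le> V K k z \<and> V K k z \<le> (real (card K) + real k) * m" if "K \<in> ?KK" for K k z
  proof (cases "cfg (?y ` K) {..<k} z")
    case True
    have "card (SS K k z) \<le> card (?y ` K) + card (z ` {..<k})" unfolding SS_def by (rule card_Un_le)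
    also have "\<dots> \<le> card K + k"
      using card_image_le[OF KD(3)[OF that], of ?y] card_image_le[of "{..<k}" z] by simp
    finally have "real (card (SS K k z)) * m \<le> (real (card K) + real k) * m"
      using m_nonneg by (intro mult_right_mono) (auto simp flip: of_nat_add)
    moreover have "0 \<le> hvol \<phi> (SS K k z)" "hvol \<phi> (SS K k z) \<le> real (card (SS K k z)) * m"
      using hvol_bounds[OF fSS[OF that]] by auto
    moreover have "r0 * hvol \<phi> (SS K k z) \<le> 1 * hvol \<phi> (SS K k z)"
      using r0 calculation by (intro mult_right_mono) auto
    ultimately show ?thesis using r0 True by (simp add: V_def)
  qed (use m_nonneg in \<open>simp add: V_def\<close>)
  have void: "(\<integral>\<^sup>+\<omega>. \<integral>\<^sup>+i. f K k (Xi k i \<omega>) * IN K k i \<omega> \<partial>count_space (Inj {..<k} J) \<partial>P) =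
      ennreal t ^ k * (\<integral>\<^sup>+z. f K k z * ennreal (exp (- t * V K k z)) \<partial>Pi\<^sub>M {..<k} (\<lambda>_. lborel))" if "K \<in> ?KK" for K k
    unfolding IN_def Xi_def using that
    by (intro void_formula[where u = "u K k" and c = "(real (card K) + real k) * m"] f_meas u_meas u01 V_eq V_bd)
  have pointwise: "AE \<omega> in P. (\<integral>\<^sup>+\<omega>'. \<Phi> F y r (\<lambda>j. X j \<omega>) (\<lambda>p. U p \<omega>') \<partial>P) =
     (\<Sum>K\<in>?KK. \<Sum>k. (\<integral>\<^sup>+i. f K k (Xi k i \<omega>) * IN K k i \<omega> \<partial>count_space (Inj {..<k} J)) / fact k)"
    using X_inj X_avoids[OF finite_imageI[OF y(1)], of ?y]
  proof eventually_elim
    fix \<omega> assume inj: "inj_on (\<lambda>j. X j \<omega>) J" and av: "\<forall>j\<in>J. X j \<omega> \<notin> ?y ` dom y"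
    let ?x = "\<lambda>j. X j \<omega>"
    let ?Z = "locs y ?x"
    have injZ: "inj_on ?Z (vset y)"
      unfolding vset_def locs_def using y(2) inj
    proof (rule inj_on_case_sum)
      show "?y ` dom y \<inter> ?x ` J = {}"
      proof (rule equals0I)
        fix p assume p: "p \<in> ?y ` dom y \<inter> ?x ` J"
        then obtain j where j: "j \<in> J" "p = X j \<omega>" by (elim IntE imageE)
        then have "p \<notin> ?y ` dom y" using av by simp
        with p show False by (elim IntE notE)
      qed
    qed
    define h where "h S = F (?Z ` S) * emeasure P {\<omega>'\<in>space P. rcluster y r ?x (\<lambda>p. U p \<omega>') = S}" for S
    have "(\<integral>\<^sup>+\<omega>'. \<Phi> F y r ?x (\<lambda>p. U p \<omega>') \<partial>P) =
      (\<integral>\<^sup>+S. \<integral>\<^sup>+\<omega>'. F (?Z ` S) * indicator {S} (rcluster y r ?x (\<lambda>p. U p \<omega>')) \<partial>P \<partial>count_space {S. finite S \<and> S \<subseteq> vset y \<and> Inl r \<in> S})"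
      unfolding \<Phi>_expand[OF r]
    proof (rule nn_integral_count_space_nn_integral)
      fix S assume "S \<in> {S. finite S \<and> S \<subseteq> vset y \<and> Inl r \<in> S}"
      have "Measurable.pred P (\<lambda>\<omega>'. rcluster y r ?x (\<lambda>p. U p \<omega>') = S)"
        unfolding rcluster_def using pred_icomp_eq[of \<phi> "vset y" "\<lambda>i _. ?Z i" P U rho "Inl r" S] by simp
      then show "(\<lambda>\<omega>'. F (?Z ` S) * indicator {S} (rcluster y r ?x (\<lambda>p. U p \<omega>'))) \<in> borel_measurable P"
        unfolding indicator_def of_bool_def by (intro borel_measurable_times_ennreal measurable_If) (auto simp: pred_def)
    qed simp
    also have "\<dots> = (\<integral>\<^sup>+S. h S \<partial>count_space {S. finite S \<and> S \<subseteq> vset y \<and> Inl r \<in> S})"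
    proof (rule nn_integral_cong)
      fix S
      have "{\<omega>'\<in>space P. rcluster y r ?x (\<lambda>p. U p \<omega>') = S} \<in> sets P"
        unfolding rcluster_def using pred_icomp_eq[of \<phi> "vset y" "\<lambda>i _. ?Z i" P U rho "Inl r" S] by (simp add: pred_def)
      then have "h S = (\<integral>\<^sup>+\<omega>'. F (?Z ` S) * indicator {\<omega>'\<in>space P. rcluster y r ?x (\<lambda>p. U p \<omega>') = S} \<omega>' \<partial>P)"
        unfolding h_def by (rule nn_integral_cmult_indicator[symmetric])
      also have "\<dots> = (\<integral>\<^sup>+\<omega>'. F (?Z ` S) * indicator {S} (rcluster y r ?x (\<lambda>p. U p \<omega>')) \<partial>P)"
        by (intro nn_integral_cong) (auto simp: indicator_def)
      finally show "(\<integral>\<^sup>+\<omega>'. F (?Z ` S) * indicator {S} (rcluster y r ?x (\<lambda>p. U p \<omega>')) \<partial>P) = h S" ..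
    qed
    also have "\<dots> = (\<Sum>K\<in>?KK. \<Sum>k. (\<integral>\<^sup>+i. h (K <+> i ` {..<k}) \<partial>count_space (Inj {..<k} J)) / fact k)"
      unfolding vset_def by (rule nn_integral_finite_sets_Plus[OF y(1)])
    also have "\<dots> = (\<Sum>K\<in>?KK. \<Sum>k. (\<integral>\<^sup>+i. f K k (Xi k i \<omega>) * IN K k i \<omega> \<partial>count_space (Inj {..<k} J)) / fact k)"
    proof (intro sum.cong refl suminf_cong arg_cong2[where f = "(/)"] nn_integral_cong)
      fix K and k :: nat and i assume K: "K \<in> ?KK" and "i \<in> space (count_space (Inj {..<k} J))"
      then have i: "i \<in> {..<k} \<rightarrow>\<^sub>E J" "inj_on i {..<k}" by (auto simp: Inj_def)
      note KD = KD[OF K]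
      let ?S = "K <+> i ` {..<k}" and ?z = "Xi k i \<omega>"
      let ?A = "J - i ` {..<k}"
      have iJ: "i ` {..<k} \<subseteq> J" using i(1) by auto
      have S: "finite ?S" "Inl r \<in> ?S" "?S \<subseteq> vset y" using KD iJ by (auto simp: vset_def)
      have ZS: "?Z ` ?S = SS K k ?z"
        unfolding locs_def image_case_sum_Plus SS_def Xi_def image_image by simp
      have cf: "cfg (?y ` K) {..<k} ?z"
      proof -
        have "inj_on ?z {..<k}"
          using i iJ inj unfolding Xi_def by (auto simp: inj_on_def PiE_iff)
        moreover have "?z l \<notin> ?y ` K" if "l < k" for l
        proof -
          have "i l \<in> J" using that i(1) by (auto simp: PiE_iff)
          then have "X (i l) \<omega> \<notin> ?y ` dom y" using av by blast
          then show ?thesis using KD(1) that by (simp add: Xi_def) blast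
        qed
        ultimately show ?thesis by (auto simp: cfg_def)
      qed
      \<comment> \<open>Windows exhausting the vertices outside the component. The added points
        outside \<open>K\<close> belong to every window, so their factors do not depend on
        \<open>n\<close>.\<close>
      define W where "W n = (dom y - K) <+> (?A \<inter> {..<n})" for n :: nat
      have W: "finite (W n)" "incseq W" "(\<Union>n. W n) = vset y - ?S" for n
        using y(1) by (auto simp: W_def vset_def intro!: incseq_SucI)
      have "emeasure P {\<omega>'\<in>space P. rcluster y r ?x (\<lambda>p. U p \<omega>') = ?S} =
        ennreal ((\<Prod>i\<in>?S. rho i) * connw \<phi> ?S ?Z (Inl r)) * (INF n. ennreal (\<Prod>w\<in>W n. 1 - rho w * (1 - nh \<phi> (?Z ` ?S) (?Z w))))"
        unfolding rcluster_def using S W injZ by (intro component_law) (auto simp: rho_def)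
      also have "(\<Prod>i\<in>?S. rho i) = r0 ^ k"
        using KD(3) i(2) by (simp add: prod.Plus rho_def card_image)
      also have "connw \<phi> ?S ?Z (Inl r) = connw \<phi> (SS K k ?z) id ?c"
        using connw_image[OF inj_on_subset[OF injZ S(3)] S(2), of \<phi>] unfolding ZS by (simp add: locs_def)
      also have "(INF n. ennreal (\<Prod>w\<in>W n. 1 - rho w * (1 - nh \<phi> (?Z ` ?S) (?Z w)))) =
         (INF n. ennreal (\<Prod>v\<in>?y ` (dom y - K). nh \<phi> (SS K k ?z) v) * ennreal (\<Prod>j\<in>?A \<inter> {..<n}. 1 - u K k ?z (X j \<omega>)))"
      proof (intro INF_cong refl)
        fix n
        have "(\<Prod>w\<in>W n. 1 - rho w * (1 - nh \<phi> (?Z ` ?S) (?Z w))) =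
           (\<Prod>l\<in>dom y - K. nh \<phi> (SS K k ?z) (?y l)) * (\<Prod>j\<in>?A \<inter> {..<n}. 1 - r0 * (1 - nh \<phi> (SS K k ?z) (X j \<omega>)))"
          unfolding W_def ZS using y(1) by (subst prod.Plus) (auto simp: rho_def locs_def)
        also have "(\<Prod>l\<in>dom y - K. nh \<phi> (SS K k ?z) (?y l)) = (\<Prod>v\<in>?y ` (dom y - K). nh \<phi> (SS K k ?z) v)"
          by (subst prod.reindex) (use y(2) in \<open>auto intro: inj_on_subset\<close>)
        finally show "ennreal (\<Prod>w\<in>W n. 1 - rho w * (1 - nh \<phi> (?Z ` ?S) (?Z w))) =
          ennreal (\<Prod>v\<in>?y ` (dom y - K). nh \<phi> (SS K k ?z) v) * ennreal (\<Prod>j\<in>?A \<inter> {..<n}. 1 - u K k ?z (X j \<omega>))"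
          using cf nh_range by (simp add: u_def ennreal_mult' prod_nonneg)
      qed
      also have "\<dots> = ennreal (\<Prod>v\<in>?y ` (dom y - K). nh \<phi> (SS K k ?z) v) * IN K k i \<omega>"
        unfolding IN_def using u01 by (intro INF_cmult_decseq decseq_prod) auto
      also have "ennreal (r0 ^ k * connw \<phi> (SS K k ?z) id ?c) * (ennreal (\<Prod>v\<in>?y ` (dom y - K). nh \<phi> (SS K k ?z) v) * IN K k i \<omega>) =
        ennreal (r0 ^ k * wt \<phi> ?c (?y ` (dom y - K)) (SS K k ?z)) * IN K k i \<omega>"
      proof -
        have c0: "0 \<le> connw \<phi> (SS K k ?z) id ?c" by (rule connw_nonneg[OF \<phi>_range])
        have p0: "0 \<le> (\<Prod>v\<in>?y ` (dom y - K). nh \<phi> (SS K k ?z) v)" using nh_range by (intro prod_nonneg) auto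
        have "ennreal (r0 ^ k * wt \<phi> ?c (?y ` (dom y - K)) (SS K k ?z)) =
          ennreal (r0 ^ k * connw \<phi> (SS K k ?z) id ?c) * ennreal (\<Prod>v\<in>?y ` (dom y - K). nh \<phi> (SS K k ?z) v)"
          unfolding wt_def mult.assoc[symmetric] using r0 c0 p0 by (intro ennreal_mult) auto
        then show ?thesis by (simp only: mult.assoc)
      qed
      finally show "h ?S = f K k ?z * IN K k i \<omega>"
        unfolding h_def ZS using cf by (simp add: f_def mult.assoc)
    qed
    finally show "(\<integral>\<^sup>+\<omega>'. \<Phi> F y r ?x (\<lambda>p. U p \<omega>') \<partial>P) =
      (\<Sum>K\<in>?KK. \<Sum>k. (\<integral>\<^sup>+i. f K k (Xi k i \<omega>) * IN K k i \<omega> \<partial>count_space (Inj {..<k} J)) / fact k)" .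
  qed
  have Xi_meas: "Xi k i \<in> measurable P (Pi\<^sub>M {..<k} (\<lambda>_. lborel))" for k i
    unfolding Xi_def by (rule measurable_restrict) simp
  have uX: "(\<lambda>\<omega>. u K k (Xi k i \<omega>) (X j \<omega>)) \<in> borel_measurable P" if "K \<in> ?KK" for K k i j
  proof -
    have "(\<lambda>\<omega>. (Xi k i \<omega>, X j \<omega>)) \<in> P \<rightarrow>\<^sub>M Pi\<^sub>M {..<k} (\<lambda>_. lborel) \<Otimes>\<^sub>M lborel"
      by (rule measurable_Pair[OF Xi_meas]) simp
    from measurable_compose[OF this u_meas[OF that]] show ?thesis by simp
  qed
  have inner: "(\<lambda>\<omega>. (\<integral>\<^sup>+i. f K k (Xi k i \<omega>) * IN K k i \<omega> \<partial>count_space (Inj {..<k} J))) \<in> borel_measurable P" if K: "K \<in> ?KK" for K k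
  proof (rule borel_measurable_nn_integral_count)
    fix i
    note [measurable] = uX[OF K] measurable_compose[OF Xi_meas f_meas[OF K]]
    show "(\<lambda>\<omega>. f K k (Xi k i \<omega>) * IN K k i \<omega>) \<in> borel_measurable P"
      unfolding IN_def by measurable
  qed auto
  have "(\<integral>\<^sup>+\<omega>. \<Phi> F y r (\<lambda>j. X j \<omega>) (\<lambda>p. U p \<omega>) \<partial>P) = (\<integral>\<^sup>+\<omega>. \<integral>\<^sup>+\<omega>'. \<Phi> F y r (\<lambda>j. X j \<omega>) (\<lambda>p. U p \<omega>') \<partial>P \<partial>P)"
    by (rule nn_integral_decouple[OF \<Phi>_measurable[OF F r]])
  also have "\<dots> = (\<integral>\<^sup>+\<omega>. (\<Sum>K\<in>?KK. \<Sum>k. (\<integral>\<^sup>+i. f K k (Xi k i \<omega>) * IN K k i \<omega> \<partial>count_space (Inj {..<k} J)) / fact k) \<partial>P)"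
    by (rule nn_integral_cong_AE[OF pointwise])
  also have "\<dots> = (\<Sum>K\<in>?KK. \<integral>\<^sup>+\<omega>. (\<Sum>k. (\<integral>\<^sup>+i. f K k (Xi k i \<omega>) * IN K k i \<omega> \<partial>count_space (Inj {..<k} J)) / fact k) \<partial>P)"
    using inner by (intro nn_integral_sum borel_measurable_suminf_order borel_measurable_divide_ennreal) auto
  also have "\<dots> = (\<Sum>K\<in>?KK. animal \<phi> (r0 * t) ?c (?y ` K) (?y ` (dom y - K)) F)"
  proof (intro sum.cong refl)
    fix K assume K: "K \<in> ?KK"
    have "(\<integral>\<^sup>+\<omega>. (\<Sum>k. (\<integral>\<^sup>+i. f K k (Xi k i \<omega>) * IN K k i \<omega> \<partial>count_space (Inj {..<k} J)) / fact k) \<partial>P) =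
      (\<Sum>k. \<integral>\<^sup>+\<omega>. (\<integral>\<^sup>+i. f K k (Xi k i \<omega>) * IN K k i \<omega> \<partial>count_space (Inj {..<k} J)) / fact k \<partial>P)"
      using inner[OF K] by (intro nn_integral_suminf borel_measurable_divide_ennreal) auto
    also have "\<dots> = animal \<phi> (r0 * t) ?c (?y ` K) (?y ` (dom y - K)) F"
      unfolding animal_def
    proof (intro suminf_cong)
      fix k
      have fk: "inverse (fact k :: ennreal) = ennreal (inverse (fact k))"
        by (simp add: inverse_ennreal flip: ennreal_fact)
      have fe: "(\<lambda>z. f K k z * ennreal (exp (- t * V K k z))) \<in> borel_measurable (Pi\<^sub>M {..<k} (\<lambda>_. lborel))"
      proof -
        have "(\<lambda>z. r0 * (if cfg (?y ` K) {..<k} z then hvol \<phi> (?y ` K \<union> z ` {..<k}) else 0)) \<in> borel_measurable (Pi\<^sub>M {..<k} (\<lambda>_. lborel))"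
          using KD[OF K] by (intro borel_measurable_times hvol_config_measurable) auto
        then have "V K k \<in> borel_measurable (Pi\<^sub>M {..<k} (\<lambda>_. lborel))"
          by (rule measurable_cong[THEN iffD1, rotated]) (simp add: V_def SS_def)
        then show ?thesis using f_meas[OF K] by measurable
      qed
      let ?G = "\<lambda>B. F (?y ` K \<union> B) * ennreal (wt \<phi> ?c (?y ` (dom y - K)) (?y ` K \<union> B) * exp (- (r0 * t) * hvol \<phi> (?y ` K \<union> B)))"
      have fV: "f K k z * ennreal (exp (- t * V K k z)) = ennreal (r0 ^ k) * (if cfg (?y ` K) {..<k} z then ?G (z ` {..<k}) else 0)" for z
        using r0 by (simp add: f_def V_def SS_def ennreal_mult' ac_simps ennreal_mult'' wt_nonneg)
      have Gm: "(\<lambda>z. if cfg (?y ` K) {..<k} z then ?G (z ` {..<k}) else 0) \<in> borel_measurable (Pi\<^sub>M {..<k} (\<lambda>_. lborel))"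
        using KD[OF K] y(1) by (intro animal_integrand_measurable F) auto
      have "(\<integral>\<^sup>+\<omega>. (\<integral>\<^sup>+i. f K k (Xi k i \<omega>) * IN K k i \<omega> \<partial>count_space (Inj {..<k} J)) / fact k \<partial>P) =
        ennreal t ^ k * (\<integral>\<^sup>+z. f K k z * ennreal (exp (- t * V K k z)) \<partial>Pi\<^sub>M {..<k} (\<lambda>_. lborel)) * inverse (fact k)"
        unfolding divide_ennreal_def using inner[OF K] by (subst nn_integral_multc) (auto simp: void[OF K])
      also have "\<dots> = ennreal t ^ k * (ennreal (r0 ^ k) * cfg_int (?y ` K) {..<k} ?G) * inverse (fact k)"
        unfolding fV cfg_int_def by (subst nn_integral_cmult[OF Gm]) simp
      also have "\<dots> = ennreal ((r0 * t) ^ k / fact k) * cfg_int (?y ` K) {..<k} ?G"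
        unfolding fk using r0 t_nonneg
        by (simp add: power_mult_distrib ennreal_mult' ennreal_mult'' ennreal_power divide_inverse ac_simps)
      finally show "(\<integral>\<^sup>+\<omega>. (\<integral>\<^sup>+i. f K k (Xi k i \<omega>) * IN K k i \<omega> \<partial>count_space (Inj {..<k} J)) / fact k \<partial>P) =
        ennreal ((r0 * t) ^ k / fact k) * cfg_int (?y ` K) {..<k} ?G" .
    qed
    finally show "(\<integral>\<^sup>+\<omega>. (\<Sum>k. (\<integral>\<^sup>+i. f K k (Xi k i \<omega>) * IN K k i \<omega> \<partial>count_space (Inj {..<k} J)) / fact k) \<partial>P) =
      animal \<phi> (r0 * t) ?c (?y ` K) (?y ` (dom y - K)) F" .
  qed
  finally show ?thesis .
qed

end

subsection \<open>Exponential moments\<close>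

definition pidx :: "real \<Rightarrow> nat set" where
  "pidx t = (if t > 0 then UNIV else {})"

text \<open>At intensity 0 nothing is assumed about \<open>X\<close>, not even measurability.
  Constant positions can replace it there because no Poisson index is in use.\<close>

definition ppts :: "real \<Rightarrow> (nat \<Rightarrow> 'w \<Rightarrow> 'a::zero) \<Rightarrow> nat \<Rightarrow> 'w \<Rightarrow> 'a" where
  "ppts t X = (if t > 0 then X else (\<lambda>_ _. 0))"

lemma (in prob_space) distr_pair_eq:
  assumes X: "X \<in> M \<rightarrow>\<^sub>M A" and Y: "Y \<in> M \<rightarrow>\<^sub>M B"
    and ind: "\<And>a b. a \<in> sets A \<Longrightarrow> b \<in> sets B \<Longrightarrow>
      prob ((X -` a \<inter> space M) \<inter> (Y -` b \<inter> space M)) = prob (X -` a \<inter> space M) * prob (Y -` b \<inter> space M)"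
  shows "distr M (A \<Otimes>\<^sub>M B) (\<lambda>\<omega>. (X \<omega>, Y \<omega>)) = distr M A X \<Otimes>\<^sub>M distr M B Y"
proof (rule pair_measure_eqI[symmetric])
  interpret X: prob_space "distr M A X" by (rule prob_space_distr[OF X])
  interpret Y: prob_space "distr M B Y" by (rule prob_space_distr[OF Y])
  show "sigma_finite_measure (distr M A X)" "sigma_finite_measure (distr M B Y)" by unfold_locales
  show "sets (distr M A X \<Otimes>\<^sub>M distr M B Y) = sets (distr M (A \<Otimes>\<^sub>M B) (\<lambda>\<omega>. (X \<omega>, Y \<omega>)))"
    by (simp cong: sets_pair_measure_cong)
  fix a b assume "a \<in> sets (distr M A X)" "b \<in> sets (distr M B Y)"
  then have ab: "a \<in> sets A" "b \<in> sets B" by auto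
  have XY: "(\<lambda>\<omega>. (X \<omega>, Y \<omega>)) \<in> M \<rightarrow>\<^sub>M A \<Otimes>\<^sub>M B" using X Y by (rule measurable_Pair)
  have "(\<lambda>\<omega>. (X \<omega>, Y \<omega>)) -` (a \<times> b) \<inter> space M = (X -` a \<inter> space M) \<inter> (Y -` b \<inter> space M)" by auto
  then show "emeasure (distr M A X) a * emeasure (distr M B Y) b = emeasure (distr M (A \<Otimes>\<^sub>M B) (\<lambda>\<omega>. (X \<omega>, Y \<omega>))) (a \<times> b)"
    using ab ind[OF ab] X Y XY by (simp add: emeasure_distr emeasure_eq_measure ennreal_mult)
qed

context kernel
begin

text \<open>For positive intensity this is \<open>Campbell\<close>. At intensity 0 there are no
  indices: both sides of Campbell's formula vanish unless \<open>I = {}\<close>, and constant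
  positions are independent of the marks.\<close>

lemma rcm_marked_poisson:
  fixes X :: "nat \<Rightarrow> 'w \<Rightarrow> 'd pt"
  assumes mp: "marked_poisson P t X U" and t: "0 \<le> t" and r0: "0 \<le> r0" "r0 \<le> 1"
  shows "rcm P (ppts t X) (pidx t) t \<phi> m U r0"
proof -
  interpret prob_space P using mp by (simp add: marked_poisson_def)
  have U: "indep_vars (\<lambda>_. borel) U UNIV" "\<And>p. distr P borel (U p) = uniform_measure lborel {0..1}"
    using mp by (auto simp: marked_poisson_def)
  have Um: "U p \<in> borel_measurable P" for p using U(1) by (cases p) (auto simp: indep_vars_def2)
  have pos: "X j \<in> borel_measurable P" "AE \<omega> in P. inj (\<lambda>j. X j \<omega>)" "poisson_process P t (\<lambda>\<omega>. range (\<lambda>j. X j \<omega>))"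
    "indep_set {(\<lambda>\<omega> j. X j \<omega>) -` A \<inter> space P | A. A \<in> sets (Pi\<^sub>M UNIV (\<lambda>_. borel))}
          {(\<lambda>\<omega> p. U p \<omega>) -` A \<inter> space P | A. A \<in> sets (Pi\<^sub>M UNIV (\<lambda>_. borel))}" if "t > 0" for j
    using mp that by (auto simp: marked_poisson_def)
  have Xm: "ppts t X j \<in> borel_measurable P" for j using pos(1) by (auto simp: ppts_def)
  have UP: "(\<lambda>\<omega> p. U p \<omega>) \<in> P \<rightarrow>\<^sub>M Pi\<^sub>M UNIV (\<lambda>_. borel)" using Um by (intro measurable_PiM_single') auto
  have XP: "(\<lambda>\<omega> j. ppts t X j \<omega>) \<in> P \<rightarrow>\<^sub>M Pi\<^sub>M UNIV (\<lambda>_. borel)" using Xm by (intro measurable_PiM_single') auto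
  show ?thesis
  proof (intro rcm.intro pois.intro pois_axioms.intro rcm_axioms.intro)
    show "prob_space P" by (rule prob_space_axioms)
    show "kernel \<phi> m" ..
    show "AE \<omega> in P. inj_on (\<lambda>j. ppts t X j \<omega>) (pidx t)"
    proof (cases "t > 0")
      case True
      then show ?thesis using pos(2) by (simp add: ppts_def pidx_def)
    qed (simp add: pidx_def)
    show "finite ((\<lambda>j. ppts t X j \<omega>) ` pidx t \<inter> B)" if om: "\<omega> \<in> space P" and B: "bounded B" for \<omega> B
    proof (cases "t > 0")
      case True
      have "range (\<lambda>j. X j \<omega>) \<in> space N_space"
        using pos(3)[OF True] measurable_space[OF _ om] unfolding poisson_process_def by metis
      then show ?thesis using True B by (simp add: ppts_def pidx_def space_N_space locally_finite_sets_def)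
    qed (simp add: pidx_def)
    show "(\<integral>\<^sup>+\<omega>. \<integral>\<^sup>+i. f (\<lambda>l\<in>I. ppts t X (i l) \<omega>) \<partial>count_space (Inj I (pidx t)) \<partial>P) =
         ennreal t ^ card I * (\<integral>\<^sup>+z. f z \<partial>Pi\<^sub>M I (\<lambda>_. lborel))"
      if I: "finite I" and f: "f \<in> borel_measurable (Pi\<^sub>M I (\<lambda>_. lborel))" for I :: "nat set" and f
    proof (cases "t > 0")
      case True
      have ppX: "ppts t X = X" using True by (simp add: ppts_def)
      have pU: "pidx t = UNIV" using True by (simp add: pidx_def)
      show ?thesis unfolding ppX pU using pos[OF True] I f t by (intro Campbell prob_space_axioms) auto
    next
      case False
      then have t0: "t = 0" using t by simp
      show ?thesis
      proof (cases "I = {}")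
        case True
        have "Inj I (pidx t) = {\<lambda>_. undefined}" using True by (auto simp: Inj_def)
        then show ?thesis using True
          by (simp add: nn_integral_count_space_finite PiM_empty emeasure_space_1 restrict_def)
      next
        case ne: False
        have "Inj I (pidx t) = {}" using ne t0 by (auto simp: Inj_def pidx_def PiE_eq_empty_iff)
        then show ?thesis using ne I t0 by (simp add: nn_integral_empty power_0_left)
      qed
    qed
    show "distr P (Pi\<^sub>M UNIV (\<lambda>_. borel) \<Otimes>\<^sub>M Pi\<^sub>M UNIV (\<lambda>_. borel)) (\<lambda>\<omega>. (\<lambda>j. ppts t X j \<omega>, \<lambda>p. U p \<omega>)) =
        distr P (Pi\<^sub>M UNIV (\<lambda>_. borel)) (\<lambda>\<omega> j. ppts t X j \<omega>) \<Otimes>\<^sub>M distr P (Pi\<^sub>M UNIV (\<lambda>_. borel)) (\<lambda>\<omega> p. U p \<omega>)"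
    proof (rule distr_pair_eq[OF XP UP])
      fix A :: "(nat \<Rightarrow> 'd pt) set" and B :: "((nat + nat) \<times> (nat + nat) \<Rightarrow> real) set"
      assume AB: "A \<in> sets (Pi\<^sub>M UNIV (\<lambda>_. borel))" "B \<in> sets (Pi\<^sub>M UNIV (\<lambda>_. borel))"
      show "prob (((\<lambda>\<omega> j. ppts t X j \<omega>) -` A \<inter> space P) \<inter> ((\<lambda>\<omega> p. U p \<omega>) -` B \<inter> space P)) =
        prob ((\<lambda>\<omega> j. ppts t X j \<omega>) -` A \<inter> space P) * prob ((\<lambda>\<omega> p. U p \<omega>) -` B \<inter> space P)"
      proof (cases "t > 0")
        case True
        have ppX: "ppts t X = X" using True by (simp add: ppts_def)
        show ?thesis unfolding ppX
          by (rule indep_setD[OF pos(4)[OF True]]) (use AB in blast)+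
      next
        case False
        have "(\<lambda>\<omega> j. ppts t X j \<omega>) -` A \<inter> space P = space P \<or> (\<lambda>\<omega> j. ppts t X j \<omega>) -` A \<inter> space P = {}"
          using False by (auto simp: ppts_def)
        moreover have "space P \<inter> ((\<lambda>\<omega> p. U p \<omega>) -` B \<inter> space P) = (\<lambda>\<omega> p. U p \<omega>) -` B \<inter> space P" by auto
        ultimately show ?thesis by (elim disjE) (simp_all add: prob_space)
      qed
    qed
  qed (use t Xm U r0 in auto)
qed

lemma marked_pairs_cong: "(\<And>i. i \<in> I \<Longrightarrow> Z i = Z' i) \<Longrightarrow> marked_pairs I Z u = marked_pairs I Z' u"
  unfolding marked_pairs_def by (intro Collect_cong ex_cong1) auto

lemma chi_ppts:
  "chi t X U y \<omega> = marked_pairs (dom y <+> pidx t) (case_sum (\<lambda>i. the (y i)) (\<lambda>j. ppts t X j \<omega>)) (\<lambda>p. U p \<omega>)"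
proof (cases "t > 0")
  case False
  have "marked_pairs (dom y <+> pidx t) (case_sum (\<lambda>i. the (y i)) (\<lambda>j. X j \<omega>)) (\<lambda>p. U p \<omega>) =
    marked_pairs (dom y <+> pidx t) (case_sum (\<lambda>i. the (y i)) (\<lambda>j. ppts t X j \<omega>)) (\<lambda>p. U p \<omega>)"
    by (rule marked_pairs_cong) (use False in \<open>auto simp: pidx_def\<close>)
  with False show ?thesis by (simp add: chi_marked_pairs pidx_def)
qed (simp add: chi_marked_pairs pidx_def ppts_def)

text \<open>Shifting every coordinate by \<open>a\<close> preserves the product of Lebesgue measures
  and the configuration condition.\<close>

lemma cfg_int_translate:
  fixes a :: "'a::euclidean_space" and I :: "'b set"
  assumes I: "finite I"
    and G: "(\<lambda>z. if cfg ((+) a ` Y) I z then G (z ` I) else 0) \<in> borel_measurable (Pi\<^sub>M I (\<lambda>_. lborel))"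
  shows "cfg_int ((+) a ` Y) I G = cfg_int Y I (\<lambda>B. G ((+) a ` B))"
proof -
  interpret L: product_sigma_finite "\<lambda>_::'b. lborel :: 'a measure" by standard
  let ?M = "Pi\<^sub>M I (\<lambda>_. lborel :: 'a measure)"
  let ?T = "\<lambda>z. \<lambda>i\<in>I. a + z i"
  have T: "?T \<in> ?M \<rightarrow>\<^sub>M ?M"
    by (rule measurable_restrict) (use component_measurable in measurable)
  have "distr ?M ?M ?T = ?M"
  proof (rule L.PiM_eqI[OF I])
    fix A assume A: "\<And>i. i \<in> I \<Longrightarrow> A i \<in> sets (lborel :: 'a measure)"
    have "?T -` (Pi\<^sub>E I A) \<inter> space ?M = Pi\<^sub>E I (\<lambda>i. (+) a -` A i)"
      by (auto simp: space_PiM PiE_iff)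
    moreover have m: "(+) a -` A i \<in> sets lborel" if "i \<in> I" for i
    proof -
      have "(+) a \<in> borel_measurable borel" by measurable
      from measurable_sets[OF this, of "A i"] show ?thesis using A[OF that] by simp
    qed
    moreover have "emeasure lborel ((+) a -` A i) = emeasure lborel (A i)" if "i \<in> I" for i
    proof -
      have "emeasure lborel (A i) = emeasure (distr lborel borel ((+) a)) (A i)" by (simp only: lborel_distr_plus)
      also have "\<dots> = emeasure lborel ((+) a -` A i)" using A[OF that] by (subst emeasure_distr) auto
      finally show ?thesis ..
    qed
    ultimately show "emeasure (distr ?M ?M ?T) (Pi\<^sub>E I A) = (\<Prod>i\<in>I. emeasure lborel (A i))"
      using A I T by (subst emeasure_distr) (auto intro!: sets_PiM_I_finite simp: L.emeasure_PiM)
  qed simp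
  then have "cfg_int ((+) a ` Y) I G = (\<integral>\<^sup>+z. (if cfg ((+) a ` Y) I z then G (z ` I) else 0) \<partial>distr ?M ?M ?T)"
    by (simp add: cfg_int_def)
  also have "\<dots> = (\<integral>\<^sup>+z. (if cfg ((+) a ` Y) I (?T z) then G (?T z ` I) else 0) \<partial>?M)"
    using T G by (subst nn_integral_distr) auto
  also have "\<dots> = cfg_int Y I (\<lambda>B. G ((+) a ` B))"
    unfolding cfg_int_def
  proof (intro nn_integral_cong)
    fix z
    have im: "?T z ` I = (+) a ` z ` I" by (auto simp: image_image)
    have "inj_on (?T z) I \<longleftrightarrow> inj_on z I" by (auto simp: inj_on_def)
    moreover have "(+) a ` z ` I \<inter> (+) a ` Y = {} \<longleftrightarrow> z ` I \<inter> Y = {}"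
      by (subst image_Int[symmetric]) auto
    ultimately have "cfg ((+) a ` Y) I (?T z) \<longleftrightarrow> cfg Y I z" unfolding cfg_def im by simp
    then show "(if cfg ((+) a ` Y) I (?T z) then G (?T z ` I) else 0) = (if cfg Y I z then G ((+) a ` z ` I) else 0)"
      unfolding im by simp
  qed
  finally show ?thesis .
qed

lemma hvol_translate: "finite S \<Longrightarrow> hvol \<phi> ((+) a ` S) = hvol \<phi> S"
proof -
  assume S: "finite S"
  have "nh \<phi> ((+) a ` S) w = nh \<phi> S (w - a)" for w
    unfolding nh_def by (subst prod.reindex) (auto simp: algebra_simps)
  then show ?thesis
    unfolding hvol_def using nn_integral_translate[of "\<lambda>w. ennreal (1 - nh \<phi> S w)" a] by simp
qed

text \<open>Stationarity, read off from the expansion: order, connection weight and volume are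
  invariant under shifts. It turns moments of the cluster of 0 into moments of the cluster of
  \<open>x\<close>.\<close>

lemma animal_translate:
  assumes F: "F \<in> borel_measurable N_space" and inv: "\<And>S. finite S \<Longrightarrow> F ((+) a ` S) = F S"
  shows "animal \<phi> \<tau> a {a} {} F = animal \<phi> \<tau> 0 {0} {} F"
proof -
  have "cfg_int {a} {..<k} (\<lambda>B. F ({a} \<union> B) * ennreal (wt \<phi> a {} ({a} \<union> B) * exp (- \<tau> * hvol \<phi> ({a} \<union> B)))) =
     cfg_int {0} {..<k} (\<lambda>B. F ({0} \<union> B) * ennreal (wt \<phi> 0 {} ({0} \<union> B) * exp (- \<tau> * hvol \<phi> ({0} \<union> B))))" (is "cfg_int _ _ ?G = _") for k :: nat
  proof -
    have "cfg_int ((+) a ` {0}) {..<k} ?G = cfg_int {0} {..<k} (\<lambda>B. ?G ((+) a ` B))"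
      by (rule cfg_int_translate) (use animal_integrand_measurable[of "{a}" "{..<k}" a "{}" F \<tau>] F in auto)
    also have "\<dots> = cfg_int {0} {..<k} (\<lambda>B. F ({0} \<union> B) * ennreal (wt \<phi> 0 {} ({0} \<union> B) * exp (- \<tau> * hvol \<phi> ({0} \<union> B))))"
      unfolding cfg_int_def
    proof (intro nn_integral_cong if_cong refl)
      fix z :: "nat \<Rightarrow> 'd pt"
      let ?S = "{0} \<union> z ` {..<k}"
      have S: "{a} \<union> (+) a ` z ` {..<k} = (+) a ` ?S" by auto
      have "wt \<phi> a {} ((+) a ` ?S) = wt \<phi> 0 {} ?S"
        using connw_translate[of 0 ?S \<phi> a] by (simp add: wt_def del: image_insert image_Un Un_insert_left)
      then show "?G ((+) a ` z ` {..<k}) = F ?S * ennreal (wt \<phi> 0 {} ?S * exp (- \<tau> * hvol \<phi> ?S))"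
        unfolding S using inv[of ?S] hvol_translate[of ?S a] by (simp del: image_insert image_Un Un_insert_left)
    qed
    finally show ?thesis by simp
  qed
  then show ?thesis unfolding animal_def by simp
qed

end

text \<open>The case distinction is expressed through the count, whose measurability is what
  \<open>N_space\<close> provides; an infinite count is added separately.\<close>

lemma exp_npts_eq: "exp_npts z \<mu> = (\<Sum>k. ennreal (exp (z * real k)) * indicator {of_nat k} (npts \<mu> UNIV)) + \<infinity> * indicator {\<infinity>} (npts \<mu> UNIV)"
proof (cases "finite \<mu>")
  case True
  then have n: "npts \<mu> UNIV = of_nat (card \<mu>)" by (simp add: npts_def emeasure_count_space)
  have "(\<Sum>k. ennreal (exp (z * real k)) * indicator {of_nat k} (of_nat (card \<mu>) :: ennreal)) =
    (\<Sum>k\<in>{card \<mu>}. ennreal (exp (z * real k)) * indicator {of_nat k} (of_nat (card \<mu>) :: ennreal))"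
    by (rule suminf_finite) (auto simp: indicator_def)
  then show ?thesis using True by (simp add: n exp_npts_def)
next
  case False
  then have "npts \<mu> UNIV = \<infinity>" by (simp add: npts_def emeasure_count_space)
  then show ?thesis using False by (simp add: exp_npts_def)
qed

lemma npts_measurable [measurable]: "B \<in> sets borel \<Longrightarrow> (\<lambda>\<mu>. npts \<mu> B) \<in> borel_measurable N_space"
proof (rule measurableI)
  fix A :: "ennreal set" assume B: "B \<in> sets borel" and A: "A \<in> sets borel"
  have "(\<lambda>\<mu>. npts \<mu> B) -` A \<inter> space N_space \<in> {(\<lambda>\<mu>. npts \<mu> B) -` A \<inter> locally_finite_sets |A B. A \<in> sets borel \<and> B \<in> sets borel}"
    using A B unfolding space_N_space by blast
  then show "(\<lambda>\<mu>. npts \<mu> B) -` A \<inter> space N_space \<in> sets N_space"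
    unfolding N_space_def by (subst sets_measure_of) (auto simp: space_measure_of_conv)
qed auto

lemma exp_npts_measurable [measurable]: "exp_npts z \<in> borel_measurable N_space"
proof -
  have "(\<lambda>\<mu>. exp_npts z \<mu>) \<in> borel_measurable N_space"
    unfolding exp_npts_eq by measurable
  then show ?thesis .
qed

lemma exp_npts_mono: "S \<subseteq> S' \<Longrightarrow> 0 \<le> z \<Longrightarrow> exp_npts z S \<le> exp_npts z S'"
  by (auto simp: exp_npts_def dest: finite_subset intro!: ennreal_leI mult_left_mono card_mono)

text \<open>The union has at most twice as many points as the larger set, so half the rate suffices,
  and a maximum of exponentials is at most their sum.\<close>

lemma exp_npts_Un:
  assumes "0 \<le> z" "S \<subseteq> A \<union> B"
  shows "exp_npts (z / 2) S \<le> exp_npts z A + exp_npts z B"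
proof (cases "finite A \<and> finite B")
  case True
  then have fS: "finite S" using assms finite_subset by blast
  have "card S \<le> card A + card B" using True assms(2) by (meson card_Un_le card_mono finite_UnI le_trans)
  then have "z / 2 * real (card S) \<le> max (z * real (card A)) (z * real (card B))"
  proof -
    have "real (card S) \<le> 2 * max (real (card A)) (real (card B))"
      using \<open>card S \<le> card A + card B\<close> by linarith
    then have "z / 2 * real (card S) \<le> z / 2 * (2 * max (real (card A)) (real (card B)))"
      using assms(1) by (intro mult_left_mono) auto
    also have "\<dots> = max (z * real (card A)) (z * real (card B))"
      using assms(1) by (simp add: max_mult_distrib_left)
    finally show ?thesis .
  qed
  then have "exp (z / 2 * real (card S)) \<le> exp (max (z * real (card A)) (z * real (card B)))" by simp
  also have "\<dots> \<le> exp (z * real (card A)) + exp (z * real (card B))" by (simp add: max_def)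
  finally show ?thesis using True fS by (simp add: exp_npts_def ennreal_leI flip: ennreal_plus)
qed (auto simp: exp_npts_def)

lemma finite_iff_npts: "finite \<mu> \<longleftrightarrow> npts \<mu> UNIV \<noteq> \<infinity>"
  by (simp add: npts_def emeasure_count_space)

lemma pred_finite_N_space: "Measurable.pred N_space (finite :: 'a::metric_space set \<Rightarrow> bool)"
proof -
  have "Measurable.pred N_space (\<lambda>\<mu> :: 'a set. npts \<mu> UNIV \<noteq> \<infinity>)" by measurable
  then show ?thesis by (simp only: finite_iff_npts[symmetric])
qed

section \<open>Cluster moments across intensities\<close>

locale rcm_family = kernel \<phi> m for \<phi> :: "('d::{finite,linorder}) pt \<Rightarrow> real" and m +
  fixes P :: "real \<Rightarrow> 'w measure" and X :: "real \<Rightarrow> nat \<Rightarrow> 'w \<Rightarrow> 'd pt"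
    and U :: "real \<Rightarrow> (nat + nat) \<times> (nat + nat) \<Rightarrow> 'w \<Rightarrow> real"
  assumes model: "\<And>t. 0 \<le> t \<Longrightarrow> marked_poisson (P t) t (X t) (U t)"
begin

definition Cl :: "real \<Rightarrow> (nat \<rightharpoonup> 'd pt) \<Rightarrow> nat \<Rightarrow> 'w \<Rightarrow> 'd pt set" where
  "Cl t y r \<omega> = cluster \<phi> (the (y r)) (chi t (X t) (U t) y \<omega>)"

definition adm :: "(nat \<rightharpoonup> 'd pt) \<Rightarrow> bool" where
  "adm y \<longleftrightarrow> finite (dom y) \<and> inj_on (\<lambda>i. the (y i)) (dom y)"

definition pos :: "real \<Rightarrow> (nat \<rightharpoonup> 'd pt) \<Rightarrow> 'w \<Rightarrow> nat + nat \<Rightarrow> 'd pt" where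
  "pos t y \<omega> = case_sum (\<lambda>i. the (y i)) (\<lambda>j. ppts t (X t) j \<omega>)"

definition idx :: "real \<Rightarrow> (nat \<rightharpoonup> 'd pt) \<Rightarrow> (nat + nat) set" where
  "idx t y = dom y <+> pidx t"

lemma Cl_pos: "Cl t y r \<omega> = cluster \<phi> (pos t y \<omega> (Inl r)) (marked_pairs (idx t y) (pos t y \<omega>) (\<lambda>p. U t p \<omega>))"
  by (simp add: Cl_def chi_ppts pos_def idx_def)

lemma rcm_at: "0 \<le> t \<Longrightarrow> 0 \<le> r0 \<Longrightarrow> r0 \<le> 1 \<Longrightarrow> rcm (P t) (ppts t (X t)) (pidx t) t \<phi> m (U t) r0"
  by (rule rcm_marked_poisson[OF model])

lemma prob_space_P: "0 \<le> t \<Longrightarrow> prob_space (P t)"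
  using model[of t] by (simp add: marked_poisson_def)

lemma image_pos: "pos t y \<omega> ` idx t y = (\<lambda>i. the (y i)) ` dom y \<union> (\<lambda>j. ppts t (X t) j \<omega>) ` pidx t"
  unfolding pos_def idx_def by (rule image_case_sum_Plus)

lemma pos_locally_finite:
  assumes "0 \<le> t" "finite (dom y)" "\<omega> \<in> space (P t)"
  shows "pos t y \<omega> ` idx t y \<in> locally_finite_sets"
proof -
  interpret rcm "P t" "ppts t (X t)" "pidx t" t \<phi> m "U t" 1 using assms(1) by (intro rcm_at) auto
  show ?thesis unfolding image_pos locally_finite_sets_def using assms X_locfin[OF assms(3)] by (auto simp: Int_Un_distrib2)
qed

lemma Cl_measurable:
  assumes t: "0 \<le> t" and y: "finite (dom y)" and r: "r \<in> dom y"
  shows "Cl t y r \<in> P t \<rightarrow>\<^sub>M N_space"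
proof -
  interpret rcm "P t" "ppts t (X t)" "pidx t" t \<phi> m "U t" 1 using t by (intro rcm_at) auto
  have "(\<lambda>\<omega>. cluster \<phi> ((\<lambda>i \<omega>. pos t y \<omega> i) (Inl r) \<omega>) (marked_pairs (idx t y) (\<lambda>i. (\<lambda>i \<omega>. pos t y \<omega> i) i \<omega>) (\<lambda>p. U t p \<omega>))) \<in> P t \<rightarrow>\<^sub>M N_space"
  proof (rule measurable_cluster)
    show "(\<lambda>\<omega>. pos t y \<omega> i) \<in> borel_measurable (P t)" for i
      by (cases i) (simp_all add: pos_def)
    show "Inl r \<in> idx t y" using r by (auto simp: idx_def)
    show "(\<lambda>i. pos t y \<omega> i) ` idx t y \<in> locally_finite_sets" if "\<omega> \<in> space (P t)" for \<omega>
      using pos_locally_finite[OF t y that] by simp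
  qed auto
  then show ?thesis by (simp add: Cl_pos[abs_def])
qed

lemma AE_good:
  assumes t: "0 \<le> t" and y: "adm y"
  shows "AE \<omega> in P t. inj_on (pos t y \<omega>) (idx t y) \<and> (\<forall>p. 0 \<le> U t p \<omega> \<and> U t p \<omega> \<le> 1)"
proof -
  interpret rcm "P t" "ppts t (X t)" "pidx t" t \<phi> m "U t" 1 using t by (intro rcm_at) auto
  have fin: "finite ((\<lambda>i. the (y i)) ` dom y)" using y by (simp add: adm_def)
  show ?thesis
    using X_inj X_avoids[OF fin] AE_U01
  proof eventually_elim
    fix \<omega> assume inj: "inj_on (\<lambda>j. ppts t (X t) j \<omega>) (pidx t)"
      and av: "\<forall>j\<in>pidx t. ppts t (X t) j \<omega> \<notin> (\<lambda>i. the (y i)) ` dom y"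
      and u: "\<forall>p. 0 < U t p \<omega> \<and> U t p \<omega> \<le> 1"
    have "inj_on (pos t y \<omega>) (idx t y)"
      unfolding pos_def idx_def
    proof (rule inj_on_case_sum)
      show "(\<lambda>i. the (y i)) ` dom y \<inter> (\<lambda>j. ppts t (X t) j \<omega>) ` pidx t = {}"
      proof (rule equals0I)
        fix p assume p: "p \<in> (\<lambda>i. the (y i)) ` dom y \<inter> (\<lambda>j. ppts t (X t) j \<omega>) ` pidx t"
        then obtain j where j: "j \<in> pidx t" "p = ppts t (X t) j \<omega>" by (elim IntE imageE)
        then have "p \<notin> (\<lambda>i. the (y i)) ` dom y" using av by simp
        with p show False by (elim IntE notE)
      qed
    qed (use y inj in \<open>auto simp: adm_def\<close>)
    then show "inj_on (pos t y \<omega>) (idx t y) \<and> (\<forall>p. 0 \<le> U t p \<omega> \<and> U t p \<omega> \<le> 1)"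
      using u by (auto simp: less_imp_le)
  qed
qed

lemma AE_Cl:
  assumes t: "0 \<le> t" and y: "adm y" and r: "r \<in> dom y"
  shows "AE \<omega> in P t. inj_on (pos t y \<omega>) (idx t y) \<and>
    Cl t y r \<omega> = pos t y \<omega> ` icomp \<phi> (\<lambda>_. 1) (idx t y) (pos t y \<omega>) (\<lambda>p. U t p \<omega>) (Inl r)"
  using AE_good[OF t y]
proof eventually_elim
  fix \<omega> assume "inj_on (pos t y \<omega>) (idx t y) \<and> (\<forall>p. 0 \<le> U t p \<omega> \<and> U t p \<omega> \<le> 1)"
  then show "inj_on (pos t y \<omega>) (idx t y) \<and>
    Cl t y r \<omega> = pos t y \<omega> ` icomp \<phi> (\<lambda>_. 1) (idx t y) (pos t y \<omega>) (\<lambda>p. U t p \<omega>) (Inl r)"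
    unfolding Cl_pos using r \<phi>_symm by (intro conjI cluster_eq_icomp) (auto simp: idx_def)
qed

lemma finite_image_icomp:
  assumes "inj_on Z I" "r \<in> I"
  shows "finite (Z ` icomp \<phi> \<rho> I Z u r) \<longleftrightarrow> finite (icomp \<phi> \<rho> I Z u r)"
  using inj_on_subset[OF assms(1) icomp_subset[OF assms(2)]] by (rule finite_image_iff)

lemma nn_integral_thinned:
  assumes t: "0 \<le> t" and r0: "0 \<le> r0" "r0 \<le> 1" and y: "adm y" and r: "r \<in> dom y" and F: "F \<in> borel_measurable N_space"
  shows "(\<integral>\<^sup>+\<omega>. (if finite (icomp \<phi> (case_sum (\<lambda>_. 1) (\<lambda>_. r0)) (idx t y) (pos t y \<omega>) (\<lambda>p. U t p \<omega>) (Inl r))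
       then F (pos t y \<omega> ` icomp \<phi> (case_sum (\<lambda>_. 1) (\<lambda>_. r0)) (idx t y) (pos t y \<omega>) (\<lambda>p. U t p \<omega>) (Inl r)) else 0) \<partial>P t) =
    (\<Sum>K\<in>{K \<in> Pow (dom y). r \<in> K}. animal \<phi> (r0 * t) (the (y r)) ((\<lambda>i. the (y i)) ` K) ((\<lambda>i. the (y i)) ` (dom y - K)) F)"
proof -
  interpret rcm "P t" "ppts t (X t)" "pidx t" t \<phi> m "U t" r0 using t r0 by (intro rcm_at) auto
  have rho_eq: "rho = case_sum (\<lambda>_. 1) (\<lambda>_. r0)" by (simp add: rho_def fun_eq_iff)
  show ?thesis
    using animal_formula[OF F _ _ r] y
    by (simp add: adm_def \<Phi>_def rcluster_def locs_def[abs_def] vset_def rho_eq pos_def idx_def cong: if_cong)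
qed

lemma case_sum_one: "case_sum (\<lambda>_. 1) (\<lambda>_. 1) = (\<lambda>_. 1)"
  by (auto simp: fun_eq_iff split: sum.splits)

lemma nn_integral_Cl_finite:
  assumes t: "0 \<le> t" and y: "adm y" and r: "r \<in> dom y" and F: "F \<in> borel_measurable N_space"
  shows "(\<integral>\<^sup>+\<omega>. (if finite (Cl t y r \<omega>) then F (Cl t y r \<omega>) else 0) \<partial>P t) =
    (\<Sum>K\<in>{K \<in> Pow (dom y). r \<in> K}. animal \<phi> t (the (y r)) ((\<lambda>i. the (y i)) ` K) ((\<lambda>i. the (y i)) ` (dom y - K)) F)"
proof -
  have "(\<integral>\<^sup>+\<omega>. (if finite (Cl t y r \<omega>) then F (Cl t y r \<omega>) else 0) \<partial>P t) =
    (\<integral>\<^sup>+\<omega>. (if finite (icomp \<phi> (\<lambda>_. 1) (idx t y) (pos t y \<omega>) (\<lambda>p. U t p \<omega>) (Inl r))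
       then F (pos t y \<omega> ` icomp \<phi> (\<lambda>_. 1) (idx t y) (pos t y \<omega>) (\<lambda>p. U t p \<omega>) (Inl r)) else 0) \<partial>P t)"
  proof (rule nn_integral_cong_AE)
    have r': "Inl r \<in> idx t y" using r by (auto simp: idx_def)
    show "AE \<omega> in P t. (if finite (Cl t y r \<omega>) then F (Cl t y r \<omega>) else 0) =
      (if finite (icomp \<phi> (\<lambda>_. 1) (idx t y) (pos t y \<omega>) (\<lambda>p. U t p \<omega>) (Inl r))
       then F (pos t y \<omega> ` icomp \<phi> (\<lambda>_. 1) (idx t y) (pos t y \<omega>) (\<lambda>p. U t p \<omega>) (Inl r)) else 0)"
      using AE_Cl[OF t y r] by eventually_elim (simp add: finite_image_icomp[OF _ r'])
  qed
  also have "\<dots> = (\<Sum>K\<in>{K \<in> Pow (dom y). r \<in> K}. animal \<phi> t (the (y r)) ((\<lambda>i. the (y i)) ` K) ((\<lambda>i. the (y i)) ` (dom y - K)) F)"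
    using nn_integral_thinned[OF t _ _ y r F, of 1] unfolding case_sum_one by simp
  finally show ?thesis .
qed

lemma adm_single [simp]: "adm [i \<mapsto> a]"
  by (simp add: adm_def)

lemma sum_single_root: "(\<Sum>K\<in>{K \<in> Pow (dom [i \<mapsto> a]). i \<in> K}. h K) = h {i}"
proof -
  have "{K \<in> Pow (dom [i \<mapsto> a]). i \<in> K} = {{i}}" by auto
  then show ?thesis by simp
qed

text \<open>Expresses \<open>s < t_star\<close> by a witness, a larger intensity with an exponential
  moment. No moment at \<open>s\<close> itself is part of the condition.\<close>

definition subcrit :: "real \<Rightarrow> bool" where
  "subcrit s \<longleftrightarrow> 0 \<le> s \<and> (\<exists>t z. s < t \<and> 0 < z \<and> (\<integral>\<^sup>+\<omega>. exp_npts z (Cl t [0 \<mapsto> 0] 0 \<omega>) \<partial>P t) < \<infinity>)"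

text \<open>Thin the process of intensity \<open>t\<close> down to \<open>s\<close>. The thinned
  component lies inside the full one, so it is almost surely finite and inherits the moment, and its
  expansion is the one at intensity \<open>s\<close>.\<close>

lemma animal_moments:
  assumes s: "0 \<le> s" "s < t" and z: "0 < z" and fin: "(\<integral>\<^sup>+\<omega>. exp_npts z (Cl t [0 \<mapsto> 0] 0 \<omega>) \<partial>P t) < \<infinity>"
  shows "animal \<phi> s 0 {0} {} (\<lambda>_. 1) = 1" and "animal \<phi> s 0 {0} {} (exp_npts z) < \<infinity>"
proof -
  have t: "0 \<le> t" "0 < t" using s by auto
  interpret prob_space "P t" by (rule prob_space_P[OF t(1)])
  let ?y = "[0 \<mapsto> 0] :: nat \<rightharpoonup> 'd pt"
  \<comment> \<open>Retention probability \<open>s / t\<close> brings intensity \<open>t\<close>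
    down to \<open>s\<close>; the added origin is always kept.\<close>
  let ?\<rho> = "case_sum (\<lambda>_. 1) (\<lambda>_. s / t) :: nat + nat \<Rightarrow> real"
  define D where "D \<omega> = icomp \<phi> ?\<rho> (idx t ?y) (pos t ?y \<omega>) (\<lambda>p. U t p \<omega>) (Inl 0)" for \<omega>
  have st: "0 \<le> s / t" "s / t \<le> 1" "s / t * t = s" using s t by auto
  have form: "(\<integral>\<^sup>+\<omega>. (if finite (D \<omega>) then F (pos t ?y \<omega> ` D \<omega>) else 0) \<partial>P t) = animal \<phi> s 0 {0} {} F"
    if "F \<in> borel_measurable N_space" for F
    using nn_integral_thinned[OF t(1) st(1,2) adm_single[of 0 0] _ that, of 0]
    unfolding D_def[symmetric] st(3) sum_single_root by simp
  have meas: "(\<lambda>\<omega>. exp_npts z (Cl t ?y 0 \<omega>)) \<in> borel_measurable (P t)"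
    by (rule measurable_compose[OF Cl_measurable[OF t(1)] exp_npts_measurable]) auto
  have "AE \<omega> in P t. exp_npts z (Cl t ?y 0 \<omega>) \<noteq> \<infinity>"
    using fin meas by (intro nn_integral_PInf_AE) auto
  note ninf = this
  have "AE \<omega> in P t. inj_on (pos t ?y \<omega>) (idx t ?y) \<and>
       Cl t ?y 0 \<omega> = pos t ?y \<omega> ` icomp \<phi> (\<lambda>_. 1) (idx t ?y) (pos t ?y \<omega>) (\<lambda>p. U t p \<omega>) (Inl 0)"
    by (rule AE_Cl[OF t(1) adm_single]) simp
  with ninf have good: "AE \<omega> in P t. finite (D \<omega>) \<and> pos t ?y \<omega> ` D \<omega> \<subseteq> Cl t ?y 0 \<omega>"
  proof eventually_elim
    fix \<omega>
    assume a: "inj_on (pos t ?y \<omega>) (idx t ?y) \<and>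
       Cl t ?y 0 \<omega> = pos t ?y \<omega> ` icomp \<phi> (\<lambda>_. 1) (idx t ?y) (pos t ?y \<omega>) (\<lambda>p. U t p \<omega>) (Inl 0)"
      and b: "exp_npts z (Cl t ?y 0 \<omega>) \<noteq> \<infinity>"
    have sub: "D \<omega> \<subseteq> icomp \<phi> (\<lambda>_. 1) (idx t ?y) (pos t ?y \<omega>) (\<lambda>p. U t p \<omega>) (Inl 0)"
      unfolding D_def using st by (intro icomp_mono) (auto split: sum.splits)
    have "finite (Cl t ?y 0 \<omega>)" using b by (auto simp: exp_npts_def split: if_splits)
    moreover have "Inl 0 \<in> idx t ?y" by (auto simp: idx_def)
    ultimately have "finite (icomp \<phi> (\<lambda>_. 1) (idx t ?y) (pos t ?y \<omega>) (\<lambda>p. U t p \<omega>) (Inl 0))"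
      using a by (intro finite_image_icomp[OF conjunct1[OF a], THEN iffD1]) simp_all
    then show "finite (D \<omega>) \<and> pos t ?y \<omega> ` D \<omega> \<subseteq> Cl t ?y 0 \<omega>"
      using sub a finite_subset by blast
  qed
  \<comment> \<open>The expansion counts finite components only, so mass 1 expresses that the
    thinned component is almost surely finite.\<close>
  have "animal \<phi> s 0 {0} {} (\<lambda>_. 1) = (\<integral>\<^sup>+\<omega>. (if finite (D \<omega>) then 1 else 0) \<partial>P t)"
    using form[of "\<lambda>_. 1"] by simp
  also have "\<dots> = (\<integral>\<^sup>+\<omega>. 1 \<partial>P t)"
    using good by (intro nn_integral_cong_AE) (auto elim: eventually_mono)
  also have "\<dots> = 1" by (simp add: emeasure_space_1)
  finally show "animal \<phi> s 0 {0} {} (\<lambda>_. 1) = 1" .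
  have "animal \<phi> s 0 {0} {} (exp_npts z) = (\<integral>\<^sup>+\<omega>. (if finite (D \<omega>) then exp_npts z (pos t ?y \<omega> ` D \<omega>) else 0) \<partial>P t)"
    using form[OF exp_npts_measurable] by simp
  also have "\<dots> \<le> (\<integral>\<^sup>+\<omega>. exp_npts z (Cl t ?y 0 \<omega>) \<partial>P t)"
  proof (rule nn_integral_mono_AE)
    show "AE \<omega> in P t. (if finite (D \<omega>) then exp_npts z (pos t ?y \<omega> ` D \<omega>) else 0) \<le> exp_npts z (Cl t ?y 0 \<omega>)"
      using good by eventually_elim (use z in \<open>auto intro: exp_npts_mono\<close>)
  qed
  also have "\<dots> < \<infinity>" by (rule fin)
  finally show "animal \<phi> s 0 {0} {} (exp_npts z) < \<infinity>" .
qed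

lemma card_translate: "card ((+) (a::'d pt) ` S) = card S"
  by (intro card_image) auto

lemma exp_npts_translate: "exp_npts z ((+) (a::'d pt) ` S) = exp_npts z S"
  by (simp add: exp_npts_def card_translate finite_image_iff)

text \<open>The unthinned process in \<open>P s\<close> has the same expansion as the thinned one in
  \<open>P t\<close>. Its total mass 1 forces finite clusters at intensity \<open>s\<close>, and
  shift invariance moves the root to \<open>a\<close>.\<close>

lemma single_root_moments:
  assumes s: "0 \<le> s" "s < t" and z: "0 < z" and fin: "(\<integral>\<^sup>+\<omega>. exp_npts z (Cl t [0 \<mapsto> 0] 0 \<omega>) \<partial>P t) < \<infinity>"
  shows "AE \<omega> in P s. finite (Cl s [i \<mapsto> a] i \<omega>)" and "(\<integral>\<^sup>+\<omega>. exp_npts z (Cl s [i \<mapsto> a] i \<omega>) \<partial>P s) < \<infinity>"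
proof -
  interpret prob_space "P s" by (rule prob_space_P[OF s(1)])
  let ?C = "Cl s [i \<mapsto> a] i"
  have C: "?C \<in> P s \<rightarrow>\<^sub>M N_space" using s by (intro Cl_measurable) auto
  have form: "(\<integral>\<^sup>+\<omega>. (if finite (?C \<omega>) then F (?C \<omega>) else 0) \<partial>P s) = animal \<phi> s 0 {0} {} F"
    if F: "F \<in> borel_measurable N_space" and inv: "\<And>S. F ((+) a ` S) = F S" for F
    using nn_integral_Cl_finite[OF s(1) adm_single[of i a] _ F, of i] animal_translate[OF F inv, of s]
    unfolding sum_single_root by simp
  have pf: "Measurable.pred (P s) (\<lambda>\<omega>. finite (?C \<omega>))"
    by (rule measurable_compose[OF C pred_finite_N_space])
  have "emeasure (P s) {\<omega>\<in>space (P s). finite (?C \<omega>)} = (\<integral>\<^sup>+\<omega>. indicator {\<omega>\<in>space (P s). finite (?C \<omega>)} \<omega> \<partial>P s)"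
    using pf by (intro nn_integral_indicator[symmetric]) (simp add: pred_def)
  also have "\<dots> = (\<integral>\<^sup>+\<omega>. (if finite (?C \<omega>) then 1 else 0) \<partial>P s)"
    by (intro nn_integral_cong) (auto simp: indicator_def)
  also have "\<dots> = 1" using form[of "\<lambda>_. 1"] animal_moments(1)[OF s z fin] by simp
  finally have "prob {\<omega>\<in>space (P s). finite (?C \<omega>)} = 1" by (simp add: emeasure_eq_measure)
  then show 1: "AE \<omega> in P s. finite (?C \<omega>)" using pf by (subst (asm) prob_Collect_eq_1) (auto simp: pred_def)
  have "(\<integral>\<^sup>+\<omega>. exp_npts z (?C \<omega>) \<partial>P s) = (\<integral>\<^sup>+\<omega>. (if finite (?C \<omega>) then exp_npts z (?C \<omega>) else 0) \<partial>P s)"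
    using 1 by (intro nn_integral_cong_AE) (auto elim: eventually_mono)
  also have "\<dots> = animal \<phi> s 0 {0} {} (exp_npts z)"
    by (rule form) (auto simp: exp_npts_translate)
  finally show "(\<integral>\<^sup>+\<omega>. exp_npts z (?C \<omega>) \<partial>P s) < \<infinity>" using animal_moments(2)[OF s z fin] by simp
qed

text \<open>Follow a path from \<open>r\<close>. After its last visit to an added point
  \<open>i\<close> it uses Poisson points only, so from there on it stays in the component of
  \<open>i\<close> with no other point added.\<close>

lemma icomp_Union:
  assumes r: "r \<in> dom y"
  shows "icomp \<phi> (\<lambda>_. 1) (idx t y) (pos t y \<omega>) u (Inl r) \<subseteq>
    (\<Union>i\<in>dom y. icomp \<phi> (\<lambda>_. 1) (idx t [i \<mapsto> the (y i)]) (pos t [i \<mapsto> the (y i)] \<omega>) u (Inl i))"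
proof
  let ?G = "gedges \<phi> (\<lambda>_. 1) (idx t y) (pos t y \<omega>) u"
  let ?D = "\<lambda>i. icomp \<phi> (\<lambda>_. 1) (idx t [i \<mapsto> the (y i)]) (pos t [i \<mapsto> the (y i)] \<omega>) u (Inl i)"
  fix j assume "j \<in> icomp \<phi> (\<lambda>_. 1) (idx t y) (pos t y \<omega>) u (Inl r)"
  then have "(Inl r, j) \<in> (?G \<union> ?G\<inverse>)\<^sup>*" by (simp add: icomp_def)
  then show "j \<in> (\<Union>i\<in>dom y. ?D i)"
  proof (induction rule: rtrancl_induct)
    case base
    then show ?case using r by (auto intro!: bexI[of _ r])
  next
    case (step j k)
    then obtain i where i: "i \<in> dom y" "j \<in> ?D i" by blast
    let ?y = "[i \<mapsto> the (y i)] :: nat \<rightharpoonup> 'd pt"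
    let ?G' = "gedges \<phi> (\<lambda>_. 1) (idx t ?y) (pos t ?y \<omega>) u"
    show ?case
    proof (cases k)
      case (Inl i')
      then have "i' \<in> dom y" using step.hyps(2) by (auto simp: gedges_def idx_def)
      then show ?thesis using Inl by (intro UN_I[of i']) simp_all
    next
      \<comment> \<open>Since \<open>j\<close> lies in the component of \<open>i\<close> alone and
        \<open>k\<close> is a Poisson point, the edge between them is also present when only
        \<open>i\<close> is added.\<close>
      case (Inr l)
      have "Inl i \<in> idx t ?y" by (auto simp: idx_def)
      from subsetD[OF icomp_subset[OF this] i(2)] have "j \<in> idx t ?y" .
      moreover have "k \<in> idx t ?y" using step.hyps(2) Inr by (auto simp: gedges_def idx_def)
      moreover have "pos t ?y \<omega> x = pos t y \<omega> x" if "x \<in> idx t ?y" for x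
        using that by (auto simp: pos_def idx_def)
      ultimately have "(j, k) \<in> ?G' \<union> ?G'\<inverse>" using step.hyps(2) by (auto simp: gedges_def)
      with i(2) have "k \<in> ?D i" unfolding icomp_def by (auto intro: rtrancl_into_rtrancl)
      with i(1) show ?thesis by blast
    qed
  qed
qed

lemma pos_single: "x \<in> idx t [i \<mapsto> the (y i)] \<Longrightarrow> pos t [i \<mapsto> the (y i)] \<omega> x = pos t y \<omega> x"
  by (auto simp: pos_def idx_def)

lemma AE_Cl_Union:
  assumes t: "0 \<le> t" and y: "adm y" and r: "r \<in> dom y"
  shows "AE \<omega> in P t. Cl t y r \<omega> \<subseteq> (\<Union>i\<in>dom y. Cl t [i \<mapsto> the (y i)] i \<omega>)"
proof -
  have fin: "finite (dom y)" using y by (simp add: adm_def)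
  have "AE \<omega> in P t. \<forall>i\<in>dom y. Cl t [i \<mapsto> the (y i)] i \<omega> =
    pos t [i \<mapsto> the (y i)] \<omega> ` icomp \<phi> (\<lambda>_. 1) (idx t [i \<mapsto> the (y i)]) (pos t [i \<mapsto> the (y i)] \<omega>) (\<lambda>p. U t p \<omega>) (Inl i)"
    using AE_Cl[OF t adm_single] by (intro AE_finite_allI[OF fin]) (auto elim: eventually_mono)
  with AE_Cl[OF t y r] show ?thesis
  proof eventually_elim
    fix \<omega>
    let ?D = "\<lambda>i. icomp \<phi> (\<lambda>_. 1) (idx t [i \<mapsto> the (y i)]) (pos t [i \<mapsto> the (y i)] \<omega>) (\<lambda>p. U t p \<omega>) (Inl i)"
    assume a: "inj_on (pos t y \<omega>) (idx t y) \<and>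
       Cl t y r \<omega> = pos t y \<omega> ` icomp \<phi> (\<lambda>_. 1) (idx t y) (pos t y \<omega>) (\<lambda>p. U t p \<omega>) (Inl r)"
      and b: "\<forall>i\<in>dom y. Cl t [i \<mapsto> the (y i)] i \<omega> = pos t [i \<mapsto> the (y i)] \<omega> ` ?D i"
    have im: "pos t [i \<mapsto> the (y i)] \<omega> ` ?D i = pos t y \<omega> ` ?D i" for i
    proof (intro image_cong refl)
      fix x assume "x \<in> ?D i"
      moreover have "?D i \<subseteq> idx t [i \<mapsto> the (y i)]" by (rule icomp_subset) (auto simp: idx_def)
      ultimately show "pos t [i \<mapsto> the (y i)] \<omega> x = pos t y \<omega> x" by (intro pos_single) blast
    qed
    show "Cl t y r \<omega> \<subseteq> (\<Union>i\<in>dom y. Cl t [i \<mapsto> the (y i)] i \<omega>)"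
      using image_mono[OF icomp_Union[OF r], of "pos t y \<omega>" t \<omega> "\<lambda>p. U t p \<omega>"] a b im
      by (simp add: image_UN)
  qed
qed

lemma AE_finite_Cl:
  assumes s: "subcrit s" and y: "adm y" and r: "r \<in> dom y"
  shows "AE \<omega> in P s. finite (Cl s y r \<omega>)"
proof -
  obtain t z where tz: "0 \<le> s" "s < t" "0 < z" "(\<integral>\<^sup>+\<omega>. exp_npts z (Cl t [0 \<mapsto> 0] 0 \<omega>) \<partial>P t) < \<infinity>"
    using s by (auto simp: subcrit_def)
  have fin: "finite (dom y)" using y by (simp add: adm_def)
  have "AE \<omega> in P s. \<forall>i\<in>dom y. finite (Cl s [i \<mapsto> the (y i)] i \<omega>)"
    using single_root_moments(1)[OF tz] by (intro AE_finite_allI[OF fin]) auto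
  with AE_Cl_Union[OF tz(1) y r] show ?thesis
    by eventually_elim (use fin in \<open>auto intro: finite_subset\<close>)
qed

lemma nn_integral_Cl:
  assumes s: "subcrit s" and y: "adm y" and r: "r \<in> dom y" and F: "F \<in> borel_measurable N_space"
  shows "(\<integral>\<^sup>+\<omega>. F (Cl s y r \<omega>) \<partial>P s) =
    (\<Sum>K\<in>{K \<in> Pow (dom y). r \<in> K}. animal \<phi> s (the (y r)) ((\<lambda>i. the (y i)) ` K) ((\<lambda>i. the (y i)) ` (dom y - K)) F)"
proof -
  have s0: "0 \<le> s" using s by (simp add: subcrit_def)
  have "(\<integral>\<^sup>+\<omega>. F (Cl s y r \<omega>) \<partial>P s) = (\<integral>\<^sup>+\<omega>. (if finite (Cl s y r \<omega>) then F (Cl s y r \<omega>) else 0) \<partial>P s)"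
    using AE_finite_Cl[OF s y r] by (intro nn_integral_cong_AE) (auto elim: eventually_mono)
  then show ?thesis using nn_integral_Cl_finite[OF s0 y r F] by simp
qed

text \<open>The cluster in the presence of 0 and \<open>x\<close> is covered by two one-point
  clusters, at the cost of halving the rate. Its moment is the sum of the expansions with
  \<open>x\<close> outside and \<open>x\<close> inside the cluster, so both are finite.\<close>

lemma two_point_moments:
  assumes s: "subcrit s" and x: "x \<noteq> 0"
  shows "\<exists>z>0. animal \<phi> s 0 {0} {x} (exp_npts z) < \<infinity> \<and> animal \<phi> s 0 {0, x} {} (exp_npts z) < \<infinity>"
proof -
  obtain t z where tz: "0 \<le> s" "s < t" "0 < z" "(\<integral>\<^sup>+\<omega>. exp_npts z (Cl t [0 \<mapsto> 0] 0 \<omega>) \<partial>P t) < \<infinity>"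
    using s by (auto simp: subcrit_def)
  let ?y = "[0 \<mapsto> 0, 1 \<mapsto> x] :: nat \<rightharpoonup> 'd pt"
  have y: "adm ?y" using x by (auto simp: adm_def inj_on_def)
  have dy: "dom ?y = {0, 1}" by auto
  have m1: "(\<lambda>\<omega>. exp_npts z (Cl s [i \<mapsto> a] i \<omega>)) \<in> borel_measurable (P s)" for i a
    by (rule measurable_compose[OF Cl_measurable[OF tz(1)] exp_npts_measurable]) auto
  have "(\<integral>\<^sup>+\<omega>. exp_npts (z / 2) (Cl s ?y 0 \<omega>) \<partial>P s) \<le>
     (\<integral>\<^sup>+\<omega>. exp_npts z (Cl s [0 \<mapsto> 0] 0 \<omega>) + exp_npts z (Cl s [1 \<mapsto> x] 1 \<omega>) \<partial>P s)"
  proof (rule nn_integral_mono_AE)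
    show "AE \<omega> in P s. exp_npts (z / 2) (Cl s ?y 0 \<omega>) \<le> exp_npts z (Cl s [0 \<mapsto> 0] 0 \<omega>) + exp_npts z (Cl s [1 \<mapsto> x] 1 \<omega>)"
    proof -
      have "AE \<omega> in P s. Cl s ?y 0 \<omega> \<subseteq> (\<Union>i\<in>dom ?y. Cl s [i \<mapsto> the (?y i)] i \<omega>)"
        by (rule AE_Cl_Union[OF tz(1) y]) simp
      then show ?thesis
      proof eventually_elim
        fix \<omega> assume "Cl s ?y 0 \<omega> \<subseteq> (\<Union>i\<in>dom ?y. Cl s [i \<mapsto> the (?y i)] i \<omega>)"
        then have "Cl s ?y 0 \<omega> \<subseteq> Cl s [0 \<mapsto> 0] 0 \<omega> \<union> Cl s [1 \<mapsto> x] 1 \<omega>" unfolding dy by simp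
        then show "exp_npts (z / 2) (Cl s ?y 0 \<omega>) \<le> exp_npts z (Cl s [0 \<mapsto> 0] 0 \<omega>) + exp_npts z (Cl s [1 \<mapsto> x] 1 \<omega>)"
          using tz(3) by (intro exp_npts_Un) auto
      qed
    qed
  qed
  also have "\<dots> = (\<integral>\<^sup>+\<omega>. exp_npts z (Cl s [0 \<mapsto> 0] 0 \<omega>) \<partial>P s) + (\<integral>\<^sup>+\<omega>. exp_npts z (Cl s [1 \<mapsto> x] 1 \<omega>) \<partial>P s)"
    by (rule nn_integral_add[OF m1 m1])
  also have "\<dots> < \<infinity>" using single_root_moments(2)[OF tz] by simp
  finally have lt: "(\<integral>\<^sup>+\<omega>. exp_npts (z / 2) (Cl s ?y 0 \<omega>) \<partial>P s) < \<infinity>" .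
  define h where "h K = animal \<phi> s (the (?y 0)) ((\<lambda>i. the (?y i)) ` K) ((\<lambda>i. the (?y i)) ` (dom ?y - K)) (exp_npts (z / 2))" for K
  have "{K \<in> Pow (dom ?y). 0 \<in> K} = {{0}, {0, 1}}" by auto
  moreover have "(\<Sum>K\<in>{K \<in> Pow (dom ?y). 0 \<in> K}. h K) < \<infinity>"
    unfolding h_def using lt by (subst nn_integral_Cl[OF s y _ exp_npts_measurable, of 0 "z / 2", symmetric]) simp_all
  ultimately have "h {0} + h {0, 1} < \<infinity>" by simp
  moreover have "h {0} = animal \<phi> s 0 {0} {x} (exp_npts (z / 2))" "h {0, 1} = animal \<phi> s 0 {0, x} {} (exp_npts (z / 2))"
    unfolding h_def dy by (simp_all add: insert_Diff_if)
  ultimately have "animal \<phi> s 0 {0} {x} (exp_npts (z / 2)) + animal \<phi> s 0 {0, x} {} (exp_npts (z / 2)) < \<infinity>" by simp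
  then show ?thesis using tz(3) by (intro exI[of _ "z / 2"]) auto
qed

end

subsection \<open>Countable direct sums of measures\<close>

text \<open>Turns a series over \<open>k\<close> of integrals over \<open>k\<close> points into one
  integral, so that the Taylor series is integrated over all cluster sizes at once.\<close>

definition dsum :: "(nat \<Rightarrow> 'a measure) \<Rightarrow> (nat \<times> 'a) measure" where
  "dsum M = measure_of (SIGMA k:UNIV. space (M k)) {A. A \<subseteq> (SIGMA k:UNIV. space (M k)) \<and> (\<forall>k. Pair k -` A \<in> sets (M k))}
     (\<lambda>A. \<Sum>k. emeasure (M k) (Pair k -` A))"

lemma sigma_algebra_dsum:
  "sigma_algebra (SIGMA k:UNIV. space (M k)) {A. A \<subseteq> (SIGMA k:UNIV. space (M k)) \<and> (\<forall>k. Pair k -` A \<in> sets (M k))}"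
proof (rule sigma_algebra_iff2[THEN iffD2], intro conjI ballI allI impI)
  fix A assume A: "A \<in> {A. A \<subseteq> (SIGMA k:UNIV. space (M k)) \<and> (\<forall>k. Pair k -` A \<in> sets (M k))}"
  have "Pair k -` ((SIGMA k:UNIV. space (M k)) - A) = space (M k) - Pair k -` A" for k by auto
  then show "(SIGMA k:UNIV. space (M k)) - A \<in> {A. A \<subseteq> (SIGMA k:UNIV. space (M k)) \<and> (\<forall>k. Pair k -` A \<in> sets (M k))}"
    using A by auto
next
  fix A :: "nat \<Rightarrow> _" assume A: "range A \<subseteq> {A. A \<subseteq> (SIGMA k:UNIV. space (M k)) \<and> (\<forall>k. Pair k -` A \<in> sets (M k))}"
  have "Pair k -` (\<Union>i. A i) = (\<Union>i. Pair k -` A i)" for k by auto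
  then show "(\<Union>i. A i) \<in> {A. A \<subseteq> (SIGMA k:UNIV. space (M k)) \<and> (\<forall>k. Pair k -` A \<in> sets (M k))}"
    using A by (auto intro!: sets.countable_nat_UN)
qed auto

lemma space_dsum: "space (dsum M) = (SIGMA k:UNIV. space (M k))"
  by (simp add: dsum_def space_measure_of_conv)

lemma sets_dsum: "sets (dsum M) = {A. A \<subseteq> (SIGMA k:UNIV. space (M k)) \<and> (\<forall>k. Pair k -` A \<in> sets (M k))}"
  unfolding dsum_def by (rule sigma_algebra.sets_measure_of_eq[OF sigma_algebra_dsum])

lemma emeasure_dsum:
  assumes "A \<in> sets (dsum M)"
  shows "emeasure (dsum M) A = (\<Sum>k. emeasure (M k) (Pair k -` A))"
  unfolding dsum_def
proof (rule emeasure_measure_of_sigma[OF sigma_algebra_dsum])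
  let ?S = "{A. A \<subseteq> (SIGMA k:UNIV. space (M k)) \<and> (\<forall>k. Pair k -` A \<in> sets (M k))}"
  show "positive ?S (\<lambda>A. \<Sum>k. emeasure (M k) (Pair k -` A))" by (simp add: positive_def)
  show "countably_additive ?S (\<lambda>A. \<Sum>k. emeasure (M k) (Pair k -` A))"
  proof (rule countably_additiveI)
    fix A :: "nat \<Rightarrow> _" assume A: "range A \<subseteq> ?S" "disjoint_family A"
    have un: "Pair k -` (\<Union>i. A i) = (\<Union>i. Pair k -` A i)" for k by auto
    have "emeasure (M k) (Pair k -` (\<Union>i. A i)) = (\<Sum>i. emeasure (M k) (Pair k -` A i))" for k
      unfolding un
    proof (rule suminf_emeasure[symmetric])
      show "range (\<lambda>i. Pair k -` A i) \<subseteq> sets (M k)" using A(1) by auto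
      show "disjoint_family (\<lambda>i. Pair k -` A i)" using A(2) by (auto simp: disjoint_family_on_def)
    qed
    then show "(\<Sum>i. \<Sum>k. emeasure (M k) (Pair k -` A i)) = (\<Sum>k. emeasure (M k) (Pair k -` (\<Union>i. A i)))"
      using nn_integral_suminf[of "\<lambda>i k. emeasure (M k) (Pair k -` A i)" "count_space UNIV"]
      by (simp add: nn_integral_count_space_nat)
  qed
  show "A \<in> ?S" using assms by (simp only: sets_dsum)
qed

lemma measurable_dsum_iff:
  "f \<in> borel_measurable (dsum M) \<longleftrightarrow> (\<forall>k. (\<lambda>z. f (k, z)) \<in> borel_measurable (M k))"
  for f :: "nat \<times> 'a \<Rightarrow> 'b::topological_space"
proof -
  have "Pair k -` (f -` A \<inter> space (dsum M)) = (\<lambda>z. f (k, z)) -` A \<inter> space (M k)" for A k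
    by (auto simp: space_dsum)
  then show ?thesis by (auto simp: measurable_def sets_dsum space_dsum)
qed

lemma measurable_dsum_fst: "fst \<in> dsum M \<rightarrow>\<^sub>M count_space UNIV"
proof -
  have "Pair k -` (fst -` A \<inter> space (dsum M)) = (if k \<in> A then space (M k) else {})" for A and k :: nat
    by (auto simp: space_dsum)
  then show ?thesis by (auto simp: measurable_def sets_dsum space_dsum)
qed

lemma nn_integral_dsum:
  fixes f :: "nat \<times> 'a \<Rightarrow> ennreal"
  assumes "f \<in> borel_measurable (dsum M)"
  shows "(\<integral>\<^sup>+x. f x \<partial>dsum M) = (\<Sum>k. \<integral>\<^sup>+z. f (k, z) \<partial>M k)"
  using assms
proof (induct rule: borel_measurable_induct)
  case (cong f g)
  have "(\<integral>\<^sup>+z. f (k, z) \<partial>M k) = (\<integral>\<^sup>+z. g (k, z) \<partial>M k)" for k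
    using cong(3) by (intro nn_integral_cong) (auto simp: space_dsum)
  moreover have "integral\<^sup>N (dsum M) f = integral\<^sup>N (dsum M) g"
    using cong(3) by (intro nn_integral_cong)
  ultimately show ?case using cong(4) by simp
next
  case (set A)
  have "(\<integral>\<^sup>+z. indicator A (k, z) \<partial>M k) = emeasure (M k) (Pair k -` A)" for k
  proof -
    have "(\<integral>\<^sup>+z. indicator A (k, z) \<partial>M k) = (\<integral>\<^sup>+z. indicator (Pair k -` A) z \<partial>M k)"
      by (intro nn_integral_cong) (simp add: indicator_def)
    then show ?thesis using set by (simp add: sets_dsum)
  qed
  then show ?case using set by (simp add: emeasure_dsum)
next
  case (mult u c)
  then show ?case
    by (simp add: measurable_dsum_iff nn_integral_cmult ennreal_suminf_cmult)
next
  case (add u v)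
  then show ?case
    by (simp add: measurable_dsum_iff nn_integral_add suminf_add[OF summableI summableI, symmetric])
next
  case (seq U)
  have m: "(\<lambda>z. U i (k, z)) \<in> borel_measurable (M k)" for i k using seq(1) by (simp add: measurable_dsum_iff)
  have i1: "incseq (\<lambda>i z. U i (k, z))" for k using seq(4) by (auto simp: incseq_def le_fun_def)
  have "(\<integral>\<^sup>+x. (SUP i. U i) x \<partial>dsum M) = (\<integral>\<^sup>+x. (SUP i. U i x) \<partial>dsum M)" by (simp add: image_comp)
  also have "\<dots> = (SUP i. \<integral>\<^sup>+x. U i x \<partial>dsum M)"
    using seq by (intro nn_integral_monotone_convergence_SUP) auto
  also have "\<dots> = (SUP i. \<Sum>k. \<integral>\<^sup>+z. U i (k, z) \<partial>M k)" using seq by simp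
  also have "\<dots> = (SUP i. \<integral>\<^sup>+k. (\<integral>\<^sup>+z. U i (k, z) \<partial>M k) \<partial>count_space UNIV)"
    by (simp add: nn_integral_count_space_nat)
  also have "\<dots> = (\<integral>\<^sup>+k. (SUP i. \<integral>\<^sup>+z. U i (k, z) \<partial>M k) \<partial>count_space UNIV)"
    using i1 by (intro nn_integral_monotone_convergence_SUP[symmetric])
      (auto simp: incseq_def le_fun_def intro!: nn_integral_mono)
  also have "\<dots> = (\<Sum>k. \<integral>\<^sup>+z. (SUP i. U i (k, z)) \<partial>M k)"
    using m i1 by (simp add: nn_integral_count_space_nat nn_integral_monotone_convergence_SUP)
  finally show ?case by (simp add: image_comp)
qed

subsection \<open>Reindexing and integrating out coordinates\<close>

text \<open>Only the image of the tuple enters the integrand, so coordinates may be renamed along a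
  bijection.\<close>

lemma cfg_int_reindex:
  fixes G :: "'a::euclidean_space set \<Rightarrow> ennreal" and I :: "'b set" and L :: "'c set"
  assumes I: "finite I" and b: "bij_betw b L I"
    and G: "(\<lambda>z. if cfg Y L z then G (z ` L) else 0) \<in> borel_measurable (Pi\<^sub>M L (\<lambda>_. lborel))"
  shows "cfg_int Y I G = cfg_int Y L G"
proof -
  interpret L: product_sigma_finite "\<lambda>_::'c. lborel :: 'a measure" by standard
  interpret I: product_sigma_finite "\<lambda>_::'b. lborel :: 'a measure" by standard
  have fL: "finite L" using I b by (simp add: bij_betw_finite)
  let ?M = "Pi\<^sub>M I (\<lambda>_. lborel :: 'a measure)" and ?N = "Pi\<^sub>M L (\<lambda>_. lborel :: 'a measure)"
  let ?T = "\<lambda>z :: 'b \<Rightarrow> 'a. \<lambda>i\<in>L. z (b i)"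
  have bI: "b i \<in> I" if "i \<in> L" for i using b that by (auto simp: bij_betw_def)
  have T: "?T \<in> ?M \<rightarrow>\<^sub>M ?N"
    by (rule measurable_restrict) (use bI in \<open>auto intro!: measurable_component_singleton\<close>)
  have "distr ?M ?N ?T = ?N"
  proof (rule L.PiM_eqI[OF fL])
    fix A assume A: "\<And>i. i \<in> L \<Longrightarrow> A i \<in> sets (lborel :: 'a measure)"
    let ?c = "the_inv_into L b"
    have inj: "inj_on b L" using b by (simp add: bij_betw_def)
    have c: "?c i \<in> L" "b (?c i) = i" if "i \<in> I" for i
      using that b by (auto simp: bij_betw_def the_inv_into_into f_the_inv_into_f)
    have cb: "?c (b i) = i" if "i \<in> L" for i using the_inv_into_f_f[OF inj that] .
    have eq: "?T -` (Pi\<^sub>E L A) \<inter> space ?M = Pi\<^sub>E I (\<lambda>i. A (?c i))"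
    proof (intro set_eqI iffI)
      fix z assume z: "z \<in> ?T -` (Pi\<^sub>E L A) \<inter> space ?M"
      have "z i \<in> A (?c i)" if "i \<in> I" for i
      proof -
        have "?T z (?c i) \<in> A (?c i)" using z c[OF that] by (auto simp: PiE_iff)
        then show ?thesis using c[OF that] by simp
      qed
      then show "z \<in> Pi\<^sub>E I (\<lambda>i. A (?c i))" using z by (auto simp: space_PiM PiE_iff)
    next
      fix z assume z: "z \<in> Pi\<^sub>E I (\<lambda>i. A (?c i))"
      have "z (b i) \<in> A i" if "i \<in> L" for i
        using z bI[OF that] cb[OF that] by (metis PiE_mem)
      then show "z \<in> ?T -` (Pi\<^sub>E L A) \<inter> space ?M" using z by (auto simp: space_PiM PiE_iff)
    qed
    have "emeasure (distr ?M ?N ?T) (Pi\<^sub>E L A) = (\<Prod>i\<in>I. emeasure lborel (A (?c i)))"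
      using A I fL T c by (subst emeasure_distr) (auto intro!: sets_PiM_I_finite simp: I.emeasure_PiM eq)
    also have "\<dots> = (\<Prod>i\<in>L. emeasure lborel (A (?c (b i))))"
      using prod.reindex_bij_betw[OF b, of "\<lambda>i. emeasure lborel (A (?c i))"] by simp
    also have "\<dots> = (\<Prod>i\<in>L. emeasure lborel (A i))" by (intro prod.cong) (simp_all add: cb)
    finally show "emeasure (distr ?M ?N ?T) (Pi\<^sub>E L A) = (\<Prod>i\<in>L. emeasure lborel (A i))" .
  qed simp
  then have "cfg_int Y L G = (\<integral>\<^sup>+z. (if cfg Y L z then G (z ` L) else 0) \<partial>distr ?M ?N ?T)"
    by (simp add: cfg_int_def)
  also have "\<dots> = (\<integral>\<^sup>+z. (if cfg Y L (?T z) then G (?T z ` L) else 0) \<partial>?M)"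
    using T G by (subst nn_integral_distr) auto
  also have "\<dots> = cfg_int Y I G"
    unfolding cfg_int_def
  proof (intro nn_integral_cong)
    fix z
    have "?T z ` L = z ` b ` L" by (auto simp: image_image)
    then have im: "?T z ` L = z ` I" using b by (simp add: bij_betw_def)
    have "inj_on (?T z) L \<longleftrightarrow> inj_on (z \<circ> b) L" by (intro inj_on_cong) simp
    also have "\<dots> \<longleftrightarrow> inj_on z (b ` L)" using b comp_inj_on_iff[of b L z] by (simp add: bij_betw_def)
    also have "\<dots> \<longleftrightarrow> inj_on z I" using b by (simp add: bij_betw_def)
    finally show "(if cfg Y L (?T z) then G (?T z ` L) else 0) = (if cfg Y I z then G (z ` I) else 0)"
      unfolding cfg_def im by simp
  qed
  finally show ?thesis ..
qed

text \<open>A cylinder over a null set is null even when the other factor has infinite measure,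
  since \<open>0 * \<infinity> = 0\<close>.\<close>

lemma AE_PiM_restrict:
  fixes Q :: "('b \<Rightarrow> 'a::euclidean_space) \<Rightarrow> bool"
  assumes I: "finite I" and K: "K \<subseteq> I" and Q: "AE z in Pi\<^sub>M K (\<lambda>_. lborel). Q z"
  shows "AE z in Pi\<^sub>M I (\<lambda>_. lborel). Q (restrict z K)"
proof -
  interpret product_sigma_finite "\<lambda>_::'b. lborel :: 'a measure" by standard
  obtain N where N: "N \<in> null_sets (Pi\<^sub>M K (\<lambda>_. lborel :: 'a measure))" "{z\<in>space (Pi\<^sub>M K (\<lambda>_. lborel)). \<not> Q z} \<subseteq> N"
    using Q by (auto elim!: AE_E3 simp: eventually_ae_filter)
  have fin: "finite K" "finite (I - K)" "K \<inter> (I - K) = {}" "K \<union> (I - K) = I" using I K by (auto intro: finite_subset)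
  let ?R = "\<lambda>z. restrict z K"
  have R: "?R \<in> Pi\<^sub>M I (\<lambda>_. lborel :: 'a measure) \<rightarrow>\<^sub>M Pi\<^sub>M K (\<lambda>_. lborel)" by (rule measurable_restrict_subset[OF K])
  have m: "(\<lambda>z. indicator N (?R z) :: ennreal) \<in> borel_measurable (Pi\<^sub>M I (\<lambda>_. lborel))"
    using N(1) by (intro measurable_compose[OF R]) auto
  have "(\<integral>\<^sup>+z. indicator N (?R z) \<partial>Pi\<^sub>M I (\<lambda>_. lborel)) =
     (\<integral>\<^sup>+x. \<integral>\<^sup>+y. indicator N (?R (merge K (I - K) (x, y))) \<partial>Pi\<^sub>M (I - K) (\<lambda>_. lborel) \<partial>Pi\<^sub>M K (\<lambda>_. lborel))"
    using product_nn_integral_fold[OF fin(3,1,2), of "\<lambda>z. indicator N (?R z)"] m unfolding fin(4) by simp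
  also have "\<dots> = (\<integral>\<^sup>+x. \<integral>\<^sup>+y. indicator N x \<partial>Pi\<^sub>M (I - K) (\<lambda>_. lborel :: 'a measure) \<partial>Pi\<^sub>M K (\<lambda>_. lborel))"
  proof (intro nn_integral_cong)
    fix x y assume "x \<in> space (Pi\<^sub>M K (\<lambda>_. lborel :: 'a measure))"
    then have "?R (merge K (I - K) (x, y)) = x"
      by (auto simp: space_PiM PiE_iff extensional_def merge_def fun_eq_iff)
    then show "indicator N (?R (merge K (I - K) (x, y))) = (indicator N x :: ennreal)" by simp
  qed
  also have "\<dots> = (\<integral>\<^sup>+x. indicator N x * emeasure (Pi\<^sub>M (I - K) (\<lambda>_. lborel :: 'a measure)) (space (Pi\<^sub>M (I - K) (\<lambda>_. lborel :: 'a measure))) \<partial>Pi\<^sub>M K (\<lambda>_. lborel))"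
    by simp
  also have "\<dots> = 0"
    using null_setsD1[OF N(1)] null_setsD2[OF N(1)] by (simp add: nn_integral_multc)
  finally have "AE z in Pi\<^sub>M I (\<lambda>_. lborel). indicator N (?R z) = (0 :: ennreal)"
    using m by (simp add: nn_integral_0_iff_AE)
  moreover have "AE z in Pi\<^sub>M I (\<lambda>_. lborel :: 'a measure). z \<in> space (Pi\<^sub>M I (\<lambda>_. lborel))" by (rule AE_space)
  ultimately show ?thesis
  proof eventually_elim
    fix z assume z: "indicator N (?R z) = (0 :: ennreal)" "z \<in> space (Pi\<^sub>M I (\<lambda>_. lborel :: 'a measure))"
    have "?R z \<in> space (Pi\<^sub>M K (\<lambda>_. lborel))" by (rule measurable_space[OF R z(2)])
    then show "Q (?R z)" using N(2) z(1) by (auto simp: indicator_def split: if_splits)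
  qed
qed

lemma suminf_ennreal_shift:
  fixes f :: "nat \<Rightarrow> ennreal"
  assumes "\<And>j. j < q \<Longrightarrow> f j = 0"
  shows "(\<Sum>k. f (q + k)) = (\<Sum>j. f j)"
proof -
  have "(\<Sum>j. f j) = (\<Sum>j. f (j + q)) + (\<Sum>i<q. f i)" by (rule suminf_offset) simp
  then show ?thesis using assms by (simp add: add.commute)
qed

subsection \<open>Sprinkled points\<close>

lemma cfg_cong: "(\<And>i. i \<in> I \<Longrightarrow> z i = z' i) \<Longrightarrow> cfg Y I z \<longleftrightarrow> cfg Y I z'"
  unfolding cfg_def by (intro conj_cong inj_on_cong) (auto simp: image_def)

lemma cfg_Un:
  assumes "K \<inter> L = {}"
  shows "cfg Y (K \<union> L) z \<longleftrightarrow> cfg Y K z \<and> cfg (Y \<union> z ` K) L z"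
proof -
  have "K - L = K" "L - K = L" using assms by auto
  then show ?thesis unfolding cfg_def by (auto simp: inj_on_Un image_Un)
qed

context kernel
begin

definition config_measurable :: "'d pt set \<Rightarrow> ('d pt set \<Rightarrow> ennreal) \<Rightarrow> bool" where
  "config_measurable Y H \<longleftrightarrow> (\<forall>J :: nat set. finite J \<longrightarrow>
     (\<lambda>z. if cfg Y J z then H (Y \<union> z ` J) else 0) \<in> borel_measurable (Pi\<^sub>M J (\<lambda>_. lborel)))"

text \<open>The points \<open>xs i\<close> belong to the cluster for \<open>i \<in> K\<close> and have an edge to it for \<open>i \<in> R\<close>.\<close>

definition sprinkle :: "'d pt set \<Rightarrow> ('d pt set \<Rightarrow> ennreal) \<Rightarrow> nat set \<Rightarrow> nat set \<Rightarrow> nat \<Rightarrow> (nat \<Rightarrow> 'd pt) \<Rightarrow> ennreal" where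
  "sprinkle Y H K R k xs = (if cfg Y K xs then cfg_int (Y \<union> xs ` K) {..<k}
     (\<lambda>B. H (Y \<union> xs ` K \<union> B) * (\<Prod>i\<in>R. ennreal (1 - nh \<phi> (Y \<union> xs ` K \<union> B) (xs i)))) else 0)"

text \<open>By Tonelli the points in \<open>K\<close> join the \<open>k\<close> remaining cluster
  points to a configuration of \<open>card K + k\<close> points, and each point in \<open>R\<close>
  integrates separately to the volume of that configuration.\<close>

lemma sprinkle_facts:
  assumes Y: "finite Y" and H: "config_measurable Y H" and K: "finite K" and R: "finite R" and KR: "K \<inter> R = {}"
  shows "sprinkle Y H K R k \<in> borel_measurable (Pi\<^sub>M (K \<union> R) (\<lambda>_. lborel))"
    and "(\<integral>\<^sup>+xs. sprinkle Y H K R k xs \<partial>Pi\<^sub>M (K \<union> R) (\<lambda>_. lborel)) =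
      cfg_int Y {..<card K + k} (\<lambda>B. H (Y \<union> B) * ennreal (hvol \<phi> (Y \<union> B)) ^ card R)"
proof -
  interpret product_sigma_finite "\<lambda>_::nat. lborel :: 'd pt measure" by standard
  obtain N where N: "K \<union> R \<subseteq> {..<N}" using K R finite_nat_iff_bounded[of "K \<union> R"] by auto
  \<comment> \<open>Moves the \<open>k\<close> remaining cluster points to fresh coordinates beyond
    \<open>K \<union> R\<close>, so that all points live in one product space.\<close>
  define L where "L = (\<lambda>i. N + i) ` {..<k}"
  have bij: "bij_betw (\<lambda>i. N + i) {..<k} L" by (auto simp: L_def bij_betw_def)
  have L: "finite L" "card L = k" by (simp_all add: L_def card_image)
  have dis: "(K \<union> R) \<inter> L = {}" using N by (auto simp: L_def)
  then have dKL: "K \<inter> L = {}" and dRL: "R \<inter> L = {}" and dKLR: "(K \<union> L) \<inter> R = {}" using KR by auto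
  have fKR: "finite (K \<union> R)" and fKL: "finite (K \<union> L)" using K R L by auto
  let ?M = "\<lambda>I. Pi\<^sub>M I (\<lambda>_::nat. lborel :: 'd pt measure)"
  define h where "h u = (if cfg Y (K \<union> L) u then H (Y \<union> u ` (K \<union> L)) else 0)" for u :: "nat \<Rightarrow> 'd pt"
  define q where "q u w = (if cfg Y (K \<union> L) u then nh \<phi> (Y \<union> u ` (K \<union> L)) w else 1)" for u :: "nat \<Rightarrow> 'd pt" and w
  define \<Psi> where "\<Psi> u = h u * (\<Prod>i\<in>R. ennreal (1 - q u (u i)))" for u
  have h_cong: "h u = h u'" and q_cong: "q u w = q u' w" if "\<And>i. i \<in> K \<union> L \<Longrightarrow> u i = u' i" for u u' w
  proof -
    have c: "cfg Y (K \<union> L) u = cfg Y (K \<union> L) u'" using that by (rule cfg_cong)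
    have i: "u ` (K \<union> L) = u' ` (K \<union> L)" using that by (intro image_cong) auto
    show "h u = h u'" "q u w = q u' w" by (simp_all only: h_def q_def c i)
  qed
  have h_meas: "h \<in> borel_measurable (?M (K \<union> L))"
    using H fKL unfolding config_measurable_def h_def[abs_def] by blast
  have q_meas: "(\<lambda>(u, w). q u w) \<in> borel_measurable (?M (K \<union> L) \<Otimes>\<^sub>M lborel)"
    using nh_config_measurable[OF Y fKL] unfolding q_def by simp
  have \<Psi>_meas: "\<Psi> \<in> borel_measurable (?M (K \<union> R \<union> L))"
  proof -
    let ?r = "\<lambda>u :: nat \<Rightarrow> 'd pt. restrict u (K \<union> L)"
    have r: "?r \<in> ?M (K \<union> R \<union> L) \<rightarrow>\<^sub>M ?M (K \<union> L)" by (rule measurable_restrict_subset) auto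
    have "(\<lambda>u. h (?r u)) \<in> borel_measurable (?M (K \<union> R \<union> L))" by (rule measurable_compose[OF r h_meas])
    moreover have "(\<lambda>u. q (?r u) (u i)) \<in> borel_measurable (?M (K \<union> R \<union> L))" if "i \<in> R" for i
    proof -
      have "(\<lambda>u. (?r u, u i)) \<in> ?M (K \<union> R \<union> L) \<rightarrow>\<^sub>M ?M (K \<union> L) \<Otimes>\<^sub>M lborel"
        using that r by (intro measurable_Pair measurable_component_singleton) auto
      from measurable_compose[OF this q_meas] show ?thesis by simp
    qed
    moreover have "h (?r u) = h u" "q (?r u) w = q u w" for u w by (intro h_cong q_cong; simp)+
    ultimately show ?thesis
      unfolding \<Psi>_def[abs_def] by (intro borel_measurable_times_ennreal borel_measurable_prod_ennreal) auto
  qed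
  have merged: "\<Psi> (merge (K \<union> R) L (xs, z)) =
    (if cfg Y K xs then (if cfg (Y \<union> xs ` K) L z then H (Y \<union> xs ` K \<union> z ` L) * (\<Prod>i\<in>R. ennreal (1 - nh \<phi> (Y \<union> xs ` K \<union> z ` L) (xs i))) else 0) else 0)" for xs z
  proof -
    let ?u = "merge (K \<union> R) L (xs, z)"
    have u: "?u i = xs i" if "i \<in> K \<union> R" for i using that by (simp add: merge_def)
    have u': "?u i = z i" if "i \<in> L" for i using that dis by (auto simp: merge_def)
    have im: "?u ` K = xs ` K" "?u ` L = z ` L" by (intro image_cong u u' refl; simp)+
    have "cfg Y K ?u = cfg Y K xs" by (rule cfg_cong) (simp add: u)
    moreover have "cfg (Y \<union> ?u ` K) L ?u = cfg (Y \<union> ?u ` K) L z" by (rule cfg_cong) (simp add: u')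
    ultimately have c: "cfg Y (K \<union> L) ?u \<longleftrightarrow> cfg Y K xs \<and> cfg (Y \<union> xs ` K) L z"
      unfolding cfg_Un[OF dKL] im by simp
    have i: "Y \<union> ?u ` (K \<union> L) = Y \<union> xs ` K \<union> z ` L" using im by (simp add: image_Un Un_assoc)
    show ?thesis unfolding \<Psi>_def h_def q_def c i using u by (simp cong: prod.cong)
  qed
  have sec: "(\<lambda>z. \<Psi> (merge (K \<union> R) L (xs, z))) \<in> borel_measurable (?M L)" if "xs \<in> space (?M (K \<union> R))" for xs
  proof -
    have "(\<lambda>z. merge (K \<union> R) L (xs, z)) \<in> ?M L \<rightarrow>\<^sub>M ?M (K \<union> R \<union> L)"
      using that by (intro measurable_compose[OF measurable_Pair measurable_merge]) auto
    from measurable_compose[OF this \<Psi>_meas] show ?thesis .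
  qed
  have spr: "sprinkle Y H K R k xs = (\<integral>\<^sup>+z. \<Psi> (merge (K \<union> R) L (xs, z)) \<partial>?M L)" if xs: "xs \<in> space (?M (K \<union> R))" for xs
  proof (cases "cfg Y K xs")
    case True
    let ?G = "\<lambda>B. H (Y \<union> xs ` K \<union> B) * (\<Prod>i\<in>R. ennreal (1 - nh \<phi> (Y \<union> xs ` K \<union> B) (xs i)))"
    let ?b = "the_inv_into {..<k} (\<lambda>i. N + i)"
    have "cfg_int (Y \<union> xs ` K) {..<k} ?G = cfg_int (Y \<union> xs ` K) L ?G"
    proof (rule cfg_int_reindex)
      show "bij_betw ?b L {..<k}" by (rule bij_betw_the_inv_into[OF bij])
      show "(\<lambda>z. if cfg (Y \<union> xs ` K) L z then ?G (z ` L) else 0) \<in> borel_measurable (?M L)"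
        using sec[OF xs] True unfolding merged by simp
    qed simp
    then show ?thesis unfolding sprinkle_def merged using True by (simp add: cfg_int_def)
  qed (simp add: sprinkle_def merged)
  have sf: "sigma_finite_measure (?M L)" by (rule sigma_finite[OF L(1)])
  have "(\<lambda>xs. \<integral>\<^sup>+z. \<Psi> (merge (K \<union> R) L (xs, z)) \<partial>?M L) \<in> borel_measurable (?M (K \<union> R))"
    using measurable_compose[OF measurable_merge \<Psi>_meas]
    by (intro sigma_finite_measure.borel_measurable_nn_integral[OF sf]) (simp add: split_beta')
  then show "sprinkle Y H K R k \<in> borel_measurable (?M (K \<union> R))"
    by (rule measurable_cong[THEN iffD1, rotated]) (simp add: spr)
  have "(\<integral>\<^sup>+xs. sprinkle Y H K R k xs \<partial>?M (K \<union> R)) = (\<integral>\<^sup>+xs. \<integral>\<^sup>+z. \<Psi> (merge (K \<union> R) L (xs, z)) \<partial>?M L \<partial>?M (K \<union> R))"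
    by (intro nn_integral_cong spr)
  also have "\<dots> = (\<integral>\<^sup>+u. \<Psi> u \<partial>?M (K \<union> R \<union> L))"
    using product_nn_integral_fold[OF dis fKR L(1) \<Psi>_meas] ..
  \<comment> \<open>Tonelli in the other order: for a fixed cluster the points in \<open>R\<close>
    are independent of each other and their integral factors.\<close>
  also have "K \<union> R \<union> L = (K \<union> L) \<union> R" by auto
  also have "(\<integral>\<^sup>+u. \<Psi> u \<partial>?M (K \<union> L \<union> R)) = (\<integral>\<^sup>+y. \<integral>\<^sup>+w. \<Psi> (merge (K \<union> L) R (y, w)) \<partial>?M R \<partial>?M (K \<union> L))"
  proof (rule product_nn_integral_fold[OF dKLR fKL R])
    have "K \<union> L \<union> R = K \<union> R \<union> L" by auto
    then show "\<Psi> \<in> borel_measurable (?M (K \<union> L \<union> R))" using \<Psi>_meas by simp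
  qed
  also have "\<dots> = (\<integral>\<^sup>+y. h y * (\<Prod>i\<in>R. \<integral>\<^sup>+w. ennreal (1 - q y w) \<partial>lborel) \<partial>?M (K \<union> L))"
  proof (intro nn_integral_cong)
    fix y assume y: "y \<in> space (?M (K \<union> L))"
    have qm: "q y \<in> borel_measurable lborel"
      using measurable_compose[OF measurable_Pair1'[OF y] q_meas] by simp
    have "\<Psi> (merge (K \<union> L) R (y, w)) = h y * (\<Prod>i\<in>R. ennreal (1 - q y (w i)))" for w
    proof -
      have "h (merge (K \<union> L) R (y, w)) = h y" by (rule h_cong) (simp add: merge_def)
      moreover have "q (merge (K \<union> L) R (y, w)) v = q y v" for v by (rule q_cong) (simp add: merge_def)
      moreover have "merge (K \<union> L) R (y, w) i = w i" if "i \<in> R" for i using that dKLR by (auto simp: merge_def)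
      ultimately show ?thesis unfolding \<Psi>_def by (simp cong: prod.cong)
    qed
    moreover have "(\<integral>\<^sup>+w. h y * (\<Prod>i\<in>R. ennreal (1 - q y (w i))) \<partial>?M R) = h y * (\<integral>\<^sup>+w. (\<Prod>i\<in>R. ennreal (1 - q y (w i))) \<partial>?M R)"
      using qm by (intro nn_integral_cmult borel_measurable_prod_ennreal) auto
    moreover have "(\<integral>\<^sup>+w. (\<Prod>i\<in>R. ennreal (1 - q y (w i))) \<partial>?M R) = (\<Prod>i\<in>R. \<integral>\<^sup>+w. ennreal (1 - q y w) \<partial>lborel)"
      using qm by (intro product_nn_integral_prod[OF R, of "\<lambda>_ w. ennreal (1 - q y w)"]) auto
    ultimately show "(\<integral>\<^sup>+w. \<Psi> (merge (K \<union> L) R (y, w)) \<partial>?M R) = h y * (\<Prod>i\<in>R. \<integral>\<^sup>+w. ennreal (1 - q y w) \<partial>lborel)" by simp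
  qed
  also have "\<dots> = cfg_int Y (K \<union> L) (\<lambda>B. H (Y \<union> B) * ennreal (hvol \<phi> (Y \<union> B)) ^ card R)"
    unfolding cfg_int_def
  proof (intro nn_integral_cong)
    fix y :: "nat \<Rightarrow> 'd pt"
    have "finite (Y \<union> y ` (K \<union> L))" using Y fKL by auto
    from nn_integral_hvol[OF this]
    show "h y * (\<Prod>i\<in>R. \<integral>\<^sup>+w. ennreal (1 - q y w) \<partial>lborel) =
      (if cfg Y (K \<union> L) y then H (Y \<union> y ` (K \<union> L)) * ennreal (hvol \<phi> (Y \<union> y ` (K \<union> L))) ^ card R else 0)"
      unfolding h_def q_def by simp
  qed
  also have "\<dots> = cfg_int Y {..<card K + k} (\<lambda>B. H (Y \<union> B) * ennreal (hvol \<phi> (Y \<union> B)) ^ card R)"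
  proof -
    have "card (K \<union> L) = card K + k" using K L dKL by (simp add: card_Un_disjoint)
    then obtain b where b: "bij_betw b {..<card K + k} (K \<union> L)"
      using fKL ex_bij_betw_nat_finite[of "K \<union> L"] by (auto simp: atLeast0LessThan)
    show ?thesis
    proof (rule cfg_int_reindex[OF fKL b])
      let ?J = "{..<card K + k}"
      have "(\<lambda>z. (if cfg Y ?J z then H (Y \<union> z ` ?J) else 0) * ennreal (if cfg Y ?J z then hvol \<phi> (Y \<union> z ` ?J) else 0) ^ card R) \<in> borel_measurable (?M ?J)"
        using H hvol_config_measurable[OF Y, of ?J] unfolding config_measurable_def
        by (intro borel_measurable_times_ennreal borel_measurable_power_ennreal) auto
      then show "(\<lambda>z. if cfg Y ?J z then H (Y \<union> z ` ?J) * ennreal (hvol \<phi> (Y \<union> z ` ?J)) ^ card R else 0) \<in> borel_measurable (?M ?J)"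
        by (rule measurable_cong[THEN iffD1, rotated]) simp
    qed
  qed
  finally show "(\<integral>\<^sup>+xs. sprinkle Y H K R k xs \<partial>?M (K \<union> R)) =
      cfg_int Y {..<card K + k} (\<lambda>B. H (Y \<union> B) * ennreal (hvol \<phi> (Y \<union> B)) ^ card R)" .
qed

end

text \<open>Expand the product of the factors \<open>1 - p i\<close>. Integrability of
  \<open>V\<close> and \<open>p i \<le> 1\<close> make every term integrable, so the signs are
  legitimate.\<close>

lemma alternating_integrals:
  fixes V :: "'x \<Rightarrow> real" and p :: "'i \<Rightarrow> 'x \<Rightarrow> real"
  assumes V: "integrable M V" "\<And>x. 0 \<le> V x" and R: "finite R"
    and p: "\<And>i. i \<in> R \<Longrightarrow> p i \<in> borel_measurable M" "\<And>i x. 0 \<le> p i x \<and> p i x \<le> 1"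
  shows "(\<Sum>J\<in>Pow R. (-1) ^ card J * enn2real (\<integral>\<^sup>+x. ennreal (V x * (\<Prod>i\<in>J. p i x)) \<partial>M)) =
    enn2real (\<integral>\<^sup>+x. ennreal (V x * (\<Prod>i\<in>R. 1 - p i x)) \<partial>M)"
proof -
  have Vm: "V \<in> borel_measurable M" using V(1) by auto
  have int: "integrable M (\<lambda>x. V x * (\<Prod>i\<in>J. q i x))"
    if "J \<subseteq> R" "\<And>i. i \<in> R \<Longrightarrow> q i \<in> borel_measurable M" "\<And>i x. 0 \<le> q i x \<and> q i x \<le> 1" for J and q :: "'i \<Rightarrow> 'x \<Rightarrow> real"
  proof (rule Bochner_Integration.integrable_bound[OF V(1)])
    show "(\<lambda>x. V x * (\<Prod>i\<in>J. q i x)) \<in> borel_measurable M"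
      using that by (intro borel_measurable_times Vm borel_measurable_prod) auto
    have "norm (V x * (\<Prod>i\<in>J. q i x)) \<le> norm (V x)" for x
    proof -
      have "(\<Prod>i\<in>J. q i x) \<le> 1" using that by (intro prod_le_1) auto
      moreover have "0 \<le> (\<Prod>i\<in>J. q i x)" using that by (intro prod_nonneg) auto
      ultimately show ?thesis using V(2)[of x] by (simp add: mult_left_le)
    qed
    then show "AE x in M. norm (V x * (\<Prod>i\<in>J. q i x)) \<le> norm (V x)" by simp
  qed
  have eq: "enn2real (\<integral>\<^sup>+x. ennreal (V x * (\<Prod>i\<in>J. q i x)) \<partial>M) = (\<integral>x. V x * (\<Prod>i\<in>J. q i x) \<partial>M)"
    if "J \<subseteq> R" "\<And>i. i \<in> R \<Longrightarrow> q i \<in> borel_measurable M" "\<And>i x. 0 \<le> q i x \<and> q i x \<le> 1" for J and q :: "'i \<Rightarrow> 'x \<Rightarrow> real"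
    using int[OF that] that(3) V(2) by (intro integral_eq_nn_integral[symmetric]) (auto intro!: mult_nonneg_nonneg prod_nonneg)
  have "(\<Sum>J\<in>Pow R. (-1) ^ card J * enn2real (\<integral>\<^sup>+x. ennreal (V x * (\<Prod>i\<in>J. p i x)) \<partial>M)) =
     (\<Sum>J\<in>Pow R. \<integral>x. (-1) ^ card J * (V x * (\<Prod>i\<in>J. p i x)) \<partial>M)"
    using p by (intro sum.cong refl) (simp add: eq)
  also have "\<dots> = (\<integral>x. (\<Sum>J\<in>Pow R. (-1) ^ card J * (V x * (\<Prod>i\<in>J. p i x))) \<partial>M)"
    using p int by (intro Bochner_Integration.integral_sum[symmetric] Bochner_Integration.integrable_mult_right) auto
  also have "\<dots> = (\<integral>x. V x * (\<Prod>i\<in>R. 1 - p i x) \<partial>M)"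
  proof (intro Bochner_Integration.integral_cong refl)
    fix x
    have "(\<Prod>i\<in>R. 1 - p i x) = (\<Prod>i\<in>R. - p i x + 1)" by simp
    also have "\<dots> = (\<Sum>J\<in>Pow R. (-1) ^ card J * (\<Prod>i\<in>J. p i x))"
      by (subst prod_add[OF R]) (simp add: prod_uminus)
    finally show "(\<Sum>J\<in>Pow R. (-1) ^ card J * (V x * (\<Prod>i\<in>J. p i x))) = V x * (\<Prod>i\<in>R. 1 - p i x)"
      by (simp add: sum_distrib_left mult.left_commute)
  qed
  also have "\<dots> = enn2real (\<integral>\<^sup>+x. ennreal (V x * (\<Prod>i\<in>R. 1 - p i x)) \<partial>M)"
    using p by (intro eq[symmetric]) auto
  finally show ?thesis .
qed

text \<open>Each level carries plain Lebesgue measure; the factor \<open>1 / fact k\<close> is part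
  of \<open>cweight\<close>.\<close>

definition configs :: "(nat \<times> (nat \<Rightarrow> 'a::euclidean_space)) measure" where
  "configs = dsum (\<lambda>k. Pi\<^sub>M {..<k} (\<lambda>_. lborel))"

lemma cfg_series:
  fixes H :: "'a::euclidean_space set \<Rightarrow> ennreal"
  assumes "\<And>k. (\<lambda>z. if cfg Y {..<k} z then H (z ` {..<k}) else 0) \<in> borel_measurable (Pi\<^sub>M {..<k :: nat} (\<lambda>_. lborel))"
  shows "(\<lambda>(k, z). if cfg Y {..<k} z then ennreal (a k) * H (z ` {..<k}) else 0) \<in> borel_measurable configs"
    and "(\<Sum>k. ennreal (a k) * cfg_int Y {..<k} H) =
      (\<integral>\<^sup>+(k, z). (if cfg Y {..<k} z then ennreal (a k) * H (z ` {..<k}) else 0) \<partial>configs)"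
proof -
  have eq: "(if cfg Y {..<k} z then ennreal (a k) * H (z ` {..<k}) else 0) = ennreal (a k) * (if cfg Y {..<k} z then H (z ` {..<k}) else 0)" for k z
    by simp
  show m: "(\<lambda>(k, z). if cfg Y {..<k} z then ennreal (a k) * H (z ` {..<k}) else 0) \<in> borel_measurable configs"
    unfolding configs_def measurable_dsum_iff eq using assms by simp
  show "(\<Sum>k. ennreal (a k) * cfg_int Y {..<k} H) =
      (\<integral>\<^sup>+(k, z). (if cfg Y {..<k} z then ennreal (a k) * H (z ` {..<k}) else 0) \<partial>configs)"
    using assms m unfolding configs_def eq cfg_int_def
    by (subst nn_integral_dsum) (auto simp: nn_integral_cmult)
qed

section \<open>The expansion as one integral over configurations\<close>

context kernel
begin

definition ewt :: "real \<Rightarrow> 'd pt set \<Rightarrow> ('d pt set \<Rightarrow> real) \<Rightarrow> 'd pt set \<Rightarrow> ennreal" where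
  "ewt s A G S = ennreal (G S) * ennreal (wt \<phi> 0 A S * exp (- s * hvol \<phi> S))"

text \<open>The part of the density that is free of the intensity, with the
  \<open>1 / fact k\<close> that passes from ordered tuples to sets.\<close>

definition cweight :: "'d pt set \<Rightarrow> 'd pt set \<Rightarrow> ('d pt set \<Rightarrow> real) \<Rightarrow> nat \<times> (nat \<Rightarrow> 'd pt) \<Rightarrow> real" where
  "cweight Y A G = (\<lambda>(k, z). if cfg Y {..<k} z then G (Y \<union> z ` {..<k}) * wt \<phi> 0 A (Y \<union> z ` {..<k}) / fact k else 0)"

definition cvol :: "'d pt set \<Rightarrow> nat \<times> (nat \<Rightarrow> 'd pt) \<Rightarrow> real" where
  "cvol Y = (\<lambda>(k, z). if cfg Y {..<k} z then hvol \<phi> (Y \<union> z ` {..<k}) else 0)"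

definition sprinkle_series :: "real \<Rightarrow> 'd pt set \<Rightarrow> 'd pt set \<Rightarrow> ('d pt set \<Rightarrow> real) \<Rightarrow> nat set \<Rightarrow> nat set \<Rightarrow> (nat \<Rightarrow> 'd pt) \<Rightarrow> ennreal" where
  "sprinkle_series s Y A G K R xs = (\<Sum>k. ennreal (s ^ k / fact k) * sprinkle Y (ewt s A G) K R k xs)"

lemma config_measurable_ewt:
  assumes "finite Y" "0 \<in> Y" "finite A" "G \<in> borel_measurable N_space"
  shows "config_measurable Y (ewt s A G)"
  unfolding config_measurable_def ewt_def
  using animal_integrand_measurable[OF assms(1) _ assms(2,3), of _ "\<lambda>S. ennreal (G S)" s] assms(4) by auto

lemma cweight_measurable:
  assumes "finite Y" "0 \<in> Y" "finite A" "G \<in> borel_measurable N_space"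
  shows "cweight Y A G \<in> borel_measurable configs"
  unfolding configs_def measurable_dsum_iff
proof
  fix k
  have "(\<lambda>z. G (Y \<union> z ` {..<k}) * (if cfg Y {..<k} z then wt \<phi> 0 A (Y \<union> z ` {..<k}) else 0) / fact k) \<in> borel_measurable (Pi\<^sub>M {..<k} (\<lambda>_. lborel))"
    by (intro borel_measurable_divide borel_measurable_times measurable_compose[OF config_N_space assms(4)] wt_config_measurable borel_measurable_const)
      (use assms in auto)
  then show "(\<lambda>z. cweight Y A G (k, z)) \<in> borel_measurable (Pi\<^sub>M {..<k} (\<lambda>_. lborel))"
    by (rule measurable_cong[THEN iffD1, rotated]) (simp add: cweight_def)
qed

lemma cvol_measurable:
  assumes "finite Y"
  shows "cvol Y \<in> borel_measurable configs"
  unfolding configs_def measurable_dsum_iff cvol_def prod.case by (intro allI hvol_config_measurable[OF assms]) simp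

lemma cweight_nonneg: "(\<And>S. 0 \<le> G S) \<Longrightarrow> 0 \<le> cweight Y A G x"
  by (auto simp: cweight_def wt_nonneg split: prod.split)

lemma cvol_bounds:
  assumes "finite Y"
  shows "0 \<le> cvol Y x \<and> cvol Y x \<le> real (fst x + card Y) * m"
proof (cases x)
  case (Pair k z)
  have "card (Y \<union> z ` {..<k}) \<le> card Y + k"
    using card_Un_le[of Y "z ` {..<k}"] card_image_le[of "{..<k}" z] by simp
  then have "real (card (Y \<union> z ` {..<k})) * m \<le> real (k + card Y) * m"
    using m_nonneg by (intro mult_right_mono) auto
  then show ?thesis
    using Pair hvol_bounds[of "Y \<union> z ` {..<k}"] assms m_nonneg by (auto simp: cvol_def)
qed

lemma fst_configs: "fst \<in> configs \<rightarrow>\<^sub>M count_space UNIV"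
  unfolding configs_def by (rule measurable_dsum_fst)

text \<open>After the series over cluster sizes has become one integral, \<open>s\<close> enters
  only through a power times an exponential, the form treated by
  \<open>analytic_integral\<close>.\<close>

lemma animal_configs:
  assumes Y: "finite Y" "0 \<in> Y" and A: "finite A" and G: "G \<in> borel_measurable N_space" "\<And>S. 0 \<le> G S" and s: "0 \<le> s"
  shows "animal \<phi> s 0 Y A (\<lambda>S. ennreal (G S)) = (\<integral>\<^sup>+x. ennreal (cweight Y A G x * (s ^ fst x * exp (- s * cvol Y x))) \<partial>configs)"
proof -
  have "animal \<phi> s 0 Y A (\<lambda>S. ennreal (G S)) = (\<Sum>k. ennreal (s ^ k / fact k) * cfg_int Y {..<k} (\<lambda>B. ewt s A G (Y \<union> B)))"
    by (simp add: animal_def ewt_def)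
  also have "\<dots> = (\<integral>\<^sup>+(k, z). (if cfg Y {..<k} z then ennreal (s ^ k / fact k) * ewt s A G (Y \<union> z ` {..<k}) else 0) \<partial>configs)"
    using config_measurable_ewt[OF Y A G(1)] by (intro cfg_series(2)) (auto simp: config_measurable_def)
  also have "\<dots> = (\<integral>\<^sup>+x. ennreal (cweight Y A G x * (s ^ fst x * exp (- s * cvol Y x))) \<partial>configs)"
    using G(2) s by (intro nn_integral_cong)
      (auto simp: cweight_def cvol_def ewt_def wt_nonneg field_simps ennreal_mult[symmetric] split: prod.split)
  finally show ?thesis .
qed

text \<open>Matches integrals over sprinkled points with Leibniz terms: points in \<open>K\<close>
  account for the derivatives of the power, points in \<open>R\<close> for the volume
  factors.\<close>

lemma nn_integral_sprinkle_series:
  assumes Y: "finite Y" "0 \<in> Y" and A: "finite A" and G: "G \<in> borel_measurable N_space" "\<And>S. 0 \<le> G S" and s: "0 \<le> s"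
    and K: "finite K" and R: "finite R" and KR: "K \<inter> R = {}"
  shows "sprinkle_series s Y A G K R \<in> borel_measurable (Pi\<^sub>M (K \<union> R) (\<lambda>_. lborel))"
    and "(\<integral>\<^sup>+xs. sprinkle_series s Y A G K R xs \<partial>Pi\<^sub>M (K \<union> R) (\<lambda>_. lborel)) =
      (\<integral>\<^sup>+x. ennreal (cweight Y A G x * (real (fact (card K) * (fst x choose card K)) * s ^ (fst x - card K) * cvol Y x ^ card R * exp (- s * cvol Y x))) \<partial>configs)"
proof -
  note H = config_measurable_ewt[OF Y A G(1), of s]
  note sp = sprinkle_facts[OF Y(1) H K R KR]
  show "sprinkle_series s Y A G K R \<in> borel_measurable (Pi\<^sub>M (K \<union> R) (\<lambda>_. lborel))"
    unfolding sprinkle_series_def[abs_def] using sp(1) by (intro borel_measurable_suminf_order borel_measurable_times_ennreal) auto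
  define q l where "q = card K" and "l = card R"
  let ?H = "\<lambda>B. ewt s A G (Y \<union> B) * ennreal (hvol \<phi> (Y \<union> B)) ^ l"
  \<comment> \<open>The \<open>q\<close>-th derivative of \<open>s ^ j / fact j\<close>, with
    \<open>j\<close> the total number of cluster points besides \<open>Y\<close>. It vanishes for
    \<open>j < q\<close>, so the shifted sum may start at 0.\<close>
  let ?a = "\<lambda>j. real (fact q * (j choose q)) * s ^ (j - q) / fact j"
  have a: "?a (q + k) = s ^ k / fact k" for k
  proof -
    have "fact q * fact k * ((q + k) choose q) = (fact (q + k) :: nat)"
      using binomial_fact_lemma[of q "q + k"] by simp
    then have "real (fact q * ((q + k) choose q)) * fact k = fact (q + k)"
      by (metis (no_types, lifting) mult.assoc mult.commute of_nat_fact of_nat_mult)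
    then have "real (fact q * ((q + k) choose q)) / fact (q + k) = 1 / fact k"
      by (simp add: field_simps)
    then show ?thesis by (simp add: field_simps)
  qed
  have "(\<integral>\<^sup>+xs. sprinkle_series s Y A G K R xs \<partial>Pi\<^sub>M (K \<union> R) (\<lambda>_. lborel)) =
     (\<Sum>k. ennreal (s ^ k / fact k) * (\<integral>\<^sup>+xs. sprinkle Y (ewt s A G) K R k xs \<partial>Pi\<^sub>M (K \<union> R) (\<lambda>_. lborel)))"
    unfolding sprinkle_series_def using sp(1) by (simp add: nn_integral_suminf nn_integral_cmult)
  also have "\<dots> = (\<Sum>k. ennreal (?a (q + k)) * cfg_int Y {..<q + k} ?H)"
    unfolding sp(2) q_def[symmetric] l_def[symmetric] a ..
  also have "\<dots> = (\<Sum>j. ennreal (?a j) * cfg_int Y {..<j} ?H)"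
  proof (rule suminf_ennreal_shift[of q "\<lambda>j. ennreal (?a j) * cfg_int Y {..<j} ?H"])
    fix j assume "j < q"
    then have "j choose q = 0" by (rule binomial_eq_0)
    then have "?a j = 0" by simp
    then show "ennreal (?a j) * cfg_int Y {..<j} ?H = 0" by (simp only: ennreal_0 mult_zero_left)
  qed
  also have "\<dots> = (\<integral>\<^sup>+(k, z). (if cfg Y {..<k} z then ennreal (?a k) * ?H (z ` {..<k}) else 0) \<partial>configs)"
  proof (rule cfg_series(2))
    fix k :: nat
    have "(\<lambda>z. (if cfg Y {..<k} z then ewt s A G (Y \<union> z ` {..<k}) else 0) * ennreal (if cfg Y {..<k} z then hvol \<phi> (Y \<union> z ` {..<k}) else 0) ^ l) \<in> borel_measurable (Pi\<^sub>M {..<k} (\<lambda>_. lborel))"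
    proof (intro borel_measurable_times_ennreal borel_measurable_power_ennreal measurable_compose[OF _ measurable_ennreal])
      show "(\<lambda>z. if cfg Y {..<k} z then ewt s A G (Y \<union> z ` {..<k}) else 0) \<in> borel_measurable (Pi\<^sub>M {..<k} (\<lambda>_. lborel))"
        using H unfolding config_measurable_def by blast
      show "(\<lambda>z. if cfg Y {..<k} z then hvol \<phi> (Y \<union> z ` {..<k}) else 0) \<in> borel_measurable (Pi\<^sub>M {..<k} (\<lambda>_. lborel))"
        by (rule hvol_config_measurable[OF Y(1)]) simp
    qed
    then show "(\<lambda>z. if cfg Y {..<k} z then ?H (z ` {..<k}) else 0) \<in> borel_measurable (Pi\<^sub>M {..<k} (\<lambda>_. lborel))"
      by (rule measurable_cong[THEN iffD1, rotated]) simp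
  qed
  also have "\<dots> = (\<integral>\<^sup>+x. ennreal (cweight Y A G x * (real (fact q * (fst x choose q)) * s ^ (fst x - q) * cvol Y x ^ l * exp (- s * cvol Y x))) \<partial>configs)"
  proof (intro nn_integral_cong)
    fix x :: "nat \<times> (nat \<Rightarrow> 'd pt)"
    obtain k z where x: "x = (k, z)" by (cases x)
    show "(case x of (k, z) \<Rightarrow> if cfg Y {..<k} z then ennreal (?a k) * ?H (z ` {..<k}) else 0) =
      ennreal (cweight Y A G x * (real (fact q * (fst x choose q)) * s ^ (fst x - q) * cvol Y x ^ l * exp (- s * cvol Y x)))"
    proof (cases "cfg Y {..<k} z")
      case True
      let ?S = "Y \<union> z ` {..<k}"
      have nn: "0 \<le> hvol \<phi> ?S" "0 \<le> wt \<phi> 0 A ?S" "0 \<le> G ?S" "0 \<le> ?a k" using hvol_bounds[of ?S] Y wt_nonneg G(2) s by auto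
      have "ennreal (?a k) * ?H (z ` {..<k}) = ennreal (?a k * (G ?S * (wt \<phi> 0 A ?S * exp (- s * hvol \<phi> ?S)) * hvol \<phi> ?S ^ l))"
        unfolding ewt_def using nn by (simp only: ennreal_mult[symmetric] ennreal_power mult_nonneg_nonneg zero_le_power exp_ge_zero)
      also have "?a k * (G ?S * (wt \<phi> 0 A ?S * exp (- s * hvol \<phi> ?S)) * hvol \<phi> ?S ^ l) =
         cweight Y A G x * (real (fact q * (fst x choose q)) * s ^ (fst x - q) * cvol Y x ^ l * exp (- s * cvol Y x))"
        using True by (simp add: x cweight_def cvol_def)
      finally show ?thesis using True by (simp add: x)
    qed (simp add: x cweight_def)
  qed
  finally show "(\<integral>\<^sup>+xs. sprinkle_series s Y A G K R xs \<partial>Pi\<^sub>M (K \<union> R) (\<lambda>_. lborel)) =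
      (\<integral>\<^sup>+x. ennreal (cweight Y A G x * (real (fact (card K) * (fst x choose card K)) * s ^ (fst x - card K) * cvol Y x ^ card R * exp (- s * cvol Y x))) \<partial>configs)"
    unfolding q_def l_def .
qed

text \<open>Excluding one more point multiplies the density by its \<open>nh\<close> without
  changing the configurations, so all terms are integrals against one density. Assumption
  \<open>fin\<close> makes that density integrable, which permits the alternating signs.\<close>

lemma alternating_animals:
  assumes Y: "finite Y" "0 \<in> Y" and A: "finite A" and G: "G \<in> borel_measurable N_space" "\<And>S. 0 \<le> G S" and s: "0 \<le> s"
    and K: "finite K" and R: "finite R" and xs: "cfg Y K xs" "cfg A R xs"
    and fin: "animal \<phi> s 0 (Y \<union> xs ` K) A (\<lambda>S. ennreal (G S)) < \<infinity>"
  shows "(\<Sum>J\<in>Pow R. (-1) ^ card J * enn2real (animal \<phi> s 0 (Y \<union> xs ` K) (A \<union> xs ` J) (\<lambda>S. ennreal (G S)))) =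
    enn2real (sprinkle_series s Y A G K R xs)"
proof -
  let ?Y = "Y \<union> xs ` K"
  have Y': "finite ?Y" "0 \<in> ?Y" using Y K by auto
  define V where "V x = cweight ?Y A G x * (s ^ fst x * exp (- s * cvol ?Y x))" for x
  \<comment> \<open>The default 1 has no effect, because \<open>V\<close> vanishes outside
    \<open>cfg\<close>.\<close>
  define p :: "nat \<Rightarrow> nat \<times> (nat \<Rightarrow> 'd pt) \<Rightarrow> real" where "p i = (\<lambda>(k, z). if cfg ?Y {..<k} z then nh \<phi> (?Y \<union> z ` {..<k}) (xs i) else 1)" for i
  have V0: "0 \<le> V x" for x using cweight_nonneg[OF G(2)] s by (simp add: V_def)
  have Vm: "V \<in> borel_measurable configs"
    unfolding V_def using cweight_measurable[OF Y' A G(1)] cvol_measurable[OF Y'(1)] measurable_compose[OF fst_configs, of "\<lambda>k. s ^ k" borel]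
    by (intro borel_measurable_times borel_measurable_exp[THEN measurable_compose[rotated]] borel_measurable_const) auto
  have Vint: "integrable configs V"
    using fin V0 Vm unfolding animal_configs[OF Y' A G s] V_def[symmetric] by (intro integrableI_nonneg) auto
  have p01: "0 \<le> p i x \<and> p i x \<le> 1" for i x using nh_range by (auto simp: p_def split: prod.split)
  have pm: "p i \<in> borel_measurable configs" for i
    unfolding configs_def measurable_dsum_iff p_def prod.case by (intro allI nh_config_measurable1[OF Y'(1)]) simp
  have an: "animal \<phi> s 0 ?Y (A \<union> xs ` J) (\<lambda>S. ennreal (G S)) = (\<integral>\<^sup>+x. ennreal (V x * (\<Prod>i\<in>J. p i x)) \<partial>configs)" if J: "J \<subseteq> R" for J
  proof -
    have fJ: "finite J" using J R by (rule finite_subset)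
    have "inj_on xs J" "A \<inter> xs ` J = {}" using J xs(2) by (auto simp: cfg_def intro: inj_on_subset)
    then have "wt \<phi> 0 (A \<union> xs ` J) S = wt \<phi> 0 A S * (\<Prod>i\<in>J. nh \<phi> S (xs i))" for S
      using A fJ by (simp add: wt_def prod.union_disjoint prod.reindex)
    then have "cweight ?Y (A \<union> xs ` J) G x = cweight ?Y A G x * (\<Prod>i\<in>J. p i x)" for x
      by (auto simp: cweight_def p_def split: prod.split)
    then show ?thesis using A fJ
      by (subst animal_configs[OF Y' _ G s]) (auto simp: V_def mult_ac intro!: nn_integral_cong)
  qed
  have sp: "sprinkle_series s Y A G K R xs = (\<integral>\<^sup>+x. ennreal (V x * (\<Prod>i\<in>R. 1 - p i x)) \<partial>configs)"
  proof -
    let ?H = "\<lambda>B. ewt s A G (?Y \<union> B) * (\<Prod>i\<in>R. ennreal (1 - nh \<phi> (?Y \<union> B) (xs i)))"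
    have "sprinkle_series s Y A G K R xs = (\<Sum>k. ennreal (s ^ k / fact k) * cfg_int ?Y {..<k} ?H)"
      using xs(1) by (simp add: sprinkle_series_def sprinkle_def)
    also have "\<dots> = (\<integral>\<^sup>+(k, z). (if cfg ?Y {..<k} z then ennreal (s ^ k / fact k) * ?H (z ` {..<k}) else 0) \<partial>configs)"
    proof (rule cfg_series(2))
      fix k :: nat
      have "(\<lambda>z. (if cfg ?Y {..<k} z then ewt s A G (?Y \<union> z ` {..<k}) else 0) *
         (\<Prod>i\<in>R. ennreal (1 - (if cfg ?Y {..<k} z then nh \<phi> (?Y \<union> z ` {..<k}) (xs i) else 1)))) \<in> borel_measurable (Pi\<^sub>M {..<k} (\<lambda>_. lborel))"
        using config_measurable_ewt[OF Y' A G(1), of s] nh_config_measurable1[OF Y'(1), of "{..<k}"] unfolding config_measurable_def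
        by (intro borel_measurable_times_ennreal borel_measurable_prod_ennreal measurable_compose[OF _ measurable_ennreal] borel_measurable_diff) auto
      then show "(\<lambda>z. if cfg ?Y {..<k} z then ?H (z ` {..<k}) else 0) \<in> borel_measurable (Pi\<^sub>M {..<k} (\<lambda>_. lborel))"
        by (rule measurable_cong[THEN iffD1, rotated]) simp
    qed
    also have "\<dots> = (\<integral>\<^sup>+x. ennreal (V x * (\<Prod>i\<in>R. 1 - p i x)) \<partial>configs)"
    proof (intro nn_integral_cong)
      fix x :: "nat \<times> (nat \<Rightarrow> 'd pt)"
      obtain k z where x: "x = (k, z)" by (cases x)
      show "(case x of (k, z) \<Rightarrow> if cfg ?Y {..<k} z then ennreal (s ^ k / fact k) * ?H (z ` {..<k}) else 0) = ennreal (V x * (\<Prod>i\<in>R. 1 - p i x))"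
      proof (cases "cfg ?Y {..<k} z")
        case True
        let ?S = "?Y \<union> z ` {..<k}"
        have nn: "0 \<le> wt \<phi> 0 A ?S" "0 \<le> G ?S" "0 \<le> s ^ k / fact k" "0 \<le> (\<Prod>i\<in>R. 1 - nh \<phi> ?S (xs i))"
          using wt_nonneg G(2) s nh_range by (auto intro: prod_nonneg)
        have pr: "(\<Prod>i\<in>R. ennreal (1 - nh \<phi> ?S (xs i))) = ennreal (\<Prod>i\<in>R. 1 - nh \<phi> ?S (xs i))"
          using nh_range by (intro prod_ennreal) auto
        have "ennreal (s ^ k / fact k) * ?H (z ` {..<k}) = ennreal (s ^ k / fact k * (G ?S * (wt \<phi> 0 A ?S * exp (- s * hvol \<phi> ?S)) * (\<Prod>i\<in>R. 1 - nh \<phi> ?S (xs i))))"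
          unfolding ewt_def pr using nn by (simp only: ennreal_mult[symmetric] mult_nonneg_nonneg exp_ge_zero)
        also have "s ^ k / fact k * (G ?S * (wt \<phi> 0 A ?S * exp (- s * hvol \<phi> ?S)) * (\<Prod>i\<in>R. 1 - nh \<phi> ?S (xs i))) = V x * (\<Prod>i\<in>R. 1 - p i x)"
          using True by (simp add: x V_def p_def cweight_def cvol_def)
        finally show ?thesis using True by (simp add: x)
      qed (simp add: x V_def cweight_def)
    qed
    finally show ?thesis .
  qed
  have "(\<Sum>J\<in>Pow R. (-1) ^ card J * enn2real (\<integral>\<^sup>+x. ennreal (V x * (\<Prod>i\<in>J. p i x)) \<partial>configs)) =
    enn2real (\<integral>\<^sup>+x. ennreal (V x * (\<Prod>i\<in>R. 1 - p i x)) \<partial>configs)"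
    by (rule alternating_integrals[OF Vint V0 R pm p01])
  then show ?thesis unfolding sp by (simp add: an)
qed

end

subsection \<open>Analyticity\<close>

text \<open>For \<open>s > 0\<close> the inequality \<open>1 + a \<le> exp a\<close> turns the
  change of \<open>s ^ k\<close> into one factor per point, and the volume is at most
  \<open>m\<close> per point. At \<open>s = 0\<close> the power \<open>0 ^ k\<close> dominates
  nothing for \<open>k > 0\<close>, so the bound is taken at a positive \<open>b\<close>.\<close>

lemma intensity_shift_bound:
  fixes s b \<epsilon> m :: real and q :: nat
  assumes sb: "0 < s \<and> b = s \<or> s = 0 \<and> 0 < b" and \<epsilon>: "0 < \<epsilon>" and m: "0 \<le> m"
  shows "\<exists>\<delta>>0. \<exists>C. \<forall>k v. 0 \<le> v \<and> v \<le> real (k + q) * m \<longrightarrow>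
    (s + \<delta>) ^ k * exp ((\<delta> - s) * v) \<le> C * (b ^ k * exp (- b * v) * exp (\<epsilon> * real (k + q)))"
  using sb
proof
  assume "0 < s \<and> b = s"
  then have s: "0 < s" and b: "b = s" by auto
  \<comment> \<open>Per point, changing the power costs \<open>\<delta> / s\<close> and changing the
    exponential costs \<open>\<delta> * m\<close> in the exponent; together they are exactly
    \<open>\<epsilon>\<close>.\<close>
  define \<delta> where "\<delta> = \<epsilon> / (1 / s + m)"
  have pos: "0 < 1 / s + m" using s m by (intro add_pos_nonneg) auto
  have \<delta>: "0 < \<delta>" "\<delta> * (1 / s + m) = \<epsilon>" using pos \<epsilon> by (simp_all add: \<delta>_def)
  have "(s + \<delta>) ^ k * exp ((\<delta> - s) * v) \<le> 1 * (b ^ k * exp (- b * v) * exp (\<epsilon> * real (k + q)))"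
    if v: "0 \<le> v" "v \<le> real (k + q) * m" for k v
  proof -
    have "s + \<delta> \<le> s * exp (\<delta> / s)"
      using exp_ge_add_one_self[of "\<delta> / s"] s by (simp add: field_simps)
    then have "(s + \<delta>) ^ k \<le> (s * exp (\<delta> / s)) ^ k" using s \<delta> by (intro power_mono) auto
    also have "\<dots> = s ^ k * exp (\<delta> / s * real k)"
      by (simp add: power_mult_distrib exp_of_nat_mult[symmetric] mult.commute)
    finally have 1: "(s + \<delta>) ^ k \<le> s ^ k * exp (\<delta> / s * real k)" .
    have "\<delta> / s * real k + (\<delta> - s) * v \<le> - s * v + \<epsilon> * real (k + q)"
    proof -
      have "\<delta> * v \<le> \<delta> * (real (k + q) * m)" using v \<delta> by (intro mult_left_mono) auto
      moreover have "\<delta> / s * real k \<le> \<delta> / s * real (k + q)" using \<delta> s by (intro mult_left_mono) auto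
      moreover have "\<delta> / s * real (k + q) + \<delta> * (real (k + q) * m) = \<epsilon> * real (k + q)"
        unfolding \<delta>(2)[symmetric] by (simp add: algebra_simps)
      ultimately show ?thesis by (simp add: algebra_simps)
    qed
    then have 2: "exp (\<delta> / s * real k) * exp ((\<delta> - s) * v) \<le> exp (- s * v) * exp (\<epsilon> * real (k + q))"
      by (simp add: exp_add[symmetric])
    have "(s + \<delta>) ^ k * exp ((\<delta> - s) * v) \<le> s ^ k * exp (\<delta> / s * real k) * exp ((\<delta> - s) * v)"
      using 1 by (intro mult_right_mono) auto
    also have "\<dots> = s ^ k * (exp (\<delta> / s * real k) * exp ((\<delta> - s) * v))" by simp
    also have "\<dots> \<le> s ^ k * (exp (- s * v) * exp (\<epsilon> * real (k + q)))"
      using 2 s by (intro mult_left_mono) auto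
    finally show ?thesis by (simp add: b mult.assoc)
  qed
  then show ?thesis using \<delta>(1) by blast
next
  assume "s = 0 \<and> 0 < b"
  then have s: "s = 0" and b: "0 < b" by auto
  \<comment> \<open>Of the two factors \<open>exp (- b * m)\<close> per Poisson point, one pays for
    \<open>exp (- b * v)\<close> on the right and the other for \<open>exp (\<delta> * v)\<close>,
    as \<open>\<delta> \<le> b\<close>. The \<open>q\<close> fixed points go into the
    constant.\<close>
  define \<delta> where "\<delta> = b * exp (- 2 * b * m)"
  have \<delta>: "0 < \<delta>" "\<delta> \<le> b" using b m by (simp_all add: \<delta>_def mult_left_le)
  have "(s + \<delta>) ^ k * exp ((\<delta> - s) * v) \<le> exp (2 * b * m * real q) * (b ^ k * exp (- b * v) * exp (\<epsilon> * real (k + q)))"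
    if v: "0 \<le> v" "v \<le> real (k + q) * m" for k v
  proof -
    have 1: "(s + \<delta>) ^ k = b ^ k * exp (- 2 * b * m * real k)"
      by (simp add: s \<delta>_def power_mult_distrib exp_of_nat_mult[symmetric] mult.commute)
    have "\<delta> * v \<le> b * v" using \<delta> v by (intro mult_right_mono) auto
    moreover have "b * v \<le> b * (real (k + q) * m)" using b v by (intro mult_left_mono) auto
    moreover have "0 \<le> \<epsilon> * real (k + q)" using \<epsilon> by simp
    ultimately have "- 2 * b * m * real k + \<delta> * v \<le> 2 * b * m * real q + (- b * v + \<epsilon> * real (k + q))"
      by (simp add: algebra_simps)
    then have 2: "exp (- 2 * b * m * real k) * exp (\<delta> * v) \<le> exp (2 * b * m * real q) * (exp (- b * v) * exp (\<epsilon> * real (k + q)))"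
      by (simp add: exp_add[symmetric])
    have "(s + \<delta>) ^ k * exp ((\<delta> - s) * v) = b ^ k * (exp (- 2 * b * m * real k) * exp (\<delta> * v))"
      unfolding 1 by (simp add: s)
    also have "\<dots> \<le> b ^ k * (exp (2 * b * m * real q) * (exp (- b * v) * exp (\<epsilon> * real (k + q))))"
      using 2 b by (intro mult_left_mono) auto
    finally show ?thesis by (simp add: mult_ac)
  qed
  then show ?thesis using \<delta>(1) by blast
qed

context kernel
begin

lemma animal_le:
  assumes Y: "finite Y" "0 \<in> Y" and A: "finite A" and s: "0 \<le> s"
    and F: "F1 \<in> borel_measurable N_space" "F2 \<in> borel_measurable N_space"
    and le: "\<And>S. finite S \<Longrightarrow> F S \<le> c * F1 S + F2 S"
  shows "animal \<phi> s 0 Y A F \<le> c * animal \<phi> s 0 Y A F1 + animal \<phi> s 0 Y A F2"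
proof -
  let ?w = "\<lambda>S. ennreal (wt \<phi> 0 A S * exp (- s * hvol \<phi> S))"
  let ?I = "\<lambda>k F. cfg_int Y {..<k :: nat} (\<lambda>B. F (Y \<union> B) * ?w (Y \<union> B))"
  have term_le: "?I k F \<le> c * ?I k F1 + ?I k F2" for k
  proof -
    let ?f = "\<lambda>F z. if cfg Y {..<k} z then F (Y \<union> z ` {..<k}) * ?w (Y \<union> z ` {..<k}) else 0"
    have m: "?f F1 \<in> borel_measurable (Pi\<^sub>M {..<k} (\<lambda>_. lborel))" "?f F2 \<in> borel_measurable (Pi\<^sub>M {..<k} (\<lambda>_. lborel))"
      using animal_integrand_measurable[OF Y(1) _ Y(2) A F(1), of "{..<k}" s] animal_integrand_measurable[OF Y(1) _ Y(2) A F(2), of "{..<k}" s] by auto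
    have "?I k F \<le> (\<integral>\<^sup>+z. c * ?f F1 z + ?f F2 z \<partial>Pi\<^sub>M {..<k} (\<lambda>_. lborel))"
      unfolding cfg_int_def
    proof (rule nn_integral_mono)
      fix z :: "nat \<Rightarrow> 'd pt"
      have "F (Y \<union> z ` {..<k}) \<le> c * F1 (Y \<union> z ` {..<k}) + F2 (Y \<union> z ` {..<k})" using Y by (intro le) auto
      from mult_right_mono[OF this, of "?w (Y \<union> z ` {..<k})"]
      show "?f F z \<le> c * ?f F1 z + ?f F2 z" by (simp add: distrib_right mult.assoc)
    qed
    also have "\<dots> = c * ?I k F1 + ?I k F2"
      unfolding cfg_int_def using m by (subst nn_integral_add) (auto simp: nn_integral_cmult)
    finally show ?thesis .
  qed
  have "animal \<phi> s 0 Y A F \<le> (\<Sum>k. c * (ennreal (s ^ k / fact k) * ?I k F1) + ennreal (s ^ k / fact k) * ?I k F2)"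
    unfolding animal_def
  proof (intro suminf_le summableI)
    fix k
    show "ennreal (s ^ k / fact k) * ?I k F \<le> c * (ennreal (s ^ k / fact k) * ?I k F1) + ennreal (s ^ k / fact k) * ?I k F2"
      using mult_left_mono[OF term_le[of k], of "ennreal (s ^ k / fact k)"] by (simp add: distrib_left mult_ac)
  qed
  also have "\<dots> = c * animal \<phi> s 0 Y A F1 + animal \<phi> s 0 Y A F2"
    unfolding animal_def by (simp add: suminf_add[OF summableI summableI, symmetric])
  finally show ?thesis .
qed

text \<open>The integrated Leibniz term in which the power is differentiated \<open>q\<close> times
  and the exponential contributes \<open>l\<close> volume factors, without their sign.\<close>

definition coef :: "real \<Rightarrow> 'd pt set \<Rightarrow> 'd pt set \<Rightarrow> ('d pt set \<Rightarrow> real) \<Rightarrow> nat \<Rightarrow> nat \<Rightarrow> ennreal" where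
  "coef s Y A G q l = (\<integral>\<^sup>+x. ennreal (cweight Y A G x * (real (fact q * (fst x choose q)) * s ^ (fst x - q) * cvol Y x ^ l * exp (- s * cvol Y x))) \<partial>configs)"

lemma card_cfg: "finite Y \<Longrightarrow> finite I \<Longrightarrow> cfg Y I z \<Longrightarrow> card (Y \<union> z ` I) = card I + card Y"
  by (simp add: cfg_def card_Un_disjoint card_image Int_commute)

text \<open>The shift bound dominates the integrand required by \<open>analytic_integral\<close> by
  the integrand at \<open>b\<close> with the additional weight \<open>exp_npts \<epsilon>\<close>,
  whose integral \<open>fin\<close> keeps finite. \<open>b\<close> differs from \<open>s\<close>
  only at \<open>s = 0\<close>.\<close>

lemma animal_analytic:
  assumes Y: "finite Y" "0 \<in> Y" and A: "finite A" and G: "G \<in> borel_measurable N_space" "\<And>S. 0 \<le> G S" and s: "0 \<le> s"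
    and sb: "0 < s \<and> b = s \<or> s = 0 \<and> 0 < b" and \<epsilon>: "0 < \<epsilon>"
    and fin: "animal \<phi> b 0 Y A (\<lambda>S. ennreal (G S * enn2real (exp_npts \<epsilon> S))) < \<infinity>"
  shows "(\<forall>q l. coef s Y A G q l < \<infinity>) \<and>
    (\<exists>\<delta>>0. \<forall>h. \<bar>h\<bar> < \<delta> \<and> 0 \<le> s + h \<longrightarrow> animal \<phi> (s + h) 0 Y A (\<lambda>S. ennreal (G S)) < \<infinity> \<and>
       (\<lambda>n. h ^ n / fact n * (\<Sum>q\<le>n. real (n choose q) * (-1) ^ (n - q) * enn2real (coef s Y A G q (n - q))))
         sums enn2real (animal \<phi> (s + h) 0 Y A (\<lambda>S. ennreal (G S))))"
proof -
  let ?W = "cweight Y A G" and ?v = "cvol Y"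
  let ?G = "\<lambda>S. G S * enn2real (exp_npts \<epsilon> S)"
  have b: "0 \<le> b" using sb by auto
  note Wm = cweight_measurable[OF Y A G(1)] and vm = cvol_measurable[OF Y(1)]
  have W0: "0 \<le> ?W x" for x by (rule cweight_nonneg[OF G(2)])
  have v0: "0 \<le> ?v x" and vle: "?v x \<le> real (fst x + card Y) * m" for x using cvol_bounds[OF Y(1)] by auto
  have Gm: "?G \<in> borel_measurable N_space"
    by (intro borel_measurable_times G measurable_compose[OF exp_npts_measurable]) auto
  have WG: "cweight Y A ?G x = ?W x * exp (\<epsilon> * real (fst x + card Y))" for x
    using Y(1) by (auto simp: cweight_def exp_npts_def card_cfg split: prod.split)
  obtain \<delta> C where \<delta>: "0 < \<delta>" and C: "\<And>k v. 0 \<le> v \<Longrightarrow> v \<le> real (k + card Y) * m \<Longrightarrow>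
    (s + \<delta>) ^ k * exp ((\<delta> - s) * v) \<le> C * (b ^ k * exp (- b * v) * exp (\<epsilon> * real (k + card Y)))"
    using intensity_shift_bound[OF sb \<epsilon> m_nonneg, of "card Y"] by blast
  have km: "(\<lambda>x :: nat \<times> (nat \<Rightarrow> 'd pt). a ^ fst x) \<in> borel_measurable configs" for a :: real
    by (rule measurable_compose[OF fst_configs]) simp
  have em: "(\<lambda>x :: nat \<times> (nat \<Rightarrow> 'd pt). exp (\<epsilon> * real (fst x + card Y))) \<in> borel_measurable configs"
    by (rule measurable_compose[OF fst_configs]) simp
  have "integrable configs (\<lambda>x. C * (?W x * exp (\<epsilon> * real (fst x + card Y)) * (b ^ fst x * exp (- b * ?v x))))"
  proof (intro Bochner_Integration.integrable_mult_right integrableI_nonneg)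
    show "(\<lambda>x. ?W x * exp (\<epsilon> * real (fst x + card Y)) * (b ^ fst x * exp (- b * ?v x))) \<in> borel_measurable configs"
      by (intro borel_measurable_times Wm km em measurable_compose[OF _ borel_measurable_exp] borel_measurable_const vm)
    show "(\<integral>\<^sup>+x. ennreal (?W x * exp (\<epsilon> * real (fst x + card Y)) * (b ^ fst x * exp (- b * ?v x))) \<partial>configs) < \<infinity>"
      using fin unfolding animal_configs[OF Y A Gm mult_nonneg_nonneg[OF G(2) enn2real_nonneg] b] WG .
  qed (use W0 b in auto)
  then have int: "integrable configs (\<lambda>x. ?W x * ((s + \<delta>) ^ fst x * exp ((\<delta> - s) * ?v x)))"
  proof (rule Bochner_Integration.integrable_bound)
    show "(\<lambda>x. ?W x * ((s + \<delta>) ^ fst x * exp ((\<delta> - s) * ?v x))) \<in> borel_measurable configs"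
      by (intro borel_measurable_times Wm km measurable_compose[OF _ borel_measurable_exp] borel_measurable_const vm)
    have "?W x * ((s + \<delta>) ^ fst x * exp ((\<delta> - s) * ?v x)) \<le> C * (?W x * exp (\<epsilon> * real (fst x + card Y)) * (b ^ fst x * exp (- b * ?v x)))" for x
      using mult_left_mono[OF C[OF v0[of x] vle[of x]] W0[of x]] by (simp add: mult_ac)
    then have "norm (?W x * ((s + \<delta>) ^ fst x * exp ((\<delta> - s) * ?v x))) \<le> norm (C * (?W x * exp (\<epsilon> * real (fst x + card Y)) * (b ^ fst x * exp (- b * ?v x))))" for x
      using W0[of x] s \<delta> by (simp add: abs_of_nonneg) (meson abs_ge_self order_trans)
    then show "AE x in configs. norm (?W x * ((s + \<delta>) ^ fst x * exp ((\<delta> - s) * ?v x))) \<le> norm (C * (?W x * exp (\<epsilon> * real (fst x + card Y)) * (b ^ fst x * exp (- b * ?v x))))"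
      by simp
  qed
  note ai = analytic_integral[OF Wm vm fst_configs v0 s \<delta> int]
  let ?t = "\<lambda>q l x. ?W x * (real (fact q * (fst x choose q)) * s ^ (fst x - q) * ?v x ^ l * exp (- s * ?v x))"
  have t0: "0 \<le> ?t q l x" for q l x using W0 v0 s by simp
  have cf: "coef s Y A G q l < \<infinity>" "(\<integral>x. ?t q l x \<partial>configs) = enn2real (coef s Y A G q l)" for q l
  proof -
    have i: "integrable configs (?t q l)" by (rule ai(1))
    show "coef s Y A G q l < \<infinity>" using i t0 unfolding coef_def by (subst nn_integral_eq_integral) auto
    show "(\<integral>x. ?t q l x \<partial>configs) = enn2real (coef s Y A G q l)"
      unfolding coef_def using i t0 by (intro integral_eq_nn_integral) auto
  qed
  have "animal \<phi> (s + h) 0 Y A (\<lambda>S. ennreal (G S)) < \<infinity> \<and>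
       (\<lambda>n. h ^ n / fact n * (\<Sum>q\<le>n. real (n choose q) * (-1) ^ (n - q) * enn2real (coef s Y A G q (n - q))))
         sums enn2real (animal \<phi> (s + h) 0 Y A (\<lambda>S. ennreal (G S)))"
    if h: "\<bar>h\<bar> < \<delta>" "0 \<le> s + h" for h
  proof -
    let ?u = "\<lambda>x. ?W x * ((s + h) ^ fst x * exp (- (s + h) * ?v x))"
    have u0: "0 \<le> ?u x" for x using W0 h by simp
    have i: "integrable configs ?u" by (rule ai(2)[OF h(1)])
    have "animal \<phi> (s + h) 0 Y A (\<lambda>S. ennreal (G S)) = ennreal (\<integral>x. ?u x \<partial>configs)"
      unfolding animal_configs[OF Y A G h(2)] using i u0 by (intro nn_integral_eq_integral) auto
    then show ?thesis using ai(3)[OF h(1)] unfolding cf(2) using u0 by (simp add: integral_nonneg_AE)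
  qed
  then show ?thesis using cf(1) \<delta> by blast
qed

end

context rcm_family
begin

text \<open>The growth condition says nothing about small clusters. Below a threshold
  \<open>N\<close> integrability is supplied by \<open>small\<close>, above it the exponential
  moment absorbs both the growth of \<open>G\<close> and the change of intensity.\<close>

lemma animal_pair_analytic:
  assumes s: "subcrit s" and x: "x \<noteq> 0" and YA: "Y = {0} \<and> A = {x} \<or> Y = {0, x} \<and> A = {}"
    and G: "G \<in> borel_measurable N_space" "\<And>S. 0 \<le> G S"
    and growth: "\<And>\<epsilon>. \<epsilon> > 0 \<Longrightarrow> \<exists>n\<^sub>0::nat. \<forall>\<mu>\<in>locally_finite_sets. of_nat n\<^sub>0 \<le> npts \<mu> UNIV \<longrightarrow> ennreal (G \<mu>) \<le> exp_npts \<epsilon> \<mu>"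
    and small: "\<And>t (n::nat). subcrit t \<Longrightarrow>
      (\<integral>\<^sup>+\<omega>. (if npts (Cl t [0 \<mapsto> 0, 1 \<mapsto> x] 0 \<omega>) UNIV < of_nat n then ennreal (G (Cl t [0 \<mapsto> 0, 1 \<mapsto> x] 0 \<omega>)) else 0) \<partial>P t) < \<infinity>"
  shows "(\<forall>q l. coef s Y A G q l < \<infinity>) \<and>
    (\<exists>\<delta>>0. \<forall>h. \<bar>h\<bar> < \<delta> \<and> 0 \<le> s + h \<longrightarrow> animal \<phi> (s + h) 0 Y A (\<lambda>S. ennreal (G S)) < \<infinity> \<and>
       (\<lambda>n. h ^ n / fact n * (\<Sum>q\<le>n. real (n choose q) * (-1) ^ (n - q) * enn2real (coef s Y A G q (n - q))))
         sums enn2real (animal \<phi> (s + h) 0 Y A (\<lambda>S. ennreal (G S))))"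
proof -
  have YA': "finite Y" "0 \<in> Y" "finite A" using YA by auto
  have s0: "0 \<le> s" using s by (simp add: subcrit_def)
  \<comment> \<open>At \<open>s = 0\<close> a positive intensity that is still subcritical takes
    over the domination; half of the witness \<open>t\<close> will do.\<close>
  obtain b where b: "subcrit b" "0 < s \<and> b = s \<or> s = 0 \<and> 0 < b"
  proof (cases "s = 0")
    case True
    obtain t z where tz: "s < t" "0 < z" "(\<integral>\<^sup>+\<omega>. exp_npts z (Cl t [0 \<mapsto> 0] 0 \<omega>) \<partial>P t) < \<infinity>"
      using s by (auto simp: subcrit_def)
    have "subcrit (t / 2)" unfolding subcrit_def using tz True by (intro conjI exI[of _ t] exI[of _ z]) auto
    then show ?thesis using True tz(1) by (intro that[of "t / 2"]) auto
  next
    case False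
    then show ?thesis using s s0 by (intro that[of s]) auto
  qed
  have b0: "0 \<le> b" using b(1) by (simp add: subcrit_def)
  obtain z where z: "0 < z" "animal \<phi> b 0 Y A (exp_npts z) < \<infinity>"
    using two_point_moments[OF b(1) x] YA by blast
  \<comment> \<open>One half of the rate \<open>z\<close> is spent on the growth of
    \<open>G\<close>, the other on the change of intensity.\<close>
  define \<epsilon> where "\<epsilon> = z / 2"
  have \<epsilon>: "0 < \<epsilon>" using z by (simp add: \<epsilon>_def)
  obtain N :: nat where N: "\<And>\<mu>. \<mu> \<in> locally_finite_sets \<Longrightarrow> of_nat N \<le> npts \<mu> UNIV \<Longrightarrow> ennreal (G \<mu>) \<le> exp_npts \<epsilon> \<mu>"
    using growth[OF \<epsilon>] by blast
  \<comment> \<open>The part of \<open>G\<close> on small clusters, whose expansion is finite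
    because \<open>small\<close> bounds its expectation.\<close>
  define F where "F \<mu> = (if npts \<mu> UNIV < of_nat N then ennreal (G \<mu>) else 0)" for \<mu>
  have Fm: "F \<in> borel_measurable N_space"
    unfolding F_def using G(1) by measurable
  have Ffin: "animal \<phi> b 0 Y A F < \<infinity>"
  proof -
    let ?y = "[0 \<mapsto> 0, 1 \<mapsto> x] :: nat \<rightharpoonup> 'd pt"
    have y: "adm ?y" using x by (auto simp: adm_def inj_on_def)
    have dy: "dom ?y = {0, 1}" by auto
    define h where "h K = animal \<phi> b (the (?y 0)) ((\<lambda>i. the (?y i)) ` K) ((\<lambda>i. the (?y i)) ` (dom ?y - K)) F" for K
    have "{K \<in> Pow (dom ?y). 0 \<in> K} = {{0}, {0, 1}}" by auto
    moreover have "(\<Sum>K\<in>{K \<in> Pow (dom ?y). 0 \<in> K}. h K) < \<infinity>"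
      unfolding h_def using small[OF b(1), of N] by (subst nn_integral_Cl[OF b(1) y _ Fm, of 0, symmetric]) (simp_all add: F_def cong: if_cong)
    ultimately have "h {0} + h {0, 1} < \<infinity>" by simp
    moreover have "h {0} = animal \<phi> b 0 {0} {x} F" "h {0, 1} = animal \<phi> b 0 {0, x} {} F"
      unfolding h_def dy by (simp_all add: insert_Diff_if)
    ultimately show ?thesis using YA by auto
  qed
  have "animal \<phi> b 0 Y A (\<lambda>S. ennreal (G S * enn2real (exp_npts \<epsilon> S))) \<le>
     ennreal (exp (\<epsilon> * real N)) * animal \<phi> b 0 Y A F + animal \<phi> b 0 Y A (exp_npts z)"
  proof (rule animal_le[OF YA' b0 Fm exp_npts_measurable])
    fix S :: "'d pt set" assume S: "finite S"
    have n: "npts S UNIV = of_nat (card S)" using S by (simp add: npts_def emeasure_count_space)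
    have e: "enn2real (exp_npts \<epsilon> S) = exp (\<epsilon> * real (card S))" using S by (simp add: exp_npts_def)
    show "ennreal (G S * enn2real (exp_npts \<epsilon> S)) \<le> ennreal (exp (\<epsilon> * real N)) * F S + exp_npts z S"
    proof (cases "card S < N")
      case True
      have "G S * enn2real (exp_npts \<epsilon> S) \<le> exp (\<epsilon> * real N) * G S"
        unfolding e using True \<epsilon> G(2) by (simp add: mult.commute mult_left_mono)
      then have "ennreal (G S * enn2real (exp_npts \<epsilon> S)) \<le> ennreal (exp (\<epsilon> * real N)) * ennreal (G S)"
        using G(2) by (simp add: ennreal_mult[symmetric] ennreal_leI)
      also have "ennreal (G S) = F S" using True by (simp add: F_def n)
      finally show ?thesis by (rule order_trans) simp
    next
      case False
      have "ennreal (G S) \<le> exp_npts \<epsilon> S"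
        using False S by (intro N finite_locally_finite) (auto simp: n)
      then have "G S \<le> exp (\<epsilon> * real (card S))" using S by (simp add: exp_npts_def)
      then have "G S * enn2real (exp_npts \<epsilon> S) \<le> exp (\<epsilon> * real (card S)) * exp (\<epsilon> * real (card S))"
        unfolding e by (intro mult_right_mono) auto
      also have "\<dots> = exp (z * real (card S))" by (simp add: exp_add[symmetric] \<epsilon>_def)
      finally have "ennreal (G S * enn2real (exp_npts \<epsilon> S)) \<le> exp_npts z S"
        using S by (simp add: exp_npts_def ennreal_leI)
      then show ?thesis by (rule order_trans) simp
    qed
  qed
  also have "\<dots> < \<infinity>" using Ffin z(2) by (simp add: ennreal_mult_less_top less_top)
  finally show ?thesis by (rule animal_analytic[OF YA' G s0 b(2) \<epsilon>])
qed

end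

subsection \<open>Coefficients of the expansion\<close>

text \<open>Induct on \<open>I\<close>: a new coordinate has to avoid a finite set, which is
  Lebesgue null.\<close>

lemma AE_cfg:
  fixes Y :: "'a::euclidean_space set" and I :: "'b set"
  assumes Y: "finite Y" and I: "finite I"
  shows "AE z in Pi\<^sub>M I (\<lambda>_. lborel). cfg Y I z"
  using I
proof (induction I rule: finite_induct)
  case empty
  show ?case by (simp add: cfg_def)
next
  case (insert i I)
  interpret product_sigma_finite "\<lambda>_::'b. lborel :: 'a measure" by standard
  let ?M = "\<lambda>I. Pi\<^sub>M I (\<lambda>_::'b. lborel :: 'a measure)"
  let ?N = "{z \<in> space (?M (insert i I)). \<not> cfg Y (insert i I) z}"
  have fI: "finite (insert i I)" using insert by simp
  have [measurable]: "Measurable.pred (?M (insert i I)) (cfg Y (insert i I))" by (rule cfg_pred[OF Y fI])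
  have N: "?N \<in> sets (?M (insert i I))" by measurable
  have "emeasure (?M (insert i I)) ?N = (\<integral>\<^sup>+z. indicator ?N z \<partial>?M (insert i I))"
    using N by simp
  also have "\<dots> = (\<integral>\<^sup>+z. \<integral>\<^sup>+w. indicator ?N (z(i := w)) \<partial>lborel \<partial>?M I)"
    using N by (intro product_nn_integral_insert insert) auto
  also have "\<dots> = (\<integral>\<^sup>+z. 0 \<partial>?M I)"
  proof (rule nn_integral_cong_AE)
    show "AE z in ?M I. (\<integral>\<^sup>+w. indicator ?N (z(i := w)) \<partial>lborel) = 0"
      using insert.IH
    proof eventually_elim
      fix z assume z: "cfg Y I z"
      have fin: "finite (Y \<union> z ` I)" using Y insert by simp
      have imp: "cfg Y (insert i I) (z(i := w))" if "w \<notin> Y \<union> z ` I" for w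
      proof -
        have "inj_on (z(i := w)) I \<longleftrightarrow> inj_on z I" using insert.hyps by (intro inj_on_cong) auto
        moreover have "(z(i := w)) ` I = z ` I" using insert.hyps by (intro image_cong) auto
        moreover have "I - {i} = I" using insert.hyps by auto
        ultimately show ?thesis using that z by (auto simp: cfg_def)
      qed
      have "(\<integral>\<^sup>+w. indicator ?N (z(i := w)) \<partial>lborel) \<le> (\<integral>\<^sup>+w. indicator (Y \<union> z ` I) w \<partial>(lborel :: 'a measure))"
        using imp by (intro nn_integral_mono) (auto simp: indicator_def)
      also have "\<dots> = 0"
        using fin emeasure_lborel_countable[OF countable_finite[OF fin]] finite_imp_closed[OF fin] by simp
      finally show "(\<integral>\<^sup>+w. indicator ?N (z(i := w)) \<partial>lborel) = 0" by simp
    qed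
  qed
  finally show ?case using N by (auto intro!: AE_I[where N = ?N])
qed

text \<open>Substitute \<open>J - K\<close> for \<open>J\<close>: the parity of
  \<open>card I - card J\<close> is the sum of the parities of \<open>card I - card K\<close> and
  \<open>card (J - K)\<close>.\<close>

lemma alternating_double_sum:
  fixes f :: "'i set \<Rightarrow> 'i set \<Rightarrow> real"
  assumes I: "finite I"
  shows "(\<Sum>J\<in>Pow I. (-1) ^ (card I - card J) * (\<Sum>K\<in>Pow J. f K (J - K))) =
    (\<Sum>K\<in>Pow I. (-1) ^ (card I - card K) * (\<Sum>J\<in>Pow (I - K). (-1) ^ card J * f K J))"
proof -
  have fin: "finite J" if "J \<in> Pow I" for J using that I by (auto intro: finite_subset)
  have "(\<Sum>J\<in>Pow I. (-1) ^ (card I - card J) * (\<Sum>K\<in>Pow J. f K (J - K))) =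
     (\<Sum>(J, K)\<in>(SIGMA J:Pow I. Pow J). (-1) ^ (card I - card J) * f K (J - K))"
    using I fin by (simp add: sum_distrib_left sum.Sigma)
  also have "\<dots> = (\<Sum>(K, J)\<in>(SIGMA K:Pow I. Pow (I - K)). (-1) ^ (card I - card K) * ((-1) ^ card J * f K J))"
  proof (rule sum.reindex_bij_witness[where i = "\<lambda>(K, J). (K \<union> J, K)" and j = "\<lambda>(J, K). (K, J - K)"])
    fix p assume p: "p \<in> (SIGMA J:Pow I. Pow J)"
    obtain J K where JK: "p = (J, K)" by (cases p)
    have K: "K \<subseteq> J" "J \<subseteq> I" "finite J" using p JK fin by auto
    then have c: "card (J - K) = card J - card K" "card K \<le> card J" "card J \<le> card I"
      using I by (auto intro: card_Diff_subset finite_subset card_mono)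
    then have "(-1) ^ (card I - card J) = (-1 :: real) ^ (card I - card K) * (-1) ^ card (J - K)"
      by (subst power_add[symmetric], subst minus_one_power_iff, subst minus_one_power_iff) (auto simp: even_add)
    then show "(case (case p of (J, K) \<Rightarrow> (K, J - K)) of (K, J) \<Rightarrow> (-1) ^ (card I - card K) * ((-1) ^ card J * f K J)) =
      (case p of (J, K) \<Rightarrow> (-1) ^ (card I - card J) * f K (J - K))"
      by (simp add: JK)
  qed auto
  also have "\<dots> = (\<Sum>K\<in>Pow I. (-1) ^ (card I - card K) * (\<Sum>J\<in>Pow (I - K). (-1) ^ card J * f K J))"
    using I by (simp add: sum_distrib_left sum.Sigma)
  finally show ?thesis .
qed

lemma sum_Pow_card:
  fixes h :: "nat \<Rightarrow> real"
  assumes I: "finite I"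
  shows "(\<Sum>K\<in>Pow I. h (card K)) = (\<Sum>q\<le>card I. real (card I choose q) * h q)"
proof -
  have "(\<Sum>K\<in>Pow I. h (card K)) = (\<Sum>q\<le>card I. \<Sum>K\<in>{K \<in> Pow I. card K = q}. h (card K))"
    using I by (intro sum.group[symmetric]) (auto intro: card_mono)
  also have "\<dots> = (\<Sum>q\<le>card I. real (card I choose q) * h q)"
  proof (intro sum.cong refl)
    fix q
    show "(\<Sum>K\<in>{K \<in> Pow I. card K = q}. h (card K)) = real (card I choose q) * h q"
      using n_subsets[OF I, of q] by (simp add: Pow_def)
  qed
  finally show ?thesis .
qed

lemma integrable_enn2real:
  assumes f: "f \<in> borel_measurable M" and fin: "(\<integral>\<^sup>+x. f x \<partial>M) < \<infinity>"
  shows "integrable M (\<lambda>x. enn2real (f x))" and "(\<integral>x. enn2real (f x) \<partial>M) = enn2real (\<integral>\<^sup>+x. f x \<partial>M)"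
proof -
  have "AE x in M. f x \<noteq> \<infinity>" using fin f by (intro nn_integral_PInf_AE) auto
  then have eq: "(\<integral>\<^sup>+x. ennreal (enn2real (f x)) \<partial>M) = (\<integral>\<^sup>+x. f x \<partial>M)"
    by (intro nn_integral_cong_AE) (auto elim!: eventually_mono simp: less_top)
  show "integrable M (\<lambda>x. enn2real (f x))" using f fin eq by (intro integrableI_nonneg) auto
  show "(\<integral>x. enn2real (f x) \<partial>M) = enn2real (\<integral>\<^sup>+x. f x \<partial>M)"
    unfolding eq[symmetric] using f by (intro integral_eq_nn_integral) auto
qed

lemma dom_added: "dom (added n J xs x) = insert 0 (insert (Suc n) J)"
  by (auto simp: added_def restrict_map_def split: if_splits)

lemma added_simps:
  "the (added n J xs x 0) = 0" "the (added n J xs x (Suc n)) = x"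
  "J \<subseteq> {1..n} \<Longrightarrow> i \<in> J \<Longrightarrow> the (added n J xs x i) = xs i"
  by (auto simp: added_def restrict_map_def)

lemma added_0: "added 0 {} xs x = [0 \<mapsto> 0, 1 \<mapsto> x]"
  by (simp add: added_def fun_eq_iff)

section \<open>Expectations in the presence of sprinkled points\<close>

context rcm_family
begin

lemma Cl_added: "Cl s (added n J xs x) 0 \<omega> = cluster \<phi> 0 (chi s (X s) (U s) (added n J xs x) \<omega>)"
  by (simp add: Cl_def added_simps)

lemma adm_added:
  assumes J: "J \<subseteq> {1..n}" and xs: "cfg {0, x} J xs" and x: "x \<noteq> 0"
  shows "adm (added n J xs x)"
proof -
  let ?y = "added n J xs x"
  have z: "0 \<notin> J" "Suc n \<notin> J" using J by auto
  have v: "the (?y 0) = 0" "the (?y (Suc n)) = x" "\<And>i. i \<in> J \<Longrightarrow> the (?y i) = xs i" using added_simps J by auto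
  have im: "(\<lambda>i. the (?y i)) ` J = xs ` J" by (intro image_cong v) simp
  have inj: "inj_on (\<lambda>i. the (?y i)) J \<longleftrightarrow> inj_on xs J" by (intro inj_on_cong v)
  have "J - {Suc n} = J" "insert (Suc n) J - {0} = insert (Suc n) J" using z by auto
  then have "inj_on (\<lambda>i. the (?y i)) (dom ?y)"
    unfolding dom_added using xs x by (auto simp: inj v im cfg_def)
  moreover have "finite (dom ?y)" using J by (auto simp: dom_added intro: finite_subset)
  ultimately show ?thesis by (simp add: adm_def)
qed

text \<open>The possible sets of added points in the cluster are sorted by whether they contain the
  index \<open>Suc n\<close> of \<open>x\<close>; this gives the two expansions, with
  \<open>x\<close> excluded and with \<open>x\<close> included.\<close>

lemma nn_integral_Cl_added:
  assumes s: "subcrit s" and J: "J \<subseteq> {1..n}" and xs: "cfg {0, x} J xs" and x: "x \<noteq> 0" and F: "F \<in> borel_measurable N_space"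
  shows "(\<integral>\<^sup>+\<omega>. F (Cl s (added n J xs x) 0 \<omega>) \<partial>P s) =
    (\<Sum>K\<in>Pow J. animal \<phi> s 0 ({0} \<union> xs ` K) ({x} \<union> xs ` (J - K)) F + animal \<phi> s 0 ({0, x} \<union> xs ` K) ({} \<union> xs ` (J - K)) F)"
proof -
  let ?y = "added n J xs x"
  have z: "0 \<notin> J" "Suc n \<notin> J" using J by auto
  have v: "the (?y 0) = 0" "the (?y (Suc n)) = x" "\<And>i. i \<in> J \<Longrightarrow> the (?y i) = xs i" using added_simps J by auto
  have im: "(\<lambda>i. the (?y i)) ` K = xs ` K" if "K \<subseteq> J" for K using that by (intro image_cong v) auto
  define h where "h K = animal \<phi> s 0 ((\<lambda>i. the (?y i)) ` K) ((\<lambda>i. the (?y i)) ` (dom ?y - K)) F" for K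
  have fJ: "finite J" using J by (rule finite_subset) simp
  have inj1: "inj_on (insert 0) (Pow J)"
  proof (rule inj_onI)
    fix K K' assume "K \<in> Pow J" "K' \<in> Pow J" "insert 0 K = insert 0 K'"
    then show "K = K'" using z insert_ident[of 0 K K'] by blast
  qed
  have inj2: "inj_on (\<lambda>K. insert 0 (insert (Suc n) K)) (Pow J)"
  proof (rule inj_onI)
    fix K K' assume "K \<in> Pow J" "K' \<in> Pow J" "insert 0 (insert (Suc n) K) = insert 0 (insert (Suc n) K')"
    then have "insert 0 (insert (Suc n) K) - {0, Suc n} = insert 0 (insert (Suc n) K') - {0, Suc n}" "0 \<notin> K" "Suc n \<notin> K" "0 \<notin> K'" "Suc n \<notin> K'"
      using z by auto
    then show "K = K'" by (auto simp: insert_Diff_if)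
  qed
  have set: "{K \<in> Pow (dom ?y). 0 \<in> K} = insert 0 ` Pow J \<union> (\<lambda>K. insert 0 (insert (Suc n) K)) ` Pow J"
  proof (intro set_eqI iffI)
    fix K assume K: "K \<in> {K \<in> Pow (dom ?y). 0 \<in> K}"
    show "K \<in> insert 0 ` Pow J \<union> (\<lambda>K. insert 0 (insert (Suc n) K)) ` Pow J"
    proof (cases "Suc n \<in> K")
      case True
      then have "K = insert 0 (insert (Suc n) (K - {0, Suc n}))" "K - {0, Suc n} \<in> Pow J" using K by (auto simp: dom_added)
      then show ?thesis by blast
    next
      case False
      then have "K = insert 0 (K - {0})" "K - {0} \<in> Pow J" using K by (auto simp: dom_added)
      then show ?thesis by blast
    qed
  qed (auto simp: dom_added)
  have dis: "insert 0 ` Pow J \<inter> (\<lambda>K. insert 0 (insert (Suc n) K)) ` Pow J = {}" using z by auto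
  have "(\<integral>\<^sup>+\<omega>. F (Cl s ?y 0 \<omega>) \<partial>P s) = (\<Sum>K\<in>{K \<in> Pow (dom ?y). 0 \<in> K}. h K)"
    using nn_integral_Cl[OF s adm_added[OF J xs x] _ F, of 0] by (simp add: dom_added h_def v)
  also have "\<dots> = (\<Sum>K\<in>insert 0 ` Pow J. h K) + (\<Sum>K\<in>(\<lambda>K. insert 0 (insert (Suc n) K)) ` Pow J. h K)"
    unfolding set using fJ dis by (intro sum.union_disjoint) auto
  also have "\<dots> = (\<Sum>K\<in>Pow J. h (insert 0 K) + h (insert 0 (insert (Suc n) K)))"
    by (simp add: sum.reindex[OF inj1] sum.reindex[OF inj2] sum.distrib)
  also have "\<dots> = (\<Sum>K\<in>Pow J. animal \<phi> s 0 ({0} \<union> xs ` K) ({x} \<union> xs ` (J - K)) F + animal \<phi> s 0 ({0, x} \<union> xs ` K) ({} \<union> xs ` (J - K)) F)"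
  proof (intro sum.cong refl)
    fix K assume K: "K \<in> Pow J"
    have d: "dom ?y - insert 0 K = insert (Suc n) (J - K)" "dom ?y - insert 0 (insert (Suc n) K) = J - K"
      using z K by (auto simp: dom_added)
    show "h (insert 0 K) + h (insert 0 (insert (Suc n) K)) =
      animal \<phi> s 0 ({0} \<union> xs ` K) ({x} \<union> xs ` (J - K)) F + animal \<phi> s 0 ({0, x} \<union> xs ` K) ({} \<union> xs ` (J - K)) F"
      unfolding h_def d using K by (simp add: v im)
  qed
  finally show ?thesis .
qed

text \<open>Joint measurability in the sprinkled points and the outcome is what makes the inner
  expectation a measurable function of \<open>xs\<close>.\<close>

lemma Cl_added_measurable:
  assumes s: "0 \<le> s" and J: "J \<subseteq> {1..n}"
  shows "(\<lambda>(xs, \<omega>). Cl s (added n J xs x) 0 \<omega>) \<in> Pi\<^sub>M {1..n} (\<lambda>_. lborel) \<Otimes>\<^sub>M P s \<rightarrow>\<^sub>M N_space"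
proof -
  interpret rcm "P s" "ppts s (X s)" "pidx s" s \<phi> m "U s" 1 using s by (intro rcm_at) auto
  let ?M = "Pi\<^sub>M {1..n} (\<lambda>_. lborel :: 'd pt measure) \<Otimes>\<^sub>M P s"
  let ?Z = "\<lambda>i (p :: (nat \<Rightarrow> 'd pt) \<times> 'w). pos s (added n J (fst p) x) (snd p) i"
  let ?I = "insert 0 (insert (Suc n) J) <+> pidx s"
  have idx: "idx s (added n J xs x) = ?I" for xs by (simp add: idx_def dom_added)
  have "(\<lambda>p. cluster \<phi> (?Z (Inl 0) p) (marked_pairs ?I (\<lambda>i. ?Z i p) (\<lambda>q. U s q (snd p)))) \<in> ?M \<rightarrow>\<^sub>M N_space"
  proof (rule measurable_cluster)
    show "?Z i \<in> borel_measurable ?M" if i: "i \<in> ?I" for i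
    proof (cases i)
      case (Inl j)
      consider "j = 0" | "j = Suc n" | "j \<in> J" using i Inl by auto
      then show ?thesis
      proof cases
        case 3
        have "(\<lambda>p. fst p j) \<in> borel_measurable ?M"
          using 3 J by (intro measurable_compose[OF measurable_fst component_measurable]) auto
        then show ?thesis using 3 J by (simp add: Inl pos_def added_simps)
      qed (simp_all add: Inl pos_def added_simps)
    next
      case (Inr j)
      then show ?thesis using measurable_compose[OF measurable_snd X_meas] by (simp add: pos_def)
    qed
    show "(\<lambda>i. ?Z i p) ` ?I \<in> locally_finite_sets" if "p \<in> space ?M" for p
      using pos_locally_finite[OF s, of "added n J (fst p) x" "snd p"] that finite_subset[OF J]
      by (auto simp: idx space_pair_measure dom_added)
    show "(\<lambda>p. U s q (snd p)) \<in> borel_measurable ?M" for q by (rule measurable_compose[OF measurable_snd U_meas])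
  qed auto
  then show ?thesis by (simp add: Cl_pos idx split_beta')
qed

end

context kernel
begin

text \<open>Each additional excluded point contributes a factor \<open>nh \<le> 1\<close> to the
  weight.\<close>

lemma animal_antimono:
  assumes A: "finite A" "finite B"
  shows "animal \<phi> s 0 Y (A \<union> B) F \<le> animal \<phi> s 0 Y A F"
proof -
  have wt: "wt \<phi> 0 (A \<union> B) S \<le> wt \<phi> 0 A S" for S
  proof -
    have "(\<Prod>v\<in>A \<union> B. nh \<phi> S v) = (\<Prod>v\<in>A. nh \<phi> S v) * (\<Prod>v\<in>B - A. nh \<phi> S v)"
      using A by (subst prod.union_disjoint[symmetric]) auto
    also have "\<dots> \<le> (\<Prod>v\<in>A. nh \<phi> S v) * 1"
      using nh_range by (intro mult_left_mono prod_le_1 prod_nonneg) auto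
    finally show ?thesis using connw_nonneg[of \<phi>, OF \<phi>_range] unfolding wt_def by (intro mult_left_mono) simp_all
  qed
  show ?thesis
    unfolding animal_def cfg_int_def
    by (intro suminf_le summableI mult_left_mono nn_integral_mono) (auto intro!: mult_left_mono ennreal_leI mult_right_mono wt)
qed

text \<open>For \<open>R = {}\<close> the sprinkle series is the expansion itself, and its integral
  over the coordinates in \<open>K\<close> is the finite number \<open>coef\<close>. Finiteness
  almost everywhere in these coordinates extends to all of \<open>I\<close>.\<close>

lemma AE_animal_finite:
  fixes I K :: "nat set"
  assumes Y: "finite Y" "0 \<in> Y" and A: "finite A" and G: "G \<in> borel_measurable N_space" "\<And>S. 0 \<le> G S" and s: "0 \<le> s"
    and I: "finite I" and K: "K \<subseteq> I" and fin: "coef s Y A G (card K) 0 < \<infinity>"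
  shows "AE xs in Pi\<^sub>M I (\<lambda>_. lborel). cfg Y K xs \<longrightarrow> animal \<phi> s 0 (Y \<union> xs ` K) A (\<lambda>S. ennreal (G S)) < \<infinity>"
proof -
  have fK: "finite K" using K I by (rule finite_subset)
  note sp = nn_integral_sprinkle_series[OF Y A G s fK, of "{}", simplified Un_empty_right]
  have "(\<integral>\<^sup>+xs. sprinkle_series s Y A G K {} xs \<partial>Pi\<^sub>M K (\<lambda>_. lborel)) < \<infinity>"
    using fin sp(2) unfolding coef_def by simp
  then have "AE xs in Pi\<^sub>M K (\<lambda>_. lborel). sprinkle_series s Y A G K {} xs \<noteq> \<infinity>"
    using sp(1) by (intro nn_integral_PInf_AE) auto
  then have "AE xs in Pi\<^sub>M I (\<lambda>_. lborel). sprinkle_series s Y A G K {} (restrict xs K) \<noteq> \<infinity>"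
    by (rule AE_PiM_restrict[OF I K])
  then show ?thesis
  proof eventually_elim
    fix xs :: "nat \<Rightarrow> 'd pt"
    assume f: "sprinkle_series s Y A G K {} (restrict xs K) \<noteq> \<infinity>"
    have c: "cfg Y K (restrict xs K) = cfg Y K xs" by (rule cfg_cong) simp
    have "sprinkle_series s Y A G K {} (restrict xs K) = animal \<phi> s 0 (Y \<union> xs ` K) A (\<lambda>S. ennreal (G S))" if "cfg Y K xs"
      using that by (simp add: sprinkle_series_def sprinkle_def c animal_def ewt_def)
    then show "cfg Y K xs \<longrightarrow> animal \<phi> s 0 (Y \<union> xs ` K) A (\<lambda>S. ennreal (G S)) < \<infinity>" using f by (auto simp: less_top)
  qed
qed

end

section \<open>Identification of the Taylor coefficients\<close>

context rcm_family
begin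

definition Dn :: "('d pt set \<Rightarrow> real) \<Rightarrow> 'd pt \<Rightarrow> nat \<Rightarrow> real \<Rightarrow> (nat \<Rightarrow> 'd pt) \<Rightarrow> 'w \<Rightarrow> real" where
  "Dn g x n s xs \<omega> = (\<Sum>J\<in>Pow {1..n}. (-1) ^ (n - card J) * g (Cl s (added n J xs x) 0 \<omega>))"

text \<open>The term \<open>n = 0\<close> is included, so that one power series is handled;
  evaluation at \<open>h = 0\<close> later identifies it with the expectation at \<open>s\<close>.
  The integrability statements let the property pass to differences of functions.\<close>

definition expansion :: "'d pt \<Rightarrow> ('d pt set \<Rightarrow> real) \<Rightarrow> real \<Rightarrow> bool" where
  "expansion x g s \<longleftrightarrow> integrable (P s) (\<lambda>\<omega>. g (Cl s [0 \<mapsto> 0, 1 \<mapsto> x] 0 \<omega>)) \<and>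
    (\<forall>n. (AE xs in Pi\<^sub>M {1..n} (\<lambda>_. lborel). integrable (P s) (Dn g x n s xs)) \<and>
       integrable (Pi\<^sub>M {1..n} (\<lambda>_. lborel)) (\<lambda>xs. \<integral>\<omega>. Dn g x n s xs \<omega> \<partial>P s)) \<and>
    (\<exists>\<delta>>0. \<forall>h. \<bar>h\<bar> < \<delta> \<and> subcrit (s + h) \<longrightarrow>
       (\<lambda>n. h ^ n / fact n * (\<integral>xs. (\<integral>\<omega>. Dn g x n s xs \<omega> \<partial>P s) \<partial>Pi\<^sub>M {1..n} (\<lambda>_. lborel))) sums
         (\<integral>\<omega>. g (Cl (s + h) [0 \<mapsto> 0, 1 \<mapsto> x] 0 \<omega>) \<partial>P (s + h)))"

lemma subcrit_nonneg: "subcrit s \<Longrightarrow> 0 \<le> s"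
  by (simp add: subcrit_def)

lemma integral_Dn_measurable:
  assumes s: "0 \<le> s" and g: "g \<in> borel_measurable N_space"
  shows "(\<lambda>xs. \<integral>\<omega>. Dn g x n s xs \<omega> \<partial>P s) \<in> borel_measurable (Pi\<^sub>M {1..n} (\<lambda>_. lborel))"
proof -
  interpret prob_space "P s" by (rule prob_space_P[OF s])
  have "(\<lambda>(xs, \<omega>). Dn g x n s xs \<omega>) \<in> borel_measurable (Pi\<^sub>M {1..n} (\<lambda>_. lborel) \<Otimes>\<^sub>M P s)"
    unfolding Dn_def split_beta'
  proof (intro borel_measurable_sum borel_measurable_times borel_measurable_const)
    fix J assume "J \<in> Pow {1..n}"
    then have J: "J \<subseteq> {1..n}" by simp
    show "(\<lambda>p. g (Cl s (added n J (fst p) x) 0 (snd p))) \<in> borel_measurable (Pi\<^sub>M {1..n} (\<lambda>_. lborel) \<Otimes>\<^sub>M P s)"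
      using measurable_compose[OF Cl_added_measurable[OF s J] g] by (simp add: split_beta')
  qed
  then show ?thesis by (rule borel_measurable_lebesgue_integral)
qed

text \<open>It is enough to assume finiteness with no sprinkled point excluded, since excluding
  points only lowers the expansion.\<close>

lemma integral_Cl_added:
  assumes s: "subcrit s" and J: "J \<subseteq> {1..n}" and xs: "cfg {0, x} J xs" and x: "x \<noteq> 0"
    and G: "G \<in> borel_measurable N_space" "\<And>S. 0 \<le> G S"
    and fin: "\<And>K. K \<subseteq> J \<Longrightarrow> animal \<phi> s 0 ({0} \<union> xs ` K) {x} (\<lambda>S. ennreal (G S)) < \<infinity>"
      "\<And>K. K \<subseteq> J \<Longrightarrow> animal \<phi> s 0 ({0, x} \<union> xs ` K) {} (\<lambda>S. ennreal (G S)) < \<infinity>"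
  shows "integrable (P s) (\<lambda>\<omega>. G (Cl s (added n J xs x) 0 \<omega>))"
    and "(\<integral>\<omega>. G (Cl s (added n J xs x) 0 \<omega>) \<partial>P s) =
      (\<Sum>K\<in>Pow J. enn2real (animal \<phi> s 0 ({0} \<union> xs ` K) ({x} \<union> xs ` (J - K)) (\<lambda>S. ennreal (G S))) +
         enn2real (animal \<phi> s 0 ({0, x} \<union> xs ` K) ({} \<union> xs ` (J - K)) (\<lambda>S. ennreal (G S))))"
proof -
  have fJ: "finite J" using J by (rule finite_subset) simp
  let ?G = "\<lambda>S. ennreal (G S)"
  have fin': "animal \<phi> s 0 ({0} \<union> xs ` K) ({x} \<union> xs ` (J - K)) ?G < \<infinity>"
    "animal \<phi> s 0 ({0, x} \<union> xs ` K) ({} \<union> xs ` (J - K)) ?G < \<infinity>" if K: "K \<in> Pow J" for K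
  proof -
    have f: "finite (xs ` (J - K))" using fJ by simp
    show "animal \<phi> s 0 ({0} \<union> xs ` K) ({x} \<union> xs ` (J - K)) ?G < \<infinity>"
      using order_le_less_trans[OF animal_antimono[OF _ f, of "{x}" s "{0} \<union> xs ` K" ?G] fin(1)[of K]] K by simp
    show "animal \<phi> s 0 ({0, x} \<union> xs ` K) ({} \<union> xs ` (J - K)) ?G < \<infinity>"
      using order_le_less_trans[OF animal_antimono[OF _ f, of "{}" s "{0, x} \<union> xs ` K" ?G] fin(2)[of K]] K by simp
  qed
  have C: "Cl s (added n J xs x) 0 \<in> P s \<rightarrow>\<^sub>M N_space"
    using fJ by (intro Cl_measurable subcrit_nonneg[OF s]) (auto simp: dom_added)
  have m: "(\<lambda>\<omega>. G (Cl s (added n J xs x) 0 \<omega>)) \<in> borel_measurable (P s)" by (rule measurable_compose[OF C G(1)])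
  have form: "(\<integral>\<^sup>+\<omega>. ?G (Cl s (added n J xs x) 0 \<omega>) \<partial>P s) =
    (\<Sum>K\<in>Pow J. animal \<phi> s 0 ({0} \<union> xs ` K) ({x} \<union> xs ` (J - K)) ?G + animal \<phi> s 0 ({0, x} \<union> xs ` K) ({} \<union> xs ` (J - K)) ?G)"
    using G(1) by (intro nn_integral_Cl_added[OF s J xs x]) simp
  have "(\<integral>\<^sup>+\<omega>. ?G (Cl s (added n J xs x) 0 \<omega>) \<partial>P s) < \<infinity>"
    unfolding form using fJ fin' by (simp add: less_top[symmetric])
  then show i: "integrable (P s) (\<lambda>\<omega>. G (Cl s (added n J xs x) 0 \<omega>))"
    using m G(2) by (intro integrableI_nonneg) auto
  have "(\<integral>\<omega>. G (Cl s (added n J xs x) 0 \<omega>) \<partial>P s) = enn2real (\<integral>\<^sup>+\<omega>. ?G (Cl s (added n J xs x) 0 \<omega>) \<partial>P s)"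
    using m G(2) by (intro integral_eq_nn_integral) auto
  also have "\<dots> = (\<Sum>K\<in>Pow J. enn2real (animal \<phi> s 0 ({0} \<union> xs ` K) ({x} \<union> xs ` (J - K)) ?G + animal \<phi> s 0 ({0, x} \<union> xs ` K) ({} \<union> xs ` (J - K)) ?G))"
    unfolding form using fin' by (subst enn2real_sum) (auto simp: less_top)
  also have "\<dots> = (\<Sum>K\<in>Pow J. enn2real (animal \<phi> s 0 ({0} \<union> xs ` K) ({x} \<union> xs ` (J - K)) ?G) + enn2real (animal \<phi> s 0 ({0, x} \<union> xs ` K) ({} \<union> xs ` (J - K)) ?G))"
    using fin' by (intro sum.cong refl enn2real_plus) auto
  finally show "(\<integral>\<omega>. G (Cl s (added n J xs x) 0 \<omega>) \<partial>P s) =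
      (\<Sum>K\<in>Pow J. enn2real (animal \<phi> s 0 ({0} \<union> xs ` K) ({x} \<union> xs ` (J - K)) ?G) +
         enn2real (animal \<phi> s 0 ({0, x} \<union> xs ` K) ({} \<union> xs ` (J - K)) ?G))" .
qed

text \<open>Regroup the alternating sum by the set \<open>K\<close> of sprinkled points in the
  cluster. For fixed \<open>K\<close> the alternating sum over the excluded points collapses to a
  sprinkle series, separately for \<open>x\<close> outside and inside.\<close>

lemma integral_Dn:
  assumes s: "subcrit s" and xs: "cfg {0, x} {1..n} xs" and x: "x \<noteq> 0"
    and G: "G \<in> borel_measurable N_space" "\<And>S. 0 \<le> G S"
    and fin: "\<And>K. K \<subseteq> {1..n} \<Longrightarrow> animal \<phi> s 0 ({0} \<union> xs ` K) {x} (\<lambda>S. ennreal (G S)) < \<infinity>"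
      "\<And>K. K \<subseteq> {1..n} \<Longrightarrow> animal \<phi> s 0 ({0, x} \<union> xs ` K) {} (\<lambda>S. ennreal (G S)) < \<infinity>"
  shows "integrable (P s) (Dn G x n s xs)"
    and "(\<integral>\<omega>. Dn G x n s xs \<omega> \<partial>P s) = (\<Sum>K\<in>Pow {1..n}. (-1) ^ (n - card K) *
      (enn2real (sprinkle_series s {0} {x} G K ({1..n} - K) xs) + enn2real (sprinkle_series s {0, x} {} G K ({1..n} - K) xs)))"
proof -
  let ?I = "{1..n}" and ?G = "\<lambda>S. ennreal (G S)"
  have sub: "cfg {0, x} J xs" if "J \<subseteq> ?I" for J using xs that unfolding cfg_def by (auto intro: inj_on_subset)
  have i: "integrable (P s) (\<lambda>\<omega>. G (Cl s (added n J xs x) 0 \<omega>))" if "J \<in> Pow ?I" for J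
    using that fin by (intro integral_Cl_added(1)[OF s _ sub x G]) auto
  show "integrable (P s) (Dn G x n s xs)"
    unfolding Dn_def[abs_def] using i by (intro Bochner_Integration.integrable_sum Bochner_Integration.integrable_mult_right)
  define f where "f K J = enn2real (animal \<phi> s 0 ({0} \<union> xs ` K) ({x} \<union> xs ` J) ?G) + enn2real (animal \<phi> s 0 ({0, x} \<union> xs ` K) ({} \<union> xs ` J) ?G)" for K J
  have "(\<integral>\<omega>. Dn G x n s xs \<omega> \<partial>P s) = (\<Sum>J\<in>Pow ?I. (-1) ^ (n - card J) * (\<integral>\<omega>. G (Cl s (added n J xs x) 0 \<omega>) \<partial>P s))"
    unfolding Dn_def using i by (subst Bochner_Integration.integral_sum) (auto intro: Bochner_Integration.integrable_mult_right)
  also have "\<dots> = (\<Sum>J\<in>Pow ?I. (-1) ^ (card ?I - card J) * (\<Sum>K\<in>Pow J. f K (J - K)))"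
  proof (intro sum.cong refl)
    fix J assume "J \<in> Pow ?I"
    then have J: "J \<subseteq> ?I" by simp
    have "(\<integral>\<omega>. G (Cl s (added n J xs x) 0 \<omega>) \<partial>P s) = (\<Sum>K\<in>Pow J. f K (J - K))"
      unfolding f_def using J fin by (intro integral_Cl_added(2)[OF s J sub[OF J] x G]) auto
    then show "(-1) ^ (n - card J) * (\<integral>\<omega>. G (Cl s (added n J xs x) 0 \<omega>) \<partial>P s) = (-1) ^ (card ?I - card J) * (\<Sum>K\<in>Pow J. f K (J - K))"
      by simp
  qed
  also have "\<dots> = (\<Sum>K\<in>Pow ?I. (-1) ^ (card ?I - card K) * (\<Sum>J\<in>Pow (?I - K). (-1) ^ card J * f K J))"
    by (rule alternating_double_sum) simp
  also have "\<dots> = (\<Sum>K\<in>Pow ?I. (-1) ^ (n - card K) *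
      (enn2real (sprinkle_series s {0} {x} G K (?I - K) xs) + enn2real (sprinkle_series s {0, x} {} G K (?I - K) xs)))"
  proof (intro sum.cong refl)
    fix K assume "K \<in> Pow ?I"
    then have K: "K \<subseteq> ?I" "finite K" by (auto intro: finite_subset)
    have s0: "0 \<le> s" by (rule subcrit_nonneg[OF s])
    have c: "cfg {0} K xs" "cfg {0, x} K xs" "cfg {x} (?I - K) xs" "cfg {} (?I - K) xs"
      using sub[OF K(1)] sub[of "?I - K"] by (auto simp: cfg_def)
    have "(\<Sum>J\<in>Pow (?I - K). (-1) ^ card J * f K J) =
      (\<Sum>J\<in>Pow (?I - K). (-1) ^ card J * enn2real (animal \<phi> s 0 ({0} \<union> xs ` K) ({x} \<union> xs ` J) ?G)) +
      (\<Sum>J\<in>Pow (?I - K). (-1) ^ card J * enn2real (animal \<phi> s 0 ({0, x} \<union> xs ` K) ({} \<union> xs ` J) ?G))"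
      unfolding f_def by (simp add: distrib_left sum.distrib)
    also have "\<dots> = enn2real (sprinkle_series s {0} {x} G K (?I - K) xs) + enn2real (sprinkle_series s {0, x} {} G K (?I - K) xs)"
    proof (intro arg_cong2[where f = "(+)"])
      show "(\<Sum>J\<in>Pow (?I - K). (-1) ^ card J * enn2real (animal \<phi> s 0 ({0} \<union> xs ` K) ({x} \<union> xs ` J) ?G)) = enn2real (sprinkle_series s {0} {x} G K (?I - K) xs)"
        by (rule alternating_animals[OF _ _ _ G s0 K(2) _ c(1,3) fin(1)[OF K(1)]]) auto
      show "(\<Sum>J\<in>Pow (?I - K). (-1) ^ card J * enn2real (animal \<phi> s 0 ({0, x} \<union> xs ` K) ({} \<union> xs ` J) ?G)) = enn2real (sprinkle_series s {0, x} {} G K (?I - K) xs)"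
        by (rule alternating_animals[OF _ _ _ G s0 K(2) _ c(2,4) fin(2)[OF K(1)]]) auto
    qed
    finally show "(-1) ^ (card ?I - card K) * (\<Sum>J\<in>Pow (?I - K). (-1) ^ card J * f K J) = (-1) ^ (n - card K) *
      (enn2real (sprinkle_series s {0} {x} G K (?I - K) xs) + enn2real (sprinkle_series s {0, x} {} G K (?I - K) xs))" by simp
  qed
  finally show "(\<integral>\<omega>. Dn G x n s xs \<omega> \<partial>P s) = (\<Sum>K\<in>Pow ?I. (-1) ^ (n - card K) *
      (enn2real (sprinkle_series s {0} {x} G K (?I - K) xs) + enn2real (sprinkle_series s {0, x} {} G K (?I - K) xs)))" .
qed

text \<open>Both sides reduce to the numbers \<open>coef\<close>: the Taylor coefficients by
  Leibniz's rule, the integrals over sprinkled points by integrating the sprinkle series.\<close>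

lemma expansion_nonneg:
  assumes s: "subcrit s" and x: "x \<noteq> 0"
    and G: "G \<in> borel_measurable N_space" "\<And>S. 0 \<le> G S"
    and growth: "\<And>\<epsilon>. \<epsilon> > 0 \<Longrightarrow> \<exists>n\<^sub>0::nat. \<forall>\<mu>\<in>locally_finite_sets. of_nat n\<^sub>0 \<le> npts \<mu> UNIV \<longrightarrow> ennreal (G \<mu>) \<le> exp_npts \<epsilon> \<mu>"
    and small: "\<And>t (n::nat). subcrit t \<Longrightarrow>
      (\<integral>\<^sup>+\<omega>. (if npts (Cl t [0 \<mapsto> 0, 1 \<mapsto> x] 0 \<omega>) UNIV < of_nat n then ennreal (G (Cl t [0 \<mapsto> 0, 1 \<mapsto> x] 0 \<omega>)) else 0) \<partial>P t) < \<infinity>"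
  shows "expansion x G s"
proof -
  have s0: "0 \<le> s" by (rule subcrit_nonneg[OF s])
  let ?G = "\<lambda>S. ennreal (G S)"
  let ?c1 = "\<lambda>q l. coef s {0} {x} G q l" and ?c2 = "\<lambda>q l. coef s {0, x} {} G q l"
  let ?a1 = "\<lambda>t. animal \<phi> t 0 {0} {x} ?G" and ?a2 = "\<lambda>t. animal \<phi> t 0 {0, x} {} ?G"
  let ?S = "\<lambda>c h n. h ^ n / fact n * (\<Sum>q\<le>n. real (n choose q) * (-1) ^ (n - q) * enn2real (c q (n - q)))"
  have an1: "(\<forall>q l. ?c1 q l < \<infinity>) \<and> (\<exists>\<delta>>0. \<forall>h. \<bar>h\<bar> < \<delta> \<and> 0 \<le> s + h \<longrightarrow> ?a1 (s + h) < \<infinity> \<and> (?S ?c1 h) sums enn2real (?a1 (s + h)))"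
    by (rule animal_pair_analytic[OF s x _ G growth small]) auto
  have an2: "(\<forall>q l. ?c2 q l < \<infinity>) \<and> (\<exists>\<delta>>0. \<forall>h. \<bar>h\<bar> < \<delta> \<and> 0 \<le> s + h \<longrightarrow> ?a2 (s + h) < \<infinity> \<and> (?S ?c2 h) sums enn2real (?a2 (s + h)))"
    by (rule animal_pair_analytic[OF s x _ G growth small]) auto
  have c1: "?c1 q l < \<infinity>" and c2: "?c2 q l < \<infinity>" for q l using an1 an2 by auto
  obtain \<delta>1 where d1: "0 < \<delta>1" "\<And>h. \<bar>h\<bar> < \<delta>1 \<Longrightarrow> 0 \<le> s + h \<Longrightarrow> ?a1 (s + h) < \<infinity> \<and> (?S ?c1 h) sums enn2real (?a1 (s + h))"
    using an1 by blast
  obtain \<delta>2 where d2: "0 < \<delta>2" "\<And>h. \<bar>h\<bar> < \<delta>2 \<Longrightarrow> 0 \<le> s + h \<Longrightarrow> ?a2 (s + h) < \<infinity> \<and> (?S ?c2 h) sums enn2real (?a2 (s + h))"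
    using an2 by blast
  \<comment> \<open>The instance without sprinkled points: the expectation is the sum of the
    expansions with \<open>x\<close> outside and inside the cluster.\<close>
  have base: "integrable (P t) (\<lambda>\<omega>. G (Cl t [0 \<mapsto> 0, 1 \<mapsto> x] 0 \<omega>)) \<and>
      (\<integral>\<omega>. G (Cl t [0 \<mapsto> 0, 1 \<mapsto> x] 0 \<omega>) \<partial>P t) = enn2real (?a1 t) + enn2real (?a2 t)"
    if t: "subcrit t" "?a1 t < \<infinity>" "?a2 t < \<infinity>" for t
  proof -
    have c: "cfg {0, x} {} (\<lambda>_. 0)" by (simp add: cfg_def)
    have "integrable (P t) (\<lambda>\<omega>. G (Cl t (added 0 {} (\<lambda>_. 0) x) 0 \<omega>))"
      using t by (intro integral_Cl_added(1)[OF t(1) _ c x G]) auto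
    moreover have "(\<integral>\<omega>. G (Cl t (added 0 {} (\<lambda>_. 0) x) 0 \<omega>) \<partial>P t) = enn2real (?a1 t) + enn2real (?a2 t)"
      using t by (subst integral_Cl_added(2)[OF t(1) _ c x G]) auto
    ultimately show ?thesis unfolding added_0 by blast
  qed
  have int: "(AE xs in Pi\<^sub>M {1..n} (\<lambda>_. lborel). integrable (P s) (Dn G x n s xs)) \<and>
      integrable (Pi\<^sub>M {1..n} (\<lambda>_. lborel)) (\<lambda>xs. \<integral>\<omega>. Dn G x n s xs \<omega> \<partial>P s) \<and>
      (\<integral>xs. (\<integral>\<omega>. Dn G x n s xs \<omega> \<partial>P s) \<partial>Pi\<^sub>M {1..n} (\<lambda>_. lborel)) =
        (\<Sum>q\<le>n. real (n choose q) * (-1) ^ (n - q) * enn2real (?c1 q (n - q))) +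
        (\<Sum>q\<le>n. real (n choose q) * (-1) ^ (n - q) * enn2real (?c2 q (n - q)))" for n
  proof -
    let ?I = "{1..n}" and ?M = "Pi\<^sub>M {1..n} (\<lambda>_. lborel :: 'd pt measure)"
    let ?s1 = "\<lambda>K xs. sprinkle_series s {0} {x} G K (?I - K) xs" and ?s2 = "\<lambda>K xs. sprinkle_series s {0, x} {} G K (?I - K) xs"
    define E where "E xs = (\<Sum>K\<in>Pow ?I. (-1) ^ (n - card K) * (enn2real (?s1 K xs) + enn2real (?s2 K xs)))" for xs
    \<comment> \<open>Two exceptional sets are discarded: sprinkled points that coincide or hit the
      roots, and those with an infinite expansion, which finite \<open>coef\<close> makes
      null.\<close>
    have "AE xs in ?M. \<forall>K\<in>Pow ?I. cfg {0} K xs \<longrightarrow> animal \<phi> s 0 ({0} \<union> xs ` K) {x} ?G < \<infinity>"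
      using c1 by (intro AE_finite_allI AE_animal_finite G s0) auto
    moreover have "AE xs in ?M. \<forall>K\<in>Pow ?I. cfg {0, x} K xs \<longrightarrow> animal \<phi> s 0 ({0, x} \<union> xs ` K) {} ?G < \<infinity>"
      using c2 by (intro AE_finite_allI AE_animal_finite G s0) auto
    moreover have "AE xs in ?M. cfg {0, x} ?I xs" by (rule AE_cfg) auto
    ultimately have ae: "AE xs in ?M. integrable (P s) (Dn G x n s xs) \<and> (\<integral>\<omega>. Dn G x n s xs \<omega> \<partial>P s) = E xs"
    proof eventually_elim
      fix xs :: "nat \<Rightarrow> 'd pt"
      assume f1: "\<forall>K\<in>Pow ?I. cfg {0} K xs \<longrightarrow> animal \<phi> s 0 ({0} \<union> xs ` K) {x} ?G < \<infinity>"
        and f2: "\<forall>K\<in>Pow ?I. cfg {0, x} K xs \<longrightarrow> animal \<phi> s 0 ({0, x} \<union> xs ` K) {} ?G < \<infinity>"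
        and c: "cfg {0, x} ?I xs"
      have sub: "cfg {0} J xs \<and> cfg {0, x} J xs" if "J \<subseteq> ?I" for J using c that unfolding cfg_def by (auto intro: inj_on_subset)
      have g1: "animal \<phi> s 0 ({0} \<union> xs ` K) {x} ?G < \<infinity>" and g2: "animal \<phi> s 0 ({0, x} \<union> xs ` K) {} ?G < \<infinity>" if "K \<subseteq> ?I" for K
        using f1 f2 sub[OF that] that by blast+
      show "integrable (P s) (Dn G x n s xs) \<and> (\<integral>\<omega>. Dn G x n s xs \<omega> \<partial>P s) = E xs"
        unfolding E_def using integral_Dn[OF s c x G g1 g2] by blast
    qed
    have K: "K \<union> (?I - K) = ?I" "finite K" "card (?I - K) = n - card K" if "K \<in> Pow ?I" for K
      using that by (auto simp: card_Diff_subset finite_subset)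
    have i1: "integrable ?M (\<lambda>xs. enn2real (?s1 K xs)) \<and> (\<integral>xs. enn2real (?s1 K xs) \<partial>?M) = enn2real (?c1 (card K) (n - card K))"
      if KI: "K \<in> Pow ?I" for K
    proof -
      have sp: "?s1 K \<in> borel_measurable (Pi\<^sub>M (K \<union> (?I - K)) (\<lambda>_. lborel))"
        "(\<integral>\<^sup>+xs. ?s1 K xs \<partial>Pi\<^sub>M (K \<union> (?I - K)) (\<lambda>_. lborel)) = ?c1 (card K) (card (?I - K))"
        unfolding coef_def using K(2)[OF KI] by (intro nn_integral_sprinkle_series G s0; simp)+
      show ?thesis
        using integrable_enn2real[of "?s1 K" ?M] sp c1 unfolding K(1,3)[OF KI] by simp
    qed
    have i2: "integrable ?M (\<lambda>xs. enn2real (?s2 K xs)) \<and> (\<integral>xs. enn2real (?s2 K xs) \<partial>?M) = enn2real (?c2 (card K) (n - card K))"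
      if KI: "K \<in> Pow ?I" for K
    proof -
      have sp: "?s2 K \<in> borel_measurable (Pi\<^sub>M (K \<union> (?I - K)) (\<lambda>_. lborel))"
        "(\<integral>\<^sup>+xs. ?s2 K xs \<partial>Pi\<^sub>M (K \<union> (?I - K)) (\<lambda>_. lborel)) = ?c2 (card K) (card (?I - K))"
        unfolding coef_def using K(2)[OF KI] by (intro nn_integral_sprinkle_series G s0; simp)+
      show ?thesis
        using integrable_enn2real[of "?s2 K" ?M] sp c2 unfolding K(1,3)[OF KI] by simp
    qed
    have iE: "integrable ?M E"
      unfolding E_def using i1 i2 by (intro Bochner_Integration.integrable_sum Bochner_Integration.integrable_mult_right Bochner_Integration.integrable_add) auto
    have ae': "AE xs in ?M. (\<integral>\<omega>. Dn G x n s xs \<omega> \<partial>P s) = E xs" using ae by (rule eventually_mono) simp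
    note Dm = integral_Dn_measurable[OF s0 G(1), of x n]
    have "integrable ?M (\<lambda>xs. \<integral>\<omega>. Dn G x n s xs \<omega> \<partial>P s)"
      using integrable_cong_AE[OF Dm borel_measurable_integrable[OF iE] ae'] iE by simp
    moreover have "(\<integral>xs. (\<integral>\<omega>. Dn G x n s xs \<omega> \<partial>P s) \<partial>?M) = (\<integral>xs. E xs \<partial>?M)"
      by (rule integral_cong_AE[OF Dm borel_measurable_integrable[OF iE] ae'])
    moreover have "(\<integral>xs. E xs \<partial>?M) = (\<Sum>K\<in>Pow ?I. (-1) ^ (n - card K) * (enn2real (?c1 (card K) (n - card K)) + enn2real (?c2 (card K) (n - card K))))"
      unfolding E_def using i1 i2 by (subst Bochner_Integration.integral_sum) auto
    \<comment> \<open>The summand depends on \<open>K\<close> only through its size, and the number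
      of subsets of size \<open>q\<close> is the binomial coefficient of Leibniz's rule.\<close>
    moreover have "\<dots> = (\<Sum>q\<le>n. real (n choose q) * ((-1) ^ (n - q) * (enn2real (?c1 q (n - q)) + enn2real (?c2 q (n - q)))))"
      using sum_Pow_card[of ?I "\<lambda>q. (-1) ^ (n - q) * (enn2real (?c1 q (n - q)) + enn2real (?c2 q (n - q)))"] by simp
    moreover have "\<dots> = (\<Sum>q\<le>n. real (n choose q) * (-1) ^ (n - q) * enn2real (?c1 q (n - q))) +
        (\<Sum>q\<le>n. real (n choose q) * (-1) ^ (n - q) * enn2real (?c2 q (n - q)))"
      by (simp add: sum.distrib[symmetric] algebra_simps)
    moreover have "AE xs in ?M. integrable (P s) (Dn G x n s xs)" using ae by (rule eventually_mono) simp
    ultimately show ?thesis by (simp only: simp_thms)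
  qed
  have sums: "(\<lambda>n. h ^ n / fact n * (\<integral>xs. (\<integral>\<omega>. Dn G x n s xs \<omega> \<partial>P s) \<partial>Pi\<^sub>M {1..n} (\<lambda>_. lborel))) sums
         (\<integral>\<omega>. G (Cl (s + h) [0 \<mapsto> 0, 1 \<mapsto> x] 0 \<omega>) \<partial>P (s + h))" if h: "\<bar>h\<bar> < min \<delta>1 \<delta>2 \<and> subcrit (s + h)" for h
  proof -
    have sh: "0 \<le> s + h" using h subcrit_nonneg by blast
    have a: "?a1 (s + h) < \<infinity> \<and> (?S ?c1 h) sums enn2real (?a1 (s + h))" "?a2 (s + h) < \<infinity> \<and> (?S ?c2 h) sums enn2real (?a2 (s + h))"
      using h by (intro d1 d2 sh; simp)+
    have "(\<lambda>n. ?S ?c1 h n + ?S ?c2 h n) sums (enn2real (?a1 (s + h)) + enn2real (?a2 (s + h)))"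
      using a by (intro sums_add) auto
    moreover have "(\<integral>\<omega>. G (Cl (s + h) [0 \<mapsto> 0, 1 \<mapsto> x] 0 \<omega>) \<partial>P (s + h)) = enn2real (?a1 (s + h)) + enn2real (?a2 (s + h))"
      using base[of "s + h"] h a by blast
    ultimately show ?thesis using int by (simp only: distrib_left)
  qed
  have "integrable (P s) (\<lambda>\<omega>. G (Cl s [0 \<mapsto> 0, 1 \<mapsto> x] 0 \<omega>))"
    using base[OF s] d1(1) d1(2)[of 0] d2(1) d2(2)[of 0] s0 by simp
  then show ?thesis
    unfolding expansion_def using int sums d1(1) d2(1) by (intro conjI allI exI[of _ "min \<delta>1 \<delta>2"]) auto
qed

end

text \<open>Expand \<open>(1 - 1) ^ card I\<close> over subsets; for the empty set the value is 1,
  which preserves the term \<open>n = 0\<close>.\<close>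

lemma sum_Pow_alternating:
  assumes "finite I"
  shows "(\<Sum>J\<in>Pow I. (-1) ^ (card I - card J) :: real) = 0 ^ card I"
proof -
  have "(\<Sum>J\<in>Pow I. (-1) ^ (card I - card J) :: real) = (\<Sum>J\<in>Pow I. (\<Prod>i\<in>J. 1) * (\<Prod>i\<in>I - J. - 1))"
    using assms by (intro sum.cong refl) (auto simp: card_Diff_subset finite_subset)
  also have "\<dots> = (\<Prod>i\<in>I. 1 + - 1 :: real)" by (rule prod_add[OF assms, symmetric])
  finally show ?thesis by simp
qed

section \<open>The degenerate case and functions of both signs\<close>

context rcm_family
begin

text \<open>Two added points sit at the origin, so almost surely the origin is no vertex and its
  cluster is \<open>{0}\<close> at every intensity. The function is constant, and the alternating
  sums with \<open>n \<ge> 1\<close> have expectation zero.\<close>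

lemma expansion_doubled_point:
  assumes s: "subcrit s" and g: "g \<in> borel_measurable N_space"
  shows "expansion 0 g s"
proof -
  have cl: "AE \<omega> in P t. Cl t (added n J xs 0) 0 \<omega> = {0}" if t: "0 \<le> t" for t n J xs
  proof -
    interpret rcm "P t" "ppts t (X t)" "pidx t" t \<phi> m "U t" 1 using t by (intro rcm_at) auto
    show ?thesis
      using AE_U01 AE_U_inj
    proof eventually_elim
      fix \<omega> assume u: "\<forall>p. 0 < U t p \<omega> \<and> U t p \<omega> \<le> 1" "inj (\<lambda>p. U t p \<omega>)"
      let ?y = "added n J xs 0"
      have "cluster \<phi> 0 (marked_pairs (idx t ?y) (pos t ?y \<omega>) (\<lambda>p. U t p \<omega>)) = {0}"
      proof (rule cluster_doubled_point)
        show "Inl 0 \<in> idx t ?y" "Inl (Suc n) \<in> idx t ?y" by (auto simp: idx_def dom_added)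
        show "pos t ?y \<omega> (Inl 0) = 0" "pos t ?y \<omega> (Inl (Suc n)) = 0" by (simp_all add: pos_def added_simps)
      qed (use u in \<open>auto simp: less_imp_le\<close>)
      then show "Cl t ?y 0 \<omega> = {0}" by (simp add: Cl_pos pos_def added_simps)
    qed
  qed
  have base: "integrable (P t) (\<lambda>\<omega>. g (Cl t (added n J xs 0) 0 \<omega>))" "(\<integral>\<omega>. g (Cl t (added n J xs 0) 0 \<omega>) \<partial>P t) = g {0}"
    if t: "0 \<le> t" and J: "J \<subseteq> {1..n}" for t n J xs
  proof -
    interpret prob_space "P t" by (rule prob_space_P[OF t])
    have "Cl t (added n J xs 0) 0 \<in> P t \<rightarrow>\<^sub>M N_space"
      using finite_subset[OF J] by (intro Cl_measurable t) (auto simp: dom_added)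
    then have m: "(\<lambda>\<omega>. g (Cl t (added n J xs 0) 0 \<omega>)) \<in> borel_measurable (P t)" by (rule measurable_compose[OF _ g])
    have ae: "AE \<omega> in P t. g (Cl t (added n J xs 0) 0 \<omega>) = g {0}" using cl[OF t, where n = n and J = J and xs = xs] by (rule eventually_mono) simp
    show "integrable (P t) (\<lambda>\<omega>. g (Cl t (added n J xs 0) 0 \<omega>))" using integrable_cong_AE[OF m _ ae] by simp
    show "(\<integral>\<omega>. g (Cl t (added n J xs 0) 0 \<omega>) \<partial>P t) = g {0}" using integral_cong_AE[OF m _ ae] by (simp add: prob_space)
  qed
  note s0 = subcrit_nonneg[OF s]
  have D: "integrable (P s) (Dn g 0 n s xs)" "(\<integral>\<omega>. Dn g 0 n s xs \<omega> \<partial>P s) = 0 ^ n * g {0}" for n xs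
  proof -
    show "integrable (P s) (Dn g 0 n s xs)"
      unfolding Dn_def[abs_def] using base(1)[OF s0]
      by (intro Bochner_Integration.integrable_sum Bochner_Integration.integrable_mult_right) auto
    have "(\<integral>\<omega>. Dn g 0 n s xs \<omega> \<partial>P s) = (\<Sum>J\<in>Pow {1..n}. (-1) ^ (n - card J) * g {0})"
      unfolding Dn_def using base[OF s0] by (subst Bochner_Integration.integral_sum) auto
    also have "\<dots> = 0 ^ n * g {0}"
      using sum_Pow_alternating[of "{1..n}"] by (simp add: sum_distrib_right[symmetric])
    finally show "(\<integral>\<omega>. Dn g 0 n s xs \<omega> \<partial>P s) = 0 ^ n * g {0}" .
  qed
  \<comment> \<open>For \<open>n = 0\<close> the product space is a single point of mass 1; for
    \<open>n > 0\<close> the integrand is zero, so the infinite measure does no harm.\<close>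
  have c: "integrable (Pi\<^sub>M {1..n} (\<lambda>_. lborel :: 'd pt measure)) (\<lambda>xs. 0 ^ n * g {0}) \<and>
     (\<integral>xs. 0 ^ n * g {0} \<partial>Pi\<^sub>M {1..n} (\<lambda>_. lborel :: 'd pt measure)) = 0 ^ n * g {0}" for n
    by (cases n) (simp_all add: PiM_empty integrable_count_space lebesgue_integral_count_space_finite)
  have "(\<lambda>n. h ^ n / fact n * (0 ^ n * g {0})) sums g {0}" for h
  proof -
    have "(\<lambda>n. if n = 0 then g {0} else 0) sums (\<Sum>n\<in>{0}. g {0})"
      using sums_If_finite_set[of "{0}" "\<lambda>_. g {0}"] by simp
    moreover have "(\<lambda>n. h ^ n / fact n * (0 ^ n * g {0})) = (\<lambda>n. if n = 0 then g {0} else 0)"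
      by (auto simp: fun_eq_iff power_0_left)
    ultimately show ?thesis by simp
  qed
  then have sums: "(\<lambda>n. h ^ n / fact n * (\<integral>xs. 0 ^ n * g {0} \<partial>Pi\<^sub>M {1..n} (\<lambda>_. lborel :: 'd pt measure))) sums g {0}" for h
    using c by (simp only:)
  have f: "(\<integral>\<omega>. g (Cl t [0 \<mapsto> 0, 1 \<mapsto> 0] 0 \<omega>) \<partial>P t) = g {0}" if "subcrit t" for t
    using base(2)[OF subcrit_nonneg[OF that], of "{}" 0] unfolding added_0 by blast
  have i: "integrable (P s) (\<lambda>\<omega>. g (Cl s [0 \<mapsto> 0, 1 \<mapsto> 0] 0 \<omega>))"
    using base(1)[OF s0, of "{}" 0] unfolding added_0 by blast
  show ?thesis
    unfolding expansion_def D(2)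
  proof (intro conjI allI exI[of _ 1] impI i)
    show "AE xs in Pi\<^sub>M {1..n} (\<lambda>_. lborel). integrable (P s) (Dn g 0 n s xs)" for n using D(1) by simp
    show "integrable (Pi\<^sub>M {1..n} (\<lambda>_. lborel :: 'd pt measure)) (\<lambda>xs. 0 ^ n * g {0})" for n using c by blast
    fix h assume "\<bar>h\<bar> < 1 \<and> subcrit (s + h)"
    then show "(\<lambda>n. h ^ n / fact n * (\<integral>xs. 0 ^ n * g {0} \<partial>Pi\<^sub>M {1..n} (\<lambda>_. lborel :: 'd pt measure))) sums
      (\<integral>\<omega>. g (Cl (s + h) [0 \<mapsto> 0, 1 \<mapsto> 0] 0 \<omega>) \<partial>P (s + h))"
      using f[of "s + h"] sums[of h] by (simp only:)
  qed simp
qed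

text \<open>Linearity rests on the integrability recorded in \<open>expansion\<close>; the inner
  expectations subtract only for almost every \<open>xs\<close>.\<close>

lemma expansion_diff:
  assumes s: "subcrit s" and e: "expansion x g1 s" "expansion x g2 s" and g: "g1 \<in> borel_measurable N_space" "g2 \<in> borel_measurable N_space"
    and int: "\<And>t. subcrit t \<Longrightarrow> integrable (P t) (\<lambda>\<omega>. g1 (Cl t [0 \<mapsto> 0, 1 \<mapsto> x] 0 \<omega>))"
      "\<And>t. subcrit t \<Longrightarrow> integrable (P t) (\<lambda>\<omega>. g2 (Cl t [0 \<mapsto> 0, 1 \<mapsto> x] 0 \<omega>))"
  shows "expansion x (\<lambda>S. g1 S - g2 S) s"
proof -
  note s0 = subcrit_nonneg[OF s]
  let ?g = "\<lambda>S. g1 S - g2 S"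
  have gm: "?g \<in> borel_measurable N_space" using g by simp
  have Dd: "Dn ?g x n s xs = (\<lambda>\<omega>. Dn g1 x n s xs \<omega> - Dn g2 x n s xs \<omega>)" for n xs
    by (simp add: Dn_def fun_eq_iff sum_subtractf right_diff_distrib)
  let ?M = "\<lambda>n. Pi\<^sub>M {1..n} (\<lambda>_. lborel :: 'd pt measure)" and ?E = "\<lambda>g n xs. \<integral>\<omega>. Dn g x n s xs \<omega> \<partial>P s"
  have a: "AE xs in ?M n. integrable (P s) (Dn g1 x n s xs)" "AE xs in ?M n. integrable (P s) (Dn g2 x n s xs)"
    "integrable (?M n) (?E g1 n)" "integrable (?M n) (?E g2 n)" for n
    using e unfolding expansion_def by blast+
  have b: "(AE xs in ?M n. integrable (P s) (Dn ?g x n s xs)) \<and> integrable (?M n) (?E ?g n) \<and>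
      (\<integral>xs. ?E ?g n xs \<partial>?M n) = (\<integral>xs. ?E g1 n xs \<partial>?M n) - (\<integral>xs. ?E g2 n xs \<partial>?M n)" for n
  proof -
    have 1: "AE xs in ?M n. integrable (P s) (Dn ?g x n s xs)"
      using a(1,2) unfolding Dd by eventually_elim (rule Bochner_Integration.integrable_diff)
    have ae: "AE xs in ?M n. ?E ?g n xs = ?E g1 n xs - ?E g2 n xs"
      using a(1,2) unfolding Dd by eventually_elim (rule Bochner_Integration.integral_diff)
    have i: "integrable (?M n) (\<lambda>xs. ?E g1 n xs - ?E g2 n xs)" using a(3,4) by (rule Bochner_Integration.integrable_diff)
    note m = integral_Dn_measurable[OF s0 gm, of x n]
    show ?thesis
      using 1 i integrable_cong_AE[OF m borel_measurable_integrable[OF i] ae] integral_cong_AE[OF m borel_measurable_integrable[OF i] ae]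
        Bochner_Integration.integral_diff[OF a(3,4)] by simp
  qed
  let ?f = "\<lambda>g t. \<integral>\<omega>. g (Cl t [0 \<mapsto> 0, 1 \<mapsto> x] 0 \<omega>) \<partial>P t"
  let ?S = "\<lambda>g h n. h ^ n / fact n * (\<integral>xs. ?E g n xs \<partial>?M n)"
  obtain \<delta>1 where d1: "0 < \<delta>1" "\<And>h. \<bar>h\<bar> < \<delta>1 \<Longrightarrow> subcrit (s + h) \<Longrightarrow> (?S g1 h) sums ?f g1 (s + h)"
    using e(1) unfolding expansion_def by blast
  obtain \<delta>2 where d2: "0 < \<delta>2" "\<And>h. \<bar>h\<bar> < \<delta>2 \<Longrightarrow> subcrit (s + h) \<Longrightarrow> (?S g2 h) sums ?f g2 (s + h)"
    using e(2) unfolding expansion_def by blast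
  have "(?S ?g h) sums ?f ?g (s + h)" if h: "\<bar>h\<bar> < min \<delta>1 \<delta>2 \<and> subcrit (s + h)" for h
  proof -
    have "(\<lambda>n. ?S g1 h n - ?S g2 h n) sums (?f g1 (s + h) - ?f g2 (s + h))"
      using h by (intro sums_diff d1 d2) auto
    moreover have "?f ?g (s + h) = ?f g1 (s + h) - ?f g2 (s + h)"
      using h by (intro Bochner_Integration.integral_diff int) auto
    moreover have "?S ?g h n = ?S g1 h n - ?S g2 h n" for n
      using b[of n] by (simp only: right_diff_distrib)
    ultimately show ?thesis by simp
  qed
  then show ?thesis
    unfolding expansion_def using b int s d1(1) d2(1)
    by (intro conjI allI exI[of _ "min \<delta>1 \<delta>2"]) (auto intro!: Bochner_Integration.integrable_diff)
qed

text \<open>Positive and negative part of \<open>g\<close> are both bounded by its absolute value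
  and so inherit growth and integrability; the nonnegative case applies to each.
  \<open>x = 0\<close> is treated apart because the expansion requires distinct added
  points.\<close>

lemma expansion_growth:
  assumes s: "subcrit s" and g: "g \<in> borel_measurable N_space"
    and growth: "\<And>\<epsilon>. \<epsilon> > 0 \<Longrightarrow> \<exists>n\<^sub>0::nat. \<forall>\<mu>\<in>locally_finite_sets. of_nat n\<^sub>0 \<le> npts \<mu> UNIV \<longrightarrow> ennreal \<bar>g \<mu>\<bar> \<le> exp_npts \<epsilon> \<mu>"
    and small: "\<And>t (n::nat). subcrit t \<Longrightarrow>
      integrable (P t) (\<lambda>\<omega>. if npts (Cl t [0 \<mapsto> 0, 1 \<mapsto> x] 0 \<omega>) UNIV < of_nat n then g (Cl t [0 \<mapsto> 0, 1 \<mapsto> x] 0 \<omega>) else 0)"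
  shows "expansion x g s"
proof (cases "x = 0")
  case True
  then show ?thesis using expansion_doubled_point[OF s g] by simp
next
  case False
  have part: "expansion x G t" if t: "subcrit t" and G: "G \<in> borel_measurable N_space" "\<And>S. 0 \<le> G S" "\<And>S. G S \<le> \<bar>g S\<bar>" for t G
  proof (rule expansion_nonneg[OF t False G(1,2)])
    fix \<epsilon> :: real assume "\<epsilon> > 0"
    from growth[OF this] obtain n0 :: nat where n0: "\<forall>\<mu>\<in>locally_finite_sets. of_nat n0 \<le> npts \<mu> UNIV \<longrightarrow> ennreal \<bar>g \<mu>\<bar> \<le> exp_npts \<epsilon> \<mu>" ..
    show "\<exists>n\<^sub>0::nat. \<forall>\<mu>\<in>locally_finite_sets. of_nat n\<^sub>0 \<le> npts \<mu> UNIV \<longrightarrow> ennreal (G \<mu>) \<le> exp_npts \<epsilon> \<mu>"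
      using n0 ennreal_leI[OF G(3)] by (meson order_trans)
  next
    fix t and n :: nat assume t: "subcrit t"
    let ?C = "Cl t [0 \<mapsto> 0, 1 \<mapsto> x] 0"
    have "(\<integral>\<^sup>+\<omega>. (if npts (?C \<omega>) UNIV < of_nat n then ennreal (G (?C \<omega>)) else 0) \<partial>P t) \<le>
       (\<integral>\<^sup>+\<omega>. ennreal (norm (if npts (?C \<omega>) UNIV < of_nat n then g (?C \<omega>) else 0)) \<partial>P t)"
      using G(3) by (intro nn_integral_mono) (auto intro: ennreal_leI)
    also have "\<dots> < \<infinity>" using small[OF t, of n] unfolding integrable_iff_bounded by blast
    finally show "(\<integral>\<^sup>+\<omega>. (if npts (?C \<omega>) UNIV < of_nat n then ennreal (G (?C \<omega>)) else 0) \<partial>P t) < \<infinity>" .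
  qed
  let ?p = "\<lambda>S. max 0 (g S)" and ?q = "\<lambda>S. max 0 (- g S)"
  have m: "?p \<in> borel_measurable N_space" "?q \<in> borel_measurable N_space" using g by auto
  have p: "expansion x ?p t" "expansion x ?q t" if "subcrit t" for t using that m by (auto intro!: part)
  have "expansion x (\<lambda>S. ?p S - ?q S) s"
    by (rule expansion_diff[OF s p[OF s] m]) (use p in \<open>unfold expansion_def, blast+\<close>)
  moreover have "(\<lambda>S. ?p S - ?q S) = g" by (auto simp: fun_eq_iff)
  ultimately show ?thesis by simp
qed

end

text \<open>Evaluating the series at \<open>h = 0\<close> identifies its constant term with
  \<open>f s\<close>; splitting that term off leaves the sum over \<open>n \<ge> 1\<close>, written
  with \<open>Suc n\<close>.\<close>

lemma local_expansions:
  fixes f :: "real \<Rightarrow> real" and c :: "real \<Rightarrow> nat \<Rightarrow> real"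
  assumes e: "\<And>s. s \<in> T \<Longrightarrow> \<exists>\<delta>>0. \<forall>h. \<bar>h\<bar> < \<delta> \<and> s + h \<in> T \<longrightarrow> (\<lambda>n. h ^ n / fact n * c s n) sums f (s + h)"
  shows "real_analytic_on f T"
    and "s \<in> T \<Longrightarrow> \<exists>\<delta>>0. \<forall>t. \<bar>t\<bar> < \<delta> \<and> s + t \<in> T \<longrightarrow>
      summable (\<lambda>n. t ^ Suc n / fact (Suc n) * c s (Suc n)) \<and> f (s + t) = f s + (\<Sum>n. t ^ Suc n / fact (Suc n) * c s (Suc n))"
proof -
  show "real_analytic_on f T"
    unfolding real_analytic_on_def
  proof
    fix s assume "s \<in> T"
    then obtain \<delta> where \<delta>: "0 < \<delta>" "\<And>h. \<bar>h\<bar> < \<delta> \<and> s + h \<in> T \<Longrightarrow> (\<lambda>n. h ^ n / fact n * c s n) sums f (s + h)"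
      using e by blast
    have "(\<lambda>n. c s n / fact n * (t - s) ^ n) sums f t" if "t \<in> T" "\<bar>t - s\<bar> < \<delta>" for t
      using \<delta>(2)[of "t - s"] that by (simp add: mult.commute)
    then show "\<exists>a. \<exists>\<delta>>0. \<forall>t\<in>T. \<bar>t - s\<bar> < \<delta> \<longrightarrow> (\<lambda>n. a n * (t - s) ^ n) sums f t"
      using \<delta>(1) by (intro exI[of _ "\<lambda>n. c s n / fact n"]) blast
  qed
  assume s: "s \<in> T"
  then obtain \<delta> where \<delta>: "0 < \<delta>" "\<And>h. \<bar>h\<bar> < \<delta> \<and> s + h \<in> T \<Longrightarrow> (\<lambda>n. h ^ n / fact n * c s n) sums f (s + h)"
    using e by blast
  have "(\<lambda>n. 0 ^ n / fact n * c s n) sums f s" using \<delta>(2)[of 0] \<delta>(1) s by simp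
  moreover have "(\<lambda>n. 0 ^ n / fact n * c s n) sums c s 0"
    using powser_sums_zero[of "\<lambda>n. c s n / fact n"] by (simp add: mult.commute)
  ultimately have c0: "c s 0 = f s" by (rule sums_unique2[symmetric])
  have "summable (\<lambda>n. t ^ Suc n / fact (Suc n) * c s (Suc n)) \<and> f (s + t) = f s + (\<Sum>n. t ^ Suc n / fact (Suc n) * c s (Suc n))"
    if t: "\<bar>t\<bar> < \<delta> \<and> s + t \<in> T" for t
  proof -
    have "(\<lambda>n. t ^ Suc n / fact (Suc n) * c s (Suc n)) sums (f (s + t) - t ^ 0 / fact 0 * c s 0)"
      using \<delta>(2)[OF t] sums_Suc_iff[of "\<lambda>n. t ^ n / fact n * c s n"] by (simp del: power_Suc fact_Suc)
    then show ?thesis unfolding c0 by (simp add: sums_iff del: power_Suc fact_Suc)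
  qed
  then show "\<exists>\<delta>>0. \<forall>t. \<bar>t\<bar> < \<delta> \<and> s + t \<in> T \<longrightarrow>
      summable (\<lambda>n. t ^ Suc n / fact (Suc n) * c s (Suc n)) \<and> f (s + t) = f s + (\<Sum>n. t ^ Suc n / fact (Suc n) * c s (Suc n))"
    using \<delta>(1) by blast
qed

theorem theorem4p5:
  fixes \<phi> :: "('d::{finite,linorder}) pt \<Rightarrow> real"
    and P :: "real \<Rightarrow> 'w measure"
    and X :: "real \<Rightarrow> nat \<Rightarrow> 'w \<Rightarrow> 'd pt"
    and U :: "real \<Rightarrow> (nat + nat) \<times> (nat + nat) \<Rightarrow> 'w \<Rightarrow> real"
    and g :: "'d pt set \<Rightarrow> real"
    and x :: "'d pt"
  defines "T \<equiv> {t. 0 \<le> t \<and> ereal t < t_star \<phi> P X U}"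
    and "C \<equiv> \<lambda>t \<omega>. cluster \<phi> 0 (chi t (X t) (U t) [0 \<mapsto> 0, 1 \<mapsto> x] \<omega>)"
    and "D \<equiv> \<lambda>n s xs \<omega>. \<Sum>J\<in>Pow {1..n}. (-1) ^ (n - card J) *
               g (cluster \<phi> 0 (chi s (X s) (U s) (added n J xs x) \<omega>))"
  assumes phi_meas: "\<phi> \<in> borel_measurable borel"
    and phi_range: "\<And>y. 0 \<le> \<phi> y \<and> \<phi> y \<le> 1"
    and phi_sym: "\<And>y. \<phi> (- y) = \<phi> y"
    and phi_int: "0 < (\<integral>\<^sup>+y. ennreal (\<phi> y) \<partial>lborel)" "(\<integral>\<^sup>+y. ennreal (\<phi> y) \<partial>lborel) < \<infinity>"
    and model: "\<And>t. 0 \<le> t \<Longrightarrow> marked_poisson (P t) t (X t) (U t)"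
    and g_meas: "g \<in> borel_measurable N_space"
    and g_growth: "\<And>\<epsilon>. \<epsilon> > 0 \<Longrightarrow> \<exists>n\<^sub>0::nat. \<forall>\<mu>\<in>locally_finite_sets.
           of_nat n\<^sub>0 \<le> npts \<mu> UNIV \<longrightarrow> ennreal \<bar>g \<mu>\<bar> \<le> exp_npts \<epsilon> \<mu>"
    and g_small: "\<And>t (n::nat). t \<in> T \<Longrightarrow>
           integrable (P t) (\<lambda>\<omega>. if npts (C t \<omega>) UNIV < of_nat n then g (C t \<omega>) else 0)"
  shows "(\<forall>t\<in>T. integrable (P t) (\<lambda>\<omega>. g (C t \<omega>))) \<and>
    real_analytic_on (\<lambda>t. \<integral>\<omega>. g (C t \<omega>) \<partial>P t) T \<and>
    (\<forall>s\<in>T.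
       (\<forall>n\<ge>1. (AE xs in Pi\<^sub>M {1..n} (\<lambda>_. lborel). integrable (P s) (D n s xs)) \<and>
               integrable (Pi\<^sub>M {1..n} (\<lambda>_. lborel)) (\<lambda>xs. \<integral>\<omega>. D n s xs \<omega> \<partial>P s)) \<and>
       (\<exists>\<delta>>0. \<forall>t. \<bar>t\<bar> < \<delta> \<and> s + t \<in> T \<longrightarrow>
          summable (\<lambda>n. t ^ Suc n / fact (Suc n) *
             (\<integral>xs. (\<integral>\<omega>. D (Suc n) s xs \<omega> \<partial>P s) \<partial>Pi\<^sub>M {1..Suc n} (\<lambda>_. lborel))) \<and>
          (\<integral>\<omega>. g (C (s + t) \<omega>) \<partial>P (s + t)) =
            (\<integral>\<omega>. g (C s \<omega>) \<partial>P s) +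
            (\<Sum>n. t ^ Suc n / fact (Suc n) *
               (\<integral>xs. (\<integral>\<omega>. D (Suc n) s xs \<omega> \<partial>P s) \<partial>Pi\<^sub>M {1..Suc n} (\<lambda>_. lborel)))))"
proof -
  define m where "m = enn2real (\<integral>\<^sup>+y. ennreal (\<phi> y) \<partial>lborel)"
  interpret rcm_family \<phi> m P X U
  proof unfold_locales
    show "(\<integral>\<^sup>+y. ennreal (\<phi> y) \<partial>lborel) = ennreal m" using phi_int by (simp add: m_def)
    show "0 \<le> m" by (simp add: m_def)
  qed (use phi_meas phi_range phi_sym model in auto)
  have Cl0: "Cl t [0 \<mapsto> 0] 0 \<omega> = cluster \<phi> 0 (chi t (X t) (U t) [0 \<mapsto> 0] \<omega>)" for t \<omega> by (simp add: Cl_def)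
  have C: "C t \<omega> = Cl t [0 \<mapsto> 0, 1 \<mapsto> x] 0 \<omega>" for t \<omega> by (simp add: C_def Cl_def)
  have D: "D n s xs = Dn g x n s xs" for n s xs by (simp add: D_def Dn_def Cl_added fun_eq_iff)
  \<comment> \<open>To be below the supremum is to be below one of its members, which is the witness
    in \<open>subcrit\<close>.\<close>
  have T: "t \<in> T \<longleftrightarrow> subcrit t" for t
    unfolding T_def t_star_def subcrit_def Cl0 less_Sup_iff by auto (meson less_imp_le order_trans)
  have e: "expansion x g s" if "subcrit s" for s
    by (rule expansion_growth[OF that g_meas g_growth]) (use g_small in \<open>simp_all add: T C cong: if_cong\<close>)
  let ?c = "\<lambda>s n. \<integral>xs. (\<integral>\<omega>. Dn g x n s xs \<omega> \<partial>P s) \<partial>Pi\<^sub>M {1..n} (\<lambda>_. lborel)"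
  let ?f = "\<lambda>t. \<integral>\<omega>. g (Cl t [0 \<mapsto> 0, 1 \<mapsto> x] 0 \<omega>) \<partial>P t"
  have series: "\<exists>\<delta>>0. \<forall>h. \<bar>h\<bar> < \<delta> \<and> s + h \<in> T \<longrightarrow> (\<lambda>n. h ^ n / fact n * ?c s n) sums ?f (s + h)" if "s \<in> T" for s
    using e that unfolding expansion_def T by blast
  note analytic = local_expansions(1)[of T ?c ?f, OF series] and taylor = local_expansions(2)[of T ?c ?f, OF series]
  have "expansion x g s" if "s \<in> T" for s using e that by (simp only: T)
  then show ?thesis
    unfolding C D using analytic taylor unfolding expansion_def by blast
qed

end
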